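(* Let $p_1,p_2$ be primes with $p_1\equiv p_2\equiv 1\pmod 4$ such that at least two of $\left(\frac{p_1}{p_2}\right),\left(\frac{2}{p_1}\right),\left(\frac{2}{p_2}\right)$ equal $-1$. Let $k=\mathbb{Q}(\sqrt{2p_1p_2},i)$, $\mathbb{K}_1=k(\sqrt{p_1})=\mathbb{Q}(\sqrt{p_1},\sqrt{2p_2},i)$ and $\mathbb{K}_2=k(\sqrt{p_2})=\mathbb{Q}(\sqrt{p_2},\sqrt{2p_1},i)$. Write $p_1=e^2+(2f)^2$, $\pi_1=e+2if$, $\pi_2=e-2if$, and let $\mathcal{H}_0,\mathcal{H}_1,\mathcal{H}_2$ be the prime ideals of $k$ above $1+i,\pi_1,\pi_2$. Then exactly four classes of $\mathbf{C}_{k,2}$ capitulate in $\mathbb{K}_1$ and exactly four in $\mathbb{K}_2$; more precisely $\ker j_{\mathbb{K}_1}=\langle[\mathcal{H}_1],[\mathcal{H}_2]\rangle$ and $\ker j_{\mathbb{K}_2}=\langle[\mathcal{H}_0\mathcal{H}_1],[\mathcal{H}_0\mathcal{H}_2]\rangle$.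
   Context: $\mathbf{C}_{k,2}$ is the $2$-Sylow subgroup of the class group of $k$ (under these hypotheses it is of type $(2,2,2)$). For an unramified extension $K/k$, $j_K:\mathbf{C}_{k,2}\to\mathbf{C}_{K,2}$ is the homomorphism induced by extension of ideals $\mathfrak a\mapsto\mathfrak a\mathcal O_K$; a class capitulates in $K$ if it lies in $\ker j_K$. *)

theory Defs
  imports "HOL-Computational_Algebra.Computational_Algebra" "HOL-Number_Theory.Number_Theory"
begin

text \<open>Number fields are modelled as subfields of the complex numbers.\<close>

definition is_subfield :: "complex set \<Rightarrow> bool" where
  "is_subfield F \<longleftrightarrow> 0 \<in> F \<and> 1 \<in> F \<and>
     (\<forall>x\<in>F. \<forall>y\<in>F. x + y \<in> F \<and> x - y \<in> F \<and> x * y \<in> F) \<and>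
     (\<forall>x\<in>F. x \<noteq> 0 \<longrightarrow> inverse x \<in> F)"

definition Qadj :: "complex list \<Rightarrow> complex set" where
  "Qadj xs = \<Inter>{F. is_subfield F \<and> set xs \<subseteq> F}"

definition OK :: "complex set \<Rightarrow> complex set" where
  "OK F = {x \<in> F. algebraic_int x}"

definition is_ideal :: "complex set \<Rightarrow> complex set \<Rightarrow> bool" where
  "is_ideal F I \<longleftrightarrow> I \<subseteq> OK F \<and> 0 \<in> I \<and> (\<forall>x\<in>I. \<forall>y\<in>I. x + y \<in> I)
      \<and> (\<forall>r\<in>OK F. \<forall>x\<in>I. r * x \<in> I)"

definition nz_ideal :: "complex set \<Rightarrow> complex set \<Rightarrow> bool" where
  "nz_ideal F I \<longleftrightarrow> is_ideal F I \<and> I \<noteq> {0}"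

definition prime_ideal :: "complex set \<Rightarrow> complex set \<Rightarrow> bool" where
  "prime_ideal F P \<longleftrightarrow> nz_ideal F P \<and> P \<noteq> OK F \<and>
     (\<forall>a\<in>OK F. \<forall>b\<in>OK F. a * b \<in> P \<longrightarrow> a \<in> P \<or> b \<in> P)"

text \<open>Ideal of O_F generated by a set S (also used for extension of ideals).\<close>
definition gen_ideal :: "complex set \<Rightarrow> complex set \<Rightarrow> complex set" where
  "gen_ideal F S = \<Inter>{J. is_ideal F J \<and> S \<subseteq> J}"

definition ideal_mult :: "complex set \<Rightarrow> complex set \<Rightarrow> complex set \<Rightarrow> complex set" where
  "ideal_mult F I J = gen_ideal F {a * b | a b. a \<in> I \<and> b \<in> J}"

fun ideal_pow :: "complex set \<Rightarrow> complex set \<Rightarrow> nat \<Rightarrow> complex set" where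
  "ideal_pow F I 0 = OK F"
| "ideal_pow F I (Suc n) = ideal_mult F I (ideal_pow F I n)"

definition principal :: "complex set \<Rightarrow> complex set \<Rightarrow> bool" where
  "principal F I \<longleftrightarrow> (\<exists>\<alpha>\<in>OK F. I = gen_ideal F {\<alpha>})"

definition ideal_equiv :: "complex set \<Rightarrow> complex set \<Rightarrow> complex set \<Rightarrow> bool" where
  "ideal_equiv F I J \<longleftrightarrow> (\<exists>\<alpha>\<in>OK F - {0}. \<exists>\<beta>\<in>OK F - {0}.
       (\<lambda>x. \<alpha> * x) ` I = (\<lambda>x. \<beta> * x) ` J)"

definition cls :: "complex set \<Rightarrow> complex set \<Rightarrow> complex set set" where
  "cls F I = {J. nz_ideal F J \<and> ideal_equiv F J I}"

text \<open>The 2-Sylow subgroup C_{F,2}: classes of 2-power order.\<close>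
definition cl2 :: "complex set \<Rightarrow> complex set set set" where
  "cl2 F = {cls F I | I. nz_ideal F I \<and> (\<exists>n. principal F (ideal_pow F I (2 ^ n)))}"

definition cap_kernel :: "complex set \<Rightarrow> complex set \<Rightarrow> complex set set set" where
  "cap_kernel F K = {cls F I | I. nz_ideal F I \<and> (\<exists>n. principal F (ideal_pow F I (2 ^ n)))
       \<and> principal K (gen_ideal K I)}"

text \<open>Subgroup generated by the classes [A],[B] (class group is finite abelian).\<close>
definition cls_span2 :: "complex set \<Rightarrow> complex set \<Rightarrow> complex set \<Rightarrow> complex set set set" where
  "cls_span2 F A B = {cls F (ideal_mult F (ideal_pow F A a) (ideal_pow F B b)) | a b. True}"

end

theory Submission
  imports Defs "HOL-Analysis.Kronecker_Approximation_Theorem" "Jordan_Normal_Form.Char_Poly"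
begin

text \<open>
  Write \<open>k = \<rat>(\<i>)(w)\<close> with \<open>w = \<surd>(2pq) / (1 + \<i>)\<close>, so that \<open>w\<^sup>2 = -\<i> p q\<close> and the ring of integers
  is \<open>\<int>[\<i>][w]\<close>.

  If \<open>I\<close> becomes principal in a quadratic extension of \<open>k\<close>, taking norms shows that \<open>I\<^sup>2\<close> is principal.
  By Hilbert 90 over \<open>\<rat>(\<i>)\<close>, where \<open>\<i>\<close> times a square is not a norm from \<open>k\<close>, every class of order two
  contains an ideal whose square is generated by a Gaussian integer, hence a product of ramified primes:
  \<open>H\<^sub>0\<close> above \<open>1 + \<i>\<close>, \<open>H\<^sub>1, H\<^sub>2\<close> above \<open>p\<close> and \<open>H\<^sub>3, H\<^sub>4\<close> above \<open>q\<close>.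

  The equation \<open>T\<^sup>2 + 1 = 2 p q U\<^sup>2\<close>, solvable under the hypothesis on the Legendre symbols, yields a relation
  \<open>H\<^sub>0 H\<^sub>j H\<^sub>l ~ 1\<close> with \<open>j \<in> {1,2}\<close> and \<open>l \<in> {3,4}\<close>; the other relation is \<open>H\<^sub>1 H\<^sub>2 H\<^sub>3 H\<^sub>4 = (w)\<close>.
  The equation \<open>T\<^sup>2 + 1 = l U\<^sup>2\<close> makes the primes above \<open>l\<close> capitulate in \<open>k(\<surd>l)\<close>, for \<open>l = p, q\<close>.
  That \<open>H\<^sub>0\<close> capitulates in neither extension follows by taking norms to \<open>\<rat>(\<surd>(2pq), \<surd>-l)\<close> and then to
  \<open>\<rat>(\<surd>(2pq))\<close>.  Finally \<open>x\<^sup>2 + \<i> p q y\<^sup>2 = \<i>\<^sup>j z\<close> is insoluble by congruences for the relevant \<open>z\<close>,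
  which makes the four classes distinct.
\<close>

text \<open>Ideals are bare sets of complex numbers, without a theory of prime factorisation. The
  base \<open>\<rat>(\<i>)\<close> is chosen because \<open>\<int>[\<i>]\<close> is principal:
  \<open>J \<tau>(J)\<close> is then generated by one Gaussian integer, so \<open>\<tau>(J)\<close>
  inverts \<open>J\<close> up to equivalence. Peeling ramified primes one at a time off an ideal
  with known square replaces unique factorisation.

  The two relations put all classes of order two into
  \<open>\<langle>[P], [Q], [H\<^sub>0]\<rangle>\<close>, where \<open>P, Q\<close> are
  \<open>H\<^sub>1, H\<^sub>2\<close> for \<open>k(\<surd>p)\<close> and
  \<open>H\<^sub>0 H\<^sub>1, H\<^sub>0 H\<^sub>2\<close> for \<open>k(\<surd>q)\<close>. Once
  \<open>P\<close> and \<open>Q\<close> capitulate, \<open>H\<^sub>0\<close> alone decides between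
  this group and \<open>\<langle>[P], [Q]\<rangle>\<close>.

  The Pell equation does not reveal which pair \<open>j, l\<close> occurs. Multiplying its relation
  by the other one gives the same relation for the complementary pair, so every choice leads to the
  same kernels. In \<open>k(\<surd>q)\<close> it is \<open>H\<^sub>3\<close> and
  \<open>H\<^sub>4\<close> that visibly capitulate; the two relations identify their classes with
  those of \<open>H\<^sub>0 H\<^sub>1\<close> and \<open>H\<^sub>0 H\<^sub>2\<close> in some
  order.\<close>

lemma algebraic_int_monic_poly:
  assumes "lead_coeff p = 1" "poly (map_poly of_int p) x = 0"
  shows   "algebraic_int (x :: complex)"
  using assms unfolding algebraic_int_altdef_ipoly by blast

section \<open>The ring of algebraic integers\<close>

definition int_span :: "complex set \<Rightarrow> complex set" where
  "int_span S = {\<Sum>s\<in>S. of_int (c s) * s | c. True}"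

lemma int_span_base: "finite S \<Longrightarrow> s \<in> S \<Longrightarrow> s \<in> int_span S"
  unfolding int_span_def
  by (auto intro!: exI[of _ "\<lambda>t. if t = s then 1 else 0"] simp: if_distrib if_distribR sum.delta cong: if_cong)

lemma int_span_add: "x \<in> int_span S \<Longrightarrow> y \<in> int_span S \<Longrightarrow> x + y \<in> int_span S"
  unfolding int_span_def
  by (clarsimp, rule_tac x="\<lambda>s. c s + ca s" in exI) (simp add: sum.distrib ring_distribs)

lemma int_span_scale: "x \<in> int_span S \<Longrightarrow> of_int k * x \<in> int_span S"
  unfolding int_span_def
  by (clarsimp, rule_tac x="\<lambda>s. k * c s" in exI) (simp add: sum_distrib_left mult.assoc)

lemma int_span_0: "0 \<in> int_span S"
  unfolding int_span_def by (auto intro!: exI[of _ "\<lambda>_. 0"])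

lemma int_span_sum: "(\<And>i. i \<in> A \<Longrightarrow> f i \<in> int_span S) \<Longrightarrow> sum f A \<in> int_span S"
  by (induction A rule: infinite_finite_induct) (auto intro: int_span_0 int_span_add)

lemma int_span_mult_closed:
  assumes "\<And>s. s \<in> S \<Longrightarrow> x * s \<in> int_span S" "y \<in> int_span S"
  shows   "x * y \<in> int_span S"
proof -
  obtain c where y: "y = (\<Sum>s\<in>S. of_int (c s) * s)"
    using assms(2) by (auto simp: int_span_def)
  have "x * y = (\<Sum>s\<in>S. of_int (c s) * (x * s))"
    unfolding y sum_distrib_left by (intro sum.cong) auto
  thus ?thesis using assms(1) by (auto intro!: int_span_sum int_span_scale)
qed

text \<open>Cayley--Hamilton: multiplication by \<open>x\<close> acts on \<open>S\<close> by an integer matrix,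
  and \<open>x\<close> is one of its eigenvalues.\<close>
lemma algebraic_int_int_span:
  assumes fin: "finite S" and s: "s \<in> S" "s \<noteq> 0"
    and x: "\<And>s. s \<in> S \<Longrightarrow> x * s \<in> int_span S"
  shows "algebraic_int x"
proof -
  define n where "n = card S"
  obtain v where v: "bij_betw v {0..<n} S"
    using ex_bij_betw_nat_finite[OF fin] n_def by blast
  have "\<forall>s. \<exists>c. s \<in> S \<longrightarrow> x * s = (\<Sum>t\<in>S. of_int (c t) * t)"
    using x by (auto simp: int_span_def)
  then obtain c where c: "\<And>s. s \<in> S \<Longrightarrow> x * s = (\<Sum>t\<in>S. of_int (c s t) * t)"
    by metis
  define A where "A = Matrix.mat n n (\<lambda>(i,j). c (v i) (v j))"
  define w where "w = Matrix.vec n v"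
  have A: "A \<in> carrier_mat n n" by (simp add: A_def)
  let ?B = "map_mat complex_of_int A"
  have B: "?B \<in> carrier_mat n n" using A by simp
  have vS: "v i \<in> S" if "i < n" for i using v that by (auto simp: bij_betw_def)
  have "?B *\<^sub>v w = x \<cdot>\<^sub>v w"
  proof (rule eq_vecI)
    fix i assume "i < dim_vec (x \<cdot>\<^sub>v w)"
    hence i: "i < n" by (simp add: w_def)
    have "(?B *\<^sub>v w) $ i = (\<Sum>j\<in>{0..<n}. of_int (c (v i) (v j)) * v j)"
      using i A by (simp add: w_def scalar_prod_def A_def)
    also have "\<dots> = (\<Sum>t\<in>S. of_int (c (v i) t) * t)"
      by (rule sum.reindex_bij_betw[OF v])
    also have "\<dots> = (x \<cdot>\<^sub>v w) $ i" using c[OF vS[OF i]] i by (simp add: w_def)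
    finally show "(?B *\<^sub>v w) $ i = (x \<cdot>\<^sub>v w) $ i" .
  qed (use A in \<open>simp add: w_def\<close>)
  moreover have "w \<noteq> 0\<^sub>v n"
  proof
    assume w0: "w = 0\<^sub>v n"
    obtain i where "i < n" "v i = s" using s v by (auto simp: bij_betw_def)
    thus False using w0 s by (auto simp: w_def Matrix.vec_eq_iff)
  qed
  ultimately have "eigenvalue ?B x"
    unfolding eigenvalue_def eigenvector_def using A by (auto simp: w_def intro!: exI[of _ w])
  hence "poly (char_poly ?B) x = 0" using eigenvalue_root_char_poly[OF B] by simp
  moreover have "char_poly ?B = map_poly of_int (char_poly A)"
    by (rule of_int_hom.char_poly_hom[OF A])
  ultimately have "poly (map_poly of_int (char_poly A)) x = 0" by simp
  moreover have "lead_coeff (char_poly A) = 1" using degree_monic_char_poly[OF A] by simp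
  ultimately show ?thesis by (rule algebraic_int_monic_poly[rotated])
qed

text \<open>Rewriting the top power keeps a finite set of monomials stable under multiplication by
  \<open>x\<close>. The degree is positive because a monic constant has no root; this later puts
  \<open>1\<close> among the monomials.\<close>

lemma algebraic_int_power_reduction:
  assumes "algebraic_int (x :: complex)"
  obtains n c where "n > 0" "x ^ n = (\<Sum>i<n. of_int (c i) * x ^ i)"
proof -
  obtain p where p: "poly (map_poly of_int p) x = 0" "lead_coeff p = 1"
    using assms by (auto simp: algebraic_int_altdef_ipoly)
  define n where "n = degree p"
  have "n > 0"
  proof (rule ccontr)
    assume "\<not> n > 0"
    hence "degree p = 0" by (simp add: n_def)
    then obtain a where "p = [:a:]" by (rule degree_eq_zeroE)
    thus False using p by (auto simp: map_poly_pCons)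
  qed
  have deg: "degree (map_poly complex_of_int p) = n" by (simp add: n_def)
  have "0 = (\<Sum>i\<le>n. of_int (Polynomial.coeff p i) * x ^ i)"
    using p(1) unfolding poly_altdef deg by simp
  also have "{..n} = insert n {..<n}" by auto
  also have "(\<Sum>i\<in>\<dots>. of_int (Polynomial.coeff p i) * x ^ i) = x ^ n + (\<Sum>i<n. of_int (Polynomial.coeff p i) * x ^ i)"
    using p(2) by (simp add: n_def)
  finally have "x ^ n = (\<Sum>i<n. of_int (- Polynomial.coeff p i) * x ^ i)"
    by (simp add: eq_neg_iff_add_eq_0 sum_negf)
  with \<open>n > 0\<close> show ?thesis by (rule that)
qed

text \<open>The monomials \<open>x ^ i * y ^ j\<close> below the two degrees span a module that
  contains \<open>1\<close> and is stable under both \<open>x\<close> and \<open>y\<close>, hence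
  under their sum and product.\<close>

lemma
  assumes "algebraic_int (x :: complex)" "algebraic_int y"
  shows algebraic_int_add: "algebraic_int (x + y)"
    and algebraic_int_mult: "algebraic_int (x * y)"
proof -
  obtain n c where n: "n > 0" and xn: "x ^ n = (\<Sum>i<n. of_int (c i) * x ^ i)"
    using algebraic_int_power_reduction[OF assms(1)] .
  obtain m b where m: "m > 0" and ym: "y ^ m = (\<Sum>i<m. of_int (b i) * y ^ i)"
    using algebraic_int_power_reduction[OF assms(2)] .
  define S where "S = (\<lambda>(i,j). x ^ i * y ^ j) ` ({..<n} \<times> {..<m})"
  have fin: "finite S" by (simp add: S_def)
  have S: "x ^ i * y ^ j \<in> int_span S" if "i < n" "j < m" for i j
    by (rule int_span_base[OF fin]) (use that in \<open>auto simp: S_def\<close>)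
  have xS: "x * s \<in> int_span S" if s: "s \<in> S" for s
  proof -
    obtain i j where ij: "i < n" "j < m" "s = x ^ i * y ^ j" using s by (auto simp: S_def)
    show ?thesis
    proof (cases "Suc i < n")
      case True
      thus ?thesis using S[of "Suc i" j] ij by (simp add: mult.assoc)
    next
      case False
      hence "Suc i = n" using ij by simp
      hence "x * s = x ^ n * y ^ j" using ij by auto
      also have "\<dots> = (\<Sum>i<n. of_int (c i) * (x ^ i * y ^ j))"
        unfolding xn sum_distrib_right by (simp add: mult.assoc)
      finally show ?thesis using S ij by (auto intro!: int_span_sum int_span_scale)
    qed
  qed
  have yS: "y * s \<in> int_span S" if s: "s \<in> S" for s
  proof -
    obtain i j where ij: "i < n" "j < m" "s = x ^ i * y ^ j" using s by (auto simp: S_def)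
    show ?thesis
    proof (cases "Suc j < m")
      case True
      thus ?thesis using S[of i "Suc j"] ij by (simp add: mult_ac)
    next
      case False
      hence "Suc j = m" using ij by simp
      hence "y * s = x ^ i * y ^ m" using ij by auto
      also have "\<dots> = (\<Sum>j<m. of_int (b j) * (x ^ i * y ^ j))"
        unfolding ym sum_distrib_left by (simp add: mult_ac)
      finally show ?thesis using S ij by (auto intro!: int_span_sum int_span_scale)
    qed
  qed
  have 1: "1 \<in> S" using n m by (force simp: S_def)
  show "algebraic_int (x + y)"
    by (rule algebraic_int_int_span[OF fin 1])
       (auto simp: ring_distribs intro!: int_span_add xS yS)
  show "algebraic_int (x * y)"
    by (rule algebraic_int_int_span[OF fin 1])
       (auto simp: mult.assoc intro: int_span_mult_closed[OF xS] yS)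
qed

lemma algebraic_int_diff:
  "algebraic_int (x :: complex) \<Longrightarrow> algebraic_int y \<Longrightarrow> algebraic_int (x - y)"
  using algebraic_int_add[of x "-y"] by simp

lemma algebraic_int_of_int_complex: "algebraic_int (of_int n :: complex)"
  by (rule int_imp_algebraic_int) simp

text \<open>The main integrality test of the development: for ideals with a known square, a quotient
  of elements usually has a visibly integral square.\<close>

lemma algebraic_int_sqrt_complex:
  assumes "algebraic_int (x\<^sup>2 :: complex)" shows "algebraic_int x"
  by (rule algebraic_int_root[OF assms, of "Polynomial.monom 1 2"])
     (auto simp: poly_monom degree_monom_eq Polynomial.coeff_monom)

section \<open>Ideals in rings of integers\<close>

lemma is_subfieldD:
  assumes "is_subfield F"
  shows "0 \<in> F" "1 \<in> F" "x \<in> F \<Longrightarrow> y \<in> F \<Longrightarrow> x + y \<in> F" "x \<in> F \<Longrightarrow> y \<in> F \<Longrightarrow> x - y \<in> F"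
    "x \<in> F \<Longrightarrow> y \<in> F \<Longrightarrow> x * y \<in> F" "x \<in> F \<Longrightarrow> inverse x \<in> F" "x \<in> F \<Longrightarrow> - x \<in> F"
    "x \<in> F \<Longrightarrow> y \<in> F \<Longrightarrow> x / y \<in> F"
proof -
  show a: "0 \<in> F" "1 \<in> F" "x \<in> F \<Longrightarrow> y \<in> F \<Longrightarrow> x + y \<in> F" "x \<in> F \<Longrightarrow> y \<in> F \<Longrightarrow> x - y \<in> F"
    "x \<in> F \<Longrightarrow> y \<in> F \<Longrightarrow> x * y \<in> F" for x y
    using assms by (auto simp: is_subfield_def)
  show b: "x \<in> F \<Longrightarrow> inverse x \<in> F" for x
    using assms by (cases "x = 0") (auto simp: is_subfield_def)
  show "x \<in> F \<Longrightarrow> - x \<in> F" using a(1) a(4)[of 0 x] by simp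
  show "x \<in> F \<Longrightarrow> y \<in> F \<Longrightarrow> x / y \<in> F" using a(5)[of x "inverse y"] b[of y] by (simp add: divide_inverse)
qed

lemma is_subfield_of_int:
  assumes "is_subfield F" shows "of_int n \<in> F"
proof -
  have "of_nat m \<in> F" for m
    by (induction m) (auto intro: is_subfieldD[OF assms])
  thus ?thesis by (cases n rule: int_cases2) (auto intro: is_subfieldD[OF assms])
qed

lemma OK_D: "x \<in> OK F \<Longrightarrow> x \<in> F" "x \<in> OK F \<Longrightarrow> algebraic_int x"
  and OK_I: "x \<in> F \<Longrightarrow> algebraic_int x \<Longrightarrow> x \<in> OK F"
  by (auto simp: OK_def)

lemma OK_ring:
  assumes "is_subfield F"
  shows OK_add: "x \<in> OK F \<Longrightarrow> y \<in> OK F \<Longrightarrow> x + y \<in> OK F"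
    and OK_mult: "x \<in> OK F \<Longrightarrow> y \<in> OK F \<Longrightarrow> x * y \<in> OK F"
    and OK_diff: "x \<in> OK F \<Longrightarrow> y \<in> OK F \<Longrightarrow> x - y \<in> OK F"
    and OK_uminus: "x \<in> OK F \<Longrightarrow> - x \<in> OK F"
    and OK_of_int: "of_int m \<in> OK F"
    and OK_0: "0 \<in> OK F"
    and OK_1: "1 \<in> OK F"
proof -
  show m: "x \<in> OK F \<Longrightarrow> y \<in> OK F \<Longrightarrow> x * y \<in> OK F" for x y
    by (auto simp: OK_def intro: algebraic_int_mult is_subfieldD[OF assms])
  show "of_int m \<in> OK F" for m
    by (auto simp: OK_def algebraic_int_of_int_complex is_subfield_of_int[OF assms])
  from this[of 0] this[of 1] show "0 \<in> OK F" "1 \<in> OK F" by auto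
qed (auto simp: OK_def intro: algebraic_int_add algebraic_int_diff is_subfieldD[OF assms])

lemma is_idealD:
  assumes "is_ideal F I"
  shows "x \<in> I \<Longrightarrow> x \<in> OK F" "0 \<in> I" "x \<in> I \<Longrightarrow> y \<in> I \<Longrightarrow> x + y \<in> I"
    "r \<in> OK F \<Longrightarrow> x \<in> I \<Longrightarrow> r * x \<in> I" "r \<in> OK F \<Longrightarrow> x \<in> I \<Longrightarrow> x * r \<in> I"
  using assms by (auto simp: is_ideal_def mult.commute[of x r])

lemma is_ideal_uminus_diff:
  assumes "is_subfield F" "is_ideal F I"
  shows "x \<in> I \<Longrightarrow> - x \<in> I" "x \<in> I \<Longrightarrow> y \<in> I \<Longrightarrow> x - y \<in> I"
proof -
  have *: "x \<in> I \<Longrightarrow> - x \<in> I" for x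
    using is_idealD(4)[OF assms(2), of "-1" x] OK_of_int[OF assms(1), of "-1"] by simp
  show "x \<in> I \<Longrightarrow> - x \<in> I" by fact
  show "x \<in> I \<Longrightarrow> y \<in> I \<Longrightarrow> x - y \<in> I"
    using *[of y] is_idealD(3)[OF assms(2), of x "-y"] by simp
qed

lemma is_ideal_OK: "is_subfield F \<Longrightarrow> is_ideal F (OK F)"
  by (auto simp: is_ideal_def OK_ring)

lemma gen_ideal_base: "S \<subseteq> gen_ideal F S"
  by (auto simp: gen_ideal_def)

lemma gen_ideal_least: "is_ideal F J \<Longrightarrow> S \<subseteq> J \<Longrightarrow> gen_ideal F S \<subseteq> J"
  by (auto simp: gen_ideal_def)

lemma is_ideal_gen_ideal:
  assumes "is_subfield F" "S \<subseteq> OK F"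
  shows "is_ideal F (gen_ideal F S)"
proof -
  have "gen_ideal F S \<subseteq> OK F" using gen_ideal_least[OF is_ideal_OK] assms by blast
  thus ?thesis unfolding is_ideal_def gen_ideal_def by blast
qed

text \<open>The factor \<open>a\<close> may be non-integral: with \<open>a = 1 / c\<close> an ideal
  contained in the multiples of \<open>c\<close> is divided by \<open>c\<close>.\<close>

lemma is_ideal_dilate:
  assumes "is_subfield F" "is_ideal F I" "\<And>x. x \<in> I \<Longrightarrow> a * x \<in> OK F"
  shows "is_ideal F ((*) a ` I)"
  unfolding is_ideal_def
proof (intro conjI ballI)
  show "(*) a ` I \<subseteq> OK F" using assms(3) by auto
  show "0 \<in> (*) a ` I" using is_idealD(2)[OF assms(2)] by force
  show "x + y \<in> (*) a ` I" if "x \<in> (*) a ` I" "y \<in> (*) a ` I" for x y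
    using that is_idealD(3)[OF assms(2)] by (auto simp: image_iff ring_distribs[symmetric])
  show "r * x \<in> (*) a ` I" if "r \<in> OK F" "x \<in> (*) a ` I" for r x
    using that is_idealD(4)[OF assms(2)] by (auto simp: image_iff mult.left_commute)
qed

lemma is_ideal_smul:
  assumes "is_subfield F" "is_ideal F I" "a \<in> OK F"
  shows "is_ideal F ((*) a ` I)"
  using assms by (intro is_ideal_dilate) (auto intro: OK_ring dest: is_idealD)

lemma gen_ideal_singleton:
  assumes "is_subfield F" "a \<in> OK F"
  shows "gen_ideal F {a} = (*) a ` OK F"
proof
  show "gen_ideal F {a} \<subseteq> (*) a ` OK F"
    using OK_1[OF assms(1)]
    by (intro gen_ideal_least is_ideal_smul assms is_ideal_OK) (auto intro!: image_eqI[of _ _ 1])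
  have "is_ideal F (gen_ideal F {a})" using assms by (intro is_ideal_gen_ideal) auto
  thus "(*) a ` OK F \<subseteq> gen_ideal F {a}"
    using gen_ideal_base[of "{a}" F] by (auto dest: is_idealD(5))
qed

text \<open>This is how statements about generators extend to the generated ideal.\<close>
lemma is_ideal_quotient:
  assumes "is_subfield F" "is_ideal F J"
  shows "is_ideal F {x \<in> OK F. \<forall>a\<in>A. a * x \<in> J}"
  unfolding is_ideal_def
  using is_idealD[OF assms(2)]
  by (auto simp: OK_ring[OF assms(1)] ring_distribs mult.left_commute)

lemma ideal_mult_memI: "a \<in> I \<Longrightarrow> b \<in> J \<Longrightarrow> a * b \<in> ideal_mult F I J"
  unfolding ideal_mult_def by (rule subsetD[OF gen_ideal_base]) auto

lemma ideal_mult_least: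
  assumes "is_ideal F L" "\<And>a b. a \<in> I \<Longrightarrow> b \<in> J \<Longrightarrow> a * b \<in> L"
  shows "ideal_mult F I J \<subseteq> L"
  unfolding ideal_mult_def using assms by (intro gen_ideal_least) auto

lemma is_ideal_mult:
  assumes "is_subfield F" "is_ideal F I" "is_ideal F J"
  shows "is_ideal F (ideal_mult F I J)"
  unfolding ideal_mult_def
  using assms by (intro is_ideal_gen_ideal) (auto intro: OK_ring dest: is_idealD)

lemma ideal_mult_commute: "ideal_mult F I J = ideal_mult F J I"
proof -
  have "{a * b | a b. a \<in> I \<and> b \<in> J} \<subseteq> {a * b | a b. a \<in> J \<and> b \<in> I}" for I J :: "complex set"
  proof clarify
    fix a b assume "a \<in> I" "b \<in> J"
    thus "\<exists>a' b'. a * b = a' * b' \<and> a' \<in> J \<and> b' \<in> I"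
      by (intro exI[of _ b] exI[of _ a]) (simp add: mult.commute)
  qed
  from this[of I J] this[of J I] show ?thesis by (simp add: ideal_mult_def)
qed

text \<open>Only elementwise products of \<open>I\<close> and \<open>J\<close> are explicit. The
  elements whose multiples by \<open>L\<close> stay in the target form an ideal, so it suffices that
  these products belong to it.\<close>

lemma ideal_mult_assoc_subset:
  assumes "is_subfield F" "is_ideal F I" "is_ideal F J" "is_ideal F L"
  shows "ideal_mult F (ideal_mult F I J) L \<subseteq> ideal_mult F I (ideal_mult F J L)"
proof (rule ideal_mult_least)
  show R: "is_ideal F (ideal_mult F I (ideal_mult F J L))" by (intro is_ideal_mult assms)
  fix a b assume a: "a \<in> ideal_mult F I J" and b: "b \<in> L"
  have "ideal_mult F I J \<subseteq> {x \<in> OK F. \<forall>a\<in>L. a * x \<in> ideal_mult F I (ideal_mult F J L)}"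
  proof (rule ideal_mult_least[OF is_ideal_quotient[OF assms(1) R]], safe)
    fix x y assume "x \<in> I" "y \<in> J"
    thus "x * y \<in> OK F" using assms by (auto intro: OK_ring dest: is_idealD)
    fix z assume "z \<in> L"
    hence "x * (y * z) \<in> ideal_mult F I (ideal_mult F J L)"
      by (intro ideal_mult_memI \<open>x \<in> I\<close> \<open>y \<in> J\<close>)
    thus "z * (x * y) \<in> ideal_mult F I (ideal_mult F J L)" by (simp add: mult_ac)
  qed
  thus "a * b \<in> ideal_mult F I (ideal_mult F J L)" using a b by (auto simp: mult.commute)
qed

lemma ideal_mult_assoc:
  assumes "is_subfield F" "is_ideal F I" "is_ideal F J" "is_ideal F L"
  shows "ideal_mult F (ideal_mult F I J) L = ideal_mult F I (ideal_mult F J L)"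
  using ideal_mult_assoc_subset[OF assms] ideal_mult_assoc_subset[OF assms(1,4,3,2)]
  by (simp add: ideal_mult_commute)

lemma ideal_mult_OK:
  assumes "is_subfield F" "is_ideal F I"
  shows "ideal_mult F (OK F) I = I" "ideal_mult F I (OK F) = I"
proof -
  show "ideal_mult F (OK F) I = I"
  proof
    show "ideal_mult F (OK F) I \<subseteq> I" by (rule ideal_mult_least) (use assms in \<open>auto dest: is_idealD\<close>)
    show "I \<subseteq> ideal_mult F (OK F) I"
      using ideal_mult_memI[OF OK_1[OF assms(1)], of _ I] by auto
  qed
  thus "ideal_mult F I (OK F) = I" by (simp add: ideal_mult_commute)
qed

lemma ideal_mult_smul:
  assumes "is_subfield F" "is_ideal F I" "is_ideal F J" "a \<in> OK F"
  shows "ideal_mult F ((*) a ` I) J = (*) a ` ideal_mult F I J"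
proof
  have IJ: "is_ideal F (ideal_mult F I J)" by (intro is_ideal_mult assms)
  show "ideal_mult F ((*) a ` I) J \<subseteq> (*) a ` ideal_mult F I J"
    by (rule ideal_mult_least[OF is_ideal_smul[OF assms(1) IJ assms(4)]])
       (auto simp: mult.assoc intro: ideal_mult_memI)
  have aI: "is_ideal F (ideal_mult F ((*) a ` I) J)" by (intro is_ideal_mult is_ideal_smul assms)
  have "ideal_mult F I J \<subseteq> {x \<in> OK F. \<forall>b\<in>{a}. b * x \<in> ideal_mult F ((*) a ` I) J}"
  proof (rule ideal_mult_least[OF is_ideal_quotient[OF assms(1) aI]], safe)
    fix x y assume xy: "x \<in> I" "y \<in> J"
    thus "x * y \<in> OK F" using assms by (auto intro: OK_ring dest: is_idealD)
    have "(a * x) * y \<in> ideal_mult F ((*) a ` I) J" using xy by (intro ideal_mult_memI) auto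
    thus "a * (x * y) \<in> ideal_mult F ((*) a ` I) J" by (simp add: mult.assoc)
  qed
  thus "(*) a ` ideal_mult F I J \<subseteq> ideal_mult F ((*) a ` I) J" by auto
qed

lemma ideal_mult_smul_right:
  assumes "is_subfield F" "is_ideal F I" "is_ideal F J" "a \<in> OK F"
  shows "ideal_mult F I ((*) a ` J) = (*) a ` ideal_mult F I J"
  using ideal_mult_smul[OF assms(1,3,2,4)] by (simp add: ideal_mult_commute)

lemma principal_mult:
  assumes "is_subfield F" "is_ideal F I" "a \<in> OK F"
  shows "ideal_mult F ((*) a ` OK F) I = (*) a ` I"
  using assms by (simp add: ideal_mult_smul is_ideal_OK ideal_mult_OK)

lemma smul_smul: "(*) a ` (*) b ` I = (*) (a * b :: 'a :: semigroup_mult) ` I"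
  by (auto simp: image_iff mult.assoc)

lemma smul_cancel: "a \<noteq> 0 \<Longrightarrow> (*) a ` I = (*) a ` J \<longleftrightarrow> I = (J :: complex set)"
  by (rule inj_image_eq_iff) (auto simp: inj_on_def)

lemma nz_ideal_mem: "nz_ideal F I \<Longrightarrow> \<exists>x\<in>I. x \<noteq> 0"
  unfolding nz_ideal_def using is_idealD(2) by blast

lemma nz_ideal_smul:
  assumes "is_subfield F" "nz_ideal F I" "a \<in> OK F" "a \<noteq> 0"
  shows "nz_ideal F ((*) a ` I)"
proof -
  obtain x where "x \<in> I" "x \<noteq> 0" using nz_ideal_mem[OF assms(2)] by blast
  hence "a * x \<in> (*) a ` I" "a * x \<noteq> 0" using assms(4) by auto
  hence "(*) a ` I \<noteq> {0}" by blast
  thus ?thesis using is_ideal_smul[OF assms(1) _ assms(3)] assms(2) by (simp add: nz_ideal_def)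
qed

lemma nz_ideal_mult:
  assumes "is_subfield F" "nz_ideal F I" "nz_ideal F J"
  shows "nz_ideal F (ideal_mult F I J)"
proof -
  obtain x y where "x \<in> I" "x \<noteq> 0" "y \<in> J" "y \<noteq> 0" using nz_ideal_mem assms by metis
  hence "x * y \<in> ideal_mult F I J" "x * y \<noteq> 0" by (auto intro: ideal_mult_memI)
  hence "ideal_mult F I J \<noteq> {0}" by blast
  thus ?thesis using is_ideal_mult[OF assms(1)] assms by (simp add: nz_ideal_def)
qed

lemma nz_ideal_OK: "is_subfield F \<Longrightarrow> nz_ideal F (OK F)"
proof -
  assume "is_subfield F"
  hence "1 \<in> OK F" "is_ideal F (OK F)" by (rule OK_1, rule is_ideal_OK)
  thus ?thesis unfolding nz_ideal_def by (metis singletonD zero_neq_one)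
qed

lemma nz_ideal_ideal: "nz_ideal F I \<Longrightarrow> is_ideal F I"
  by (simp add: nz_ideal_def)

lemma ideal_equivI:
  assumes "a \<in> OK F" "a \<noteq> 0" "b \<in> OK F" "b \<noteq> 0" "(*) a ` I = (*) b ` J"
  shows "ideal_equiv F I J"
  using assms unfolding ideal_equiv_def by blast

lemma ideal_equivE:
  assumes "ideal_equiv F I J"
  obtains a b where "a \<in> OK F" "a \<noteq> 0" "b \<in> OK F" "b \<noteq> 0" "(*) a ` I = (*) b ` J"
  using assms unfolding ideal_equiv_def by blast

lemma ideal_equiv_refl: "is_subfield F \<Longrightarrow> ideal_equiv F I I"
  by (rule ideal_equivI[of 1 _ 1]) (auto intro: OK_1)

lemma ideal_equiv_sym: "ideal_equiv F I J \<Longrightarrow> ideal_equiv F J I"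
  by (metis ideal_equivI ideal_equivE)

lemma ideal_equiv_trans:
  assumes "is_subfield F" "ideal_equiv F I J" "ideal_equiv F J L"
  shows "ideal_equiv F I L"
proof -
  from assms(2) obtain a b where 1: "a \<in> OK F" "a \<noteq> 0" "b \<in> OK F" "b \<noteq> 0" "(*) a ` I = (*) b ` J"
    by (rule ideal_equivE)
  from assms(3) obtain c d where 2: "c \<in> OK F" "c \<noteq> 0" "d \<in> OK F" "d \<noteq> 0" "(*) c ` J = (*) d ` L"
    by (rule ideal_equivE)
  have "(*) (c * a) ` I = (*) c ` (*) b ` J" using 1 by (simp add: smul_smul[symmetric])
  also have "\<dots> = (*) b ` (*) d ` L" using 2(5) by (simp add: smul_smul mult.commute[of c b] flip: 2(5))
  finally have "(*) (c * a) ` I = (*) (b * d) ` L" by (simp add: smul_smul)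
  thus ?thesis using 1 2 assms(1) by (intro ideal_equivI[of "c * a" _ "b * d"]) (auto intro: OK_mult)
qed

lemma ideal_equiv_mult_right:
  assumes "is_subfield F" "ideal_equiv F I J" "is_ideal F I" "is_ideal F J" "is_ideal F L"
  shows "ideal_equiv F (ideal_mult F I L) (ideal_mult F J L)"
proof -
  from assms(2) obtain a b where 1: "a \<in> OK F" "a \<noteq> 0" "b \<in> OK F" "b \<noteq> 0" "(*) a ` I = (*) b ` J"
    by (rule ideal_equivE)
  have "(*) a ` ideal_mult F I L = (*) b ` ideal_mult F J L"
    using ideal_mult_smul[OF assms(1,3,5) 1(1)] ideal_mult_smul[OF assms(1,4,5) 1(3)] 1(5) by simp
  thus ?thesis using 1 by (intro ideal_equivI) auto
qed

lemma ideal_equiv_smul: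
  assumes "is_subfield F" "a \<in> OK F" "a \<noteq> 0"
  shows "ideal_equiv F ((*) a ` I) I"
  by (rule ideal_equivI[of 1 _ a]) (use assms OK_1[OF assms(1)] in auto)

lemma principal_iff_equiv_OK:
  assumes "is_subfield F" "nz_ideal F I"
  shows "principal F I \<longleftrightarrow> ideal_equiv F I (OK F)"
proof
  assume "principal F I"
  then obtain a where a: "a \<in> OK F" "I = (*) a ` OK F"
    unfolding principal_def by (auto simp: gen_ideal_singleton[OF assms(1)])
  with nz_ideal_mem[OF assms(2)] have "a \<noteq> 0" by auto
  with a show "ideal_equiv F I (OK F)" using ideal_equiv_smul[OF assms(1)] by simp
next
  assume "ideal_equiv F I (OK F)"
  then obtain a b where ab: "a \<in> OK F" "a \<noteq> 0" "b \<in> OK F" "b \<noteq> 0" "(*) a ` I = (*) b ` OK F"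
    by (rule ideal_equivE)
  have "b \<in> (*) b ` OK F" using OK_1[OF assms(1)] by (auto intro!: image_eqI[of _ _ 1])
  then obtain c where c: "c \<in> I" "b = a * c" using ab(5) by auto
  have "c \<in> OK F" using c assms by (auto simp: nz_ideal_def dest: is_idealD)
  moreover have "(*) a ` I = (*) a ` (*) c ` OK F" using ab c by (simp add: smul_smul)
  hence "I = (*) c ` OK F" using ab by (simp add: smul_cancel)
  ultimately show "principal F I" unfolding principal_def
    using gen_ideal_singleton[OF assms(1)] by blast
qed

lemma cls_eq_iff:
  assumes "is_subfield F" "nz_ideal F I" "nz_ideal F J"
  shows "cls F I = cls F J \<longleftrightarrow> ideal_equiv F I J"
proof
  assume "cls F I = cls F J"
  moreover have "I \<in> cls F I" using assms by (simp add: cls_def ideal_equiv_refl)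
  ultimately show "ideal_equiv F I J" by (simp add: cls_def)
next
  assume "ideal_equiv F I J"
  thus "cls F I = cls F J" unfolding cls_def
    using ideal_equiv_trans[OF assms(1)] ideal_equiv_sym by blast
qed

section \<open>Extension of ideals\<close>

lemma OK_mono: "F \<subseteq> K \<Longrightarrow> OK F \<subseteq> OK K"
  by (auto simp: OK_def)

lemma is_ideal_extension:
  assumes "is_subfield K" "F \<subseteq> K" "is_ideal F I"
  shows "is_ideal K (gen_ideal K I)"
  using assms OK_mono[OF assms(2)] by (intro is_ideal_gen_ideal) (auto dest: is_idealD)

text \<open>An equality of ideals is replaced by one membership and by divisibility of the elements
  of \<open>I\<close> alone, which is how capitulation is used and proved below.\<close>

lemma capitulates_iff:
  assumes K: "is_subfield K" "F \<subseteq> K" "is_ideal F I"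
  shows "principal K (gen_ideal K I) \<longleftrightarrow>
    (\<exists>a\<in>gen_ideal K I. \<forall>x\<in>I. \<exists>r\<in>OK K. x = a * r)"
proof
  assume "principal K (gen_ideal K I)"
  then obtain a where a: "a \<in> OK K" "gen_ideal K I = (*) a ` OK K"
    unfolding principal_def by (auto simp: gen_ideal_singleton[OF K(1)])
  have "a \<in> gen_ideal K I" using a OK_1[OF K(1)] by (auto intro!: image_eqI[of _ _ 1])
  moreover have "I \<subseteq> (*) a ` OK K" using gen_ideal_base a by blast
  ultimately show "\<exists>a\<in>gen_ideal K I. \<forall>x\<in>I. \<exists>r\<in>OK K. x = a * r" by blast
next
  assume "\<exists>a\<in>gen_ideal K I. \<forall>x\<in>I. \<exists>r\<in>OK K. x = a * r"
  then obtain a where a: "a \<in> gen_ideal K I" "\<forall>x\<in>I. \<exists>r\<in>OK K. x = a * r" by blast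
  have id: "is_ideal K (gen_ideal K I)" by (rule is_ideal_extension[OF K])
  have aK: "a \<in> OK K" using a id by (auto dest: is_idealD)
  have "gen_ideal K I \<subseteq> (*) a ` OK K"
    by (rule gen_ideal_least[OF is_ideal_smul[OF K(1) is_ideal_OK[OF K(1)] aK]]) (use a in auto)
  moreover have "(*) a ` OK K \<subseteq> gen_ideal K I" using a(1) is_idealD(5)[OF id] by auto
  ultimately have "gen_ideal K I = gen_ideal K {a}" using gen_ideal_singleton[OF K(1) aK] by auto
  thus "principal K (gen_ideal K I)" unfolding principal_def using aK by blast
qed

lemma capitulates_mult:
  assumes K: "is_subfield F" "is_subfield K" "F \<subseteq> K" and I: "is_ideal F I" "is_ideal F J"
    and cap: "principal K (gen_ideal K I)" "principal K (gen_ideal K J)"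
  shows "principal K (gen_ideal K (ideal_mult F I J))"
proof -
  let ?M = "ideal_mult F I J"
  have M: "is_ideal F ?M" by (intro is_ideal_mult K I)
  have idM: "is_ideal K (gen_ideal K ?M)" by (rule is_ideal_extension[OF K(2,3) M])
  obtain a where a: "a \<in> gen_ideal K I" "\<And>x. x \<in> I \<Longrightarrow> \<exists>r\<in>OK K. x = a * r"
    using cap(1) capitulates_iff[OF K(2,3) I(1)] by blast
  obtain b where b: "b \<in> gen_ideal K J" "\<And>x. x \<in> J \<Longrightarrow> \<exists>r\<in>OK K. x = b * r"
    using cap(2) capitulates_iff[OF K(2,3) I(2)] by blast
  have OKFK: "x \<in> OK K" if "x \<in> OK F" for x using OK_mono[OF K(3)] that by blast
  have 1: "gen_ideal K I \<subseteq> {x \<in> OK K. \<forall>y\<in>J. y * x \<in> gen_ideal K ?M}"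
  proof (rule gen_ideal_least[OF is_ideal_quotient[OF K(2) idM]], safe)
    fix x assume "x \<in> I"
    thus "x \<in> OK K" using I OKFK by (auto dest: is_idealD)
    fix y assume "y \<in> J"
    have "x * y \<in> ?M" using \<open>x \<in> I\<close> \<open>y \<in> J\<close> by (rule ideal_mult_memI)
    thus "y * x \<in> gen_ideal K ?M" using gen_ideal_base[of ?M K] by (auto simp: mult.commute)
  qed
  have "gen_ideal K J \<subseteq> {y \<in> OK K. \<forall>x\<in>{a}. x * y \<in> gen_ideal K ?M}"
  proof (rule gen_ideal_least[OF is_ideal_quotient[OF K(2) idM]], safe)
    fix y assume "y \<in> J"
    thus "y \<in> OK K" using I OKFK by (auto dest: is_idealD)
    show "a * y \<in> gen_ideal K ?M" using 1 a(1) \<open>y \<in> J\<close> by (auto simp: mult.commute)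
  qed
  hence ab: "a * b \<in> gen_ideal K ?M" using b(1) by auto
  have aK: "a \<in> OK K" "b \<in> OK K"
    using a b is_ideal_extension[OF K(2,3) I(1)] is_ideal_extension[OF K(2,3) I(2)] by (auto dest: is_idealD)
  have "gen_ideal K ?M \<subseteq> (*) (a * b) ` OK K"
  proof (rule gen_ideal_least[OF is_ideal_smul[OF K(2) is_ideal_OK[OF K(2)] OK_mult[OF K(2) aK]]])
    \<comment> \<open>A product formed over \<open>F\<close> can only be compared with an ideal of
      \<open>F\<close>, hence the intersection with \<open>OK F\<close>.\<close>
    have "?M \<subseteq> OK F \<inter> (*) (a * b) ` OK K"
    proof (rule ideal_mult_least)
      have i: "is_ideal K ((*) (a * b) ` OK K)"
        by (intro is_ideal_smul is_ideal_OK OK_mult K aK)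
      show "is_ideal F (OK F \<inter> (*) (a * b) ` OK K)"
        using is_ideal_OK[OF K(1)] i OKFK unfolding is_ideal_def by blast
      fix x y assume xy: "x \<in> I" "y \<in> J"
      obtain r s where "r \<in> OK K" "s \<in> OK K" "x = a * r" "y = b * s" using a(2) b(2) xy by meson
      hence "x * y = (a * b) * (r * s)" "r * s \<in> OK K" by (auto intro: OK_mult[OF K(2)] simp: mult_ac)
      hence "x * y \<in> (*) (a * b) ` OK K" by blast
      moreover have "x * y \<in> OK F" using xy I K by (auto intro: OK_mult dest: is_idealD)
      ultimately show "x * y \<in> OK F \<inter> (*) (a * b) ` OK K" by blast
    qed
    thus "?M \<subseteq> (*) (a * b) ` OK K" by blast
  qed
  hence "\<forall>x\<in>?M. \<exists>r\<in>OK K. x = (a * b) * r" using gen_ideal_base[of ?M K] by blast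
  thus ?thesis using ab capitulates_iff[OF K(2,3) M] by blast
qed

lemma capitulates_equiv:
  assumes K: "is_subfield F" "is_subfield K" "F \<subseteq> K" and I: "is_ideal F I" "is_ideal F J"
    and eq: "ideal_equiv F I J" and cap: "principal K (gen_ideal K I)"
  shows "principal K (gen_ideal K J)"
proof -
  obtain a where a: "a \<in> gen_ideal K I" "\<And>x. x \<in> I \<Longrightarrow> \<exists>r\<in>OK K. x = a * r"
    using cap capitulates_iff[OF K(2,3) I(1)] by blast
  from eq obtain x y where xy: "x \<in> OK F" "x \<noteq> 0" "y \<in> OK F" "y \<noteq> 0" "(*) x ` I = (*) y ` J"
    by (rule ideal_equivE)
  have OKFK: "x \<in> OK K" if "x \<in> OK F" for x using OK_mono[OF K(3)] that by blast
  have idJ: "is_ideal K (gen_ideal K J)" by (rule is_ideal_extension[OF K(2,3) I(2)])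
  let ?yJ = "(*) y ` gen_ideal K J"
  have yJ: "is_ideal K ?yJ" by (rule is_ideal_smul[OF K(2) idJ OKFK[OF xy(3)]])
  have "gen_ideal K I \<subseteq> {z \<in> OK K. \<forall>c\<in>{x}. c * z \<in> ?yJ}"
  proof (rule gen_ideal_least[OF is_ideal_quotient[OF K(2) yJ]], safe)
    fix z assume z: "z \<in> I"
    thus "z \<in> OK K" using I OKFK by (auto dest: is_idealD)
    have "x * z \<in> (*) y ` J" using z xy(5) by blast
    thus "x * z \<in> ?yJ" using gen_ideal_base by blast
  qed
  hence "x * a \<in> ?yJ" using a(1) by auto
  then obtain c where c: "c \<in> gen_ideal K J" "x * a = y * c" by blast
  have "\<exists>r\<in>OK K. z = c * r" if z: "z \<in> J" for z
  proof -
    have "y * z \<in> (*) x ` I" using z xy(5) by blast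
    then obtain w where w: "w \<in> I" "y * z = x * w" by blast
    obtain r where r: "r \<in> OK K" "w = a * r" using a(2) w by blast
    have "y * z = y * (c * r)" using w r c by (simp flip: mult.assoc)
    thus ?thesis using r xy by auto
  qed
  thus ?thesis using c(1) capitulates_iff[OF K(2,3) I(2)] by blast
qed

text \<open>The generator of the extension is \<open>s\<close>. For \<open>x\<close> in
  \<open>I\<close> the square of \<open>x / s\<close> is \<open>x^2 / c\<close> times
  \<open>inverse u\<close>, so \<open>x / s\<close> is integral. This puts \<open>I^2\<close> inside
  \<open>s\<close> times the extension, so \<open>c = s * z\<close> with \<open>z\<close> in the
  extension, and then \<open>s = u * z\<close>.\<close>

lemma capitulates_square:
  assumes K: "is_subfield F" "is_subfield K" "F \<subseteq> K" and I: "is_ideal F I"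
    and sq: "ideal_mult F I I = (*) c ` OK F" "c \<in> OK F"
    and s: "s \<in> K" "s\<^sup>2 = c * u" "s \<noteq> 0" and u: "u \<in> OK K" "inverse u \<in> OK K"
  shows "principal K (gen_ideal K I)"
proof -
  have OKFK: "x \<in> OK K" if "x \<in> OK F" for x using OK_mono[OF K(3)] that by blast
  have "u \<noteq> 0" using s by auto
  have "algebraic_int (s\<^sup>2)" unfolding s(2) using OK_D(2)[OF sq(2)] OK_D(2)[OF u(1)]
    by (rule algebraic_int_mult)
  hence sK: "s \<in> OK K" using s(1) by (auto intro: OK_I algebraic_int_sqrt_complex)
  have div: "x / s \<in> OK K" if x: "x \<in> I" for x
  proof -
    have "x * x \<in> ideal_mult F I I" using x by (intro ideal_mult_memI)
    then obtain r where r: "r \<in> OK F" "x * x = c * r" using sq by auto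
    have "c \<noteq> 0" using s by auto
    hence "(x / s)\<^sup>2 = r * inverse u" using r s \<open>u \<noteq> 0\<close>
      by (simp add: power_divide power2_eq_square[of x] field_simps)
    moreover have "algebraic_int (r * inverse u)"
      using OK_D(2)[OF r(1)] OK_D(2)[OF u(2)] by (rule algebraic_int_mult)
    ultimately have "algebraic_int (x / s)" by (metis algebraic_int_sqrt_complex)
    moreover have "x \<in> K" using x I K(3) by (auto dest: is_idealD OK_D)
    ultimately show ?thesis using is_subfieldD(8)[OF K(2)] s(1) by (intro OK_I) auto
  qed
  let ?E = "gen_ideal K I"
  have E: "is_ideal K ?E" by (rule is_ideal_extension[OF K(2,3) I])
  have sE: "is_ideal K ((*) s ` ?E)" by (rule is_ideal_smul[OF K(2) E sK])
  have "ideal_mult F I I \<subseteq> OK F \<inter> (*) s ` ?E"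
  proof (rule ideal_mult_least)
    show "is_ideal F (OK F \<inter> (*) s ` ?E)"
      using is_ideal_OK[OF K(1)] sE OKFK unfolding is_ideal_def by blast
    fix x y assume xy: "x \<in> I" "y \<in> I"
    have "y \<in> ?E" using xy gen_ideal_base by blast
    hence "(x / s) * y \<in> ?E" using is_idealD(4)[OF E div[OF xy(1)]] by blast
    moreover have "x * y = s * ((x / s) * y)" using s by simp
    ultimately have "x * y \<in> (*) s ` ?E" by blast
    thus "x * y \<in> OK F \<inter> (*) s ` ?E" using xy I K by (auto intro: OK_mult dest: is_idealD)
  qed
  moreover have "c \<in> ideal_mult F I I" unfolding sq(1) using OK_1[OF K(1)]
    by (auto intro!: image_eqI[of _ _ 1])
  ultimately obtain z where z: "z \<in> ?E" "c = s * z" by auto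
  have "s * s = s * (z * u)" using z s by (simp add: power2_eq_square)
  hence "s = u * z" using s by simp
  hence "s \<in> ?E" using is_idealD(4)[OF E u(1) z(1)] by simp
  moreover have "\<forall>x\<in>I. \<exists>r\<in>OK K. x = s * r" using div s by (metis nonzero_mult_div_cancel_left times_divide_eq_right)
  ultimately show ?thesis using capitulates_iff[OF K(2,3) I] by blast
qed

section \<open>Gaussian integers\<close>

definition ZI :: "complex set" where
  "ZI = {z. Re z \<in> \<int> \<and> Im z \<in> \<int>}"

definition gdvd :: "complex \<Rightarrow> complex \<Rightarrow> bool" (infix "gdvd" 50) where
  "a gdvd b \<longleftrightarrow> (\<exists>c\<in>ZI. b = a * c)"

text \<open>The floors are exact on \<open>ZI\<close> and give a value of type \<open>int\<close>,
  so that norms can enter divisibility and congruences directly.\<close>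

definition gnorm :: "complex \<Rightarrow> int" where
  "gnorm z = \<lfloor>Re z\<rfloor> ^ 2 + \<lfloor>Im z\<rfloor> ^ 2"

lemma ZI_closed [simp, intro]:
  "0 \<in> ZI" "1 \<in> ZI" "\<i> \<in> ZI" "of_int n \<in> ZI" "of_nat m \<in> ZI" "numeral k \<in> ZI"
  "x \<in> ZI \<Longrightarrow> y \<in> ZI \<Longrightarrow> x + y \<in> ZI" "x \<in> ZI \<Longrightarrow> y \<in> ZI \<Longrightarrow> x - y \<in> ZI"
  "x \<in> ZI \<Longrightarrow> y \<in> ZI \<Longrightarrow> x * y \<in> ZI" "x \<in> ZI \<Longrightarrow> - x \<in> ZI" "x \<in> ZI \<Longrightarrow> cnj x \<in> ZI"
  by (auto simp: ZI_def)

lemma ZI_power [simp, intro]: "x \<in> ZI \<Longrightarrow> x ^ n \<in> ZI"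
  by (induction n) auto

lemma ZI_cases:
  assumes "z \<in> ZI" obtains a b where "z = of_int a + \<i> * of_int b" "Re z = of_int a" "Im z = of_int b"
proof -
  obtain a b where "Re z = of_int a" "Im z = of_int b"
    using assms by (auto simp: ZI_def elim!: Ints_cases)
  thus ?thesis using that[of a b] by (simp add: complex_eq_iff)
qed

lemma gnorm_gi [simp]: "gnorm (of_int a + \<i> * of_int b) = a ^ 2 + b ^ 2"
  by (simp add: gnorm_def)

lemma of_int_gnorm: "z \<in> ZI \<Longrightarrow> of_int (gnorm z) = z * cnj z"
  by (elim ZI_cases) (simp add: gnorm_def complex_eq_iff power2_eq_square)

lemma gnorm_cmod: "z \<in> ZI \<Longrightarrow> of_int (gnorm z) = (cmod z)\<^sup>2"
  by (elim ZI_cases) (simp add: gnorm_def cmod_def)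

lemma gnorm_mult: "x \<in> ZI \<Longrightarrow> y \<in> ZI \<Longrightarrow> gnorm (x * y) = gnorm x * gnorm y"
proof -
  assume a: "x \<in> ZI" "y \<in> ZI"
  hence "complex_of_int (gnorm (x * y)) = of_int (gnorm x * gnorm y)"
    by (simp add: of_int_gnorm mult_ac)
  thus ?thesis unfolding of_int_eq_iff .
qed

lemma gnorm_nonneg: "gnorm z \<ge> 0" by (simp add: gnorm_def)

lemma gnorm_eq_0_iff: "z \<in> ZI \<Longrightarrow> gnorm z = 0 \<longleftrightarrow> z = 0"
  by (elim ZI_cases) (auto simp: gnorm_def complex_eq_iff)

lemma gnorm_cnj: "z \<in> ZI \<Longrightarrow> gnorm (cnj z) = gnorm z"
  by (elim ZI_cases) (simp add: gnorm_def)

lemma gnorm_of_int [simp]: "gnorm (of_int n) = n ^ 2" by (simp add: gnorm_def)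

lemma gnorm_1 [simp]: "gnorm 1 = 1" by (simp add: gnorm_def)

lemma gdvdI: "c \<in> ZI \<Longrightarrow> b = a * c \<Longrightarrow> a gdvd b"
  by (auto simp: gdvd_def)

lemma gdvd_refl [simp]: "a gdvd a" by (rule gdvdI[of 1]) auto

lemma gdvd_0 [simp]: "a gdvd 0" by (rule gdvdI[of 0]) auto

lemma gdvd_add: "a gdvd b \<Longrightarrow> a gdvd c \<Longrightarrow> a gdvd b + c"
  unfolding gdvd_def by (metis ZI_closed(7) ring_class.ring_distribs(1))

lemma gdvd_mult: "a gdvd b \<Longrightarrow> c \<in> ZI \<Longrightarrow> a gdvd b * c"
  unfolding gdvd_def by (metis ZI_closed(9) mult.assoc)

lemma gdvd_mult2: "a gdvd b \<Longrightarrow> c \<in> ZI \<Longrightarrow> a gdvd c * b"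
  using gdvd_mult[of a b c] by (simp add: mult.commute)

lemma gdvd_uminus: "a gdvd b \<Longrightarrow> a gdvd - b"
  using gdvd_mult[of a b "-1"] by simp

lemma gdvd_diff: "a gdvd b \<Longrightarrow> a gdvd c \<Longrightarrow> a gdvd b - c"
  using gdvd_add[of a b "-c"] gdvd_uminus[of a c] by simp

lemma gdvd_trans: "a gdvd b \<Longrightarrow> b gdvd c \<Longrightarrow> a gdvd c"
  unfolding gdvd_def by (metis ZI_closed(9) mult.assoc)

lemma gdvd_cnj: "a gdvd b \<Longrightarrow> cnj a gdvd cnj b"
  unfolding gdvd_def by (metis ZI_closed(11) complex_cnj_mult)

lemma gdvd_gnorm: "a gdvd b \<Longrightarrow> a \<in> ZI \<Longrightarrow> gnorm a dvd gnorm b"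
  unfolding gdvd_def using gnorm_mult by auto

lemma of_int_gdvd_iff:
  assumes "z \<in> ZI" shows "of_int n gdvd z \<longleftrightarrow> n dvd \<lfloor>Re z\<rfloor> \<and> n dvd \<lfloor>Im z\<rfloor>"
proof
  assume "of_int n gdvd z"
  then obtain c where c: "c \<in> ZI" "z = of_int n * c" by (auto simp: gdvd_def)
  from c(1) show "n dvd \<lfloor>Re z\<rfloor> \<and> n dvd \<lfloor>Im z\<rfloor>"
  proof (cases rule: ZI_cases)
    case (1 a b)
    have "Re z = of_int (n * a)" "Im z = of_int (n * b)" unfolding c(2) 1 by simp_all
    thus ?thesis by (simp only: floor_of_int) simp
  qed
next
  assume *: "n dvd \<lfloor>Re z\<rfloor> \<and> n dvd \<lfloor>Im z\<rfloor>"
  then obtain a b where ab: "\<lfloor>Re z\<rfloor> = n * a" "\<lfloor>Im z\<rfloor> = n * b" by (auto simp: dvd_def)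
  obtain c d where cd: "z = of_int c + \<i> * of_int d" "Re z = of_int c" "Im z = of_int d"
    using assms by (rule ZI_cases)
  have "c = n * a" "d = n * b" using ab cd by simp_all
  hence "z = of_int n * (of_int a + \<i> * of_int b)" using cd by (simp add: algebra_simps)
  thus "of_int n gdvd z" by (intro gdvdI[of "of_int a + \<i> * of_int b"]) auto
qed

text \<open>Units are written as powers of \<open>\<i>\<close> because later arguments depend on the
  parity of the exponent.\<close>

lemma gnorm_1_iff:
  assumes "u \<in> ZI" shows "gnorm u = 1 \<longleftrightarrow> (\<exists>k::nat. u = \<i> ^ k)"
proof
  assume *: "gnorm u = 1"
  from assms obtain a b where u: "u = of_int a + \<i> * of_int b" by (rule ZI_cases)
  with * have ab: "a ^ 2 + b ^ 2 = 1" by simp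
  have "a ^ 2 \<ge> 0" "b ^ 2 \<ge> 0" by auto
  hence "a ^ 2 = 0 \<and> b ^ 2 = 1 \<or> a ^ 2 = 1 \<and> b ^ 2 = 0" using ab by arith
  hence "u \<in> {\<i>, -\<i>, 1, -1}" using u by (auto simp: power2_eq_1_iff)
  moreover have "\<i> = \<i> ^ 1" "-\<i> = \<i> ^ 3" "1 = \<i> ^ 0" "-1 = \<i> ^ 2" by (auto simp: power3_eq_cube)
  ultimately show "\<exists>k::nat. u = \<i> ^ k" by blast
next
  assume "\<exists>k::nat. u = \<i> ^ k"
  then obtain k :: nat where k: "u = \<i> ^ k" ..
  have "gnorm (\<i> ^ k) = 1"
    by (induction k) (auto simp: gnorm_mult, simp add: gnorm_def)
  thus "gnorm u = 1" using k by simp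
qed

lemma gnorm_1_inverse:
  assumes "u \<in> ZI" "gnorm u = 1" shows "cnj u * u = 1"
proof -
  have "complex_of_int (gnorm u) = u * cnj u" using of_int_gnorm assms by blast
  thus ?thesis using assms by (simp add: mult.commute)
qed

text \<open>Rounding both coordinates of \<open>a / b\<close> moves each by at most 1/2, so the
  remainder has at most half the norm of \<open>b\<close>.\<close>

lemma ZI_division:
  assumes "a \<in> ZI" "b \<in> ZI" "b \<noteq> 0"
  obtains q where "q \<in> ZI" "gnorm (a - b * q) < gnorm b"
proof -
  define w where "w = a / b"
  define q where "q = Complex (of_int (round (Re w))) (of_int (round (Im w)))"
  have q: "q \<in> ZI" by (simp add: q_def ZI_def)
  have "\<bar>Re (w - q)\<bar> \<le> 1/2" "\<bar>Im (w - q)\<bar> \<le> 1/2"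
    using of_int_round_abs_le[of "Re w"] of_int_round_abs_le[of "Im w"]
    by (auto simp: q_def abs_minus_commute)
  hence "(Re (w - q))\<^sup>2 \<le> (1/2)\<^sup>2" "(Im (w - q))\<^sup>2 \<le> (1/2)\<^sup>2"
    by (metis abs_le_square_iff abs_of_nonneg zero_le_divide_1_iff zero_le_numeral)+
  hence "(Re (w - q))\<^sup>2 + (Im (w - q))\<^sup>2 \<le> 1/4 + 1/4" by (intro add_mono) (simp_all add: power_divide)
  hence "(cmod (w - q))\<^sup>2 < 1" unfolding cmod_power2 by simp
  hence "(cmod b)\<^sup>2 * (cmod (w - q))\<^sup>2 < (cmod b)\<^sup>2 * 1" using assms(3) by (intro mult_strict_left_mono) auto
  moreover have "a - b * q = b * (w - q)" using assms by (simp add: w_def field_simps)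
  ultimately have "(cmod (a - b * q))\<^sup>2 < (cmod b)\<^sup>2" by (simp add: norm_mult power_mult_distrib)
  hence "real_of_int (gnorm (a - b * q)) < of_int (gnorm b)"
    using assms q by (simp add: gnorm_cmod)
  thus ?thesis using q that by simp
qed

text \<open>A nonzero element of least norm divides all others. The set is described by closure
  properties because it will also be the trace on \<open>ZI\<close> of an ideal of a larger
  ring.\<close>

lemma ZI_PID:
  assumes J: "J \<subseteq> ZI" "0 \<in> J" "\<And>x y. x \<in> J \<Longrightarrow> y \<in> J \<Longrightarrow> x + y \<in> J"
    "\<And>r x. r \<in> ZI \<Longrightarrow> x \<in> J \<Longrightarrow> r * x \<in> J"
  obtains g where "g \<in> J" "\<And>x. x \<in> J \<Longrightarrow> g gdvd x"
proof (cases "\<exists>x\<in>J. x \<noteq> 0")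
  case False
  hence "0 gdvd x" if "x \<in> J" for x using that by auto
  thus ?thesis using that[of 0] J(2) by blast
next
  case True
  define P where "P = (\<lambda>x. x \<in> J \<and> x \<noteq> 0)"
  define g where "g = arg_min (\<lambda>x. nat (gnorm x)) P"
  obtain x0 where "P x0" using True by (auto simp: P_def)
  hence g: "P g" "\<And>y. P y \<Longrightarrow> nat (gnorm g) \<le> nat (gnorm y)"
    unfolding g_def using arg_min_nat_lemma[of P x0 "\<lambda>x. nat (gnorm x)"] by auto
  show ?thesis
  proof (rule that)
    show "g \<in> J" using g by (simp add: P_def)
    fix x assume x: "x \<in> J"
    have gZ: "g \<in> ZI" "g \<noteq> 0" using g J by (auto simp: P_def)
    obtain q where q: "q \<in> ZI" "gnorm (x - g * q) < gnorm g"
      using ZI_division[of x g] x J gZ by blast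
    have "x + (-q) * g \<in> J" using q(1) g(1) by (intro J(3) J(4) x) (auto simp: P_def)
    hence mem: "x - g * q \<in> J" by (simp add: mult.commute)
    have "x - g * q = 0"
    proof (rule ccontr)
      assume "x - g * q \<noteq> 0"
      hence "nat (gnorm g) \<le> nat (gnorm (x - g * q))" using mem by (intro g) (simp add: P_def)
      thus False using q gnorm_nonneg[of "x - g * q"] by linarith
    qed
    thus "g gdvd x" using q by (auto intro: gdvdI)
  qed
qed

lemma ZI_bezout:
  assumes "a \<in> ZI" "b \<in> ZI"
  obtains x y where "x \<in> ZI" "y \<in> ZI" "a * x + b * y gdvd a" "a * x + b * y gdvd b"
proof -
  define J where "J = {a * x + b * y | x y. x \<in> ZI \<and> y \<in> ZI}"
  obtain g where g: "g \<in> J" "\<And>x. x \<in> J \<Longrightarrow> g gdvd x"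
  proof (rule ZI_PID[of J])
    show "J \<subseteq> ZI" using assms by (auto simp: J_def)
    have "0 = a * 0 + b * 0" by simp
    thus "0 \<in> J" unfolding J_def by blast
    show "x + y \<in> J" if "x \<in> J" "y \<in> J" for x y
    proof -
      from that obtain x1 x2 y1 y2 where "x1 \<in> ZI" "x2 \<in> ZI" "y1 \<in> ZI" "y2 \<in> ZI"
        "x = a * x1 + b * x2" "y = a * y1 + b * y2" unfolding J_def by blast
      moreover from this have "x + y = a * (x1 + y1) + b * (x2 + y2)" by (simp add: algebra_simps)
      ultimately show ?thesis unfolding J_def by blast
    qed
    show "r * x \<in> J" if "r \<in> ZI" "x \<in> J" for r x
    proof -
      from that obtain x1 x2 where "x1 \<in> ZI" "x2 \<in> ZI" "x = a * x1 + b * x2" unfolding J_def by blast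
      moreover from this have "r * x = a * (r * x1) + b * (r * x2)" by (simp add: algebra_simps)
      ultimately show ?thesis unfolding J_def using that by blast
    qed
  qed blast
  have "a = a * 1 + b * 0" "b = a * 0 + b * 1" by auto
  hence "a \<in> J" "b \<in> J" unfolding J_def by blast+
  hence "g gdvd a" "g gdvd b" using g(2) by auto
  moreover obtain x y where "x \<in> ZI" "y \<in> ZI" "g = a * x + b * y" using g(1) unfolding J_def by blast
  ultimately show ?thesis using that[of x y] by simp
qed

definition gprime :: "complex \<Rightarrow> bool" where
  "gprime q \<longleftrightarrow> q \<in> ZI \<and> q \<noteq> 0 \<and> gnorm q \<noteq> 1 \<and>
     (\<forall>a\<in>ZI. \<forall>b\<in>ZI. q gdvd a * b \<longrightarrow> q gdvd a \<or> q gdvd b)"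

lemma gprimeD:
  assumes "gprime q"
  shows "q \<in> ZI" "q \<noteq> 0" "gnorm q \<noteq> 1" "a \<in> ZI \<Longrightarrow> b \<in> ZI \<Longrightarrow> q gdvd a * b \<Longrightarrow> q gdvd a \<or> q gdvd b"
  using assms by (auto simp: gprime_def)

lemma gprimeI_irreducible:
  assumes q: "q \<in> ZI" "q \<noteq> 0" "gnorm q \<noteq> 1"
    and irr: "\<And>d. d \<in> ZI \<Longrightarrow> d gdvd q \<Longrightarrow> gnorm d = 1 \<or> q gdvd d"
  shows "gprime q"
  unfolding gprime_def
proof (intro conjI ballI impI q)
  fix a b assume ab: "a \<in> ZI" "b \<in> ZI" "q gdvd a * b"
  obtain x y where xy: "x \<in> ZI" "y \<in> ZI" "q * x + a * y gdvd q" "q * x + a * y gdvd a"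
    by (rule ZI_bezout[OF q(1) ab(1)])
  have d: "q * x + a * y \<in> ZI" using xy q ab by auto
  from irr[OF d xy(3)] show "q gdvd a \<or> q gdvd b"
  proof
    assume n: "gnorm (q * x + a * y) = 1"
    define u where "u = cnj (q * x + a * y)"
    have u: "u \<in> ZI" unfolding u_def using d by blast
    have "u * (q * x + a * y) = 1" using gnorm_1_inverse[OF d n] by (simp add: u_def)
    hence "b = b * (u * (q * x + a * y))" by simp
    also have "\<dots> = q * (b * u * x) + (a * b) * (u * y)" by (simp add: algebra_simps)
    also have "q gdvd \<dots>" using u xy ab by (intro gdvd_add gdvd_mult[OF ab(3)] gdvdI[of "b * u * x"]) auto
    finally show ?thesis by blast
  qed (use xy gdvd_trans in blast)
qed

lemma gprime_if_prime_gnorm: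
  assumes "q \<in> ZI" "prime (gnorm q)"
  shows "gprime q"
proof (rule gprimeI_irreducible)
  show "q \<noteq> 0" using assms(2) by (auto simp: gnorm_def)
  show "gnorm q \<noteq> 1" using assms by auto
  fix d assume d: "d \<in> ZI" "d gdvd q"
  then obtain c where c: "c \<in> ZI" "q = d * c" by (auto simp: gdvd_def)
  have "gnorm q = gnorm d * gnorm c" using c d by (simp add: gnorm_mult)
  hence "gnorm d = 1 \<or> gnorm c = 1"
    using assms(2) gnorm_nonneg[of d] gnorm_nonneg[of c] by (auto simp: prime_int_iff)
  thus "gnorm d = 1 \<or> q gdvd d"
  proof
    assume "gnorm c = 1"
    hence "q * cnj c = d" using gnorm_1_inverse[of c] c by (simp add: mult_ac)
    thus ?thesis using c by (auto intro!: gdvdI[of "cnj c"])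
  qed auto
qed fact+

text \<open>A non-unit divisor of least norm is irreducible, hence prime.\<close>

lemma gprime_factor_exists:
  assumes "t \<in> ZI" "t \<noteq> 0" "gnorm t \<noteq> 1"
  obtains q where "gprime q" "q gdvd t"
proof -
  define P where "P = (\<lambda>q. q \<in> ZI \<and> q gdvd t \<and> gnorm q \<noteq> 1)"
  define q where "q = arg_min (\<lambda>x. nat (gnorm x)) P"
  have "P t" using assms by (simp add: P_def)
  hence q: "P q" "\<And>y. P y \<Longrightarrow> nat (gnorm q) \<le> nat (gnorm y)"
    unfolding q_def using arg_min_nat_lemma[of P t "\<lambda>x. nat (gnorm x)"] by auto
  have qZ: "q \<in> ZI" "q gdvd t" "gnorm q \<noteq> 1" using q by (auto simp: P_def)
  have q0: "q \<noteq> 0" using qZ assms by (auto simp: gdvd_def)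
  have "gprime q"
  proof (rule gprimeI_irreducible[OF qZ(1) q0 qZ(3)])
    fix d assume d: "d \<in> ZI" "d gdvd q"
    show "gnorm d = 1 \<or> q gdvd d"
    proof (rule ccontr)
      assume *: "\<not> (gnorm d = 1 \<or> q gdvd d)"
      hence "P d" using d gdvd_trans[OF d(2) qZ(2)] by (simp add: P_def)
      hence le: "nat (gnorm q) \<le> nat (gnorm d)" by (rule q)
      obtain c where c: "c \<in> ZI" "q = d * c" using d by (auto simp: gdvd_def)
      have eq: "gnorm q = gnorm d * gnorm c" using c d by (simp add: gnorm_mult)
      have "gnorm d > 0" using q0 c d gnorm_eq_0_iff[of d] gnorm_nonneg[of d] by force
      moreover have "gnorm c > 0" using q0 c d gnorm_eq_0_iff[of c] gnorm_nonneg[of c] by force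
      ultimately have "gnorm c = 1" using le eq by (simp add: nat_le_eq_zle)
      hence "q * cnj c = d" using gnorm_1_inverse[of c] c by (simp add: mult_ac)
      thus False using * c by (metis ZI_closed(11) gdvdI)
    qed
  qed
  thus ?thesis using that qZ by blast
qed

text \<open>The ideal identity \<open>(a, c)\<^sup>2 = (a\<^sup>2, ac, ab) = a (a, c, b)\<close> behind the next lemma.\<close>
lemma ZI_coprime_square:
  assumes Z: "a \<in> ZI" "b \<in> ZI" "c \<in> ZI" "x \<in> ZI" "y \<in> ZI"
    and cop: "a * x + b * y = 1" and sq: "a * b = c\<^sup>2" and c0: "c \<noteq> 0"
  obtains k :: nat and g where "g \<in> ZI" "g \<noteq> 0" "a = \<i> ^ k * g\<^sup>2"
proof -
  obtain r s where rs: "r \<in> ZI" "s \<in> ZI" "a * r + c * s gdvd a" "a * r + c * s gdvd c"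
    by (rule ZI_bezout[OF Z(1,3)])
  define g where "g = a * r + c * s"
  obtain a' c' where a': "a' \<in> ZI" "a = g * a'" and c': "c' \<in> ZI" "c = g * c'"
    using rs(3,4) unfolding gdvd_def g_def[symmetric] by blast
  have g0: "g \<noteq> 0" using c' c0 by auto
  have "g\<^sup>2 = a * (a * r\<^sup>2 + 2 * r * s * c + b * s\<^sup>2)"
    using sq by (simp add: g_def power2_eq_square algebra_simps)
  hence 1: "a gdvd g\<^sup>2" using Z rs by (intro gdvdI[of "a * r\<^sup>2 + 2 * r * s * c + b * s\<^sup>2"]) auto
  have "a = a * (a * x + b * y)" using cop by simp
  also have "\<dots> = a * (a * x) + (a * b) * y" by (simp add: algebra_simps)
  also have "\<dots> = g\<^sup>2 * (a'\<^sup>2 * x + c'\<^sup>2 * y)"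
    unfolding sq using a' c' by (simp add: power2_eq_square algebra_simps)
  finally have 2: "a = g\<^sup>2 * (a'\<^sup>2 * x + c'\<^sup>2 * y)" .
  define u where "u = a'\<^sup>2 * x + c'\<^sup>2 * y"
  have u: "u \<in> ZI" using Z a' c' by (auto simp: u_def)
  obtain v where v: "v \<in> ZI" "g\<^sup>2 = a * v" using 1 by (auto simp: gdvd_def)
  have "a = g\<^sup>2 * u" using 2 by (simp add: u_def)
  hence "(g\<^sup>2 * u) * v = g\<^sup>2" using v(2) by simp
  hence "g\<^sup>2 * (u * v) = g\<^sup>2 * 1" by (simp only: mult.assoc mult_1_right)
  hence "u * v = 1" using g0 by simp
  hence "gnorm u * gnorm v = 1" using gnorm_mult[OF u v(1)] by simp
  hence "gnorm u = 1" using gnorm_nonneg[of u] by (metis zmult_eq_1_iff abs_1 abs_of_nonneg abs_minus_cancel)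
  then obtain k :: nat where "u = \<i> ^ k" using gnorm_1_iff[OF u] by blast
  moreover have "g \<in> ZI" using Z rs by (auto simp: g_def)
  ultimately show ?thesis using that[of g k] 2 g0 by (simp add: u_def mult.commute)
qed

section \<open>Primes congruent to 1 modulo 4 and residues of Gaussian integers\<close>

lemma sqrt_minus_one_mod_prime:
  assumes "prime (p::nat)" "p mod 4 = 1"
  obtains r :: int where "int p dvd r\<^sup>2 + 1"
proof -
  have p2: "p > 2" using assms prime_gt_1_nat[of p] by (cases "p = 2") auto
  have "even ((p - 1) div 2)" using assms(2) by presburger
  have "[Legendre (-1) (int p) = (-1) ^ ((p - 1) div 2)] (mod int p)"
    using euler_criterion[OF assms(1) p2, of "-1"] .
  hence cong: "[Legendre (-1) (int p) = 1] (mod int p)" using \<open>even ((p - 1) div 2)\<close> by simp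
  have "QuadRes (int p) (-1)"
  proof (rule ccontr)
    assume nq: "\<not> QuadRes (int p) (-1)"
    hence "Legendre (-1) (int p) \<in> {0, -1}" by (auto simp: Legendre_def)
    hence "int p dvd 2 \<or> int p dvd 1" using cong by (auto simp: cong_iff_dvd_diff dvd_diff_commute)
    thus False using p2 zdvd_imp_le[of "int p" 2] zdvd_imp_le[of "int p" 1] by auto
  qed
  then obtain r where "[r\<^sup>2 = -1] (mod int p)" by (auto simp: QuadRes_def)
  hence "int p dvd r\<^sup>2 + 1" by (simp add: cong_iff_dvd_diff)
  thus ?thesis by (rule that)
qed

text \<open>For \<open>p\<close> dividing \<open>r^2 + 1\<close>, the gcd \<open>g\<close> of
  \<open>p\<close> and \<open>r + \<i>\<close> has norm 1, \<open>p\<close> or \<open>p^2\<close>.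
  Norm 1 would force \<open>p\<close> to divide \<open>r - \<i>\<close>, norm \<open>p^2\<close>
  would make \<open>g\<close> an associate of \<open>p\<close>, hence \<open>p\<close> a divisor of
  \<open>r + \<i>\<close>; both fail because the imaginary part is 1 up to sign.\<close>

lemma prime_1_mod_4_sum_of_squares:
  assumes "prime (p::nat)" "p mod 4 = 1"
  obtains a b :: int where "int p = a\<^sup>2 + b\<^sup>2"
proof -
  obtain r where r: "int p dvd r\<^sup>2 + 1" using sqrt_minus_one_mod_prime[OF assms] .
  define z where "z = of_int r + \<i> * of_int 1"
  have z: "z \<in> ZI" by (auto simp: z_def)
  have pz: "\<not> of_int (int p) gdvd z"
    using prime_gt_1_nat[OF assms(1)] z by (subst of_int_gdvd_iff) (auto simp: z_def)
  have zz: "z * cnj z = of_int (r\<^sup>2 + 1)" by (simp add: z_def power2_eq_square algebra_simps)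
  obtain x y where xy: "x \<in> ZI" "y \<in> ZI" "of_int (int p) * x + z * y gdvd of_int (int p)"
    "of_int (int p) * x + z * y gdvd z"
    using ZI_bezout[of "of_int (int p)" z] z by auto
  define g where "g = of_int (int p) * x + z * y"
  have g: "g \<in> ZI" using z xy by (auto simp: g_def)
  obtain c where c: "c \<in> ZI" "of_int (int p) = g * c" using xy by (auto simp: gdvd_def g_def)
  have "gnorm (of_int (int p)) = gnorm g * gnorm c" unfolding c(2) by (rule gnorm_mult[OF g c(1)])
  hence N: "int p ^ 2 = gnorm g * gnorm c" unfolding gnorm_of_int .
  have "gnorm g dvd int p ^ 2" using N by simp
  then obtain i where i: "i \<le> 2" "gnorm g = int p ^ i"
    using divides_primepow[of "int p" "gnorm g" 2] assms(1) gnorm_nonneg[of g] by auto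
  have "i \<noteq> 0"
  proof
    assume "i = 0"
    hence n1: "gnorm g = 1" using i by simp
    have "g * cnj z = of_int (int p) * (x * cnj z) + (z * cnj z) * y"
      by (simp add: g_def algebra_simps)
    moreover have "of_int (int p) gdvd of_int (r\<^sup>2 + 1)"
      using r by (subst of_int_gdvd_iff) (simp_all del: of_int_add of_int_power)
    ultimately have "of_int (int p) gdvd g * cnj z"
      unfolding zz using xy z by (auto intro!: gdvd_add gdvd_mult)
    hence "of_int (int p) gdvd cnj g * (g * cnj z)" using g by (rule_tac gdvd_mult2) auto
    moreover have "cnj g * (g * cnj z) = cnj z"
      using gnorm_1_inverse[OF g n1] by (simp flip: mult.assoc)
    ultimately have "of_int (int p) gdvd cnj z" by simp
    hence "of_int (int p) gdvd z" using gdvd_cnj by fastforce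
    thus False using pz by blast
  qed
  moreover have "i \<noteq> 2"
  proof
    assume "i = 2"
    hence "gnorm c = 1" using N i assms(1) by simp
    hence "of_int (int p) * cnj c = g" using gnorm_1_inverse[of c] c by (simp add: mult_ac)
    hence "of_int (int p) gdvd g" using c by (auto intro!: gdvdI[of "cnj c"])
    thus False using pz gdvd_trans[of "of_int (int p)" g z] xy(4) unfolding g_def by blast
  qed
  ultimately have "i = 1" using i by linarith
  hence "gnorm g = int p" using i by simp
  thus ?thesis using that[of "\<lfloor>Re g\<rfloor>" "\<lfloor>Im g\<rfloor>"] by (simp add: gnorm_def)
qed

text \<open>Reduction of Gaussian integers modulo a prime containing \<open>\<i> - r\<close>.\<close>
definition gred :: "int \<Rightarrow> complex \<Rightarrow> int" where
  "gred r z = \<lfloor>Re z\<rfloor> + \<lfloor>Im z\<rfloor> * r"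

lemma gred_add: "x \<in> ZI \<Longrightarrow> y \<in> ZI \<Longrightarrow> gred r (x + y) = gred r x + gred r y"
  by (elim ZI_cases) (simp add: gred_def algebra_simps)

lemma gred_simps [simp]: "gred r (of_int n) = n" "gred r (of_nat m) = int m" "gred r \<i> = r"
  "gred r 1 = 1" "gred r 0 = 0" "gred r (numeral k) = numeral k"
  by (simp_all add: gred_def)

text \<open>The residue \<open>r\<close> stands for \<open>\<i>\<close>, so the failure of
  multiplicativity is a multiple of \<open>r^2 + 1\<close>.\<close>

lemma gred_mult:
  assumes "p dvd r\<^sup>2 + 1" "x \<in> ZI" "y \<in> ZI"
  shows "[gred r (x * y) = gred r x * gred r y] (mod p)"
proof -
  from assms(2) obtain a b where x: "x = of_int a + \<i> * of_int b" "Re x = of_int a" "Im x = of_int b" by (rule ZI_cases)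
  from assms(3) obtain c d where y: "y = of_int c + \<i> * of_int d" "Re y = of_int c" "Im y = of_int d" by (rule ZI_cases)
  have "Re (x * y) = of_int (a * c - b * d)" "Im (x * y) = of_int (a * d + b * c)" using x y by auto
  hence "gred r (x * y) = (a * c - b * d) + (a * d + b * c) * r" unfolding gred_def by (simp only: floor_of_int)
  moreover have "gred r x = a + b * r" "gred r y = c + d * r" using x y by (auto simp: gred_def)
  ultimately have "gred r x * gred r y - gred r (x * y) = (b * d) * (r\<^sup>2 + 1)"
    by (simp add: algebra_simps power2_eq_square)
  thus ?thesis using assms(1) by (metis cong_iff_dvd_diff cong_sym dvd_mult)
qed

lemma gred_power:
  assumes "p dvd r\<^sup>2 + 1" "x \<in> ZI"
  shows "[gred r (x ^ n) = gred r x ^ n] (mod p)"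
proof (induction n)
  case (Suc n)
  have "[gred r (x * x ^ n) = gred r x * gred r (x ^ n)] (mod p)" using gred_mult assms by blast
  moreover have "[gred r x * gred r (x ^ n) = gred r x * gred r x ^ n] (mod p)" by (intro cong_mult Suc cong_refl)
  ultimately show ?case using cong_trans by auto
qed auto

lemma gred_gdvd:
  assumes "p dvd r\<^sup>2 + 1" "q gdvd z" "p dvd gred r q" "q \<in> ZI"
  shows "p dvd gred r z"
proof -
  obtain c where c: "c \<in> ZI" "z = q * c" using assms by (auto simp: gdvd_def)
  have "[gred r z = gred r q * gred r c] (mod p)" unfolding c(2) by (rule gred_mult[OF assms(1,4) c(1)])
  thus ?thesis using assms(3) by (metis cong_dvd_iff dvd_mult2)
qed

text \<open>The residues \<open>r\<close> and \<open>- r\<close> belong to the two Gaussian primes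
  above \<open>p\<close>. Adding the two conditions gives \<open>p\<close> dividing twice the real
  part, then \<open>r\<close> times the imaginary part, and neither 2 nor \<open>r\<close> is
  divisible by \<open>p\<close>.\<close>

lemma gdvd_of_int_if_gred:
  assumes "prime (p :: int)" "p > 2" "p dvd r\<^sup>2 + 1" "z \<in> ZI" "p dvd gred r z" "p dvd gred (-r) z"
  shows "of_int p gdvd z"
proof -
  define a b where "a = \<lfloor>Re z\<rfloor>" and "b = \<lfloor>Im z\<rfloor>"
  have 1: "p dvd a + b * r" "p dvd a - b * r" using assms by (auto simp: gred_def a_def b_def)
  have p2: "\<not> p dvd 2" using assms(2) zdvd_imp_le[of p 2] by auto
  have pr: "\<not> p dvd r"
  proof
    assume "p dvd r"
    hence "p dvd 1" using assms(3) by (metis dvd_add_right_iff dvd_power zero_less_numeral dvd_trans)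
    thus False using assms(1) by auto
  qed
  have "p dvd 2 * a" using dvd_add[OF 1] by simp
  hence a: "p dvd a" using p2 assms(1) prime_dvd_mult_iff by blast
  have "p dvd b * r" using 1(1) a by (simp add: dvd_add_right_iff)
  hence "p dvd b" using pr assms(1) prime_dvd_mult_iff by blast
  thus ?thesis using a of_int_gdvd_iff[OF assms(4)] by (simp add: a_def b_def)
qed

section \<open>Quadratic residues\<close>

lemma QuadRes_cancel:
  assumes "prime (p :: int)" "QuadRes p (a * b)" "QuadRes p a" "\<not> p dvd a"
  shows "QuadRes p b"
proof -
  obtain y z where y: "[y\<^sup>2 = a * b] (mod p)" and z: "[z\<^sup>2 = a] (mod p)"
    using assms by (auto simp: QuadRes_def)
  have "\<not> p dvd z"
  proof
    assume "p dvd z"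
    hence "p dvd z\<^sup>2" by (simp add: power2_eq_square)
    thus False using z assms(4) cong_dvd_iff by blast
  qed
  hence "coprime z p" using assms(1) prime_imp_coprime coprime_commute by blast
  then obtain w where w: "[z * w = 1] (mod p)" using cong_solve_coprime_int by blast
  have "[(y * w)\<^sup>2 = (a * b) * w\<^sup>2] (mod p)"
    unfolding power_mult_distrib by (intro cong_mult y cong_refl)
  moreover have "[(a * b) * w\<^sup>2 = (z\<^sup>2 * b) * w\<^sup>2] (mod p)"
    by (intro cong_mult cong_refl cong_sym[OF z])
  moreover have "[(z * w)\<^sup>2 * b = 1\<^sup>2 * b] (mod p)" by (intro cong_mult cong_refl cong_pow w)
  hence "[(z\<^sup>2 * b) * w\<^sup>2 = b] (mod p)" by (simp add: power_mult_distrib mult_ac)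
  ultimately have "[(y * w)\<^sup>2 = b] (mod p)" using cong_trans by blast
  thus ?thesis by (auto simp: QuadRes_def)
qed

lemma QuadRes_mult: "QuadRes p a \<Longrightarrow> QuadRes p b \<Longrightarrow> QuadRes p (a * b)"
  unfolding QuadRes_def by (metis cong_mult power_mult_distrib)

lemma QuadRes_cong: "[a = b] (mod p) \<Longrightarrow> QuadRes p a \<longleftrightarrow> QuadRes p b"
  unfolding QuadRes_def using cong_sym cong_trans by blast

lemma QuadRes_square: "QuadRes p (a\<^sup>2)"
  unfolding QuadRes_def by (rule exI[of _ a]) simp

lemma QuadRes_cancel_square:
  "prime (p :: int) \<Longrightarrow> QuadRes p (a * b\<^sup>2) \<Longrightarrow> \<not> p dvd b \<Longrightarrow> QuadRes p a"
  using QuadRes_cancel[of p "b\<^sup>2" a] QuadRes_square[of p b] by (simp add: mult.commute prime_dvd_power_iff)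

lemma Legendre_neg: "Legendre a p = -1 \<longleftrightarrow> \<not> [a = 0] (mod p) \<and> \<not> QuadRes p a"
  by (auto simp: Legendre_def)

text \<open>If \<open>r\<^sup>2 = -1\<close> and \<open>r\<close> is a square, then \<open>2 = -r (1 + r)\<^sup>2\<close> is one.\<close>
lemma QuadRes_2_if_fourth_root:
  assumes "p dvd r\<^sup>2 + 1" "QuadRes p r \<or> QuadRes p (-r)"
  shows "QuadRes p 2"
proof -
  have r2: "[r\<^sup>2 = -1] (mod p)" using assms(1) by (simp add: cong_iff_dvd_diff)
  have "[r * r\<^sup>2 = r * (-1)] (mod p)" by (intro cong_mult cong_refl r2)
  hence r3: "QuadRes p r \<longleftrightarrow> QuadRes p (-r)"
    using QuadRes_mult[OF QuadRes_square[of p r], of r] QuadRes_mult[OF QuadRes_square[of p r], of "-r"]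
      QuadRes_cong[of "r * r\<^sup>2" "-r" p] QuadRes_cong[of "- (r * r\<^sup>2)" r p] cong_minus_minus_iff[of "r * r\<^sup>2" "-r" p]
    by (auto simp: mult.commute)
  have "QuadRes p (-r * (1 + r)\<^sup>2)" using r3 assms(2) by (intro QuadRes_mult QuadRes_square) auto
  moreover have "-r * (1 + r)\<^sup>2 - 2 = (r\<^sup>2 + 1) * (-2 - r)" by (simp add: power2_eq_square algebra_simps)
  hence "[-r * (1 + r)\<^sup>2 = 2] (mod p)" using assms(1) by (simp add: cong_iff_dvd_diff)
  ultimately show ?thesis using QuadRes_cong by blast
qed

section \<open>The negative Pell equation\<close>

text \<open>Dirichlet approximation yields infinitely many \<open>(a, b)\<close> with bounded
  \<open>a^2 - D b^2\<close>. Two of them share this value \<open>n\<close> and their residues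
  modulo \<open>n\<close>; the quotient of the corresponding elements of norm \<open>n\<close> is
  then an integral element of norm 1.\<close>

lemma pell_solution_exists:
  fixes D :: int
  assumes D: "D > 0" "sqrt (of_int D) \<notin> \<rat>"
  obtains x y :: int where "x > 0" "y > 0" "x\<^sup>2 = D * y\<^sup>2 + 1"
proof -
  define s where "s = sqrt (of_int D)"
  have s: "s > 0" "s\<^sup>2 = of_int D" using D by (auto simp: s_def)
  define f where "f = (\<lambda>(a, b). a\<^sup>2 - D * b\<^sup>2 :: int)"
  \<comment> \<open>From \<open>|s - a/b| < 1/b^2 \<le> 1\<close> one gets
    \<open>|a/b + s| \<le> 2 s + 1\<close>, and \<open>a^2 - D b^2\<close> is up to sign
    \<open>b^2 (s - a/b) (a/b + s)\<close>.\<close>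
  define M where "M = \<lceil>2 * s + 1\<rceil>"
  have inf: "infinite (approx_set s)" using D rational_iff_finite_approx_set by (simp add: s_def)
  have fM: "f z \<in> {-M..M} - {0}" if "z \<in> approx_set s" for z
  proof -
    obtain a b where z: "z = (a, b)" by (cases z)
    with that have b: "b > 0" and ab: "\<bar>s - a / b\<bar> < 1 / (real_of_int b)\<^sup>2"
      by (auto simp: approx_set_def)
    have "1 / (real_of_int b)\<^sup>2 \<le> 1" using b by simp
    with ab have "\<bar>s - a / b\<bar> < 1" by linarith
    hence "\<bar>a / b + s\<bar> \<le> 2 * s + 1" using s by linarith
    moreover have "(real_of_int b)\<^sup>2 * \<bar>s - a / b\<bar> \<le> 1"
      using mult_left_mono[OF less_imp_le[OF ab], of "(real_of_int b)\<^sup>2"] b by simp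
    ultimately have "((real_of_int b)\<^sup>2 * \<bar>s - a / b\<bar>) * \<bar>a / b + s\<bar> \<le> 1 * (2 * s + 1)"
      by (intro mult_mono) auto
    also have "((real_of_int b)\<^sup>2 * \<bar>s - a / b\<bar>) * \<bar>a / b + s\<bar> = \<bar>(real_of_int b)\<^sup>2 * (s - a / b) * (a / b + s)\<bar>"
      by (simp add: abs_mult)
    also have "(real_of_int b)\<^sup>2 * (s - a / b) * (a / b + s) = of_int (- f z)"
      using b s(2) by (simp add: z f_def field_simps power2_eq_square)
    finally have "of_int \<bar>f z\<bar> \<le> 2 * s + 1" by simp
    hence "\<bar>f z\<bar> \<le> M" unfolding M_def by linarith
    moreover have "f z \<noteq> 0"
    proof
      assume "f z = 0"
      hence "real_of_int (a\<^sup>2) = of_int (D * b\<^sup>2)" by (simp add: f_def z)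
      hence "(a / b)\<^sup>2 = real_of_int D" using b by (simp add: field_simps)
      hence "\<bar>real_of_int a / of_int b\<bar> = s" unfolding s_def by (metis real_sqrt_abs)
      moreover have "\<bar>real_of_int a / of_int b\<bar> \<in> \<rat>" by (intro Rats_abs_iff[THEN iffD2] Rats_divide) auto
      ultimately show False using D(2) by (simp add: s_def)
    qed
    ultimately show ?thesis by auto
  qed
  define g where "g = (\<lambda>z. (f z, fst z mod \<bar>f z\<bar>, snd z mod \<bar>f z\<bar>))"
  have "g ` approx_set s \<subseteq> {-M..M} \<times> {0..M} \<times> {0..M}"
  proof
    fix t assume "t \<in> g ` approx_set s"
    then obtain z where z: "z \<in> approx_set s" "t = g z" by blast
    from fM[OF z(1)] have n: "f z \<noteq> 0" "\<bar>f z\<bar> \<le> M" by auto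
    have "c mod \<bar>f z\<bar> \<in> {0..M}" for c
    proof -
      have "\<bar>f z\<bar> > 0" using n by simp
      hence "0 \<le> c mod \<bar>f z\<bar>" "c mod \<bar>f z\<bar> < \<bar>f z\<bar>" by (rule pos_mod_sign, rule pos_mod_bound)
      thus ?thesis using n(2) by simp
    qed
    thus "t \<in> {-M..M} \<times> {0..M} \<times> {0..M}" using z n by (auto simp: g_def)
  qed
  hence "finite (g ` approx_set s)" by (rule finite_subset) auto
  then obtain z0 where z0: "z0 \<in> approx_set s" "infinite {z \<in> approx_set s. g z = g z0}"
    using pigeonhole_infinite[OF inf] by blast
  have "\<exists>z1. z1 \<in> approx_set s \<and> g z1 = g z0 \<and> z1 \<noteq> z0"
  proof (rule ccontr)
    assume "\<not> ?thesis"
    hence "{z \<in> approx_set s. g z = g z0} \<subseteq> {z0}" by blast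
    thus False using z0(2) finite_subset by blast
  qed
  then obtain z1 where z1: "z1 \<in> approx_set s" "g z1 = g z0" "z1 \<noteq> z0" by blast
  obtain a b where ab: "z0 = (a, b)" by (cases z0)
  obtain c d where cd: "z1 = (c, d)" by (cases z1)
  define n where "n = a\<^sup>2 - D * b\<^sup>2"
  have n: "n \<noteq> 0" "c\<^sup>2 - D * d\<^sup>2 = n" "c mod \<bar>n\<bar> = a mod \<bar>n\<bar>" "d mod \<bar>n\<bar> = b mod \<bar>n\<bar>"
    using fM[OF z0(1)] z1(2) by (auto simp: n_def g_def f_def ab cd)
  have pos: "b > 0" "d > 0" using z0(1) z1(1) by (auto simp: approx_set_def ab cd)
  have "[c = a] (mod n)" "[d = b] (mod n)" using n(3,4) by (simp_all add: mod_eq_dvd_iff cong_iff_dvd_diff)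
  then obtain k l where kl: "c = a + n * k" "d = b + n * l"
    by (metis add.commute cong_iff_lin cong_sym)
  \<comment> \<open>This is \<open>x + y \<surd>D = (c + d \<surd>D) / (a + b \<surd>D)\<close>,
    with the division by \<open>n\<close> already carried out through \<open>c = a + n k\<close> and
    \<open>d = b + n l\<close>.\<close>
  define x y where "x = 1 + a * k - D * b * l" and "y = a * l - b * k"
  have xn: "n * x = a * c - D * b * d" and yn: "n * y = a * d - b * c"
    by (simp_all add: x_def y_def kl n_def algebra_simps power2_eq_square)
  have "n\<^sup>2 * (x\<^sup>2 - D * y\<^sup>2) = (n * x)\<^sup>2 - D * (n * y)\<^sup>2" by (simp add: power_mult_distrib algebra_simps)
  also have "\<dots> = (a\<^sup>2 - D * b\<^sup>2) * (c\<^sup>2 - D * d\<^sup>2)"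
    unfolding xn yn by (simp add: algebra_simps power2_eq_square)
  also have "\<dots> = n\<^sup>2 * 1" using n by (simp add: n_def power2_eq_square)
  finally have xy: "x\<^sup>2 - D * y\<^sup>2 = 1" using n(1) by simp
  have "y \<noteq> 0"
  proof
    assume "y = 0"
    hence eq: "a * d = b * c" using yn by simp
    have "n * d\<^sup>2 = (a * d)\<^sup>2 - D * (b * d)\<^sup>2" by (simp add: n_def algebra_simps power_mult_distrib)
    also have "\<dots> = b\<^sup>2 * (c\<^sup>2 - D * d\<^sup>2)" unfolding eq by (simp add: algebra_simps power_mult_distrib)
    finally have "d\<^sup>2 = b\<^sup>2" using n by simp
    hence "d = b" using pos by (simp add: power2_eq_iff)
    hence "c = a" using eq pos by simp
    thus False using z1(3) ab cd \<open>d = b\<close> by simp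
  qed
  moreover have "x \<noteq> 0"
  proof
    assume "x = 0"
    hence "D * y\<^sup>2 = -1" using xy by simp
    moreover have "D * y\<^sup>2 \<ge> 0" using D by simp
    ultimately show False by linarith
  qed
  ultimately show ?thesis using xy that[of "\<bar>x\<bar>" "\<bar>y\<bar>"] by simp
qed

text \<open>From the minimal solution of \<open>x\<^sup>2 - D y\<^sup>2 = 1\<close>: the factors \<open>(x - 1) / 2\<close> and \<open>(x + 1) / 2\<close>
  are coprime with product \<open>D (y / 2)\<^sup>2\<close>, hence they are \<open>a u\<^sup>2\<close> and \<open>b v\<^sup>2\<close> with \<open>a b = D\<close>.\<close>
lemma negative_pell_solvable:
  fixes D :: nat
  assumes D: "D > 0" "sqrt (of_nat D) \<notin> \<rat>"
    and even: "\<And>x y :: nat. x\<^sup>2 = D * y\<^sup>2 + 1 \<Longrightarrow> odd x \<and> even y"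
    and split: "\<And>a b u v :: nat. a * b = D \<Longrightarrow> b * v\<^sup>2 = a * u\<^sup>2 + 1 \<Longrightarrow> a = 1 \<or> b = 1"
  obtains t u :: nat where "t\<^sup>2 + 1 = D * u\<^sup>2"
proof -
  define P where "P = (\<lambda>y :: nat. y > 0 \<and> (\<exists>x :: nat. x\<^sup>2 = D * y\<^sup>2 + 1))"
  obtain x0 y0 :: int where xy0: "x0 > 0" "y0 > 0" "x0\<^sup>2 = int D * y0\<^sup>2 + 1"
    using pell_solution_exists[of "int D"] D by auto
  have "int ((nat x0)\<^sup>2) = int (D * (nat y0)\<^sup>2 + 1)" using xy0 by simp
  hence "P (nat y0)" unfolding P_def of_nat_eq_iff using xy0 by auto
  hence P: "P (LEAST y. P y)" by (rule LeastI)
  define y where "y = (LEAST y. P y)"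
  obtain x where xy: "y > 0" "x\<^sup>2 = D * y\<^sup>2 + 1" using P by (auto simp: P_def y_def)
  obtain m z where mz: "x = 2 * m + 1" "y = 2 * z" using even[OF xy(2)] by (auto elim!: oddE evenE)
  have "4 * (m * (m + 1)) = 4 * (D * z\<^sup>2)" using xy(2) by (simp add: mz power2_eq_square algebra_simps)
  hence mm: "m * (m + 1) = D * z\<^sup>2" by simp
  have "z > 0" using xy mz by simp
  hence "m > 0" using mm D(1) by (cases m) auto
  define a where "a = gcd m D"
  have "a > 0" using D by (simp add: a_def)
  define m' b where "m' = m div a" and "b = D div a"
  have m': "m = a * m'" and b: "D = a * b" and cop: "coprime m' b"
    using D div_gcd_coprime[of m D] by (simp_all add: m'_def b_def a_def)
  have "(a * m') * (m + 1) = (a * b) * z\<^sup>2" using mm unfolding m'[symmetric] b[symmetric] .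
  hence "a * (m' * (m + 1)) = a * (b * z\<^sup>2)" by (simp only: mult.assoc)
  hence eq: "m' * (m + 1) = b * z\<^sup>2" using \<open>a > 0\<close> by simp
  hence "b dvd m' * (m + 1)" by simp
  hence "b dvd m + 1" using cop coprime_dvd_mult_right_iff coprime_commute by blast
  then obtain w where w: "m + 1 = b * w" by (auto elim!: dvdE)
  have "b > 0" using b D by (auto intro: Nat.gr0I)
  have "b * (m' * w) = b * z\<^sup>2" using eq unfolding w by (simp only: mult.left_commute)
  hence mw: "m' * w = z\<^sup>2" using \<open>b > 0\<close> by simp
  have "coprime m (m + 1)" by simp
  hence "coprime m' w" unfolding w by (subst (asm) m') (auto dest: coprime_imp_coprime)
  moreover have "m' > 0" "w > 0" using mw \<open>z > 0\<close> by (auto intro!: Nat.gr0I)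
  moreover have "is_nth_power 2 (m' * w)" unfolding mw by (auto simp: is_nth_power_def)
  ultimately have "is_nth_power 2 m' \<and> is_nth_power 2 w"
    using is_nth_power_mult_coprime_natD by blast
  then obtain u v where uv: "m' = u\<^sup>2" "w = v\<^sup>2" by (auto simp: is_nth_power_def)
  have bv: "b * v\<^sup>2 = a * u\<^sup>2 + 1" using w m' uv by simp
  from split[OF b[symmetric] bv] show ?thesis
  proof
    assume "a = 1"
    thus ?thesis using that[of u v] bv b by simp
  next
    \<comment> \<open>Here \<open>u\<close> is a positive solution of the original equation with
      \<open>u * v = z\<close>, where \<open>y = 2 * z\<close>, contradicting minimality of
      \<open>y\<close>.\<close>
    assume "b = 1"
    hence v: "v\<^sup>2 = D * u\<^sup>2 + 1" using bv b by simp
    have "u > 0" using m' uv \<open>m > 0\<close> by (auto intro: Nat.gr0I)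
    hence "P u" using v by (auto simp: P_def)
    hence "y \<le> u" unfolding y_def by (rule Least_le)
    have "(u * v)\<^sup>2 = z\<^sup>2" using mw uv by (simp add: power_mult_distrib)
    hence "u * v = z" by simp
    moreover have "v > 0" using v by (auto intro: Nat.gr0I)
    ultimately have "u \<le> z" by (metis mult.right_neutral mult_le_mono2 Suc_leI One_nat_def)
    thus ?thesis using \<open>y \<le> u\<close> mz \<open>z > 0\<close> by simp
  qed
qed

lemma sqrt_nat_irrational:
  assumes "prime (p :: nat)" "p dvd D" "\<not> p\<^sup>2 dvd D"
  shows "sqrt (of_nat D) \<notin> \<rat>"
proof
  assume "sqrt (of_nat D) \<in> \<rat>"
  moreover have "algebraic_int (sqrt (of_nat D) :: real)"
    by (intro algebraic_int_sqrt int_imp_algebraic_int) auto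
  ultimately have "sqrt (of_nat D) \<in> \<int>" by (rule rational_algebraic_int_is_int[rotated])
  then obtain k where k: "sqrt (of_nat D) = of_int k" by (elim Ints_cases)
  hence "real_of_int (int D) = of_int (k\<^sup>2)" by (metis of_int_of_nat_eq of_int_power of_nat_0_le_iff real_sqrt_pow2)
  hence "int D = k\<^sup>2" unfolding of_int_eq_iff .
  hence "int D = int ((nat \<bar>k\<bar>)\<^sup>2)" by simp
  hence "D = (nat \<bar>k\<bar>)\<^sup>2" unfolding of_nat_eq_iff .
  thus False using assms prime_dvd_power[of p "nat \<bar>k\<bar>" 2] by (auto dest: dvd_power_same[of p _ 2])
qed

lemma odd_square_mod_8: "odd (x :: nat) \<Longrightarrow> x\<^sup>2 mod 8 = 1"
proof -
  assume "odd x"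
  then obtain k where k: "x = 2 * k + 1" by (elim oddE)
  have "x\<^sup>2 = 4 * (k * (k + 1)) + 1" by (simp add: k power2_eq_square algebra_simps)
  moreover have "even (k * (k + 1))" by simp
  then obtain l where "k * (k + 1) = 2 * l" by (elim evenE)
  ultimately have "x\<^sup>2 = 8 * l + 1" by simp
  thus ?thesis by simp
qed

text \<open>A prime \<open>D\<close> has only trivial splittings, and the required parities follow
  modulo 4. Evenness of \<open>t\<close> makes \<open>p * u^2\<close> odd, which is what later
  renders \<open>t + \<i>\<close> coprime to its conjugate.\<close>

lemma negative_pell_prime:
  assumes "prime (p :: nat)" "p mod 4 = 1"
  obtains t u :: nat where "t\<^sup>2 + 1 = p * u\<^sup>2" "even t"
proof -
  have sq4: "y\<^sup>2 mod 4 = (if odd y then 1 else 0)" for y :: nat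
  proof (cases "odd y")
    case True
    hence "y\<^sup>2 mod 8 = 1" by (rule odd_square_mod_8)
    hence "y\<^sup>2 mod 4 = 1" by presburger
    thus ?thesis using True by simp
  next
    case False
    then obtain k where "y = 2 * k" by (auto elim: evenE)
    thus ?thesis by (simp add: power_mult_distrib)
  qed
  have mod4: "(p * y\<^sup>2) mod 4 = (if odd y then 1 else 0)" for y
  proof -
    have "(p * y\<^sup>2) mod 4 = ((p mod 4) * (y\<^sup>2 mod 4)) mod 4" by (rule mod_mult_eq[symmetric])
    thus ?thesis unfolding assms(2) sq4 by auto
  qed
  obtain t u where tu: "t\<^sup>2 + 1 = p * u\<^sup>2"
  proof (rule negative_pell_solvable[of p])
    show "p > 0" "sqrt (of_nat p) \<notin> \<rat>"
      using assms prime_gt_0_nat sqrt_nat_irrational[of p p] prime_gt_1_nat[of p]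
      by (auto simp: power2_eq_square)
    fix x y :: nat assume "x\<^sup>2 = p * y\<^sup>2 + 1"
    hence "x\<^sup>2 mod 4 = ((p * y\<^sup>2) mod 4 + 1) mod 4" by (simp add: mod_Suc_eq)
    hence "x\<^sup>2 mod 4 = (if odd y then 2 else 1)" unfolding mod4 by auto
    moreover have "x\<^sup>2 mod 4 = (if odd x then 1 else 0)" by (rule sq4)
    ultimately show "odd x \<and> even y" by (cases "odd x"; cases "odd y") simp_all
  next
    fix a b :: nat assume "a * b = p"
    thus "a = 1 \<or> b = 1" using assms(1) prime_product by blast
  qed
  have "even t"
  proof (rule ccontr)
    assume "odd t"
    hence "t\<^sup>2 mod 4 = 1" using sq4[of t] by simp
    hence "(t\<^sup>2 + 1) mod 4 = 2" by presburger
    moreover have "(t\<^sup>2 + 1) mod 4 = (if odd u then 1 else 0)" unfolding tu by (rule mod4)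
    ultimately show False by (cases "odd u") simp_all
  qed
  thus ?thesis using tu that by blast
qed

text \<open>The hypothesis of the theorem: at most one of the symbols \<open>(p/q)\<close>, \<open>(2/p)\<close>, \<open>(2/q)\<close> is 1.\<close>
locale prime_pair =
  fixes p q :: nat
  assumes primes: "prime p" "prime q" "p \<noteq> q" "p mod 4 = 1" "q mod 4 = 1"
    and recip: "QuadRes (int q) (int p) \<longleftrightarrow> QuadRes (int p) (int q)"
    and nonres: "\<not> (QuadRes (int q) (int p) \<and> QuadRes (int p) 2)"
      "\<not> (QuadRes (int q) (int p) \<and> QuadRes (int q) 2)"
      "\<not> (QuadRes (int p) 2 \<and> QuadRes (int q) 2)"

lemma prime_pair_sym: "prime_pair p q \<Longrightarrow> prime_pair q p"
  by (auto simp: prime_pair_def)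

lemma QuadRes_minus_1:
  assumes "prime (p::nat)" "p mod 4 = 1" shows "QuadRes (int p) (-1)"
proof -
  obtain r where "int p dvd r\<^sup>2 + 1" using sqrt_minus_one_mod_prime assms by blast
  hence "[r\<^sup>2 = -1] (mod int p)" by (simp add: cong_iff_dvd_diff)
  thus ?thesis by (auto simp: QuadRes_def)
qed

lemma QuadRes_minus:
  assumes "prime (p::nat)" "p mod 4 = 1" shows "QuadRes (int p) (- a) \<longleftrightarrow> QuadRes (int p) a"
  using QuadRes_mult[OF QuadRes_minus_1[OF assms], of a] QuadRes_mult[OF QuadRes_minus_1[OF assms], of "-a"] by auto

context prime_pair
begin

lemma gt2: "p > 2" "q > 2" "odd p" "odd q"
proof -
  show "odd p" "odd q" using primes(4,5) by presburger+
  thus "p > 2" "q > 2" using primes prime_gt_1_nat[of p] prime_gt_1_nat[of q]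
    by (cases "p = 2"; cases "q = 2"; simp)+
qed

lemma not_dvd: "\<not> int p dvd int q" "\<not> int q dvd int p" "\<not> int p dvd 2" "\<not> int q dvd 2"
  using primes gt2 primes_dvd_imp_eq[of p q] primes_dvd_imp_eq[of q p]
    zdvd_imp_le[of "int p" 2] zdvd_imp_le[of "int q" 2] by (auto simp: int_dvd_int_iff)

lemma prime_int: "prime (int p)" "prime (int q)"
  using primes by auto

text \<open>Modulo a divisor of \<open>a\<close> the equation reads \<open>b v^2 = 1\<close>; modulo
  a divisor of \<open>b\<close> it reads \<open>a u^2 = -1\<close>, and \<open>-1\<close> is a
  square because \<open>l\<close> is 1 modulo 4.\<close>

lemma QuadRes_cofactor:
  assumes l: "prime (l :: nat)" "l mod 4 = 1" and eq: "b * v\<^sup>2 = a * u\<^sup>2 + 1"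
  shows "l dvd a \<Longrightarrow> QuadRes (int l) (int b)" "l dvd b \<Longrightarrow> QuadRes (int l) (int a)"
proof -
  have pl: "prime (int l)" using l by simp
  have eq': "int b * (int v)\<^sup>2 = int a * (int u)\<^sup>2 + 1" using arg_cong[OF eq, of int] by simp
  have *: "QuadRes (int l) c" if "[c * d\<^sup>2 = e] (mod int l)" "QuadRes (int l) e" "\<not> int l dvd e" for c d e
  proof -
    have "QuadRes (int l) (c * d\<^sup>2)" using that QuadRes_cong by blast
    moreover have "\<not> int l dvd d"
    proof
      assume "int l dvd d"
      hence "int l dvd c * d\<^sup>2" by (simp add: power2_eq_square)
      thus False using that(1,3) cong_dvd_iff by blast
    qed
    ultimately show ?thesis using QuadRes_cancel_square[OF pl] by blast
  qed
  have nd: "\<not> int l dvd 1" using l by auto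
  show "QuadRes (int l) (int b)" if "l dvd a"
  proof (rule *)
    have "int l dvd int a * (int u)\<^sup>2" using that by simp
    thus "[int b * (int v)\<^sup>2 = 1] (mod int l)" using eq' by (simp add: cong_iff_dvd_diff)
    show "QuadRes (int l) 1" using QuadRes_square[of "int l" 1] by simp
  qed (fact nd)
  show "QuadRes (int l) (int a)" if "l dvd b"
  proof (rule *)
    have "int l dvd int b * (int v)\<^sup>2" using that by simp
    thus "[int a * (int u)\<^sup>2 = -1] (mod int l)" using eq' by (simp add: cong_iff_dvd_diff)
    show "QuadRes (int l) (-1)" using QuadRes_minus_1[OF l] .
  qed (use nd in simp)
qed

text \<open>Each of the six nontrivial splittings of \<open>2 p q\<close> makes two of the symbols
  \<open>(p/q)\<close>, \<open>(2/p)\<close>, \<open>(2/q)\<close> equal to 1: directly for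
  \<open>{2, p q}\<close>, and after cancelling one residue from a product in the other
  cases.\<close>

lemma negative_pell_2pq:
  obtains t u :: nat where "t\<^sup>2 + 1 = 2 * p * q * u\<^sup>2"
proof (rule negative_pell_solvable[of "2 * p * q"])
  show "2 * p * q > 0" using gt2 by simp
  have "odd (p * q)" using gt2 by simp
  hence "\<not> 2\<^sup>2 dvd 2 * p * q" by (auto simp: power2_eq_square mult.assoc)
  thus "sqrt (of_nat (2 * p * q)) \<notin> \<rat>" by (intro sqrt_nat_irrational[of 2]) auto
  fix x y :: nat assume eq: "x\<^sup>2 = 2 * p * q * y\<^sup>2 + 1"
  hence "odd (x\<^sup>2)" by simp
  hence x: "odd x" by simp
  then obtain k where k: "x = 2 * k + 1" by (elim oddE)
  have "2 * (2 * k * (k + 1)) = 2 * (p * q * y\<^sup>2)" using eq by (simp add: k power2_eq_square algebra_simps)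
  hence "2 * k * (k + 1) = p * q * y\<^sup>2" by simp
  hence "even (p * q * y\<^sup>2)" by (metis dvd_triv_left mult.assoc)
  thus "odd x \<and> even y" using x gt2 by simp
next
  fix a b u v :: nat
  assume ab: "a * b = 2 * p * q" and eq: "b * v\<^sup>2 = a * u\<^sup>2 + 1"
  note res = QuadRes_cofactor[OF primes(1,4) eq] QuadRes_cofactor[OF primes(2,5) eq]
  have "a dvd 2 * p * q" using ab by (metis dvd_triv_left)
  then obtain a1 a2 a3 where a: "a = a1 * a2 * a3" "a1 dvd 2" "a2 dvd p" "a3 dvd q"
    using division_decomp by metis
  have dd: "a1 = 1 \<or> a1 = 2" "a2 = 1 \<or> a2 = p" "a3 = 1 \<or> a3 = q"
    using a primes prime_nat_iff two_is_prime_nat by (metis)+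
  have pos: "p > 0" "q > 0" using gt2 by auto
  have contra: False
    if "a \<noteq> 1" "b \<noteq> 1"
  proof -
    from that ab a(1) dd pos consider "a = 2" "b = p * q" | "a = p" "b = 2 * q" | "a = q" "b = 2 * p"
      | "a = 2 * p" "b = q" | "a = 2 * q" "b = p" | "a = p * q" "b = 2"
      by (elim disjE) (auto simp: mult_ac)
    thus False
    proof cases
      case 1 thus ?thesis using res nonres by simp
    next
      case 6 thus ?thesis using res nonres by simp
    next
      case 2
      hence "QuadRes (int p) (int q * 2)" "QuadRes (int q) (int p)" using res by (simp_all add: mult.commute)
      thus ?thesis using QuadRes_cancel[OF prime_int(1)] recip nonres not_dvd by blast
    next
      case 3
      hence "QuadRes (int q) (int p * 2)" "QuadRes (int p) (int q)" using res by (simp_all add: mult.commute)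
      thus ?thesis using QuadRes_cancel[OF prime_int(2)] recip nonres not_dvd by blast
    next
      case 4
      hence "QuadRes (int q) (int p * 2)" "QuadRes (int p) (int q)" using res by (simp_all add: mult.commute)
      thus ?thesis using QuadRes_cancel[OF prime_int(2)] recip nonres not_dvd by blast
    next
      case 5
      hence "QuadRes (int p) (int q * 2)" "QuadRes (int q) (int p)" using res by (simp_all add: mult.commute)
      thus ?thesis using QuadRes_cancel[OF prime_int(1)] recip nonres not_dvd by blast
    qed
  qed
  thus "a = 1 \<or> b = 1" by blast
qed

end

section \<open>Quadratic extensions\<close>

lemma is_subfield_Qadj: "is_subfield (Qadj xs)"
  unfolding Qadj_def is_subfield_def by auto

lemma Qadj_base: "x \<in> set xs \<Longrightarrow> x \<in> Qadj xs"
  unfolding Qadj_def by auto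

lemma Qadj_least: "is_subfield F \<Longrightarrow> set xs \<subseteq> F \<Longrightarrow> Qadj xs \<subseteq> F"
  unfolding Qadj_def by auto

definition qext :: "complex set \<Rightarrow> complex \<Rightarrow> complex set" where
  "qext F \<delta> = {a + b * \<delta> | a b. a \<in> F \<and> b \<in> F}"

lemma qextI: "a \<in> F \<Longrightarrow> b \<in> F \<Longrightarrow> a + b * \<delta> \<in> qext F \<delta>"
  unfolding qext_def by blast

lemma qextE:
  assumes "x \<in> qext F \<delta>" obtains a b where "a \<in> F" "b \<in> F" "x = a + b * \<delta>"
  using assms unfolding qext_def by blast

lemma qext_contains:
  assumes "is_subfield F" shows "F \<subseteq> qext F \<delta>" "\<delta> \<in> qext F \<delta>"
proof -
  show "F \<subseteq> qext F \<delta>" using qextI[of _ F 0] is_subfieldD(1)[OF assms] by force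
  show "\<delta> \<in> qext F \<delta>" using qextI[of 0 F 1] is_subfieldD(1,2)[OF assms] by force
qed

lemma qext_least:
  assumes "is_subfield E" "F \<subseteq> E" "\<delta> \<in> E" shows "qext F \<delta> \<subseteq> E"
proof
  fix x assume "x \<in> qext F \<delta>"
  then obtain a b where "a \<in> F" "b \<in> F" "x = a + b * \<delta>" by (rule qextE)
  thus "x \<in> E" using assms(2,3) is_subfieldD(3,5)[OF assms(1)] by blast
qed

lemma is_subfield_qext:
  assumes F: "is_subfield F" and sq: "\<delta>\<^sup>2 \<in> F"
  shows "is_subfield (qext F \<delta>)"
  unfolding is_subfield_def
proof (intro conjI ballI impI)
  note Fs = is_subfieldD[OF F]
  show "0 \<in> qext F \<delta>" "1 \<in> qext F \<delta>" using qext_contains(1)[OF F] Fs by auto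
  fix x assume "x \<in> qext F \<delta>"
  then obtain a b where x: "a \<in> F" "b \<in> F" "x = a + b * \<delta>" by (rule qextE)
  {
    fix y assume "y \<in> qext F \<delta>"
    then obtain c d where y: "c \<in> F" "d \<in> F" "y = c + d * \<delta>" by (rule qextE)
    have "x + y = (a + c) + (b + d) * \<delta>" "x - y = (a - c) + (b - d) * \<delta>"
      "x * y = (a * c + b * d * \<delta>\<^sup>2) + (a * d + b * c) * \<delta>"
      using x y by (simp_all add: algebra_simps power2_eq_square)
    moreover have "(a + c) + (b + d) * \<delta> \<in> qext F \<delta>" "(a - c) + (b - d) * \<delta> \<in> qext F \<delta>"
      "(a * c + b * d * \<delta>\<^sup>2) + (a * d + b * c) * \<delta> \<in> qext F \<delta>"
      using x y sq by (intro qextI Fs; simp)+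
    ultimately show "x + y \<in> qext F \<delta>" "x - y \<in> qext F \<delta>" "x * y \<in> qext F \<delta>" by simp_all
  }
  assume x0: "x \<noteq> 0"
  show "inverse x \<in> qext F \<delta>"
  proof (cases "a - b * \<delta> = 0")
    \<comment> \<open>The conjugate of \<open>x\<close> can only vanish here when \<open>x\<close>
      already lies in \<open>F\<close>, since \<open>\<delta> = a / b\<close> unless
      \<open>b = 0\<close>.\<close>
    case True
    have "x \<in> F"
    proof (cases "b = 0")
      case False
      hence "\<delta> = a / b" using True by (simp add: field_simps)
      hence "\<delta> \<in> F" using Fs(8) x by simp
      thus ?thesis using x Fs(3,5) by simp
    qed (use x in simp)
    thus ?thesis using Fs(6) qext_contains(1)[OF F] by blast
  next
    case False
    define N where "N = a\<^sup>2 - b\<^sup>2 * \<delta>\<^sup>2"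
    have NF: "N \<in> F" unfolding N_def power2_eq_square[of a] power2_eq_square[of b] using x sq by (intro Fs)
    have N: "N = x * (a - b * \<delta>)" by (simp add: N_def x(3) algebra_simps power2_eq_square)
    have "x * (a - b * \<delta>) \<noteq> 0" by (rule no_zero_divisors[OF x0 False])
    hence "N \<noteq> 0" unfolding N .
    have "a / N + (- b / N) * \<delta> = (a - b * \<delta>) / N" by (simp add: diff_divide_distrib)
    also have "\<dots> = inverse x" unfolding N inverse_eq_divide
      using False x0 by (simp only: mult.commute[of x] divide_divide_eq_left[symmetric]) simp
    finally have "inverse x = a / N + (- b / N) * \<delta>" by simp
    moreover have "a / N + (- b / N) * \<delta> \<in> qext F \<delta>" by (intro qextI Fs x NF)
    ultimately show ?thesis by simp
  qed
qed

text \<open>The coordinates are picked by choice to obtain a total function on the complex numbers;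
  they are unique once \<open>\<delta>\<close> lies outside \<open>F\<close>.\<close>

definition qconj :: "complex set \<Rightarrow> complex \<Rightarrow> complex \<Rightarrow> complex" where
  "qconj F \<delta> x = (SOME y. \<exists>a\<in>F. \<exists>b\<in>F. x = a + b * \<delta> \<and> y = a - b * \<delta>)"

locale quad_ext =
  fixes F :: "complex set" and \<delta> :: complex
  assumes F: "is_subfield F" and sq: "\<delta>\<^sup>2 \<in> F" and irr: "\<delta> \<notin> F"
begin

abbreviation "K \<equiv> qext F \<delta>"
abbreviation "\<sigma> \<equiv> qconj F \<delta>"

lemma K: "is_subfield K" using F sq by (rule is_subfield_qext)

lemma FK: "F \<subseteq> K" using qext_contains(1)[OF F] .

lemma basis_unique:
  assumes "a \<in> F" "b \<in> F" "c \<in> F" "d \<in> F" "a + b * \<delta> = c + d * \<delta>"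
  shows "a = c" "b = d"
proof -
  have "(b - d) * \<delta> = c - a" using assms(5) by (simp add: algebra_simps)
  moreover have "\<delta> = (c - a) / (b - d)" if "b \<noteq> d" using calculation that by (simp add: field_simps)
  ultimately show "b = d" using is_subfieldD(4,8)[OF F] assms irr by metis
  thus "a = c" using assms by simp
qed

lemma conj_eq: "a \<in> F \<Longrightarrow> b \<in> F \<Longrightarrow> \<sigma> (a + b * \<delta>) = a - b * \<delta>"
  unfolding qconj_def
proof (rule some_equality)
  assume ab: "a \<in> F" "b \<in> F"
  thus "\<exists>c\<in>F. \<exists>d\<in>F. a + b * \<delta> = c + d * \<delta> \<and> a - b * \<delta> = c - d * \<delta>" by blast
  show "y = a - b * \<delta>" if "\<exists>c\<in>F. \<exists>d\<in>F. a + b * \<delta> = c + d * \<delta> \<and> y = c - d * \<delta>" for y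
    using that basis_unique[OF ab] by auto
qed

lemma conj_F: "a \<in> F \<Longrightarrow> \<sigma> a = a"
  using conj_eq[of a 0] is_subfieldD(1)[OF F] by simp

lemma conj_mem: "x \<in> K \<Longrightarrow> \<sigma> x \<in> K"
proof (elim qextE)
  fix a b assume ab: "a \<in> F" "b \<in> F" "x = a + b * \<delta>"
  have "a + (- b) * \<delta> \<in> K" using ab is_subfieldD(7)[OF F] by (intro qextI)
  thus "\<sigma> x \<in> K" using ab by (simp add: conj_eq)
qed

lemma conj_conj: "x \<in> K \<Longrightarrow> \<sigma> (\<sigma> x) = x"
proof (elim qextE)
  fix a b assume ab: "a \<in> F" "b \<in> F" "x = a + b * \<delta>"
  have "\<sigma> (a + (- b) * \<delta>) = a - (- b) * \<delta>" using ab is_subfieldD(7)[OF F] by (intro conj_eq)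
  thus "\<sigma> (\<sigma> x) = x" using ab by (simp add: conj_eq)
qed

lemma conj_add: "x \<in> K \<Longrightarrow> y \<in> K \<Longrightarrow> \<sigma> (x + y) = \<sigma> x + \<sigma> y"
proof (elim qextE)
  fix a b c d assume *: "a \<in> F" "b \<in> F" "x = a + b * \<delta>" "c \<in> F" "d \<in> F" "y = c + d * \<delta>"
  have 1: "\<sigma> ((a + c) + (b + d) * \<delta>) = (a + c) - (b + d) * \<delta>"
    using * by (intro conj_eq is_subfieldD[OF F])
  have 2: "(a + c) + (b + d) * \<delta> = x + y" using * by (simp add: algebra_simps)
  have 3: "\<sigma> x = a - b * \<delta>" "\<sigma> y = c - d * \<delta>" using * by (simp_all add: conj_eq)
  show "\<sigma> (x + y) = \<sigma> x + \<sigma> y" unfolding 1[unfolded 2] 3 by (simp add: algebra_simps)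
qed

lemma conj_mult: "x \<in> K \<Longrightarrow> y \<in> K \<Longrightarrow> \<sigma> (x * y) = \<sigma> x * \<sigma> y"
proof (elim qextE)
  fix a b c d assume *: "a \<in> F" "b \<in> F" "x = a + b * \<delta>" "c \<in> F" "d \<in> F" "y = c + d * \<delta>"
  have 1: "\<sigma> ((a * c + b * d * \<delta>\<^sup>2) + (a * d + b * c) * \<delta>) = (a * c + b * d * \<delta>\<^sup>2) - (a * d + b * c) * \<delta>"
    using * sq by (intro conj_eq is_subfieldD[OF F])
  have 2: "(a * c + b * d * \<delta>\<^sup>2) + (a * d + b * c) * \<delta> = x * y"
    using * by (simp add: algebra_simps power2_eq_square)
  have 3: "\<sigma> x = a - b * \<delta>" "\<sigma> y = c - d * \<delta>" using * by (simp_all add: conj_eq)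
  show "\<sigma> (x * y) = \<sigma> x * \<sigma> y" unfolding 1[unfolded 2] 3 by (simp add: algebra_simps power2_eq_square)
qed

text \<open>Conjugation fixes the integers, so \<open>x\<close> and its conjugate are roots of the
  same monic integer polynomial.\<close>

lemma conj_algebraic_int:
  assumes "x \<in> K" "algebraic_int x" shows "algebraic_int (\<sigma> x)"
proof -
  obtain f where f: "poly (map_poly of_int f) x = 0" "lead_coeff f = 1"
    using assms(2) by (auto simp: algebraic_int_altdef_ipoly)
  have int: "of_int m \<in> F" for m by (rule is_subfield_of_int[OF F])
  have "poly (map_poly of_int g) x \<in> K \<and> \<sigma> (poly (map_poly of_int g) x) = poly (map_poly of_int g) (\<sigma> x)"
    for g :: "int poly"
  proof (induction g)
    case 0
    thus ?case using conj_F[OF is_subfieldD(1)[OF F]] is_subfieldD(1)[OF K] by simp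
  next
    case (pCons a g)
    have a: "of_int a \<in> K" "\<sigma> (of_int a) = of_int a" using int conj_F FK by auto
    have "x * poly (map_poly of_int g) x \<in> K" using assms pCons is_subfieldD(5)[OF K] by blast
    thus ?case using a pCons assms is_subfieldD(3)[OF K]
      by (simp add: map_poly_pCons conj_add conj_mult)
  qed
  from this[of f] have "poly (map_poly of_int f) (\<sigma> x) = \<sigma> 0" using f(1) by simp
  also have "\<sigma> 0 = 0" by (rule conj_F[OF is_subfieldD(1)[OF F]])
  finally show ?thesis using f(2) algebraic_int_monic_poly by blast
qed

lemma conj_OK: "x \<in> OK K \<Longrightarrow> \<sigma> x \<in> OK K"
  using conj_mem conj_algebraic_int by (auto simp: OK_def)

lemma trace_norm_mem:
  assumes "x \<in> K" shows "x + \<sigma> x \<in> F" "x * \<sigma> x \<in> F"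
proof -
  obtain a b where ab: "a \<in> F" "b \<in> F" "x = a + b * \<delta>" using assms by (rule qextE)
  have s: "\<sigma> x = a - b * \<delta>" using ab by (simp add: conj_eq)
  have "x + \<sigma> x = a + a" "x * \<sigma> x = a * a - b * b * \<delta>\<^sup>2"
    unfolding s unfolding ab(3) by (simp_all add: algebra_simps power2_eq_square)
  moreover have "a + a \<in> F" "a * a - b * b * \<delta>\<^sup>2 \<in> F" by (intro is_subfieldD(3,4,5)[OF F] ab sq)+
  ultimately show "x + \<sigma> x \<in> F" "x * \<sigma> x \<in> F" by auto
qed

lemma trace_norm_OK:
  assumes "x \<in> OK K" shows "x + \<sigma> x \<in> OK F" "x * \<sigma> x \<in> OK F"
  using trace_norm_mem[of x] assms conj_algebraic_int[of x]
  by (auto simp: OK_def intro: algebraic_int_add algebraic_int_mult)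

lemma conj_eq_0_iff: "x \<in> K \<Longrightarrow> \<sigma> x = 0 \<longleftrightarrow> x = 0"
  using conj_conj conj_F[OF is_subfieldD(1)[OF F]] by metis

text \<open>A trace condition on \<open>z\<close> alone would not survive multiplication by ring
  elements; letting \<open>c\<close> range over a set stable under \<open>OK K\<close> absorbs the
  multiplier. This carries trace statements from \<open>I\<close> to its extension.\<close>

lemma is_ideal_trace:
  assumes M: "is_ideal F M" and A: "A \<subseteq> OK K" "\<And>c r. c \<in> A \<Longrightarrow> r \<in> OK K \<Longrightarrow> c * r \<in> A"
  shows "is_ideal K {z \<in> OK K. \<forall>c\<in>A. c * z + \<sigma> (c * z) \<in> M}"
  unfolding is_ideal_def
proof (safe, goal_cases)
  case 1 thus ?case by (rule OK_0[OF K])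
next
  case (2 c) thus ?case using conj_F[OF is_subfieldD(1)[OF F]] is_idealD(2)[OF M] by simp
next
  case (3 x y) thus ?case by (intro OK_add[OF K])
next
  case (4 x y c)
  have cx: "c * x \<in> K" "c * y \<in> K" using 4 A(1) by (auto dest!: OK_D(1) intro: is_subfieldD(5)[OF K])
  have "c * (x + y) + \<sigma> (c * (x + y)) = (c * x + \<sigma> (c * x)) + (c * y + \<sigma> (c * y))"
    unfolding distrib_left conj_add[OF cx] by (simp add: algebra_simps)
  moreover have "(c * x + \<sigma> (c * x)) + (c * y + \<sigma> (c * y)) \<in> M" using 4 by (auto intro: is_idealD(3)[OF M, of "c * x + \<sigma> (c * x)"])
  ultimately show ?case by simp
next
  case (5 r x) thus ?case by (intro OK_mult[OF K])
next
  case (6 r x c)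
  hence "(c * r) * x + \<sigma> ((c * r) * x) \<in> M" using A(2) by blast
  thus ?case by (simp add: mult.assoc)
qed

lemma conj_extension_mem:
  assumes I: "is_ideal F I" and x: "x \<in> gen_ideal K I"
  shows "\<sigma> x \<in> gen_ideal K I"
proof -
  let ?E = "gen_ideal K I"
  have E: "is_ideal K ?E" by (rule is_ideal_extension[OF K FK I])
  have "is_ideal K {z \<in> OK K. \<sigma> z \<in> ?E}"
    unfolding is_ideal_def
  proof (safe, goal_cases)
    case 2 thus ?case using conj_F[OF is_subfieldD(1)[OF F]] is_idealD(2)[OF E] by simp
  next
    case (4 x y) thus ?case by (simp add: conj_add OK_D is_idealD(3)[OF E])
  next
    case (6 r x) thus ?case by (simp add: conj_mult OK_D conj_OK is_idealD(4)[OF E])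
  qed (auto intro: OK_ring[OF K])
  moreover have "I \<subseteq> {z \<in> OK K. \<sigma> z \<in> ?E}"
  proof
    fix z assume z: "z \<in> I"
    hence "z \<in> OK F" "z \<in> F" using is_idealD(1)[OF I] by (auto dest: OK_D)
    thus "z \<in> {z \<in> OK K. \<sigma> z \<in> ?E}" using z gen_ideal_base[of I K] OK_mono[OF FK] by (auto simp: conj_F)
  qed
  ultimately show ?thesis using gen_ideal_least x by blast
qed

text \<open>If \<open>I O\<^sub>K = \<alpha> O\<^sub>K\<close> then \<open>I\<^sup>2\<close> is generated by the norm of \<open>\<alpha>\<close>.  That the norm lies in
  \<open>I\<^sup>2\<close> is a polarisation argument for the quadratic form \<open>x \<mapsto> x \<sigma>(x)\<close>.\<close>
lemma capitulates_imp_square_principal: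
  assumes I: "nz_ideal F I" and cap: "principal K (gen_ideal K I)"
  obtains \<nu> where "\<nu> \<in> OK F" "\<nu> \<noteq> 0" "ideal_mult F I I = (*) \<nu> ` OK F"
proof -
  let ?E = "gen_ideal K I" and ?M = "ideal_mult F I I"
  have II: "is_ideal F I" using I by (rule nz_ideal_ideal)
  have M: "is_ideal F ?M" by (intro is_ideal_mult F II)
  have E: "is_ideal K ?E" by (rule is_ideal_extension[OF K FK II])
  have IF: "x \<in> OK F" "x \<in> F" "x \<in> OK K" "x \<in> K" if "x \<in> I" for x
    using that is_idealD(1)[OF II] OK_mono[OF FK] by (auto dest: OK_D)
  obtain \<alpha> where \<alpha>: "\<alpha> \<in> ?E" "\<And>x. x \<in> I \<Longrightarrow> \<exists>r\<in>OK K. x = \<alpha> * r"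
    using cap capitulates_iff[OF K FK II] by blast
  have \<alpha>K: "\<alpha> \<in> OK K" using \<alpha>(1) is_idealD(1)[OF E] by blast
  have "\<alpha> \<noteq> 0" using nz_ideal_mem[OF I] \<alpha>(2) by force
  define \<nu> where "\<nu> = \<alpha> * \<sigma> \<alpha>"
  have \<nu>: "\<nu> \<in> OK F" unfolding \<nu>_def by (rule trace_norm_OK[OF \<alpha>K])
  have \<nu>0: "\<nu> \<noteq> 0" using \<open>\<alpha> \<noteq> 0\<close> conj_eq_0_iff[OF OK_D(1)[OF \<alpha>K]] by (simp add: \<nu>_def)
  \<comment> \<open>The polar form is extended from \<open>I\<close> to the extended ideal in one
    variable at a time. The starting point is that for \<open>b\<close> and \<open>y\<close> in
    \<open>I\<close> the trace of \<open>b * w * y\<close> is \<open>b * y\<close> times the trace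
    of \<open>w\<close>.\<close>
  have tr1: "x * z + \<sigma> (x * z) \<in> ?M" if z: "z \<in> ?E" and x: "x \<in> I" for x z
  proof -
    let ?A = "{b * w | b w. b \<in> I \<and> w \<in> OK K}"
    let ?J = "{z \<in> OK K. \<forall>c\<in>?A. c * z + \<sigma> (c * z) \<in> ?M}"
    have "is_ideal K ?J"
    proof (rule is_ideal_trace[OF M])
      show "?A \<subseteq> OK K" using IF OK_mult[OF K] by auto
      show "c * r \<in> ?A" if "c \<in> ?A" "r \<in> OK K" for c r
        using that OK_mult[OF K] by clarsimp (metis mult.assoc)
    qed
    moreover have "I \<subseteq> ?J"
    proof (safe, goal_cases)
      case (1 y) thus ?case using IF by blast
    next
      case (2 y _ b w)
      have "b * w * y + \<sigma> (b * w * y) = (b * y) * (w + \<sigma> w)"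
      proof -
        have "\<sigma> (w * (b * y)) = \<sigma> w * (b * y)"
          using 2 IF(2) conj_mult[of w "b * y"] conj_F[of "b * y"] is_subfieldD(5)[OF F, of b y]
            OK_D(1)[of w K] FK by auto
        thus ?thesis by (simp add: algebra_simps)
      qed
      moreover have "(b * y) * (w + \<sigma> w) \<in> ?M"
        using 2 by (intro is_idealD(5)[OF M] trace_norm_OK ideal_mult_memI)
      ultimately show ?case by simp
    qed
    ultimately have "z \<in> ?J" using z gen_ideal_least by blast
    moreover have "x * 1 \<in> ?A" using x OK_1[OF K] by blast
    hence "x \<in> ?A" by simp
    ultimately show ?thesis by blast
  qed
  have tr2: "y * z + \<sigma> (y * z) \<in> ?M" if z: "z \<in> ?E" and y: "y \<in> ?E" for y z
  proof -
    let ?J = "{z \<in> OK K. \<forall>c\<in>?E. c * z + \<sigma> (c * z) \<in> ?M}"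
    have "is_ideal K ?J"
      by (rule is_ideal_trace[OF M]) (use is_idealD[OF E] in auto)
    moreover have "I \<subseteq> ?J"
    proof
      fix t assume t: "t \<in> I"
      have "c * t + \<sigma> (c * t) \<in> ?M" if "c \<in> ?E" for c
        using tr1[OF that t] by (simp only: mult.commute[of c])
      thus "t \<in> ?J" using IF(3)[OF t] by blast
    qed
    ultimately have "z \<in> ?J" using z gen_ideal_least by blast
    thus ?thesis using y by blast
  qed
  have "is_ideal K {x \<in> ?E. x * \<sigma> x \<in> ?M}"
    unfolding is_ideal_def
  proof (safe, goal_cases)
    case (1 x) thus ?case using is_idealD(1)[OF E] by blast
  next
    case 2 thus ?case by (rule is_idealD(2)[OF E])
  next
    case 3 thus ?case using is_idealD(2)[OF M] by simp
  next
    case (4 x y) thus ?case by (intro is_idealD(3)[OF E])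
  next
    case (5 x y)
    have xy: "x \<in> K" "y \<in> K" "\<sigma> y \<in> K" using 5 is_idealD(1)[OF E] conj_mem by (auto dest: OK_D)
    have "(x + y) * \<sigma> (x + y) = (x * \<sigma> x + y * \<sigma> y) + (x * \<sigma> y + \<sigma> (x * \<sigma> y))"
      using xy by (simp add: conj_add conj_mult conj_conj algebra_simps)
    moreover have "\<sigma> y \<in> ?E" using conj_extension_mem[OF II] 5 by blast
    hence "(x * \<sigma> x + y * \<sigma> y) + (x * \<sigma> y + \<sigma> (x * \<sigma> y)) \<in> ?M"
      using 5 by (intro is_idealD(3)[OF M] tr2) auto
    ultimately show ?case by simp
  next
    case (6 r x) thus ?case by (intro is_idealD(4)[OF E])
  next
    case (7 r x)
    have xy: "x \<in> K" "r \<in> K" using 7 is_idealD(1)[OF E] by (auto dest: OK_D)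
    have eq: "(r * x) * \<sigma> (r * x) = (r * \<sigma> r) * (x * \<sigma> x)"
      unfolding conj_mult[OF xy(2,1)] by (simp only: mult_ac)
    show ?case unfolding eq using 7 by (auto intro!: is_idealD(4)[OF M trace_norm_OK(2)])
  qed
  moreover have "I \<subseteq> {x \<in> ?E. x * \<sigma> x \<in> ?M}"
    using gen_ideal_base[of I K] IF by (auto simp: conj_F intro: ideal_mult_memI)
  ultimately have "\<nu> \<in> ?M" unfolding \<nu>_def using \<alpha>(1) gen_ideal_least by blast
  hence "(*) \<nu> ` OK F \<subseteq> ?M" using is_idealD(5)[OF M] by auto
  moreover have "?M \<subseteq> (*) \<nu> ` OK F"
  proof (rule ideal_mult_least[OF is_ideal_smul[OF F is_ideal_OK[OF F] \<nu>]])
    fix a b assume ab: "a \<in> I" "b \<in> I"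
    obtain r s where rs: "r \<in> OK K" "s \<in> OK K" "a = \<alpha> * r" "b = \<alpha> * s" using \<alpha>(2) ab by meson
    \<comment> \<open>As \<open>b\<close> is fixed by the conjugation, the second generator may be
      replaced by its conjugate, so that the norm \<open>\<nu>\<close> appears in
      \<open>a * b\<close>.\<close>
    have "b = \<sigma> (\<alpha> * s)" using rs(4) conj_F[of b] IF(2)[OF ab(2)] by simp
    also have "\<dots> = \<sigma> \<alpha> * \<sigma> s" using rs \<alpha>K by (simp add: conj_mult OK_D)
    finally have eq: "a * b = \<nu> * (r * \<sigma> s)" using rs(3) by (simp add: \<nu>_def mult_ac)
    hence "r * \<sigma> s = a * b / \<nu>" using \<nu>0 by (simp add: field_simps)
    hence "r * \<sigma> s \<in> F" using IF(2)[OF ab(1)] IF(2)[OF ab(2)] OK_D(1)[OF \<nu>] is_subfieldD(5,8)[OF F] by auto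
    moreover have "r * \<sigma> s \<in> OK K" using rs conj_OK OK_mult[OF K] by blast
    ultimately have "r * \<sigma> s \<in> OK F" by (auto simp: OK_def)
    thus "a * b \<in> (*) \<nu> ` OK F" using eq by blast
  qed
  ultimately show ?thesis using that[OF \<nu> \<nu>0] by blast
qed

end

section \<open>The field \<open>\<rat>(\<surd>(2pq), \<i>)\<close> as a quadratic extension of \<open>\<rat>(\<i>)\<close>\<close>

definition QI :: "complex set" where
  "QI = {z. Re z \<in> \<rat> \<and> Im z \<in> \<rat>}"

lemma is_subfield_QI: "is_subfield QI"
  by (auto simp: is_subfield_def QI_def inverse_complex.code intro!: Rats_divide Rats_add)

lemma ZI_QI: "x \<in> ZI \<Longrightarrow> x \<in> QI"
  using Ints_subset_Rats by (auto simp: ZI_def QI_def)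

lemma of_real_Rats_mem:
  assumes "is_subfield F" "r \<in> \<rat>" shows "of_real r \<in> F"
proof -
  obtain a b where "r = of_int a / of_int b" using assms(2) by (metis Rats_cases')
  hence "complex_of_real r = of_int a / of_int b" by simp
  thus ?thesis using is_subfieldD(8)[OF assms(1)] is_subfield_of_int[OF assms(1)] by simp
qed

lemma QI_subset:
  assumes "is_subfield F" "\<i> \<in> F" shows "QI \<subseteq> F"
proof
  fix z assume "z \<in> QI"
  hence "of_real (Re z) \<in> F" "of_real (Im z) \<in> F"
    by (auto simp: QI_def intro: of_real_Rats_mem[OF assms(1)])
  hence "of_real (Re z) + \<i> * of_real (Im z) \<in> F" using assms by (intro is_subfieldD(3,5)[OF assms(1)])
  thus "z \<in> F" using complex_eq[of z] by simp
qed

lemma algebraic_int_ZI: "x \<in> ZI \<Longrightarrow> algebraic_int x"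
  by (elim ZI_cases) (auto intro!: algebraic_int_add algebraic_int_mult algebraic_int_of_int_complex)

lemma Int_if_algebraic_int_of_real:
  assumes "algebraic_int (complex_of_real r)" "r \<in> \<rat>" shows "r \<in> \<int>"
  using assms rational_algebraic_int_is_int[of r] by simp

lemma even_if_sum_squares_mod_4:
  fixes a b :: int
  assumes "4 dvd a\<^sup>2 + b\<^sup>2" shows "even a \<and> even b"
proof -
  have sq: "c\<^sup>2 mod 4 = (if even c then 0 else 1)" for c :: int
  proof (cases "even c")
    case True thus ?thesis by (auto elim!: evenE simp: power_mult_distrib)
  next
    case False
    then obtain m where "c = 2 * m + 1" by (elim oddE)
    moreover define l where "l = m * m + m"
    ultimately have "c\<^sup>2 = 4 * l + 1" by (simp add: power2_eq_square algebra_simps)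
    thus ?thesis using False by simp
  qed
  have "(a\<^sup>2 mod 4 + b\<^sup>2 mod 4) mod 4 = 0" using assms by (simp add: mod_add_eq mod_eq_0_iff_dvd)
  thus ?thesis unfolding sq by (auto split: if_splits)
qed

text \<open>Twice each coordinate and the norm are rational algebraic integers. So
  \<open>2 z\<close> has integer coordinates whose squares sum to a multiple of 4, and both
  coordinates are even.\<close>

lemma OK_QI: "OK QI = ZI"
proof (intro equalityI subsetI)
  fix z assume "z \<in> ZI"
  thus "z \<in> OK QI" by (auto simp: OK_def ZI_QI algebraic_int_ZI)
next
  fix z assume "z \<in> OK QI"
  hence z: "Re z \<in> \<rat>" "Im z \<in> \<rat>" "algebraic_int z" by (auto simp: OK_def QI_def)
  have "algebraic_int (z + cnj z)" "algebraic_int (-\<i> * (z - cnj z))" "algebraic_int (z * cnj z)"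
    using z(3) by (auto intro!: algebraic_int_add algebraic_int_mult algebraic_int_diff)
  moreover have "z + cnj z = of_real (2 * Re z)" "-\<i> * (z - cnj z) = of_real (2 * Im z)"
    "z * cnj z = of_real ((Re z)\<^sup>2 + (Im z)\<^sup>2)"
    by (auto simp: complex_eq_iff power2_eq_square)
  ultimately have ai: "algebraic_int (complex_of_real (2 * Re z))" "algebraic_int (complex_of_real (2 * Im z))"
    "algebraic_int (complex_of_real ((Re z)\<^sup>2 + (Im z)\<^sup>2))" by metis+
  have "2 * Re z \<in> \<int>" "2 * Im z \<in> \<int>" "(Re z)\<^sup>2 + (Im z)\<^sup>2 \<in> \<int>"
    by (intro Int_if_algebraic_int_of_real ai Rats_add Rats_mult Rats_power z; simp)+
  then obtain a b c where abc: "2 * Re z = of_int a" "2 * Im z = of_int b" "(Re z)\<^sup>2 + (Im z)\<^sup>2 = of_int c"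
    by (auto elim!: Ints_cases)
  have "real_of_int (a\<^sup>2 + b\<^sup>2) = (2 * Re z)\<^sup>2 + (2 * Im z)\<^sup>2" using abc by simp
  also have "\<dots> = 4 * ((Re z)\<^sup>2 + (Im z)\<^sup>2)" by (simp add: power_mult_distrib)
  finally have "real_of_int (a\<^sup>2 + b\<^sup>2) = of_int (4 * c)" using abc by simp
  hence "a\<^sup>2 + b\<^sup>2 = 4 * c" unfolding of_int_eq_iff .
  hence "even a \<and> even b" by (intro even_if_sum_squares_mod_4) simp
  then obtain a' b' where "a = 2 * a'" "b = 2 * b'" by (auto elim!: evenE)
  hence "Re z = of_int a'" "Im z = of_int b'" using abc by auto
  thus "z \<in> ZI" by (simp add: ZI_def)
qed

text \<open>The polynomial \<open>X\<^sup>2 - t X + m\<close> times its complex conjugate has integer coefficients.\<close>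
lemma algebraic_int_quadratic:
  assumes "t \<in> ZI" "m \<in> ZI" "x\<^sup>2 = t * x - m"
  shows "algebraic_int x"
proof (rule algebraic_int_root[OF algebraic_int_0])
  let ?P = "[:m * cnj m, -(t * cnj m + m * cnj t), m + cnj m + t * cnj t, -(t + cnj t), 1:]"
  have "poly ?P x = (x\<^sup>2 - t * x + m) * (x\<^sup>2 - cnj t * x + cnj m)"
    by (simp add: algebra_simps power2_eq_square)
  thus "poly ?P x = 0" using assms(3) by simp
  have R: "u + cnj u \<in> \<int>" "u * cnj u \<in> \<int>" if "u \<in> ZI" for u
  proof -
    have "u * cnj u = of_int (gnorm u)" using of_int_gnorm[OF that] by simp
    thus "u * cnj u \<in> \<int>" by simp
    from that show "u + cnj u \<in> \<int>" by (elim ZI_cases) (simp add: algebra_simps)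
  qed
  have "t * cnj m + cnj (t * cnj m) \<in> \<int>" using assms by (intro R ZI_closed)
  hence "t * cnj m + m * cnj t \<in> \<int>" by (simp add: mult.commute)
  hence c: "m * cnj m \<in> \<int>" "-(t * cnj m + m * cnj t) \<in> \<int>" "m + cnj m + t * cnj t \<in> \<int>" "-(t + cnj t) \<in> \<int>"
    using assms by (intro Ints_minus Ints_add[of "m + cnj m"] R; simp)+
  show "\<forall>i. Polynomial.coeff ?P i \<in> \<int>"
    using c by (auto simp: coeff_pCons split: nat.splits)
qed auto

lemma Qadj_pair_eq_qext:
  assumes "s\<^sup>2 \<in> QI"
  shows "Qadj [s, \<i>] = qext QI s"
proof
  have i: "\<i> \<in> QI" by (simp add: QI_def)
  show "Qadj [s, \<i>] \<subseteq> qext QI s"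
    using qext_contains[OF is_subfield_QI] i
    by (intro Qadj_least is_subfield_qext is_subfield_QI assms) auto
  show "qext QI s \<subseteq> Qadj [s, \<i>]"
    by (intro qext_least is_subfield_Qadj QI_subset) (auto intro: Qadj_base)
qed

context prime_pair
begin

definition s :: complex where "s = csqrt (of_nat (2 * p * q))"
text \<open>Since \<open>(1 + \<i>)^2 = 2 * \<i>\<close>, the division turns the radicand
  \<open>2 p q\<close> into \<open>- \<i> p q\<close>. With \<open>s = (1 + \<i>) * w\<close> in
  place of \<open>w\<close> one would only get a proper subring of the integers.\<close>

definition w :: complex where "w = s / (1 + \<i>)"
abbreviation k :: "complex set" where "k \<equiv> Qadj [s, \<i>]"

lemma s_eq: "s = of_real (sqrt (of_nat (2 * p * q)))"
  using csqrt_of_real_nonneg[of "of_nat (2 * p * q)"] by (simp add: s_def)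

lemma s_sq: "s\<^sup>2 = of_nat (2 * p * q)"
  unfolding s_def by (rule power2_csqrt)

lemma w_sq: "w\<^sup>2 = - \<i> * of_nat (p * q)"
proof -
  have "(1 + \<i>)\<^sup>2 = 2 * \<i>" by (simp add: power2_eq_square algebra_simps)
  hence "w\<^sup>2 = of_nat (p * q) / \<i>" by (simp add: w_def power_divide s_sq)
  thus ?thesis by (simp add: divide_i)
qed

lemma sqrt_irrational: "sqrt (of_nat (2 * p * q)) \<notin> \<rat>"
proof -
  have "odd (p * q)" using gt2 by simp
  hence "\<not> 2\<^sup>2 dvd 2 * p * q" by (auto simp: power2_eq_square mult.assoc)
  thus ?thesis by (intro sqrt_nat_irrational[of 2]) auto
qed

lemma s_w: "s = (1 + \<i>) * w"
proof -
  have "(1 + \<i>) \<noteq> 0" by (simp add: complex_eq_iff)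
  thus ?thesis by (simp add: w_def)
qed

lemma i_QI [simp]: "\<i> \<in> QI" "1 + \<i> \<in> QI" "1 \<in> QI" by (simp_all add: QI_def)

lemma of_nat_QI [simp]: "of_nat m \<in> QI" by (simp add: ZI_QI)

lemma s_not_QI: "s \<notin> QI"
  using sqrt_irrational by (auto simp: QI_def s_eq)

sublocale base: quad_ext QI w
proof
  show "w\<^sup>2 \<in> QI" unfolding w_sq by (intro ZI_QI) auto
  show "w \<notin> QI" using s_not_QI s_w is_subfieldD(5)[OF is_subfield_QI i_QI(2)] by metis
qed (fact is_subfield_QI)

lemma k_eq: "k = qext QI w"
proof -
  have "s\<^sup>2 \<in> QI" unfolding s_sq by (rule of_nat_QI)
  hence k1: "k = qext QI s" by (rule Qadj_pair_eq_qext)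
  have "w = 0 + (1 / (1 + \<i>)) * s" by (simp add: w_def)
  moreover have "0 + (1 / (1 + \<i>)) * s \<in> qext QI s"
    by (intro qextI is_subfieldD(1,8)[OF is_subfield_QI]) auto
  ultimately have "w \<in> qext QI s" by simp
  hence "qext QI w \<subseteq> qext QI s" using \<open>s\<^sup>2 \<in> QI\<close> is_subfield_QI
    by (intro qext_least is_subfield_qext qext_contains) auto
  moreover have "s \<in> qext QI w" unfolding s_w
    using qextI[of 0 QI "1 + \<i>" w] is_subfieldD(1)[OF is_subfield_QI] by simp
  hence "qext QI s \<subseteq> qext QI w" using base.K base.FK by (intro qext_least) auto
  ultimately show ?thesis using k1 by blast
qed

lemmas k_field = base.K[folded k_eq]

abbreviation O\<^sub>k :: "complex set" where "O\<^sub>k \<equiv> OK k"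
abbreviation \<tau> :: "complex \<Rightarrow> complex" where "\<tau> \<equiv> qconj QI w"

lemma w_k: "w \<in> O\<^sub>k" "w \<in> k"
proof -
  show "w \<in> k" unfolding k_eq using qext_contains(2)[OF is_subfield_QI] .
  moreover have "algebraic_int (w\<^sup>2)" unfolding w_sq by (intro algebraic_int_ZI) auto
  ultimately show "w \<in> O\<^sub>k" by (intro OK_I algebraic_int_sqrt_complex[of w])
qed

lemma ZI_k: "x \<in> ZI \<Longrightarrow> x \<in> O\<^sub>k"
  using OK_mono[OF base.FK] unfolding OK_QI k_eq by blast

text \<open>The prime \<open>l\<close> splits into two distinct Gaussian primes, so divisibility by
  \<open>l\<close> can be tested at the two residues of \<open>\<i>\<close>, where a square vanishes
  only with its root.\<close>

lemma gdvd_prime_square: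
  assumes "prime (l :: nat)" "l mod 4 = 1" "c \<in> ZI" "of_nat l gdvd c\<^sup>2"
  shows "of_nat l gdvd c"
proof -
  obtain r where r: "int l dvd r\<^sup>2 + 1" using sqrt_minus_one_mod_prime assms by blast
  have l2: "int l > 2" using assms(1,2) prime_gt_1_nat[of l] by (cases "l = 2") auto
  have pl: "prime (int l)" using assms by simp
  have "int l dvd gred \<rho> c" if "int l dvd \<rho>\<^sup>2 + 1" for \<rho>
  proof -
    have "int l dvd gred \<rho> (c\<^sup>2)" using that assms by (intro gred_gdvd[OF that assms(4)]) auto
    moreover have "[gred \<rho> (c\<^sup>2) = (gred \<rho> c)\<^sup>2] (mod int l)" by (rule gred_power[OF that assms(3)])
    ultimately have "int l dvd (gred \<rho> c)\<^sup>2" using cong_dvd_iff by blast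
    thus ?thesis using pl prime_dvd_power by blast
  qed
  from this[OF r] this[of "-r"] r have "of_int (int l) gdvd c"
    by (intro gdvd_of_int_if_gred[OF pl l2 r assms(3)]) auto
  thus ?thesis by simp
qed

lemma gdvd_coprime_nats:
  assumes "coprime (a :: nat) b" "of_nat a gdvd z" "of_nat b gdvd z" "z \<in> ZI"
  shows "of_nat (a * b) gdvd z"
proof -
  have "int a dvd \<lfloor>Re z\<rfloor>" "int a dvd \<lfloor>Im z\<rfloor>" "int b dvd \<lfloor>Re z\<rfloor>" "int b dvd \<lfloor>Im z\<rfloor>"
    using of_int_gdvd_iff[OF assms(4), of "int a"] of_int_gdvd_iff[OF assms(4), of "int b"] assms by auto
  hence "int a * int b dvd \<lfloor>Re z\<rfloor>" "int a * int b dvd \<lfloor>Im z\<rfloor>" using assms(1) by (auto intro!: divides_mult)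
  hence "of_int (int (a * b)) gdvd z" by (subst of_int_gdvd_iff[OF assms(4)]) simp
  thus ?thesis by simp
qed

text \<open>The hypotheses are the real and imaginary parts of \<open>a^2 + \<i> n b^2\<close> being
  divisible by 4, for \<open>a = a1 + \<i> a2\<close> and \<open>b = b1 + \<i> b2\<close>.\<close>

lemma parity_mod_4:
  fixes a1 a2 b1 b2 n :: int
  assumes n: "odd n" and re: "4 dvd a1\<^sup>2 - a2\<^sup>2 - 2 * n * (b1 * b2)"
    and im: "4 dvd 2 * (a1 * a2) + n * (b1\<^sup>2 - b2\<^sup>2)"
  shows "even a1 \<and> even a2 \<and> even b1 \<and> even b2"
proof -
  have "even (a1\<^sup>2 - a2\<^sup>2 - 2 * n * (b1 * b2))" using re by (rule dvd_trans[rotated]) simp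
  hence a: "even a1 \<longleftrightarrow> even a2" by simp
  have "even (2 * (a1 * a2) + n * (b1\<^sup>2 - b2\<^sup>2))" using im by (rule dvd_trans[rotated]) simp
  hence b: "even b1 \<longleftrightarrow> even b2" using n by simp
  have sq: "4 dvd c\<^sup>2 - d\<^sup>2" if "even c \<longleftrightarrow> even d" for c d :: int
  proof -
    have "even (c - d)" "even (c + d)" using that by simp_all
    then obtain e f where "c - d = 2 * e" "c + d = 2 * f" by (elim evenE)
    hence "c\<^sup>2 - d\<^sup>2 = 4 * (e * f)" by (simp add: power2_eq_square square_diff_square_factored)
    thus ?thesis by simp
  qed
  have half: "even y" if "4 dvd 2 * y" for y :: int using that by presburger
  have "4 dvd 2 * n * (b1 * b2)" using dvd_diff[OF sq[OF a] re] by simp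
  hence "even (n * (b1 * b2))" using half[of "n * (b1 * b2)"] by (simp only: mult.assoc)
  hence "even b1 \<and> even b2" using n b by simp
  have "4 dvd n * (b1\<^sup>2 - b2\<^sup>2)" using sq[OF b] by simp
  hence "4 dvd 2 * (a1 * a2)" using im by (simp add: dvd_add_left_iff)
  hence "even (a1 * a2)" by (rule half)
  thus ?thesis using a \<open>even b1 \<and> even b2\<close> by auto
qed

lemma ZI_double_odd:
  assumes a: "a \<in> ZI" "b \<in> ZI" and dv: "4 gdvd a\<^sup>2 + \<i> * of_nat (p * q) * b\<^sup>2"
  shows "2 gdvd a \<and> 2 gdvd b"
proof -
  obtain a1 a2 where a': "a = of_int a1 + \<i> * of_int a2" "Re a = of_int a1" "Im a = of_int a2"
    using a(1) by (rule ZI_cases)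
  obtain b1 b2 where b': "b = of_int b1 + \<i> * of_int b2" "Re b = of_int b1" "Im b = of_int b2"
    using a(2) by (rule ZI_cases)
  let ?n = "int (p * q)"
  let ?R = "a1\<^sup>2 - a2\<^sup>2 - 2 * ?n * (b1 * b2)" and ?I = "2 * (a1 * a2) + ?n * (b1\<^sup>2 - b2\<^sup>2)"
  let ?z = "a\<^sup>2 + \<i> * of_nat (p * q) * b\<^sup>2"
  have z: "?z = of_int ?R + \<i> * of_int ?I"
    unfolding a'(1) b'(1) by (simp add: algebra_simps power2_eq_square)
  have "?z \<in> ZI" using a by auto
  moreover have "of_int 4 gdvd ?z" using dv by simp
  ultimately have "4 dvd \<lfloor>Re ?z\<rfloor> \<and> 4 dvd \<lfloor>Im ?z\<rfloor>" using of_int_gdvd_iff by blast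
  moreover have "Re ?z = of_int ?R" "Im ?z = of_int ?I" unfolding z by simp_all
  ultimately have "4 dvd ?R" "4 dvd ?I" by (simp_all only: floor_of_int)
  moreover have "odd ?n" using gt2 by simp
  ultimately have "even a1 \<and> even a2 \<and> even b1 \<and> even b2" by (rule parity_mod_4[rotated])
  hence "of_int 2 gdvd a" "of_int 2 gdvd b"
    using a' b' of_int_gdvd_iff[OF a(1), of 2] of_int_gdvd_iff[OF a(2), of 2] by auto
  thus ?thesis by simp
qed

text \<open>The traces of \<open>x + y w\<close> and of \<open>w (x + y w)\<close> put
  \<open>2 x\<close> and \<open>2 p q y\<close> into \<open>ZI\<close>. The norm then shows that
  \<open>p q\<close> divides the square of the latter, hence the latter itself, so
  \<open>2 y\<close> is in \<open>ZI\<close>. Finally four times the norm is a value of the form at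
  \<open>(2 x, 2 y)\<close> divisible by 4, which removes the factor 2.\<close>

lemma O_k_iff:
  assumes xy: "x \<in> QI" "y \<in> QI"
  shows "x + y * w \<in> O\<^sub>k \<longleftrightarrow> x \<in> ZI \<and> y \<in> ZI"
proof
  assume "x \<in> ZI \<and> y \<in> ZI"
  thus "x + y * w \<in> O\<^sub>k" by (intro OK_add[OF k_field] OK_mult[OF k_field _ w_k(1)] ZI_k) auto
next
  assume "x + y * w \<in> O\<^sub>k"
  hence \<alpha>: "x + y * w \<in> OK base.K" unfolding k_eq .
  let ?n = "complex_of_nat (p * q)"
  have n0: "?n \<noteq> 0" using gt2 by simp
  have "(x + y * w) + \<tau> (x + y * w) \<in> ZI" "(x + y * w) * \<tau> (x + y * w) \<in> ZI"
    using base.trace_norm_OK[OF \<alpha>] unfolding OK_QI .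
  moreover have "(x + y * w) * (x - y * w) = x\<^sup>2 - y\<^sup>2 * w\<^sup>2"
    by (simp add: algebra_simps power2_eq_square)
  ultimately have tr: "2 * x \<in> ZI" and nm: "x\<^sup>2 + \<i> * ?n * y\<^sup>2 \<in> ZI"
    using xy by (simp_all add: base.conj_eq w_sq mult_ac)
  have "w * (x + y * w) \<in> OK base.K" using \<alpha> w_k(1) unfolding k_eq by (intro OK_mult base.K)
  moreover have eq: "w * (x + y * w) = (- \<i> * ?n * y) + x * w"
    using w_sq by (simp add: algebra_simps power2_eq_square)
  moreover have mem: "- \<i> * ?n * y \<in> QI"
    by (intro is_subfieldD(5,7)[OF is_subfield_QI] of_nat_QI i_QI xy)
  ultimately have "(- \<i> * ?n * y + x * w) + \<tau> (- \<i> * ?n * y + x * w) \<in> ZI"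
    using base.trace_norm_OK[of "w * (x + y * w)"] unfolding OK_QI by simp
  hence "- 2 * \<i> * ?n * y \<in> ZI" using base.conj_eq[OF mem xy(1)] by (simp add: algebra_simps)
  hence "\<i> * (- 2 * \<i> * ?n * y) \<in> ZI" by (rule ZI_closed(9)[OF ZI_closed(3)])
  moreover have "\<i> * (- 2 * \<i> * ?n * y) = 2 * ?n * y" by simp
  ultimately have c: "2 * ?n * y \<in> ZI" by metis
  define c' where "c' = 2 * ?n * y"
  have cZ: "c' \<in> ZI" using c by (simp add: c'_def)
  have "- \<i> * (4 * (x\<^sup>2 + \<i> * ?n * y\<^sup>2) - (2 * x)\<^sup>2) \<in> ZI"
    by (rule ZI_closed(9)[OF _ ZI_closed(8)[OF ZI_closed(9)[OF ZI_closed(6) nm] ZI_power[OF tr]]]) simp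
  moreover have "c'\<^sup>2 = ?n * (- \<i> * (4 * (x\<^sup>2 + \<i> * ?n * y\<^sup>2) - (2 * x)\<^sup>2))"
    by (simp add: c'_def power2_eq_square algebra_simps)
  ultimately have nc: "?n gdvd c'\<^sup>2" by (intro gdvdI)
  have "of_nat p gdvd ?n" "of_nat q gdvd ?n"
    by (rule gdvdI[of "of_nat q"], simp_all) (rule gdvdI[of "of_nat p"], simp_all)
  hence "of_nat p gdvd c'\<^sup>2" "of_nat q gdvd c'\<^sup>2" using nc gdvd_trans by blast+
  hence "of_nat p gdvd c'" "of_nat q gdvd c'" using primes cZ gdvd_prime_square by blast+
  hence "?n gdvd c'" using primes cZ by (intro gdvd_coprime_nats) (auto simp: primes_coprime)
  then obtain b where b: "b \<in> ZI" "c' = ?n * b" by (auto simp: gdvd_def)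
  have "2 * y = b" using b n0 by (simp add: c'_def)
  have "4 * (x\<^sup>2 + \<i> * ?n * y\<^sup>2) = (2 * x)\<^sup>2 + \<i> * ?n * (2 * y)\<^sup>2"
    by (simp add: power_mult_distrib algebra_simps)
  hence "4 gdvd (2 * x)\<^sup>2 + \<i> * ?n * b\<^sup>2" using nm \<open>2 * y = b\<close> by (metis gdvdI)
  hence "2 gdvd 2 * x \<and> 2 gdvd b" using tr b by (intro ZI_double_odd)
  thus "x \<in> ZI \<and> y \<in> ZI" using \<open>2 * y = b\<close> by (auto simp: gdvd_def)
qed

lemma O_kE:
  assumes "z \<in> O\<^sub>k"
  obtains x y where "x \<in> ZI" "y \<in> ZI" "z = x + y * w"
proof -
  have "z \<in> qext QI w" using assms by (auto simp: OK_def k_eq)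
  then obtain x y where "x \<in> QI" "y \<in> QI" "z = x + y * w" by (rule qextE)
  thus ?thesis using that O_k_iff assms by blast
qed

lemma O_kI: "x \<in> ZI \<Longrightarrow> y \<in> ZI \<Longrightarrow> x + y * w \<in> O\<^sub>k"
  using O_k_iff ZI_QI by blast

lemma O_k_QI: "z \<in> O\<^sub>k \<Longrightarrow> z \<in> QI \<Longrightarrow> z \<in> ZI"
  using O_k_iff[of z 0] is_subfieldD(1)[OF is_subfield_QI] by simp

lemma smul_O_k_iff:
  assumes "c \<in> ZI" "c \<noteq> 0" "x \<in> ZI" "y \<in> ZI"
  shows "x + y * w \<in> (*) c ` O\<^sub>k \<longleftrightarrow> c gdvd x \<and> c gdvd y"
proof
  assume "x + y * w \<in> (*) c ` O\<^sub>k"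
  then obtain z where z: "z \<in> O\<^sub>k" "x + y * w = c * z" by blast
  from z(1) obtain a b where ab: "a \<in> ZI" "b \<in> ZI" "z = a + b * w" by (rule O_kE)
  have "x + y * w = c * a + (c * b) * w" using z ab by (simp add: algebra_simps)
  hence "x = c * a" "y = c * b"
    using base.basis_unique[of x y "c * a" "c * b"] assms ab by (auto intro: ZI_QI)
  thus "c gdvd x \<and> c gdvd y" using ab by (auto intro: gdvdI)
next
  assume "c gdvd x \<and> c gdvd y"
  then obtain a b where ab: "a \<in> ZI" "b \<in> ZI" "x = c * a" "y = c * b" by (auto simp: gdvd_def)
  hence "x + y * w = c * (a + b * w)" by (simp add: algebra_simps)
  thus "x + y * w \<in> (*) c ` O\<^sub>k" using O_kI[OF ab(1,2)] by blast
qed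

lemma O_k_integral:
  assumes "\<theta> \<in> k" "\<theta> + \<tau> \<theta> \<in> ZI" "\<theta> * \<tau> \<theta> \<in> ZI" shows "\<theta> \<in> O\<^sub>k"
proof -
  have "\<theta>\<^sup>2 = (\<theta> + \<tau> \<theta>) * \<theta> - \<theta> * \<tau> \<theta>" by (simp add: algebra_simps power2_eq_square)
  hence "algebraic_int \<theta>" using assms by (intro algebraic_int_quadratic)
  thus ?thesis using assms by (intro OK_I)
qed

lemmas tau_add = base.conj_add[folded k_eq]
  and tau_mult = base.conj_mult[folded k_eq]
  and tau_tau = base.conj_conj[folded k_eq]
  and tau_mem = base.conj_mem[folded k_eq]
  and tau_OK = base.conj_OK[folded k_eq]
  and tau_eq_0 = base.conj_eq_0_iff[folded k_eq]
  and trace_norm_ZI = base.trace_norm_OK[folded k_eq, unfolded OK_QI]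
  and tau_QI = base.conj_F

lemma tau_ZI: "x \<in> ZI \<Longrightarrow> \<tau> x = x" by (intro tau_QI ZI_QI)

section \<open>Conjugate ideals and ideal norms in \<open>k\<close>\<close>

lemma is_ideal_tau:
  assumes J: "is_ideal k J" shows "is_ideal k (\<tau> ` J)"
  unfolding is_ideal_def
proof (intro conjI ballI)
  have JO: "x \<in> O\<^sub>k" "x \<in> k" if "x \<in> J" for x using is_idealD(1)[OF J that] by (auto dest: OK_D)
  show "\<tau> ` J \<subseteq> O\<^sub>k" using JO tau_OK by auto
  show "0 \<in> \<tau> ` J" using is_idealD(2)[OF J] tau_ZI[of 0] by force
  show "x + y \<in> \<tau> ` J" if "x \<in> \<tau> ` J" "y \<in> \<tau> ` J" for x y
  proof -
    obtain a b where ab: "a \<in> J" "b \<in> J" "x = \<tau> a" "y = \<tau> b" using \<open>x \<in> \<tau> ` J\<close> \<open>y \<in> \<tau> ` J\<close> by blast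
    hence "x + y = \<tau> (a + b)" using JO by (simp add: tau_add)
    thus ?thesis using is_idealD(3)[OF J] ab by blast
  qed
  show "r * x \<in> \<tau> ` J" if "r \<in> O\<^sub>k" "x \<in> \<tau> ` J" for r x
  proof -
    obtain a where a: "a \<in> J" "x = \<tau> a" using \<open>x \<in> \<tau> ` J\<close> by blast
    have r: "r \<in> k" "\<tau> r \<in> O\<^sub>k" "\<tau> r \<in> k" using \<open>r \<in> O\<^sub>k\<close> tau_OK tau_mem by (auto dest: OK_D)
    have "r * x = \<tau> (\<tau> r * a)" using r a JO by (simp add: tau_mult tau_tau)
    thus ?thesis using is_idealD(4)[OF J r(2) a(1)] by blast
  qed
qed

lemma tau_image_image: "J \<subseteq> k \<Longrightarrow> \<tau> ` \<tau> ` J = J"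
  using tau_tau by (force simp: image_image)

lemma ideal_mult_tau_subset:
  assumes "is_ideal k I" "is_ideal k J"
  shows "ideal_mult k (\<tau> ` I) (\<tau> ` J) \<subseteq> \<tau> ` ideal_mult k I J"
proof (rule ideal_mult_least)
  show "is_ideal k (\<tau> ` ideal_mult k I J)" by (intro is_ideal_tau is_ideal_mult k_field assms)
  fix x y assume "x \<in> \<tau> ` I" "y \<in> \<tau> ` J"
  then obtain a b where ab: "a \<in> I" "b \<in> J" "x = \<tau> a" "y = \<tau> b" by blast
  have "a \<in> k" "b \<in> k" using ab is_idealD(1)[OF assms(1)] is_idealD(1)[OF assms(2)] OK_D(1) by blast+
  hence "x * y = \<tau> (a * b)" using ab by (simp add: tau_mult)
  thus "x * y \<in> \<tau> ` ideal_mult k I J" using ideal_mult_memI[OF ab(1,2)] by blast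
qed

lemma ideal_subset_k: "is_ideal k I \<Longrightarrow> I \<subseteq> k"
  by (meson OK_D(1) is_idealD(1) subsetI)

lemma ideal_mult_tau:
  assumes "is_ideal k I" "is_ideal k J"
  shows "ideal_mult k (\<tau> ` I) (\<tau> ` J) = \<tau> ` ideal_mult k I J"
proof
  show "ideal_mult k (\<tau> ` I) (\<tau> ` J) \<subseteq> \<tau> ` ideal_mult k I J" by (rule ideal_mult_tau_subset[OF assms])
  have "ideal_mult k (\<tau> ` \<tau> ` I) (\<tau> ` \<tau> ` J) \<subseteq> \<tau> ` ideal_mult k (\<tau> ` I) (\<tau> ` J)"
    by (intro ideal_mult_tau_subset is_ideal_tau assms)
  hence "ideal_mult k I J \<subseteq> \<tau> ` ideal_mult k (\<tau> ` I) (\<tau> ` J)"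
    using assms by (simp add: tau_image_image ideal_subset_k)
  hence "\<tau> ` ideal_mult k I J \<subseteq> \<tau> ` \<tau> ` ideal_mult k (\<tau> ` I) (\<tau> ` J)" by (rule image_mono)
  thus "\<tau> ` ideal_mult k I J \<subseteq> ideal_mult k (\<tau> ` I) (\<tau> ` J)"
    using assms k_field by (simp add: tau_image_image ideal_subset_k is_ideal_mult is_ideal_tau)
qed

text \<open>For \<open>n\<close> generating \<open>J \<tau>(J) \<inter> \<int>[\<i>]\<close> and \<open>a, b \<in> J\<close>, the quotient \<open>a \<tau>(b) / n\<close> has trace and
  norm in \<open>\<int>[\<i>]\<close>.\<close>
lemma ideal_norm_principal:
  assumes J: "nz_ideal k J"
  obtains n where "n \<in> ZI" "n \<noteq> 0" "ideal_mult k J (\<tau> ` J) = (*) n ` O\<^sub>k"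
proof -
  let ?M = "ideal_mult k J (\<tau> ` J)"
  have JI: "is_ideal k J" using J by (rule nz_ideal_ideal)
  have M: "is_ideal k ?M" by (intro is_ideal_mult is_ideal_tau k_field JI)
  have JO: "x \<in> O\<^sub>k" "x \<in> k" if "x \<in> J" for x using is_idealD(1)[OF JI that] by (auto dest: OK_D)
  obtain n where n: "n \<in> ?M \<inter> ZI" "\<And>x. x \<in> ?M \<inter> ZI \<Longrightarrow> n gdvd x"
    by (rule ZI_PID[of "?M \<inter> ZI"]) (use is_idealD[OF M] ZI_k in auto)
  have norm: "a * \<tau> a \<in> ?M \<inter> ZI" if "a \<in> J" for a
    using that JO trace_norm_ZI by (auto intro: ideal_mult_memI)
  obtain a0 where a0: "a0 \<in> J" "a0 \<noteq> 0" using nz_ideal_mem[OF J] by blast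
  hence "a0 * \<tau> a0 \<noteq> 0" using tau_eq_0 JO by simp
  hence n0: "n \<noteq> 0" using n(2)[OF norm[OF a0(1)]] by (auto simp: gdvd_def)
  have "?M \<subseteq> (*) n ` O\<^sub>k"
  proof (rule ideal_mult_least)
    show "is_ideal k ((*) n ` O\<^sub>k)" using n by (intro is_ideal_smul is_ideal_OK k_field ZI_k) auto
    fix a b' assume a: "a \<in> J" and "b' \<in> \<tau> ` J"
    then obtain b where b: "b \<in> J" "b' = \<tau> b" by blast
    have ab: "a * \<tau> b \<in> k" "a \<in> k" "b \<in> k" "\<tau> b \<in> k" "\<tau> a \<in> k" "n \<in> k"
      using JO a b tau_mem n is_subfieldD(5)[OF k_field] OK_D(1)[OF ZI_k] by auto
    have tconj: "\<tau> (a * \<tau> b) = b * \<tau> a" using ab by (simp add: tau_mult tau_tau mult.commute)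
    have "a * \<tau> b + b * \<tau> a \<in> ?M"
      using a b by (intro is_idealD(3)[OF M] ideal_mult_memI) auto
    moreover have "a * \<tau> b + b * \<tau> a \<in> ZI"
      using trace_norm_ZI(1)[of "a * \<tau> b"] tconj JO a b tau_OK OK_mult[OF k_field] by simp
    ultimately obtain t where t: "t \<in> ZI" "a * \<tau> b + b * \<tau> a = n * t" using n(2) by (auto simp: gdvd_def)
    obtain na where na: "na \<in> ZI" "a * \<tau> a = n * na" using n(2)[OF norm[OF a]] by (auto simp: gdvd_def)
    obtain nb where nb: "nb \<in> ZI" "b * \<tau> b = n * nb" using n(2)[OF norm[OF b(1)]] by (auto simp: gdvd_def)
    define \<theta> where "\<theta> = a * \<tau> b / n"
    have \<theta>k: "\<theta> \<in> k" unfolding \<theta>_def using ab by (intro is_subfieldD(8)[OF k_field])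
    have n\<theta>: "n * \<theta> = a * \<tau> b" using n0 by (simp add: \<theta>_def)
    have "\<tau> (n * \<theta>) = n * \<tau> \<theta>" using ab \<theta>k n by (simp add: tau_mult tau_ZI)
    hence nt: "n * \<tau> \<theta> = b * \<tau> a" using n\<theta> tconj by simp
    have "n * (\<theta> + \<tau> \<theta>) = n * t" using n\<theta> nt t by (simp add: algebra_simps)
    hence "\<theta> + \<tau> \<theta> = t" using n0 by simp
    moreover have "(n * \<theta>) * (n * \<tau> \<theta>) = (a * \<tau> a) * (b * \<tau> b)" unfolding n\<theta> nt by (simp only: mult_ac)
    hence "n * (n * (\<theta> * \<tau> \<theta>)) = n * (n * (na * nb))" unfolding na nb by (simp only: mult_ac)
    hence "\<theta> * \<tau> \<theta> = na * nb" using n0 by simp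
    ultimately have "\<theta> \<in> O\<^sub>k" using t na nb \<theta>k by (intro O_k_integral) auto
    thus "a * b' \<in> (*) n ` O\<^sub>k" using n\<theta> b by (metis image_eqI)
  qed
  moreover have "(*) n ` O\<^sub>k \<subseteq> ?M" using n is_idealD(5)[OF M] by auto
  ultimately show ?thesis using that n n0 by blast
qed

end

section \<open>Classes of order two\<close>

lemma gred_square_plus:
  assumes "P dvd r\<^sup>2 + 1" "x \<in> ZI" "v \<in> ZI"
  shows "[gred r (x\<^sup>2 + of_int P * v) = (gred r x)\<^sup>2] (mod P)"
proof -
  have "gred r (x\<^sup>2 + of_int P * v) = gred r (x\<^sup>2) + gred r (of_int P * v)"
    using assms by (intro gred_add) auto
  moreover have "[gred r (of_int P * v) = gred r (of_int P) * gred r v] (mod P)"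
    using assms by (intro gred_mult) auto
  hence "P dvd gred r (of_int P * v)" by (subst cong_dvd_iff) auto
  hence "[gred r (of_int P * v) = 0] (mod P)" by (simp add: cong_0_iff)
  ultimately show ?thesis using cong_add[OF gred_power[OF assms(1,2), of 2]] by fastforce
qed

lemma gred_unit_mult:
  assumes "P dvd r\<^sup>2 + 1" "z \<in> ZI"
  shows "[gred r (\<i> ^ j * z) = r ^ j * gred r z] (mod P)"
proof -
  have "[gred r (\<i> ^ j * z) = gred r (\<i> ^ j) * gred r z] (mod P)" using assms by (intro gred_mult) auto
  moreover have "[gred r (\<i> ^ j) * gred r z = r ^ j * gred r z] (mod P)"
    using gred_power[OF assms(1), of \<i> j] by (intro cong_mult cong_refl) auto
  ultimately show ?thesis using cong_trans by blast
qed

lemma not_dvd_sqrt_minus_one: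
  assumes "prime (P :: int)" "P dvd r\<^sup>2 + 1" shows "\<not> P dvd r"
proof
  assume "P dvd r"
  hence "P dvd r\<^sup>2" by (simp add: power2_eq_square)
  hence "P dvd 1" using assms(2) by (simp add: dvd_add_right_iff)
  thus False using assms(1) by auto
qed

text \<open>If \<open>z\<close> did not vanish modulo \<open>P\<close>, an odd power of
  \<open>r\<close> would be a square there, hence \<open>r\<close> itself, and then 2 as
  well.\<close>

lemma unit_times_square_mod:
  assumes P: "prime (P :: int)" "P dvd r\<^sup>2 + 1" "\<not> QuadRes P 2" and "odd j"
    and Z: "x \<in> ZI" "v \<in> ZI" "z \<in> ZI" and eq: "x\<^sup>2 + of_int P * v = \<i> ^ j * z\<^sup>2"
  shows "P dvd gred r z" "P dvd gred r x"
proof -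
  have "[gred r (x\<^sup>2 + of_int P * v) = (gred r x)\<^sup>2] (mod P)" by (rule gred_square_plus[OF P(2) Z(1,2)])
  moreover have "[gred r (\<i> ^ j * z\<^sup>2) = r ^ j * gred r (z\<^sup>2)] (mod P)" using Z by (intro gred_unit_mult P) auto
  moreover have "[r ^ j * gred r (z\<^sup>2) = r ^ j * (gred r z)\<^sup>2] (mod P)"
    by (intro cong_mult cong_refl gred_power P Z)
  ultimately have c: "[(gred r x)\<^sup>2 = r ^ j * (gred r z)\<^sup>2] (mod P)"
    unfolding eq using cong_trans cong_sym by blast
  show z: "P dvd gred r z"
  proof (rule ccontr)
    assume nz: "\<not> P dvd gred r z"
    have "QuadRes P (r ^ j * (gred r z)\<^sup>2)" using c by (auto simp: QuadRes_def)
    hence "QuadRes P (r ^ j)" using QuadRes_cancel_square[OF P(1)] nz by blast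
    moreover obtain m where "j = 2 * m + 1" using \<open>odd j\<close> by (elim oddE)
    hence "r ^ j = r * (r ^ m)\<^sup>2" by (simp add: power_mult mult.commute)
    ultimately have "QuadRes P (r * (r ^ m)\<^sup>2)" by simp
    moreover have "\<not> P dvd r ^ m"
      using not_dvd_sqrt_minus_one[OF P(1,2)] prime_dvd_power[OF P(1)] by blast
    ultimately have "QuadRes P r" using QuadRes_cancel_square[OF P(1)] by blast
    thus False using QuadRes_2_if_fourth_root[OF P(2)] P(3) by blast
  qed
  hence "P dvd r ^ j * (gred r z)\<^sup>2" by (simp add: power2_eq_square)
  hence "P dvd (gred r x)\<^sup>2" using c cong_dvd_iff by blast
  thus "P dvd gred r x" using P(1) prime_dvd_power by blast
qed

lemma unit_if_inverse_in_ZI: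
  assumes "u \<in> ZI" "v \<in> ZI" "u * v = 1"
  obtains j :: nat where "u = \<i> ^ j"
proof -
  have "gnorm u * gnorm v = 1" using gnorm_mult[OF assms(1,2)] assms(3) by simp
  hence "gnorm u = 1" using gnorm_nonneg[of u] gnorm_nonneg[of v] by (metis abs_of_nonneg zmult_eq_1_iff abs_1 abs_minus_cancel)
  thus ?thesis using gnorm_1_iff[OF assms(1)] that by blast
qed

lemma ideal_mult_swap:
  assumes F: "is_subfield F" and "is_ideal F A" "is_ideal F B" "is_ideal F C" "is_ideal F D"
  shows "ideal_mult F (ideal_mult F A B) (ideal_mult F C D) = ideal_mult F (ideal_mult F A C) (ideal_mult F B D)"
proof -
  have "ideal_mult F (ideal_mult F A B) (ideal_mult F C D) = ideal_mult F A (ideal_mult F (ideal_mult F B C) D)"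
    using assms by (simp add: ideal_mult_assoc is_ideal_mult)
  also have "ideal_mult F B C = ideal_mult F C B" by (rule ideal_mult_commute)
  also have "ideal_mult F A (ideal_mult F (ideal_mult F C B) D) = ideal_mult F (ideal_mult F A C) (ideal_mult F B D)"
    using assms by (simp add: ideal_mult_assoc is_ideal_mult)
  finally show ?thesis .
qed

lemma principal_mult_principal:
  assumes "is_subfield F" "a \<in> OK F" "b \<in> OK F"
  shows "ideal_mult F ((*) a ` OK F) ((*) b ` OK F) = (*) (a * b) ` OK F"
  using assms by (simp add: principal_mult is_ideal_smul is_ideal_OK smul_smul)

lemma smul_OK_eqD:
  assumes "is_subfield F" "(*) a ` OK F = (*) b ` OK F" "a \<noteq> 0"
  obtains u v where "u \<in> OK F" "v \<in> OK F" "u * v = 1" "a = b * u"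
proof -
  have "a \<in> (*) a ` OK F" "b \<in> (*) b ` OK F" using OK_1[OF assms(1)] by (auto intro!: image_eqI[of _ _ 1])
  then obtain u v where uv: "u \<in> OK F" "v \<in> OK F" "a = b * u" "b = a * v" using assms(2) by blast
  have "a * (u * v) = a * 1" using uv by (metis mult.assoc mult.commute mult_1_right)
  hence "u * v = 1" using assms(3) by simp
  thus ?thesis using that uv by blast
qed

context prime_pair
begin

text \<open>Infinite descent on the norm of \<open>z\<close>. At both primes above \<open>p\<close>
  the unit is a non-square, so \<open>p\<close> divides \<open>x\<close> and \<open>z\<close>;
  cancelling one \<open>p\<close> shows that it divides \<open>y\<close>, and then
  \<open>p^2\<close> cancels from the equation.\<close>

lemma unit_norm_even_aux:
  assumes nr: "\<not> QuadRes (int p) 2" and "odd j"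
  shows "x \<in> ZI \<Longrightarrow> y \<in> ZI \<Longrightarrow> z \<in> ZI \<Longrightarrow> z \<noteq> 0 \<Longrightarrow>
    x\<^sup>2 + \<i> * of_nat (p * q) * y\<^sup>2 = \<i> ^ j * z\<^sup>2 \<Longrightarrow> False"
proof (induction "nat (gnorm z)" arbitrary: x y z rule: less_induct)
  case less
  obtain r where r: "int p dvd r\<^sup>2 + 1" using sqrt_minus_one_mod_prime primes by blast
  hence r': "int p dvd (-r)\<^sup>2 + 1" by simp
  have p2: "int p > 2" using gt2 by simp
  have p0: "complex_of_nat p \<noteq> 0" "complex_of_nat q \<noteq> 0" using gt2 by auto
  define v where "v = \<i> * of_nat q * y\<^sup>2"
  have v: "v \<in> ZI" using less.prems by (auto simp: v_def)
  have eq: "x\<^sup>2 + of_int (int p) * v = \<i> ^ j * z\<^sup>2" using less.prems(5) by (simp add: v_def mult_ac)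
  note d = unit_times_square_mod[OF prime_int(1) r nr \<open>odd j\<close> less.prems(1) v less.prems(3) eq]
    unit_times_square_mod[OF prime_int(1) r' nr \<open>odd j\<close> less.prems(1) v less.prems(3) eq]
  have "of_int (int p) gdvd z"
    by (rule gdvd_of_int_if_gred[OF prime_int(1) p2 r less.prems(3) d(1,3)])
  moreover have "of_int (int p) gdvd x"
    by (rule gdvd_of_int_if_gred[OF prime_int(1) p2 r less.prems(1) d(2,4)])
  ultimately
  obtain x' z' where x': "x' \<in> ZI" "x = of_nat p * x'" and z': "z' \<in> ZI" "z = of_nat p * z'"
    by (auto simp: gdvd_def)
  have "of_nat p * (of_nat p * x'\<^sup>2 + v) = of_nat p * (of_nat p * (\<i> ^ j * z'\<^sup>2))"
    using eq by (simp add: x' z' power2_eq_square algebra_simps)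
  hence "of_nat p * x'\<^sup>2 + v = of_nat p * (\<i> ^ j * z'\<^sup>2)" using p0 by (simp only: mult_cancel_left) simp
  hence "v = of_nat p * (\<i> ^ j * z'\<^sup>2 - x'\<^sup>2)" by (simp add: algebra_simps)
  hence "of_nat p gdvd v" using x' z' by (intro gdvdI[of "\<i> ^ j * z'\<^sup>2 - x'\<^sup>2"]) auto
  hence "of_nat p gdvd (- \<i>) * v" by (rule gdvd_mult2) auto
  moreover have "(- \<i>) * v = of_nat q * y\<^sup>2" by (simp only: v_def mult.assoc[symmetric]) simp
  ultimately have qy: "of_int (int p) gdvd of_nat q * y\<^sup>2" by simp
  have dy: "int p dvd gred \<rho> y" if \<rho>: "int p dvd \<rho>\<^sup>2 + 1" for \<rho>
  proof -
    have "int p dvd gred \<rho> (of_nat q * y\<^sup>2)" by (rule gred_gdvd[OF \<rho> qy]) auto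
    moreover have "[gred \<rho> (of_nat q * y\<^sup>2) = gred \<rho> (of_nat q) * gred \<rho> (y\<^sup>2)] (mod int p)"
      using less.prems by (intro gred_mult[OF \<rho>]) auto
    moreover have "[gred \<rho> (of_nat q) * gred \<rho> (y\<^sup>2) = int q * (gred \<rho> y)\<^sup>2] (mod int p)"
      using gred_power[OF \<rho> less.prems(2), of 2] by (intro cong_mult) auto
    ultimately have "int p dvd int q * (gred \<rho> y)\<^sup>2" using cong_dvd_iff cong_trans by blast
    thus ?thesis using prime_int(1) not_dvd prime_dvd_multD prime_dvd_power by blast
  qed
  have "of_int (int p) gdvd y"
    by (rule gdvd_of_int_if_gred[OF prime_int(1) p2 r less.prems(2) dy[OF r] dy[OF r']])
  then obtain y' where y': "y' \<in> ZI" "y = of_nat p * y'" by (auto simp: gdvd_def)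
  have "(of_nat p)\<^sup>2 * (x'\<^sup>2 + \<i> * of_nat (p * q) * y'\<^sup>2) = (of_nat p)\<^sup>2 * (\<i> ^ j * z'\<^sup>2)"
    using less.prems(5) by (simp add: x' y' z' power_mult_distrib algebra_simps)
  hence "x'\<^sup>2 + \<i> * of_nat (p * q) * y'\<^sup>2 = \<i> ^ j * z'\<^sup>2" using p0 by (simp only: mult_cancel_left) simp
  moreover have z0: "z' \<noteq> 0" using z' less.prems by auto
  moreover have "nat (gnorm z') < nat (gnorm z)"
  proof -
    have "gnorm z = gnorm (of_int (int p)) * gnorm z'" using gnorm_mult[of "of_int (int p)" z'] z' by simp
    hence "gnorm z = int p ^ 2 * gnorm z'" unfolding gnorm_of_int .
    moreover have "gnorm z' > 0" using z0 gnorm_eq_0_iff[OF z'(1)] gnorm_nonneg[of z'] by simp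
    moreover have "1 < int p ^ 2" using p2 by (simp add: power2_eq_square less_1_mult)
    ultimately have "gnorm z' < gnorm z" using mult_strict_right_mono[of 1 "int p ^ 2" "gnorm z'"] by simp
    thus ?thesis using \<open>gnorm z' > 0\<close> by simp
  qed
  ultimately show False using less.hyps x' y' z' by blast
qed

text \<open>By \<open>nonres\<close>, 2 is a non-residue modulo \<open>p\<close> or modulo
  \<open>q\<close>, and the form is symmetric in the two.\<close>

lemma unit_norm_even:
  assumes Z: "x \<in> ZI" "y \<in> ZI" "z \<in> ZI" "z \<noteq> 0"
    and eq: "x\<^sup>2 + \<i> * of_nat (p * q) * y\<^sup>2 = \<i> ^ j * z\<^sup>2"
  shows "even j"
proof (rule ccontr)
  assume j: "odd j"
  interpret other: prime_pair q p using prime_pair_axioms by (rule prime_pair_sym)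
  have "x\<^sup>2 + \<i> * of_nat (q * p) * y\<^sup>2 = \<i> ^ j * z\<^sup>2" using eq by (simp only: mult.commute[of q])
  thus False using unit_norm_even_aux[OF _ j Z eq] other.unit_norm_even_aux[OF _ j Z] nonres(3) by blast
qed

lemma tau_eq: "x \<in> ZI \<Longrightarrow> y \<in> ZI \<Longrightarrow> \<tau> (x + y * w) = x - y * w"
  by (intro base.conj_eq ZI_QI)

lemma norm_eq: "x \<in> ZI \<Longrightarrow> y \<in> ZI \<Longrightarrow> (x + y * w) * \<tau> (x + y * w) = x\<^sup>2 + \<i> * of_nat (p * q) * y\<^sup>2"
proof -
  assume "x \<in> ZI" "y \<in> ZI"
  hence "\<tau> (x + y * w) = x - y * w" by (rule tau_eq)
  hence "(x + y * w) * \<tau> (x + y * w) = (x + y * w) * (x - y * w)" by simp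
  also have "\<dots> = x\<^sup>2 - w\<^sup>2 * y\<^sup>2" by (simp add: algebra_simps power2_eq_square)
  finally have "(x + y * w) * \<tau> (x + y * w) = x\<^sup>2 - w\<^sup>2 * y\<^sup>2" .
  thus ?thesis unfolding w_sq by (simp add: algebra_simps)
qed

text \<open>Hilbert 90: if \<open>N(\<gamma>) = n\<^sup>2\<close> then \<open>\<delta> = \<gamma> + n\<close> satisfies \<open>\<delta>\<^sup>2 = \<gamma> (Tr(\<gamma>) + 2n)\<close>, so \<open>\<delta> \<tau>(J)\<close>
  has its square generated by a Gaussian integer.\<close>
lemma order_two_class_representative:
  assumes J: "nz_ideal k J" and sq: "ideal_mult k J J = (*) \<gamma> ` O\<^sub>k" and \<gamma>: "\<gamma> \<in> O\<^sub>k" "\<gamma> \<noteq> 0"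
  obtains A t where "nz_ideal k A" "t \<in> ZI" "t \<noteq> 0" "ideal_mult k A A = (*) t ` O\<^sub>k" "ideal_equiv k A J"
proof -
  have JI: "is_ideal k J" using J by (rule nz_ideal_ideal)
  let ?L = "\<tau> ` J"
  have L: "is_ideal k ?L" by (rule is_ideal_tau[OF JI])
  obtain n where n: "n \<in> ZI" "n \<noteq> 0" "ideal_mult k J ?L = (*) n ` O\<^sub>k"
    using ideal_norm_principal[OF J] .
  have LL: "ideal_mult k ?L ?L = (*) (\<tau> g) ` O\<^sub>k" if g: "g \<in> O\<^sub>k" "ideal_mult k J J = (*) g ` O\<^sub>k" for g
  proof -
    have "ideal_mult k ?L ?L = \<tau> ` (*) g ` O\<^sub>k" unfolding ideal_mult_tau[OF JI JI] g(2) ..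
    also have "\<dots> = (*) (\<tau> g) ` \<tau> ` O\<^sub>k"
      unfolding image_image using g(1) by (intro image_cong) (auto simp: tau_mult OK_D)
    also have "\<tau> ` O\<^sub>k = O\<^sub>k"
    proof
      show "\<tau> ` O\<^sub>k \<subseteq> O\<^sub>k" using tau_OK by blast
      hence "\<tau> ` \<tau> ` O\<^sub>k \<subseteq> \<tau> ` O\<^sub>k" by (rule image_mono)
      thus "O\<^sub>k \<subseteq> \<tau> ` O\<^sub>k" by (simp add: tau_image_image ideal_subset_k is_ideal_OK k_field)
    qed
    finally show ?thesis .
  qed
  have nO: "n \<in> O\<^sub>k" by (rule ZI_k[OF n(1)])
  have "(*) (\<gamma> * \<tau> \<gamma>) ` O\<^sub>k = ideal_mult k (ideal_mult k J J) (ideal_mult k ?L ?L)"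
    unfolding LL[OF \<gamma>(1) sq] sq using \<gamma> tau_OK by (simp add: principal_mult_principal k_field)
  also have "\<dots> = ideal_mult k (ideal_mult k J ?L) (ideal_mult k J ?L)"
    by (intro ideal_mult_swap k_field JI L)
  also have "\<dots> = (*) (n * n) ` O\<^sub>k" unfolding n(3) using nO by (simp add: principal_mult_principal k_field)
  finally have eqN: "(*) (\<gamma> * \<tau> \<gamma>) ` O\<^sub>k = (*) (n * n) ` O\<^sub>k" .
  have NZ: "\<gamma> * \<tau> \<gamma> \<in> ZI" by (rule trace_norm_ZI[OF \<gamma>(1)])
  have "\<gamma> * \<tau> \<gamma> \<noteq> 0" using \<gamma> tau_eq_0 by (simp add: OK_D)
  then obtain u v where uv: "u \<in> O\<^sub>k" "v \<in> O\<^sub>k" "u * v = 1" "\<gamma> * \<tau> \<gamma> = n * n * u"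
    by (rule smul_OK_eqD[OF k_field eqN])
  \<comment> \<open>The unit is a quotient of Gaussian integers, so it lies in \<open>QI\<close>.
    The same holds for its inverse, which makes it a power of \<open>\<i>\<close>.\<close>
  have "u = (\<gamma> * \<tau> \<gamma>) / (n * n)" using uv n by simp
  moreover have "(\<gamma> * \<tau> \<gamma>) / (n * n) \<in> QI"
    by (intro is_subfieldD(5,8)[OF is_subfield_QI] ZI_QI[OF NZ] ZI_QI[OF n(1)])
  ultimately have uQ: "u \<in> QI" by simp
  have "v = inverse u" using uv(3) inverse_unique by metis
  hence "v \<in> QI" using is_subfieldD(6)[OF is_subfield_QI uQ] by simp
  hence "u \<in> ZI" "v \<in> ZI" using uQ uv O_k_QI by auto
  then obtain j where j: "u = \<i> ^ j" using uv(3) unit_if_inverse_in_ZI by metis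
  obtain x y where xy: "x \<in> ZI" "y \<in> ZI" "\<gamma> = x + y * w" using \<gamma>(1) by (rule O_kE)
  have "x\<^sup>2 + \<i> * of_nat (p * q) * y\<^sup>2 = \<i> ^ j * n\<^sup>2"
    using norm_eq[OF xy(1,2)] uv(4) xy(3) j by (simp add: power2_eq_square mult.commute)
  hence "even j" by (rule unit_norm_even[OF xy(1,2) n(1,2)])
  then obtain m where m: "j = 2 * m" by (elim evenE)
  have uu: "u = 1 \<or> u = -1" using j m by (cases "even m") (auto simp: power_mult)
  \<comment> \<open>Only the sign of the norm is left to adjust: replacing \<open>\<gamma>\<close>
    by \<open>\<i> * \<gamma>\<close> keeps the ideal and multiplies the norm by
    \<open>-1\<close>.\<close>
  obtain g where g: "g \<in> O\<^sub>k" "g \<noteq> 0" "ideal_mult k J J = (*) g ` O\<^sub>k" "g * \<tau> g = n * n"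
  proof (cases "u = 1")
    case True
    thus ?thesis using that[of \<gamma>] \<gamma> sq uv by simp
  next
    case False
    hence u1: "u = -1" using uu by simp
    have iO: "\<i> \<in> O\<^sub>k" by (rule ZI_k) auto
    have "\<tau> (\<i> * \<gamma>) = \<i> * \<tau> \<gamma>" using iO \<gamma> by (simp add: tau_mult OK_D tau_ZI)
    hence "(\<i> * \<gamma>) * \<tau> (\<i> * \<gamma>) = (\<i> * \<i>) * (\<gamma> * \<tau> \<gamma>)" by (simp only: mult_ac)
    also have "\<dots> = n * n" unfolding uv(4) u1 by simp
    finally have "(\<i> * \<gamma>) * \<tau> (\<i> * \<gamma>) = n * n" .
    moreover have "(*) (\<i> * \<gamma>) ` O\<^sub>k = (*) \<gamma> ` (*) \<i> ` O\<^sub>k" by (simp only: smul_smul mult.commute[of \<i>])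
    moreover have "(*) \<i> ` O\<^sub>k = O\<^sub>k"
    proof (intro equalityI subsetI)
      show "x \<in> O\<^sub>k" if "x \<in> (*) \<i> ` O\<^sub>k" for x using that iO by (auto intro: OK_mult[OF k_field])
      show "x \<in> (*) \<i> ` O\<^sub>k" if "x \<in> O\<^sub>k" for x
      proof (rule image_eqI)
        show "x = \<i> * (- \<i> * x)" by simp
        show "- \<i> * x \<in> O\<^sub>k" by (rule OK_mult[OF k_field OK_uminus[OF k_field iO] that])
      qed
    qed
    ultimately show ?thesis using that[of "\<i> * \<gamma>"] \<gamma> sq OK_mult[OF k_field iO] by simp
  qed
  show ?thesis
  proof (cases "g + n = 0")
    \<comment> \<open>Hilbert 90 degenerates here, but then \<open>g = - n\<close> is itself a
      Gaussian integer and \<open>J\<close> serves as its own representative.\<close>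
    case True
    hence gn: "g = - n" by (simp add: eq_neg_iff_add_eq_0)
    show ?thesis by (rule that[of J g]) (use gn g n J ideal_equiv_refl[OF k_field] in auto)
  next
    case False
    define \<delta> where "\<delta> = g + n"
    define t where "t = (g + \<tau> g) + 2 * n"
    have \<delta>O: "\<delta> \<in> O\<^sub>k" unfolding \<delta>_def by (intro OK_add k_field g nO)
    have \<delta>0: "\<delta> \<noteq> 0" using False by (simp add: \<delta>_def)
    have tZ: "t \<in> ZI" unfolding t_def using trace_norm_ZI(1)[OF g(1)] n by auto
    have \<delta>2: "\<delta> * \<delta> = g * t"
    proof -
      have "\<delta> * \<delta> = g * g + 2 * n * g + n * n" by (simp add: \<delta>_def algebra_simps)
      thus ?thesis unfolding g(4)[symmetric] by (simp add: t_def algebra_simps)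
    qed
    hence t0: "t \<noteq> 0" using \<delta>0 by auto
    let ?A = "(*) \<delta> ` ?L"
    have A: "is_ideal k ?A" by (rule is_ideal_smul[OF k_field L \<delta>O])
    have "ideal_mult k ?A ?A = (*) (\<delta> * \<delta>) ` ideal_mult k ?L ?L"
      using \<delta>O L A by (simp add: ideal_mult_smul ideal_mult_smul_right k_field smul_smul)
    also have "\<dots> = (*) (n * n * t) ` O\<^sub>k"
    proof -
      have "\<delta> * \<delta> * \<tau> g = n * n * t" unfolding \<delta>2 g(4)[symmetric] by (simp only: mult_ac)
      thus ?thesis unfolding LL[OF g(1,3)] smul_smul by simp
    qed
    finally have AA: "ideal_mult k ?A ?A = (*) (n * n * t) ` O\<^sub>k" .
    have L_nz: "nz_ideal k ?L"
    proof -
      obtain x where "x \<in> J" "x \<noteq> 0" using nz_ideal_mem[OF J] by blast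
      hence "\<tau> x \<in> ?L" "\<tau> x \<noteq> 0" using tau_eq_0 ideal_subset_k[OF JI] by auto
      thus ?thesis using L unfolding nz_ideal_def by blast
    qed
    \<comment> \<open>The conjugate ideal has the class of \<open>J\<close>: multiplying it by the
      principal ideal \<open>J^2\<close> gives \<open>(J \<tau>(J)) J = n J\<close>.\<close>
    have "ideal_equiv k ?L (ideal_mult k ?L (ideal_mult k J J))"
      unfolding g(3) using ideal_mult_smul_right[OF k_field L is_ideal_OK[OF k_field] g(1)]
      by (simp add: ideal_mult_OK[OF k_field L] ideal_equiv_sym[OF ideal_equiv_smul[OF k_field g(1,2)]])
    also have "ideal_mult k ?L (ideal_mult k J J) = ideal_mult k (ideal_mult k J ?L) J"
      unfolding ideal_mult_assoc[OF k_field L JI JI, symmetric] ideal_mult_commute[of k ?L J] ..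
    also have "\<dots> = (*) n ` J" unfolding n(3) by (rule principal_mult[OF k_field JI nO])
    finally have "ideal_equiv k ?L J"
      using ideal_equiv_smul[OF k_field nO n(2)] ideal_equiv_trans[OF k_field] by blast
    hence "ideal_equiv k ?A J"
      using ideal_equiv_smul[OF k_field \<delta>O \<delta>0] ideal_equiv_trans[OF k_field] by blast
    thus ?thesis using that[of ?A "n * n * t"] AA n tZ t0 nz_ideal_smul[OF k_field L_nz \<delta>O \<delta>0] by auto
  qed
qed

text \<open>\<open>H\<close> is the prime ideal above a Gaussian prime \<open>c\<close> that ramifies in \<open>k\<close>.\<close>
definition ram :: "complex \<Rightarrow> complex set \<Rightarrow> bool" where
  "ram c H \<longleftrightarrow> is_ideal k H \<and> c \<in> ZI \<and> c \<noteq> 0 \<and> ideal_mult k H H = (*) c ` O\<^sub>k \<and>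
     (\<forall>x\<in>O\<^sub>k. x * x \<in> (*) c ` O\<^sub>k \<longrightarrow> x \<in> H)"

lemma ramD:
  assumes "ram c H"
  shows "is_ideal k H" "c \<in> ZI" "c \<noteq> 0" "ideal_mult k H H = (*) c ` O\<^sub>k"
    "x \<in> O\<^sub>k \<Longrightarrow> x * x \<in> (*) c ` O\<^sub>k \<Longrightarrow> x \<in> H" "c \<in> O\<^sub>k"
  using assms by (auto simp: ram_def ZI_k)

lemma ram_nz: assumes "ram c H" shows "nz_ideal k H"
proof -
  have "c \<in> H" using ramD[OF assms] OK_mult[OF k_field] by auto
  thus ?thesis using ramD[OF assms] by (auto simp: nz_ideal_def)
qed

lemma ideal_square_mem: "x \<in> A \<Longrightarrow> ideal_mult k A A = (*) c ` O\<^sub>k \<Longrightarrow> x * x \<in> (*) c ` O\<^sub>k"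
  using ideal_mult_memI by blast

lemma smul_mult_subset:
  assumes "a \<in> ZI" "b \<in> ZI" shows "(*) (a * b) ` O\<^sub>k \<subseteq> (*) a ` O\<^sub>k"
  using assms by (auto simp: mult.assoc intro!: imageI OK_mult[OF k_field ZI_k])

text \<open>If \<open>A\<^sup>2 = (c t)\<close> with \<open>c\<close> ramified then \<open>A \<subseteq> H\<close>, and \<open>A' = A H / c\<close> works.\<close>
lemma ram_divide:
  assumes H: "ram c H" and A: "nz_ideal k A" and t: "t \<in> ZI" "ideal_mult k A A = (*) (c * t) ` O\<^sub>k"
  obtains A' where "nz_ideal k A'" "ideal_mult k A' A' = (*) t ` O\<^sub>k" "A = ideal_mult k A' H"
proof -
  note Hd = ramD[OF H]
  have AI: "is_ideal k A" using A by (rule nz_ideal_ideal)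
  have AH: "A \<subseteq> H"
  proof
    fix x assume x: "x \<in> A"
    have "x * x \<in> (*) (c * t) ` O\<^sub>k" by (rule ideal_square_mem[OF x t(2)])
    hence "x * x \<in> (*) c ` O\<^sub>k" using smul_mult_subset[OF Hd(2) t(1)] by blast
    thus "x \<in> H" using Hd(5) is_idealD(1)[OF AI x] by blast
  qed
  let ?B = "ideal_mult k A H"
  have BI: "is_ideal k ?B" by (intro is_ideal_mult k_field AI Hd)
  have "?B \<subseteq> ideal_mult k H H"
    by (rule ideal_mult_least[OF is_ideal_mult[OF k_field Hd(1) Hd(1)]]) (use AH in \<open>auto intro: ideal_mult_memI\<close>)
  hence "?B \<subseteq> (*) c ` O\<^sub>k" unfolding Hd(4) .
  hence div: "(1 / c) * x \<in> O\<^sub>k" if "x \<in> ?B" for x using that Hd(3) by auto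
  define A' where "A' = (*) (1 / c) ` ?B"
  have A'I: "is_ideal k A'" unfolding A'_def by (rule is_ideal_dilate[OF k_field BI div])
  have cA': "(*) c ` A' = ?B" unfolding A'_def smul_smul using Hd(3) by simp
  have cO: "c \<in> O\<^sub>k" "t \<in> O\<^sub>k" using Hd t ZI_k by auto
  have "(*) c ` (*) c ` ideal_mult k A' A' = ideal_mult k ((*) c ` A') ((*) c ` A')"
    using A'I cO is_ideal_smul[OF k_field A'I cO(1)]
    by (simp add: ideal_mult_smul ideal_mult_smul_right k_field)
  also have "\<dots> = ideal_mult k (ideal_mult k A A) (ideal_mult k H H)"
    unfolding cA' by (intro ideal_mult_swap k_field AI Hd)
  also have "\<dots> = (*) ((c * t) * c) ` O\<^sub>k" unfolding t(2) Hd(4)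
    by (intro principal_mult_principal k_field cO OK_mult[OF k_field])
  also have "\<dots> = (*) c ` (*) c ` (*) t ` O\<^sub>k" by (simp only: smul_smul mult_ac)
  finally have "(*) c ` (*) c ` ideal_mult k A' A' = (*) c ` (*) c ` (*) t ` O\<^sub>k" .
  hence sq: "ideal_mult k A' A' = (*) t ` O\<^sub>k" unfolding smul_cancel[OF Hd(3)] .
  have "(*) c ` ideal_mult k A' H = ideal_mult k ?B H"
    unfolding cA'[symmetric] by (intro ideal_mult_smul[symmetric] k_field A'I Hd)
  also have "\<dots> = ideal_mult k A (ideal_mult k H H)" by (intro ideal_mult_assoc k_field AI Hd)
  also have "\<dots> = (*) c ` A" unfolding Hd(4) using principal_mult[OF k_field AI cO(1)]
    by (simp add: ideal_mult_commute)
  finally have eq: "A = ideal_mult k A' H" using Hd(3) by (simp add: smul_cancel)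
  have "A' \<noteq> {0}"
  proof
    assume "A' = {0}"
    hence "?B = {0}" using cA' by simp
    moreover have "nz_ideal k ?B" by (rule nz_ideal_mult[OF k_field A ram_nz[OF H]])
    ultimately show False by (simp add: nz_ideal_def)
  qed
  thus ?thesis using that[of A'] A'I sq eq by (simp add: nz_ideal_def)
qed

text \<open>The counterpart of \<open>ram_divide\<close> when all of \<open>A\<close> is divisible
  by \<open>c\<close>: the square of \<open>A\<close> then contains \<open>c\<close> twice, so a
  second factor \<open>c\<close> comes out of \<open>t\<close>.\<close>

lemma dilate_divide:
  assumes c: "c \<in> ZI" "c \<noteq> 0" and A: "nz_ideal k A" and sub: "A \<subseteq> (*) c ` O\<^sub>k"
    and t: "t \<in> ZI" "ideal_mult k A A = (*) (c * t) ` O\<^sub>k"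
  obtains A' t' where "nz_ideal k A'" "A = (*) c ` A'" "t' \<in> ZI" "t = c * t'"
    "ideal_mult k A' A' = (*) t' ` O\<^sub>k"
proof -
  have AI: "is_ideal k A" using A by (rule nz_ideal_ideal)
  have div: "(1 / c) * x \<in> O\<^sub>k" if "x \<in> A" for x using that c sub by auto
  define A' where "A' = (*) (1 / c) ` A"
  have A'I: "is_ideal k A'" unfolding A'_def by (rule is_ideal_dilate[OF k_field AI div])
  have cA': "A = (*) c ` A'" unfolding A'_def smul_smul using c by simp
  have cO: "c \<in> O\<^sub>k" using c ZI_k by auto
  have "(*) c ` (*) c ` ideal_mult k A' A' = ideal_mult k ((*) c ` A') ((*) c ` A')"
    using A'I cO is_ideal_smul[OF k_field A'I cO]
    by (simp add: ideal_mult_smul ideal_mult_smul_right k_field)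
  also have "\<dots> = (*) c ` (*) t ` O\<^sub>k" using t(2) unfolding cA'[symmetric] by (simp add: smul_smul)
  finally have "(*) c ` (*) c ` ideal_mult k A' A' = (*) c ` (*) t ` O\<^sub>k" .
  hence sq: "(*) c ` ideal_mult k A' A' = (*) t ` O\<^sub>k" unfolding smul_cancel[OF c(2)] .
  have AA': "is_ideal k (ideal_mult k A' A')" by (intro is_ideal_mult k_field A'I)
  have "t \<in> (*) t ` O\<^sub>k" using OK_1[OF k_field] by (auto intro!: image_eqI[of _ _ 1])
  then obtain z where z: "z \<in> ideal_mult k A' A'" "t = c * z" unfolding sq[symmetric] by blast
  have "z = t / c" using z c by simp
  hence "z \<in> QI" using is_subfieldD(8)[OF is_subfield_QI] ZI_QI t c by simp
  moreover have "z \<in> O\<^sub>k" using z is_idealD(1)[OF AA'] by blast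
  ultimately have zZ: "z \<in> ZI" by (intro O_k_QI)
  have "(*) c ` ideal_mult k A' A' = (*) c ` (*) z ` O\<^sub>k" unfolding sq z(2) by (simp add: smul_smul)
  hence "ideal_mult k A' A' = (*) z ` O\<^sub>k" unfolding smul_cancel[OF c(2)] .
  moreover have "nz_ideal k A'" using A A'I cA' by (auto simp: nz_ideal_def)
  ultimately show ?thesis using that[of A' z] cA' zZ z by blast
qed

text \<open>At an unramified Gaussian prime \<open>c\<close> the ideal \<open>c O\<^sub>k\<close> is radical.\<close>
lemma unram_subset:
  assumes c: "gprime c" "\<not> c gdvd 1 + \<i>" "\<not> c gdvd of_nat (p * q)"
    and A: "is_ideal k A" and t: "t \<in> ZI" "ideal_mult k A A = (*) (c * t) ` O\<^sub>k"
  shows "A \<subseteq> (*) c ` O\<^sub>k"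
proof
  fix z assume z: "z \<in> A"
  note cd = gprimeD[OF c(1)]
  obtain x y where xy: "x \<in> ZI" "y \<in> ZI" "z = x + y * w" using is_idealD(1)[OF A z] by (rule O_kE)
  have i_unit: "c gdvd v" if "c gdvd \<i> * v" for v
  proof -
    have "c gdvd (- \<i>) * (\<i> * v)" using that by (rule gdvd_mult2) auto
    thus ?thesis by (simp flip: mult.assoc)
  qed
  have "z * z \<in> (*) (c * t) ` O\<^sub>k" by (rule ideal_square_mem[OF z t(2)])
  hence "z * z \<in> (*) c ` O\<^sub>k" using smul_mult_subset[OF cd(1) t(1)] by blast
  moreover have "z * z = (x\<^sup>2 - \<i> * of_nat (p * q) * y\<^sup>2) + (2 * x * y) * w"
  proof -
    have "z * z = x\<^sup>2 + w\<^sup>2 * y\<^sup>2 + (2 * x * y) * w" by (simp add: xy algebra_simps power2_eq_square)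
    thus ?thesis unfolding w_sq by (simp add: algebra_simps)
  qed
  ultimately have d: "c gdvd x\<^sup>2 - \<i> * of_nat (p * q) * y\<^sup>2" "c gdvd 2 * x * y"
    using smul_O_k_iff[OF cd(1,2), of "x\<^sup>2 - \<i> * of_nat (p * q) * y\<^sup>2" "2 * x * y"] xy by auto
  have n2: "\<not> c gdvd 2"
  proof
    assume "c gdvd 2"
    moreover have "(2 :: complex) = (1 + \<i>) * (1 - \<i>)" by (simp add: algebra_simps)
    ultimately have "c gdvd 1 - \<i>" using cd(4)[of "1 + \<i>" "1 - \<i>"] c(2) by auto
    moreover have "1 - \<i> = \<i> * (- (1 + \<i>))" by (simp add: algebra_simps)
    ultimately have "c gdvd - (1 + \<i>)" using i_unit by metis
    hence "c gdvd - (- (1 + \<i>))" by (rule gdvd_uminus)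
    thus False using c(2) unfolding minus_minus by blast
  qed
  have "c gdvd x \<or> c gdvd y" using cd(4)[of "2 * x" y] cd(4)[of 2 x] d(2) xy n2 by auto
  hence "c gdvd x \<and> c gdvd y"
  proof
    assume x: "c gdvd x"
    hence "c gdvd x * x" using xy by (intro gdvd_mult) auto
    hence "c gdvd x\<^sup>2" by (simp add: power2_eq_square)
    hence "c gdvd x\<^sup>2 - (x\<^sup>2 - \<i> * of_nat (p * q) * y\<^sup>2)" using d(1) by (rule gdvd_diff)
    moreover have "x\<^sup>2 - (x\<^sup>2 - \<i> * of_nat (p * q) * y\<^sup>2) = \<i> * (of_nat (p * q) * (y * y))"
      by (simp only: power2_eq_square mult.assoc) simp
    ultimately have "c gdvd \<i> * (of_nat (p * q) * (y * y))" by metis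
    hence "c gdvd of_nat (p * q) * (y * y)" by (rule i_unit)
    hence "c gdvd y" using cd(4)[of "of_nat (p * q)" "y * y"] cd(4)[of y y] c(3) xy by auto
    thus ?thesis using x by blast
  next
    assume y: "c gdvd y"
    hence "c gdvd (\<i> * of_nat (p * q) * y) * y" using xy by (intro gdvd_mult2) auto
    hence "c gdvd (x\<^sup>2 - \<i> * of_nat (p * q) * y\<^sup>2) + \<i> * of_nat (p * q) * y\<^sup>2"
      using d by (intro gdvd_add) (auto simp: power2_eq_square mult_ac)
    hence "c gdvd x * x" by (simp add: power2_eq_square)
    thus ?thesis using cd(4)[of x x] xy y by auto
  qed
  thus "z \<in> (*) c ` O\<^sub>k" using smul_O_k_iff[OF cd(1,2) xy(1,2)] xy(3) by simp
qed

lemma unit_square_ideal: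
  assumes "nz_ideal k A" "ideal_mult k A A = O\<^sub>k" shows "A = O\<^sub>k"
proof -
  have A: "is_ideal k A" using assms(1) by (rule nz_ideal_ideal)
  have "ideal_mult k A A \<subseteq> A" by (rule ideal_mult_least[OF A]) (use is_idealD[OF A] in auto)
  thus ?thesis using assms(2) is_idealD(1)[OF A] by blast
qed

lemma unit_smul_O_k: "gnorm u = 1 \<Longrightarrow> u \<in> ZI \<Longrightarrow> (*) u ` O\<^sub>k = O\<^sub>k"
proof -
  assume u: "gnorm u = 1" "u \<in> ZI"
  have "x \<in> (*) u ` O\<^sub>k" if "x \<in> O\<^sub>k" for x
  proof (rule image_eqI)
    show "x = u * (cnj u * x)" using gnorm_1_inverse[OF u(2,1)] by (simp add: mult.commute[of u] mult.assoc[symmetric])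
    show "cnj u * x \<in> O\<^sub>k" using u that by (intro OK_mult[OF k_field ZI_k]) auto
  qed
  thus ?thesis using u by (auto intro: OK_mult[OF k_field ZI_k])
qed

text \<open>Descent on the norm of \<open>t\<close>: an ideal whose square is generated by a Gaussian integer is
  equivalent to a product of ramified primes.\<close>
lemma ramified_class_induct:
  assumes fam: "\<And>c. gprime c \<Longrightarrow> c gdvd (1 + \<i>) \<or> c gdvd of_nat (p * q) \<Longrightarrow>
      \<exists>c' H j. ram c' H \<and> c = c' * \<i> ^ j \<and> (\<forall>A. nz_ideal k A \<longrightarrow> P A \<longrightarrow> P (ideal_mult k A H))"
    and one: "P O\<^sub>k"
    and equiv: "\<And>A B. nz_ideal k A \<Longrightarrow> nz_ideal k B \<Longrightarrow> ideal_equiv k A B \<Longrightarrow> P A \<Longrightarrow> P B"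
  shows "nz_ideal k A \<Longrightarrow> t \<in> ZI \<Longrightarrow> t \<noteq> 0 \<Longrightarrow> ideal_mult k A A = (*) t ` O\<^sub>k \<Longrightarrow> P A"
proof (induction "nat (gnorm t)" arbitrary: A t rule: less_induct)
  case less
  have smaller: "nat (gnorm t') < nat (gnorm t)"
    if "c \<in> ZI" "gnorm c \<noteq> 1" "t' \<in> ZI" "t = c * t'" for c t'
  proof -
    have eq: "gnorm t = gnorm c * gnorm t'" using that gnorm_mult by simp
    have "gnorm t > 0" using less.prems gnorm_eq_0_iff[of t] gnorm_nonneg[of t] by simp
    hence pos: "gnorm c > 0" "gnorm t' > 0" using eq gnorm_nonneg[of c] gnorm_nonneg[of t']
      by (auto simp: zero_less_mult_iff)
    hence "gnorm c > 1" using that(2) by simp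
    hence "gnorm t' < gnorm t" using eq pos mult_strict_right_mono[of 1 "gnorm c" "gnorm t'"] by simp
    thus ?thesis using pos by simp
  qed
  show ?case
  proof (cases "gnorm t = 1")
    case True
    hence "ideal_mult k A A = O\<^sub>k" using less.prems unit_smul_O_k by simp
    hence "A = O\<^sub>k" by (rule unit_square_ideal[OF less.prems(1)])
    thus ?thesis using one by simp
  next
    case False
    then obtain c where c: "gprime c" "c gdvd t" using gprime_factor_exists less.prems by blast
    note cd = gprimeD[OF c(1)]
    obtain t' where t': "t' \<in> ZI" "t = c * t'" using c by (auto simp: gdvd_def)
    show ?thesis
    proof (cases "c gdvd (1 + \<i>) \<or> c gdvd of_nat (p * q)")
      case True
      obtain c' H j where H: "ram c' H" "c = c' * \<i> ^ j"
        "\<And>A. nz_ideal k A \<Longrightarrow> P A \<Longrightarrow> P (ideal_mult k A H)" using fam[OF c(1) True] by blast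
      define t'' where "t'' = \<i> ^ j * t'"
      have t'': "t'' \<in> ZI" "t = c' * t''" using t' H(2) by (auto simp: t''_def)
      obtain A' where A': "nz_ideal k A'" "ideal_mult k A' A' = (*) t'' ` O\<^sub>k" "A = ideal_mult k A' H"
        using ram_divide[OF H(1) less.prems(1) t''(1)] less.prems(4) t''(2) by blast
      have "gnorm c = gnorm c'" using H(2) ramD(2)[OF H(1)] gnorm_1_iff[of "\<i> ^ j"]
        by (auto simp: gnorm_mult)
      hence "nat (gnorm t'') < nat (gnorm t)" using smaller[OF ramD(2)[OF H(1)] _ t''] cd by simp
      moreover have "t'' \<noteq> 0" using t'' less.prems by auto
      ultimately have "P A'" using less.hyps A' t'' by blast
      thus ?thesis using H(3) A' by simp
    next
      case False
      have AI: "is_ideal k A" using less.prems(1) by (rule nz_ideal_ideal)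
      have sq: "ideal_mult k A A = (*) (c * t') ` O\<^sub>k" using less.prems t' by simp
      have "A \<subseteq> (*) c ` O\<^sub>k" using False by (intro unram_subset[OF c(1) _ _ AI t'(1) sq]) auto
      then obtain A' t'' where A': "nz_ideal k A'" "A = (*) c ` A'" "t'' \<in> ZI" "t' = c * t''"
        "ideal_mult k A' A' = (*) t'' ` O\<^sub>k"
        by (rule dilate_divide[OF cd(1,2) less.prems(1) _ t'(1) sq])
      have "t = c * (c * t'')" using t' A' by simp
      hence "nat (gnorm t'') < nat (gnorm t)" "t'' \<noteq> 0"
        using smaller[of "c * c" t''] less.prems(3) cd A'(3) gnorm_nonneg[of c]
        by (auto simp: mult.assoc gnorm_mult zmult_eq_1_iff)
      hence "P A'" using less.hyps A' by blast
      thus ?thesis using equiv[OF A'(1) less.prems(1)] A'(2)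
          ideal_equiv_sym[OF ideal_equiv_smul[OF k_field ZI_k[OF cd(1)] cd(2)]] by simp
    qed
  qed
qed

text \<open>If \<open>a\<close> generates \<open>H\<close> then \<open>z = a^2 u\<close> with a unit
  \<open>u\<close>, and norms give \<open>z^2 = N(a)^2 N(u)\<close>. So \<open>N(a) / z\<close> lies
  in \<open>QI\<close> and has a Gaussian unit as its square, hence is a power of
  \<open>\<i>\<close>. Non-principality thus reduces to the insolubility of norm equations.\<close>

lemma principal_ram_norm:
  assumes H: "is_ideal k H" and sq: "ideal_mult k H H = (*) z ` O\<^sub>k" and z: "z \<in> ZI" "z \<noteq> 0"
    and pr: "principal k H"
  obtains x y j where "x \<in> ZI" "y \<in> ZI" "x\<^sup>2 + \<i> * of_nat (p * q) * y\<^sup>2 = \<i> ^ j * z"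
proof -
  obtain a where a: "a \<in> O\<^sub>k" "H = (*) a ` O\<^sub>k" using pr
    unfolding principal_def by (auto simp: gen_ideal_singleton[OF k_field])
  have eq: "(*) z ` O\<^sub>k = (*) (a * a) ` O\<^sub>k" using sq unfolding a(2)
    by (simp add: principal_mult_principal k_field a)
  obtain u v where uv: "u \<in> O\<^sub>k" "v \<in> O\<^sub>k" "u * v = 1" "z = a * a * u"
    by (rule smul_OK_eqD[OF k_field eq z(2)])
  obtain x y where xy: "x \<in> ZI" "y \<in> ZI" "a = x + y * w" using a(1) by (rule O_kE)
  define N where "N = a * \<tau> a"
  have N: "N = x\<^sup>2 + \<i> * of_nat (p * q) * y\<^sup>2" unfolding N_def xy(3) by (rule norm_eq[OF xy(1,2)])
  have NZ: "N \<in> ZI" unfolding N_def by (rule trace_norm_ZI[OF a(1)])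
  have mem: "a \<in> k" "u \<in> k" "v \<in> k" using a uv by (auto dest: OK_D)
  have "\<tau> z = z" by (rule tau_ZI[OF z(1)])
  hence "z * z = (a * a * u) * \<tau> (a * a * u)" using uv(4) by simp
  also have "\<dots> = N * N * (u * \<tau> u)"
    unfolding N_def using mem is_subfieldD(5)[OF k_field] by (simp add: tau_mult)
  finally have zz: "z * z = N * N * (u * \<tau> u)" .
  define \<epsilon> where "\<epsilon> = v * \<tau> v"
  have \<epsilon>: "\<epsilon> \<in> ZI" unfolding \<epsilon>_def by (rule trace_norm_ZI[OF uv(2)])
  have u\<epsilon>: "(u * \<tau> u) * \<epsilon> = 1"
  proof -
    have "(u * \<tau> u) * \<epsilon> = (u * v) * \<tau> (u * v)" unfolding \<epsilon>_def using mem by (simp add: tau_mult)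
    thus ?thesis using uv(3) tau_ZI[of 1] by simp
  qed
  have "z * z * \<epsilon> = N * N * ((u * \<tau> u) * \<epsilon>)" unfolding zz by (simp only: mult_ac)
  hence NN: "N * N = z * z * \<epsilon>" unfolding u\<epsilon> by simp
  define e where "e = N / z"
  have ee: "e * e = \<epsilon>" using NN z by (simp add: e_def field_simps)
  have "e \<in> QI" unfolding e_def by (intro is_subfieldD(8)[OF is_subfield_QI] ZI_QI NZ z)
  moreover have "algebraic_int e"
    by (rule algebraic_int_sqrt_complex) (simp add: power2_eq_square ee algebraic_int_ZI[OF \<epsilon>])
  ultimately have eZ: "e \<in> ZI" using OK_QI by (auto simp: OK_def)
  have uZ: "u * \<tau> u \<in> ZI" by (rule trace_norm_ZI[OF uv(1)])
  have "e * (e * (u * \<tau> u)) = (u * \<tau> u) * (e * e)" by (simp only: mult_ac)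
  hence "e * (e * (u * \<tau> u)) = 1" unfolding ee u\<epsilon> .
  with unit_if_inverse_in_ZI[OF eZ ZI_closed(9)[OF eZ uZ]] obtain j :: nat where "e = \<i> ^ j" by blast
  hence "N = \<i> ^ j * z" using z by (simp add: e_def field_simps)
  thus ?thesis by (intro that[OF xy(1,2), of j]) (simp only: N)
qed

end

section \<open>The ramified primes of \<open>k\<close>\<close>

lemma gprime_bezout:
  assumes c: "gprime c" and v: "v \<in> ZI" "\<not> c gdvd v"
  obtains x y where "x \<in> ZI" "y \<in> ZI" "c * x + v * y = 1"
proof -
  note cd = gprimeD[OF c]
  obtain x y where xy: "x \<in> ZI" "y \<in> ZI" "c * x + v * y gdvd c" "c * x + v * y gdvd v"
    by (rule ZI_bezout[OF cd(1) v(1)])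
  define g where "g = c * x + v * y"
  have g: "g \<in> ZI" using xy cd v by (auto simp: g_def)
  obtain h where h: "h \<in> ZI" "c = g * h" using xy(3) by (auto simp: gdvd_def g_def)
  have "\<not> c gdvd g" using gdvd_trans[of c g v] xy(4) v(2) by (auto simp: g_def)
  moreover have "c gdvd g * h" using h(2) by simp
  ultimately have "c gdvd h" using cd(4)[OF g h(1)] by blast
  then obtain h' where h': "h' \<in> ZI" "h = c * h'" by (auto simp: gdvd_def)
  have "c * (g * h') = c * 1" using h h' by (metis mult.assoc mult.commute mult_1_right)
  hence "g * h' = 1" using cd(2) by simp
  hence "c * (x * h') + v * (y * h') = 1" by (simp add: g_def algebra_simps)
  thus ?thesis using that[of "x * h'" "y * h'"] xy h' by auto
qed

lemma gprime_assoc: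
  assumes c: "gprime c" "c gdvd z" and z: "z \<in> ZI" "prime (gnorm z)"
  obtains j :: nat where "c = z * \<i> ^ j"
proof -
  note cd = gprimeD[OF c(1)]
  obtain h where h: "h \<in> ZI" "z = c * h" using c by (auto simp: gdvd_def)
  have "gnorm z = gnorm c * gnorm h" unfolding h(2) by (rule gnorm_mult[OF cd(1) h(1)])
  hence "gnorm h = 1" using z(2) cd(3) gnorm_nonneg[of c] gnorm_nonneg[of h] by (auto simp: prime_int_iff)
  then obtain j :: nat where j: "h = \<i> ^ j" using gnorm_1_iff[OF h(1)] by blast
  have "\<i> ^ j * \<i> ^ (3 * j) = (\<i> ^ 4) ^ j" by (simp flip: power_add power_mult)
  also have "\<i> ^ 4 = 1" by simp
  finally have "\<i> ^ j * \<i> ^ (3 * j) = 1" by simp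
  hence "z * \<i> ^ (3 * j) = c" using h(2) j by (simp add: mult.assoc)
  thus ?thesis using that by metis
qed

text \<open>Removes one Gaussian prime from \<open>c\<close> and preserves coprimality with the
  conjugate, so it can be iterated until the cofactor has square norm. The equation does not tell
  \<open>z\<close> from its conjugate, hence the disjunction.\<close>

lemma gprime_split:
  assumes z: "z \<in> ZI" "prime (gnorm z)" and c: "c \<in> ZI" "x \<in> ZI" "y \<in> ZI" "m \<in> ZI"
    and cop: "c * x + cnj c * y = 1" and eq: "c * cnj c = of_int (gnorm z) * m"
  obtains z' c' x' y' where "z' = z \<or> z' = cnj z" "c = z' * c'" "c' \<in> ZI" "x' \<in> ZI" "y' \<in> ZI"
    "c' * x' + cnj c' * y' = 1" "c' * cnj c' = m"
proof -
  have gp: "gprime z" using z by (rule gprime_if_prime_gnorm)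
  have zz: "of_int (gnorm z) = z * cnj z" by (rule of_int_gnorm[OF z(1)])
  have z0: "z \<noteq> 0" using gprimeD(2)[OF gp] .
  have "z gdvd c * cnj c" unfolding eq zz
    using z c by (intro gdvdI[of "cnj z * m"]) (auto simp: mult.assoc)
  hence "z gdvd c \<or> z gdvd cnj c" using gprimeD(4)[OF gp] c by blast
  hence "z gdvd c \<or> cnj z gdvd c" using gdvd_cnj[of z "cnj c"] by auto
  then obtain z' where z': "z' = z \<or> z' = cnj z" "z' gdvd c" by blast
  then obtain c' where c': "c' \<in> ZI" "c = z' * c'" by (auto simp: gdvd_def)
  have "z' * cnj z' = z * cnj z" "z' * cnj z' \<noteq> 0" using z'(1) z0 by (auto simp: mult.commute)
  moreover have "(z' * cnj z') * (c' * cnj c') = (z * cnj z) * m"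
    using eq unfolding zz c'(2) by (simp add: mult_ac)
  ultimately have "c' * cnj c' = m" by simp
  moreover have "c' * (z' * x) + cnj c' * (cnj z' * y) = 1"
    using cop unfolding c'(2) by (simp add: mult_ac)
  moreover have "z' * x \<in> ZI" "cnj z' * y \<in> ZI" using z' z c by auto
  ultimately show ?thesis using that[of z' c' "z' * x" "cnj z' * y"] z' c' by blast
qed

text \<open>Odd primes do not ramify in the Gaussian integers: otherwise \<open>z\<close> divides
  its trace \<open>2 a\<close>, so \<open>l\<close> divides \<open>a\<close>, then \<open>b\<close>,
  and \<open>l^2\<close> divides \<open>a^2 + b^2 = l\<close>.\<close>

lemma prime_gnorm_not_gdvd_cnj:
  assumes "prime l" "l > 2" "z \<in> ZI" "gnorm z = l"
  shows "\<not> z gdvd cnj z"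
proof
  assume d: "z gdvd cnj z"
  obtain a b where ab: "z = of_int a + \<i> * of_int b" "Re z = of_int a" "Im z = of_int b"
    using assms(3) by (rule ZI_cases)
  have l: "l = a\<^sup>2 + b\<^sup>2" using assms(4) ab by simp
  have "z gdvd z + cnj z" using d by (intro gdvd_add) auto
  also have "z + cnj z = of_int (2 * a)" using ab by (simp add: complex_eq_iff)
  finally have "gnorm z dvd gnorm (of_int (2 * a))" using assms(3) by (rule gdvd_gnorm)
  hence "l dvd (2 * a)\<^sup>2" unfolding gnorm_of_int assms(4) .
  hence "l dvd 2 * a" using assms(1) prime_dvd_power by blast
  moreover have "\<not> l dvd 2" using assms(2) zdvd_imp_le[of l 2] by auto
  ultimately have a: "l dvd a" using assms(1) prime_dvd_mult_iff by blast
  hence "l dvd a\<^sup>2" by (simp add: power2_eq_square)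
  moreover have "l dvd a\<^sup>2 + b\<^sup>2" unfolding l[symmetric] by simp
  ultimately have "l dvd b\<^sup>2" by (simp add: dvd_add_right_iff)
  hence b: "l dvd b" using assms(1) prime_dvd_power by blast
  have "l\<^sup>2 dvd a\<^sup>2 + b\<^sup>2" using a b by (intro dvd_add dvd_power_same)
  hence "l\<^sup>2 dvd l" using l by simp
  hence "l\<^sup>2 \<le> l" using assms(2) by (intro zdvd_imp_le) auto
  moreover have "l * 1 < l * l" using assms(2) by (intro mult_strict_left_mono) auto
  ultimately show False by (simp add: power2_eq_square)
qed

context prime_pair
begin

text \<open>For \<open>c\<close> and \<open>a\<close> as in the next lemmas, \<open>H = (c, w - a)\<close> and \<open>(w - a)\<^sup>2 = -c v - 2 a (w - a)\<close>;
  the relevant cases are \<open>a = 0\<close> with \<open>c\<close> of norm \<open>p\<close> or \<open>q\<close>, and \<open>a = 1\<close> with \<open>c = 1 + \<i>\<close>.\<close>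
lemma ram_if_contains:
  assumes H: "is_ideal k H" "1 \<notin> H" and c: "gprime c" "c \<in> H" and a: "a \<in> ZI" "w - a \<in> H"
    and v: "v \<in> ZI" "\<not> c gdvd v" "a\<^sup>2 + \<i> * of_nat (p * q) = c * v" and a2: "c gdvd 2 * a"
  shows "ram c H"
proof -
  note cd = gprimeD[OF c(1)]
  define \<pi> where "\<pi> = w - a"
  have \<pi>H: "\<pi> \<in> H" using a by (simp add: \<pi>_def)
  have cO: "c \<in> O\<^sub>k" by (rule ZI_k[OF cd(1)])
  obtain m where m: "m \<in> ZI" "2 * a = c * m" using a2 by (auto simp: gdvd_def)
  have \<pi>2: "\<pi> * \<pi> = - c * v - c * m * \<pi>"
  proof -
    have "\<pi> * \<pi> = w\<^sup>2 + a\<^sup>2 - 2 * a * w" by (simp add: \<pi>_def power2_eq_square algebra_simps)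
    also have "\<dots> = - (a\<^sup>2 + \<i> * of_nat (p * q)) - 2 * a * \<pi>"
      unfolding w_sq by (simp add: \<pi>_def power2_eq_square algebra_simps)
    finally show ?thesis unfolding v(3) m(2) by simp
  qed
  have HZ: "c gdvd e" if e: "e \<in> ZI" "e \<in> H" for e
  proof (rule ccontr)
    assume "\<not> c gdvd e"
    then obtain x y where "x \<in> ZI" "y \<in> ZI" "c * x + e * y = 1" using gprime_bezout[OF c(1) e(1)] by blast
    moreover from this have "c * x + e * y \<in> H"
      using c e by (intro is_idealD(3,5)[OF H(1)] ZI_k)
    ultimately show False using H(2) by simp
  qed
  have decomp: "\<exists>e b. e \<in> ZI \<and> b \<in> ZI \<and> x = e + b * \<pi>" if x: "x \<in> O\<^sub>k" for x
  proof -
    obtain x0 b where xb: "x0 \<in> ZI" "b \<in> ZI" "x = x0 + b * w" using x by (rule O_kE)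
    have "x = (x0 + b * a) + b * \<pi>" unfolding xb(3) by (simp add: \<pi>_def algebra_simps)
    moreover have "x0 + b * a \<in> ZI" using xb a by auto
    ultimately show ?thesis using xb(2) by (intro exI[of _ "x0 + b * a"] exI[of _ b]) simp
  qed
  have HdE: "\<exists>f b. f \<in> ZI \<and> b \<in> ZI \<and> x = c * f + b * \<pi>" if x: "x \<in> H" for x
  proof -
    obtain e b where eb: "e \<in> ZI" "b \<in> ZI" "x = e + b * \<pi>" using decomp is_idealD(1)[OF H(1) x] by blast
    have "b * \<pi> \<in> H" using is_idealD(4)[OF H(1) ZI_k[OF eb(2)] \<pi>H] .
    hence "x - b * \<pi> \<in> H" using x is_ideal_uminus_diff(2)[OF k_field H(1)] by blast
    hence "c gdvd e" using HZ eb by simp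
    thus ?thesis using eb by (auto simp: gdvd_def)
  qed
  let ?M = "ideal_mult k H H"
  have M: "is_ideal k ?M" by (intro is_ideal_mult k_field H)
  have \<pi>O: "\<pi> \<in> O\<^sub>k" using \<pi>H is_idealD(1)[OF H(1)] by blast
  have "?M \<subseteq> (*) c ` O\<^sub>k"
  proof (rule ideal_mult_least[OF is_ideal_smul[OF k_field is_ideal_OK[OF k_field] cO]])
    fix x y assume "x \<in> H" "y \<in> H"
    then obtain f b f' b' where fb: "f \<in> ZI" "b \<in> ZI" "x = c * f + b * \<pi>" "f' \<in> ZI" "b' \<in> ZI" "y = c * f' + b' * \<pi>"
      using HdE by meson
    have "x * y = c * (c * f * f' + (f * b' + f' * b) * \<pi>) + b * b' * (\<pi> * \<pi>)"
      unfolding fb(3,6) by (simp add: algebra_simps)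
    also have "\<dots> = c * (c * f * f' + (f * b' + f' * b) * \<pi> + b * b' * (- v - m * \<pi>))"
      unfolding \<pi>2 by (simp add: algebra_simps)
    finally have "x * y = c * (c * f * f' + (f * b' + f' * b) * \<pi> + b * b' * (- v - m * \<pi>))" .
    moreover have "c * f * f' + (f * b' + f' * b) * \<pi> + b * b' * (- v - m * \<pi>) \<in> O\<^sub>k"
    proof -
      have "c \<in> O\<^sub>k" "f \<in> O\<^sub>k" "f' \<in> O\<^sub>k" "b \<in> O\<^sub>k" "b' \<in> O\<^sub>k" "v \<in> O\<^sub>k" "m \<in> O\<^sub>k"
        using fb cd v m ZI_k by blast+
      thus ?thesis using \<pi>O
        by (intro OK_add[OF k_field] OK_mult[OF k_field] OK_diff[OF k_field] OK_uminus[OF k_field])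
    qed
    ultimately show "x * y \<in> (*) c ` O\<^sub>k" by blast
  qed
  moreover have "c \<in> ?M"
  proof -
    \<comment> \<open>Both \<open>c * c\<close> and \<open>c * v\<close> lie in \<open>H^2\<close>,
      and they combine to \<open>c\<close> because \<open>c\<close> does not divide
      \<open>v\<close>.\<close>
    obtain x y where xy: "x \<in> ZI" "y \<in> ZI" "c * x + v * y = 1" using gprime_bezout[OF c(1) v(1,2)] .
    have "c * v = - (\<pi> * \<pi> + (c * \<pi>) * m)" unfolding \<pi>2 by (simp add: algebra_simps)
    moreover have "\<pi> * \<pi> + (c * \<pi>) * m \<in> ?M"
      using c \<pi>H m by (intro is_idealD(3)[OF M] is_idealD(5)[OF M] ideal_mult_memI ZI_k)
    ultimately have "c * v \<in> ?M" using is_ideal_uminus_diff(1)[OF k_field M] by metis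
    moreover have "c * c \<in> ?M" using c by (intro ideal_mult_memI)
    ultimately have "(c * c) * x + (c * v) * y \<in> ?M"
      using is_idealD(3)[OF M is_idealD(5)[OF M ZI_k[OF xy(1)]] is_idealD(5)[OF M ZI_k[OF xy(2)]]] by blast
    also have "(c * c) * x + (c * v) * y = c * (c * x + v * y)" by (simp only: distrib_left mult.assoc)
    finally show ?thesis using xy(3) by simp
  qed
  hence "(*) c ` O\<^sub>k \<subseteq> ?M" using is_idealD(5)[OF M] by auto
  moreover have "x \<in> H" if x: "x \<in> O\<^sub>k" "x * x \<in> (*) c ` O\<^sub>k" for x
  proof -
    obtain e b where eb: "e \<in> ZI" "b \<in> ZI" "x = e + b * \<pi>" using decomp x by blast
    have b\<pi>: "b * \<pi> \<in> H" using is_idealD(4)[OF H(1) ZI_k[OF eb(2)] \<pi>H] .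
    \<comment> \<open>Modulo \<open>H\<close> the element \<open>x\<close> equals the Gaussian
      integer \<open>e\<close>, so \<open>e^2\<close> lies in \<open>H\<close> and the prime
      \<open>c\<close> divides \<open>e\<close>.\<close>
    have "x * x \<in> H" using x(2) is_idealD(5)[OF H(1) _ c(2)] by auto
    moreover have "(b * \<pi>) * (x + e) \<in> H"
      by (rule is_idealD(5)[OF H(1) OK_add[OF k_field x(1) ZI_k[OF eb(1)]] b\<pi>])
    ultimately have "x * x - (b * \<pi>) * (x + e) \<in> H" using is_ideal_uminus_diff(2)[OF k_field H(1)] by blast
    moreover have "x * x - (b * \<pi>) * (x + e) = e * e" unfolding eb(3) by (simp add: algebra_simps)
    ultimately have "c gdvd e * e" using HZ[of "e * e"] eb by auto
    hence "c gdvd e" using cd(4)[OF eb(1,1)] by blast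
    then obtain f where "f \<in> ZI" "e = c * f" by (auto simp: gdvd_def)
    hence "e \<in> H" using is_idealD(5)[OF H(1) ZI_k c(2)] by simp
    thus ?thesis unfolding eb(3) using b\<pi> by (intro is_idealD(3)[OF H(1)])
  qed
  ultimately show ?thesis unfolding ram_def using H cd by blast
qed

text \<open>The ideal is written down as the module generated by \<open>c\<close> and
  \<open>w - a\<close>. This provides the primes above \<open>q\<close>, which the theorem does not
  name.\<close>

lemma ram_exists:
  assumes c: "gprime c" and a: "a \<in> ZI"
    and v: "v \<in> ZI" "\<not> c gdvd v" "a\<^sup>2 + \<i> * of_nat (p * q) = c * v" and a2: "c gdvd 2 * a"
  shows "\<exists>H. ram c H"
proof -
  note cd = gprimeD[OF c]
  define \<pi> where "\<pi> = w - a"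
  define H where "H = {e + b * \<pi> | e b. e \<in> ZI \<and> b \<in> ZI \<and> c gdvd e}"
  have \<pi>2: "\<pi> * \<pi> = - c * v - 2 * a * \<pi>"
  proof -
    have "\<pi> * \<pi> = w\<^sup>2 + a\<^sup>2 - 2 * a * w" by (simp add: \<pi>_def power2_eq_square algebra_simps)
    also have "\<dots> = - (a\<^sup>2 + \<i> * of_nat (p * q)) - 2 * a * \<pi>"
      unfolding w_sq by (simp add: \<pi>_def power2_eq_square algebra_simps)
    finally show ?thesis unfolding v(3) by simp
  qed
  have HI: "e + b * \<pi> \<in> H" if "e \<in> ZI" "b \<in> ZI" "c gdvd e" for e b
    using that unfolding H_def by blast
  have "is_ideal k H"
    unfolding is_ideal_def
  proof (intro conjI ballI)
    show "H \<subseteq> O\<^sub>k"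
    proof
      fix x assume "x \<in> H"
      then obtain e b where eb: "e \<in> ZI" "b \<in> ZI" "x = e + b * \<pi>" unfolding H_def by blast
      have eq: "x = (e - b * a) + b * w" unfolding eb(3) by (simp add: \<pi>_def algebra_simps)
      show "x \<in> O\<^sub>k" unfolding eq using eb a by (intro O_kI) auto
    qed
    show "0 \<in> H" using HI[of 0 0] by simp
    fix x assume "x \<in> H"
    then obtain e b where eb: "e \<in> ZI" "b \<in> ZI" "x = e + b * \<pi>" "c gdvd e" unfolding H_def by blast
    show "x + y \<in> H" if "y \<in> H" for y
    proof -
      obtain e' b' where eb': "e' \<in> ZI" "b' \<in> ZI" "y = e' + b' * \<pi>" "c gdvd e'" using \<open>y \<in> H\<close> unfolding H_def by blast
      have eq: "x + y = (e + e') + (b + b') * \<pi>" unfolding eb(3) eb'(3) by (simp add: algebra_simps)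
      show ?thesis unfolding eq using eb eb' by (intro HI gdvd_add) auto
    qed
    show "r * x \<in> H" if "r \<in> O\<^sub>k" for r
    proof -
      obtain r0 r1 where r: "r0 \<in> ZI" "r1 \<in> ZI" "r = r0 + r1 * w" using \<open>r \<in> O\<^sub>k\<close> by (rule O_kE)
      define \<rho> where "\<rho> = r0 + r1 * a"
      have \<rho>: "\<rho> \<in> ZI" "r = \<rho> + r1 * \<pi>" using r a by (auto simp: \<rho>_def \<pi>_def algebra_simps)
      have "r * x = \<rho> * e + (\<rho> * b + r1 * e) * \<pi> + r1 * b * (\<pi> * \<pi>)"
        unfolding \<rho>(2) eb(3) by (simp add: algebra_simps)
      also have "\<dots> = (e * \<rho> + c * (- v * r1 * b)) + (\<rho> * b + r1 * e - 2 * a * r1 * b) * \<pi>"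
        unfolding \<pi>2 by (simp add: algebra_simps)
      also have "\<dots> \<in> H" using eb r a v \<rho> cd
        by (intro HI gdvd_add gdvd_mult[OF eb(4)] gdvdI[of "- v * r1 * b" _ c]) auto
      finally show ?thesis .
    qed
  qed
  moreover have "1 \<notin> H"
  proof
    assume "1 \<in> H"
    then obtain e b where eb: "e \<in> ZI" "b \<in> ZI" "1 = e + b * \<pi>" "c gdvd e" unfolding H_def by blast
    hence "1 + 0 * w = (e - b * a) + b * w" by (simp add: \<pi>_def algebra_simps)
    hence "0 = b" using base.basis_unique(2)[of 1 0 "e - b * a" b] eb a by (auto intro: ZI_QI)
    hence "c gdvd 1" using eb by simp
    hence "gnorm c dvd 1" using gdvd_gnorm[of c 1] cd by simp
    thus False using cd(3) gnorm_nonneg[of c] by simp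
  qed
  moreover have "c \<in> H" "w - a \<in> H" using HI[of c 0] HI[of 0 1] cd by (auto simp: \<pi>_def)
  ultimately show ?thesis using ram_if_contains[of H c a v] c a v a2 by blast
qed

text \<open>The square of \<open>w - a\<close> is a multiple of \<open>c\<close>, so a prime ideal
  containing \<open>c\<close> contains \<open>w - a\<close> too. This matches the prime ideals given
  in the theorem with \<open>ram\<close>.\<close>

lemma ram_prime_ideal:
  assumes c: "gprime c" and a: "a \<in> ZI"
    and v: "v \<in> ZI" "\<not> c gdvd v" "a\<^sup>2 + \<i> * of_nat (p * q) = c * v" and a2: "c gdvd 2 * a"
    and H: "prime_ideal k H" "c \<in> H"
  shows "ram c H"
proof (rule ram_if_contains[OF _ _ c H(2) a _ v a2])
  show HI: "is_ideal k H" using H by (simp add: prime_ideal_def nz_ideal_def)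
  show "1 \<notin> H"
  proof
    assume "1 \<in> H"
    hence "x \<in> H" if "x \<in> O\<^sub>k" for x using is_idealD(4)[OF HI that] by force
    hence "H = O\<^sub>k" using is_idealD(1)[OF HI] by blast
    thus False using H by (simp add: prime_ideal_def)
  qed
  have wa: "w - a \<in> O\<^sub>k" by (intro OK_diff k_field w_k ZI_k a)
  obtain m where m: "m \<in> ZI" "2 * a = c * m" using a2 by (auto simp: gdvd_def)
  have "(w - a) * (w - a) = w\<^sup>2 + a\<^sup>2 - 2 * a * w" by (simp add: power2_eq_square algebra_simps)
  also have "\<dots> = - (a\<^sup>2 + \<i> * of_nat (p * q)) - 2 * a * (w - a)"
    unfolding w_sq by (simp add: power2_eq_square algebra_simps)
  also have "\<dots> = c * (- v - m * (w - a))" unfolding v(3) m(2) by (simp add: algebra_simps)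
  also have "\<dots> \<in> H"
    by (rule is_idealD(5)[OF HI OK_diff[OF k_field OK_uminus[OF k_field ZI_k[OF v(1)]]
        OK_mult[OF k_field ZI_k[OF m(1)] wa]] H(2)])
  finally show "w - a \<in> H" using H(1) wa by (auto simp: prime_ideal_def)
qed

text \<open>With \<open>p q = 4 m + 1\<close> the cofactor of \<open>1 + \<i>\<close> in
  \<open>1 + \<i> p q\<close> is \<open>(2 m + 1) + 2 m \<i>\<close>, whose norm is odd.\<close>

lemma ram_data_1i:
  obtains v where "gprime (1 + \<i>)" "v \<in> ZI" "\<not> (1 + \<i>) gdvd v" "1\<^sup>2 + \<i> * of_nat (p * q) = (1 + \<i>) * v"
    "(1 + \<i>) gdvd 2 * 1"
proof -
  have "odd (p * q)" using gt2 by simp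
  have "p * q mod 4 = (p mod 4) * (q mod 4) mod 4" by (rule mod_mult_eq[symmetric])
  hence "p * q mod 4 = 1" using primes(4,5) by simp
  then obtain m where m: "p * q = 4 * m + 1" by (metis mod_eqE mod_mult_div_eq add.commute mult_div_mod_eq)
  define v where "v = of_int (2 * int m + 1) + \<i> * of_int (2 * int m)"
  have i: "(1 + \<i>) = of_int 1 + \<i> * of_int 1" by simp
  have n2: "gnorm (1 + \<i>) = 2" unfolding i gnorm_gi by simp
  have Z: "1 + \<i> \<in> ZI" by auto
  show ?thesis
  proof (rule that[of v])
    show "gprime (1 + \<i>)" using gprime_if_prime_gnorm[OF Z] n2 by simp
    show "v \<in> ZI" by (auto simp: v_def)
    show "\<not> (1 + \<i>) gdvd v"
    proof
      assume "(1 + \<i>) gdvd v"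
      hence "gnorm (1 + \<i>) dvd gnorm v" using Z by (rule gdvd_gnorm)
      moreover have "gnorm v = (2 * int m + 1)\<^sup>2 + (2 * int m)\<^sup>2" unfolding v_def by (rule gnorm_gi)
      ultimately show False unfolding n2 by simp
    qed
    have "complex_of_nat (p * q) = 4 * of_nat m + 1" unfolding m by simp
    thus "1\<^sup>2 + \<i> * of_nat (p * q) = (1 + \<i>) * v" by (simp add: v_def algebra_simps)
    show "(1 + \<i>) gdvd 2 * 1" by (rule gdvdI[of "1 - \<i>"]) (auto simp: algebra_simps)
  qed
qed

lemma ram_data_prime:
  assumes l: "prime (l :: nat)" "l > 2" "l * l' = p * q" "\<not> l dvd l'" and z: "z \<in> ZI" "gnorm z = int l"
  obtains v where "gprime z" "v \<in> ZI" "\<not> z gdvd v" "0\<^sup>2 + \<i> * of_nat (p * q) = z * v" "z gdvd 2 * 0"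
proof -
  have pl: "prime (int l)" using l by simp
  have gp: "gprime z" using z pl by (intro gprime_if_prime_gnorm) auto
  have zz: "complex_of_nat l = z * cnj z" using of_int_gnorm[OF z(1)] z(2) by simp
  define v where "v = (\<i> * of_nat l') * cnj z"
  show ?thesis
  proof (rule that[OF gp])
    show "v \<in> ZI" using z by (auto simp: v_def)
    show "\<not> z gdvd v"
    proof
      assume "z gdvd v"
      hence "z gdvd \<i> * of_nat l' \<or> z gdvd cnj z" using gprimeD(4)[OF gp] z unfolding v_def by auto
      moreover have "\<not> z gdvd cnj z" using prime_gnorm_not_gdvd_cnj[OF pl _ z] l by simp
      moreover have "\<not> z gdvd \<i> * of_nat l'"
      proof
        assume "z gdvd \<i> * of_nat l'"
        hence "gnorm z dvd gnorm (\<i> * of_nat l')" using z by (intro gdvd_gnorm)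
        also have "gnorm (\<i> * of_nat l') = int l' ^ 2" by (simp add: gnorm_def)
        finally have "int l dvd int l'" using pl z prime_dvd_power by metis
        thus False using l(4) by simp
      qed
      ultimately show False by blast
    qed
    have "complex_of_nat (p * q) = z * cnj z * of_nat l'" unfolding zz[symmetric] l(3)[symmetric] by simp
    thus "0\<^sup>2 + \<i> * of_nat (p * q) = z * v" by (simp add: v_def mult_ac)
  qed simp
qed

definition zfactor :: "nat \<Rightarrow> complex \<Rightarrow> bool" where
  "zfactor l z \<longleftrightarrow> z \<in> ZI \<and> gnorm z = int l"

lemma zfactor_cnj: "zfactor l z \<Longrightarrow> zfactor l (cnj z)"
  by (auto simp: zfactor_def gnorm_cnj)

lemma zfactor_ram_data:
  assumes "l = p \<or> l = q" "zfactor l z"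
  obtains v where "gprime z" "v \<in> ZI" "\<not> z gdvd v" "0\<^sup>2 + \<i> * of_nat (p * q) = z * v" "z gdvd 2 * 0"
proof -
  have "prime l" "l > 2" using assms(1) primes gt2 by auto
  moreover obtain l' where "l * l' = p * q" "\<not> l dvd l'"
    using assms(1) primes primes_dvd_imp_eq[of p q] primes_dvd_imp_eq[of q p] that[of q] that[of p]
    by (metis mult.commute)
  ultimately show ?thesis using ram_data_prime assms(2) that unfolding zfactor_def by metis
qed

lemma zfactor_ram:
  assumes "l = p \<or> l = q" "zfactor l z"
  shows "\<exists>H. ram z H" "prime_ideal k H \<Longrightarrow> z \<in> H \<Longrightarrow> ram z H"
proof -
  obtain v where v: "gprime z" "v \<in> ZI" "\<not> z gdvd v" "0\<^sup>2 + \<i> * of_nat (p * q) = z * v" "z gdvd 2 * 0"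
    using zfactor_ram_data[OF assms] .
  show "\<exists>H. ram z H" by (rule ram_exists[OF v(1) _ v(2-5)]) auto
  show "prime_ideal k H \<Longrightarrow> z \<in> H \<Longrightarrow> ram z H" by (rule ram_prime_ideal[OF v(1) _ v(2-5)]) auto
qed

lemma ram_1i: "prime_ideal k H \<Longrightarrow> 1 + \<i> \<in> H \<Longrightarrow> ram (1 + \<i>) H"
proof -
  obtain v where v: "gprime (1 + \<i>)" "v \<in> ZI" "\<not> (1 + \<i>) gdvd v" "1\<^sup>2 + \<i> * of_nat (p * q) = (1 + \<i>) * v"
    "(1 + \<i>) gdvd 2 * 1" using ram_data_1i .
  show "prime_ideal k H \<Longrightarrow> 1 + \<i> \<in> H \<Longrightarrow> ram (1 + \<i>) H" by (rule ram_prime_ideal[OF v(1) _ v(2-5)]) auto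
qed

lemma zfactor_mult_cnj: "zfactor l z \<Longrightarrow> z * cnj z = of_nat l"
  using of_int_gnorm[of z] by (auto simp: zfactor_def)

lemma ramified_gprime_cases:
  assumes c: "gprime c" "c gdvd (1 + \<i>) \<or> c gdvd of_nat (p * q)" and z: "zfactor p z" "zfactor q z'"
  obtains c' j where "c' \<in> {1 + \<i>, z, cnj z, z', cnj z'}" "c = c' * \<i> ^ j"
proof -
  have zZ: "z \<in> ZI" "z' \<in> ZI" "prime (gnorm z)" "prime (gnorm z')" "prime (gnorm (cnj z))" "prime (gnorm (cnj z'))"
    using z primes by (auto simp: zfactor_def gnorm_cnj)
  have i: "(1 + \<i>) = of_int 1 + \<i> * of_int 1" by simp
  have n2: "prime (gnorm (1 + \<i>))" unfolding i gnorm_gi by simp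
  have "\<exists>c'\<in>{1 + \<i>, z, cnj z, z', cnj z'}. c gdvd c'"
  proof (cases "c gdvd 1 + \<i>")
    case False
    hence "c gdvd (z * cnj z) * (z' * cnj z')" using c(2) zfactor_mult_cnj z by simp
    thus ?thesis using gprimeD(4)[OF c(1)] zZ by (metis ZI_closed(9,11) insertCI)
  qed auto
  then obtain c' where c': "c' \<in> {1 + \<i>, z, cnj z, z', cnj z'}" "c gdvd c'" by blast
  have "c' \<in> ZI \<and> prime (gnorm c')" using c'(1) zZ n2 by auto
  then obtain j where "c = c' * \<i> ^ j" using gprime_assoc[OF c(1) c'(2)] by blast
  thus ?thesis using that c' by blast
qed

section \<open>Relations and non-principal ideals\<close>

text \<open>The quotients \<open>x / g\<close> have integral squares, so \<open>A\<close> lies in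
  the multiples of \<open>g\<close>; after division by \<open>g\<close> the square is the whole
  ring. This concludes the peeling of ramified factors.\<close>

lemma principal_if_square:
  assumes A: "nz_ideal k A" and g: "g \<in> ZI" "g \<noteq> 0" and sq: "ideal_mult k A A = (*) (\<i> ^ j * g\<^sup>2) ` O\<^sub>k"
  shows "A = (*) g ` O\<^sub>k"
proof -
  have AI: "is_ideal k A" using A by (rule nz_ideal_ideal)
  have gk: "g \<in> k" using ZI_k[OF g(1)] by (auto dest: OK_D)
  have sub: "A \<subseteq> (*) g ` O\<^sub>k"
  proof
    fix x assume x: "x \<in> A"
    obtain r where r: "r \<in> O\<^sub>k" "x * x = (\<i> ^ j * g\<^sup>2) * r" using ideal_square_mem[OF x sq] by blast
    have "(x / g)\<^sup>2 = \<i> ^ j * r" using r g by (simp add: power_divide power2_eq_square field_simps)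
    moreover have "algebraic_int (\<i> ^ j * r)"
      by (intro algebraic_int_mult[OF algebraic_int_ZI OK_D(2)[OF r(1)]]) auto
    ultimately have "algebraic_int (x / g)" by (metis algebraic_int_sqrt_complex)
    moreover have "x / g \<in> k" using is_idealD(1)[OF AI x] gk is_subfieldD(8)[OF k_field] by (auto dest: OK_D)
    ultimately have "x / g \<in> O\<^sub>k" by (intro OK_I)
    thus "x \<in> (*) g ` O\<^sub>k" using g by (intro image_eqI[of _ _ "x / g"]) auto
  qed
  have "ideal_mult k A A = (*) (g * (\<i> ^ j * g)) ` O\<^sub>k" unfolding sq by (simp only: power2_eq_square mult_ac)
  then obtain A' t' where A': "nz_ideal k A'" "A = (*) g ` A'" "t' \<in> ZI" "\<i> ^ j * g = g * t'"
    "ideal_mult k A' A' = (*) t' ` O\<^sub>k"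
    by (rule dilate_divide[OF g A sub ZI_closed(9)[OF _ g(1)], rotated]) auto
  have "t' = \<i> ^ j" using A'(4) g by simp
  hence "gnorm t' = 1" using gnorm_1_iff[OF A'(3)] by blast
  hence "ideal_mult k A' A' = O\<^sub>k" using A'(5) unit_smul_O_k A'(3) by simp
  thus ?thesis using unit_square_ideal[OF A'(1)] A'(2) by simp
qed

text \<open>With \<open>\<epsilon> = T + U s\<close> of norm \<open>-1\<close>, \<open>(1 + \<i> \<epsilon>)\<^sup>2 = 2 \<i> \<epsilon> (1 + \<i> T)\<close>, and \<open>1 + \<i> T\<close> is \<open>1 + \<i>\<close> times
  a Gaussian prime above \<open>p\<close> times one above \<open>q\<close>, up to a unit and a square.\<close>
lemma pell_relation:
  assumes z: "zfactor p z" "zfactor q z'"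
  obtains z1 z2 A g and j :: nat where "z1 = z \<or> z1 = cnj z" "z2 = z' \<or> z2 = cnj z'" "nz_ideal k A" "principal k A"
    "g \<in> ZI" "g \<noteq> 0" "ideal_mult k A A = (*) ((1 + \<i>) * (z1 * (z2 * (\<i> ^ j * g\<^sup>2)))) ` O\<^sub>k"
proof -
  obtain T U where TU: "T\<^sup>2 + 1 = 2 * p * q * U\<^sup>2" using negative_pell_2pq .
  have "even (T\<^sup>2 + 1)" unfolding TU by simp
  hence "odd T" by simp
  then obtain m where m: "T = 2 * m + 1" by (elim oddE)
  have "T\<^sup>2 mod 8 = 1" by (rule odd_square_mod_8[OF \<open>odd T\<close>])
  hence "(T\<^sup>2 + 1) mod 4 = 2" by presburger
  hence "\<not> 4 dvd T\<^sup>2 + 1" by presburger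
  have oddN: "odd (p * q * U\<^sup>2)"
  proof
    assume "even (p * q * U\<^sup>2)"
    then obtain b where "p * q * U\<^sup>2 = 2 * b" by (elim evenE)
    hence "T\<^sup>2 + 1 = 4 * b" using TU by simp
    thus False using \<open>\<not> 4 dvd T\<^sup>2 + 1\<close> by simp
  qed
  \<comment> \<open>This is \<open>(1 + \<i> T) / (1 + \<i>)\<close>, written out with
    \<open>T = 2 m + 1\<close>.\<close>
  define c where "c = (of_int (int m + 1) + \<i> * of_int (int m) :: complex)"
  have cZ: "c \<in> ZI" by (auto simp: c_def)
  have c0: "(1 + \<i>) * c = 1 + \<i> * of_nat T" by (simp add: c_def m algebra_simps)
  have cc: "c * cnj c = of_nat (p * q * U\<^sup>2)"
  proof -
    have "2 * (c * cnj c) = of_nat (T\<^sup>2 + 1)" by (simp add: c_def m algebra_simps power2_eq_square)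
    thus ?thesis unfolding TU by simp
  qed
  \<comment> \<open>Coprimality of \<open>c\<close> and its conjugate: their product is the odd
    number \<open>2 b + 1\<close>, while \<open>(1 + \<i>) c + (1 - \<i>) cnj c = 2\<close>.\<close>
  obtain b where b: "p * q * U\<^sup>2 = 2 * b + 1" using oddN by (elim oddE)
  have "(1 + \<i>) * c + (1 - \<i>) * cnj c = 2" by (simp add: c_def algebra_simps)
  moreover have "c * (cnj c - of_nat b * (1 + \<i>)) + cnj c * (- of_nat b * (1 - \<i>))
      = c * cnj c - of_nat b * ((1 + \<i>) * c + (1 - \<i>) * cnj c)" by (simp add: algebra_simps)
  ultimately have cop: "c * (cnj c - of_nat b * (1 + \<i>)) + cnj c * (- of_nat b * (1 - \<i>)) = 1"
    unfolding cc b by simp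
  have zp: "z \<in> ZI" "prime (gnorm z)" "gnorm z = int p" "z' \<in> ZI" "prime (gnorm z')" "gnorm z' = int q"
    using z primes by (auto simp: zfactor_def)
  have eq1: "c * cnj c = of_int (gnorm z) * of_nat (q * U\<^sup>2)" unfolding cc zp by (simp add: mult_ac)
  have XY: "cnj c - of_nat b * (1 + \<i>) \<in> ZI" "- of_nat b * (1 - \<i>) \<in> ZI" using cZ by auto
  obtain z1 c1 x1 y1 where 1: "z1 = z \<or> z1 = cnj z" "c = z1 * c1" "c1 \<in> ZI" "x1 \<in> ZI" "y1 \<in> ZI"
    "c1 * x1 + cnj c1 * y1 = 1" "c1 * cnj c1 = of_nat (q * U\<^sup>2)"
    by (rule gprime_split[OF zp(1,2) cZ XY _ cop eq1]) auto
  have eq2: "c1 * cnj c1 = of_int (gnorm z') * of_nat (U\<^sup>2)" unfolding 1 zp by simp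
  obtain z2 c2 x2 y2 where 2: "z2 = z' \<or> z2 = cnj z'" "c1 = z2 * c2" "c2 \<in> ZI" "x2 \<in> ZI" "y2 \<in> ZI"
    "c2 * x2 + cnj c2 * y2 = 1" "c2 * cnj c2 = of_nat (U\<^sup>2)"
    by (rule gprime_split[OF zp(4,5) 1(3-5) _ 1(6) eq2]) auto
  have "U \<noteq> 0" using oddN by (intro notI) simp
  hence U0: "complex_of_nat U \<noteq> 0" by simp
  have sq2: "c2 * cnj c2 = (of_nat U)\<^sup>2" using 2(7) by simp
  obtain j :: nat and g where g: "g \<in> ZI" "g \<noteq> 0" "c2 = \<i> ^ j * g\<^sup>2"
    using ZI_coprime_square[OF 2(3) ZI_closed(11)[OF 2(3)] ZI_closed(5) 2(4,5) 2(6) sq2 U0] .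
  define \<epsilon> where "\<epsilon> = of_nat T + of_nat U * s"
  define \<epsilon>' where "\<epsilon>' = - of_nat T + of_nat U * s"
  have sO: "s \<in> O\<^sub>k"
  proof (rule OK_I)
    show "s \<in> k" by (auto intro: Qadj_base)
    show "algebraic_int s" by (rule algebraic_int_sqrt_complex) (simp only: s_sq algebraic_int_ZI ZI_closed)
  qed
  have \<epsilon>O: "\<epsilon> \<in> O\<^sub>k" "\<epsilon>' \<in> O\<^sub>k" unfolding \<epsilon>_def \<epsilon>'_def
    by (intro OK_add[OF k_field] OK_uminus[OF k_field] OK_mult[OF k_field ZI_k sO] ZI_k; simp)+
  have TUc: "of_nat T * of_nat T + 1 = of_nat (2 * p * q) * (of_nat U * of_nat U :: complex)"
  proof -
    have "complex_of_nat (T * T + 1) = of_nat (2 * p * q * (U * U))" using TU by (simp only: power2_eq_square)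
    thus ?thesis by (simp only: of_nat_add of_nat_mult of_nat_1)
  qed
  have ss: "s * s = of_nat (2 * p * q)" using s_sq by (simp add: power2_eq_square)
  have U2s: "(of_nat U * s) * (of_nat U * s) = of_nat T * of_nat T + 1"
    unfolding TUc ss[symmetric] by (simp only: mult_ac)
  have unit: "\<epsilon> * \<epsilon>' = 1" using U2s by (simp add: \<epsilon>_def \<epsilon>'_def algebra_simps)
  have \<epsilon>2: "\<epsilon> * \<epsilon> = 2 * of_nat T * \<epsilon> + 1" using U2s by (simp add: \<epsilon>_def algebra_simps)
  \<comment> \<open>The denominator absorbs the factor \<open>2 \<i> = (1 + \<i>)^2\<close>, leaving
    \<open>\<gamma>^2 = \<epsilon> (1 + \<i>) c\<close>; this also shows that
    \<open>\<gamma>\<close> is integral.\<close>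
  define \<gamma> where "\<gamma> = (1 + \<i> * \<epsilon>) / (1 + \<i>)"
  have i1: "1 + \<i> \<noteq> 0" by (simp add: complex_eq_iff)
  have "(1 + \<i> * \<epsilon>) * (1 + \<i> * \<epsilon>) = 1 + 2 * \<i> * \<epsilon> - \<epsilon> * \<epsilon>" by (simp add: algebra_simps)
  also have "\<dots> = (2 * \<i>) * (\<epsilon> * (1 + \<i> * of_nat T))" unfolding \<epsilon>2 by (simp add: algebra_simps)
  also have "2 * \<i> = (1 + \<i>) * (1 + \<i>)" by (simp add: algebra_simps)
  finally have "((1 + \<i>) * \<gamma>) * ((1 + \<i>) * \<gamma>) = (1 + \<i>) * (1 + \<i>) * (\<epsilon> * (1 + \<i> * of_nat T))"
    using i1 by (simp add: \<gamma>_def)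
  hence "((1 + \<i>) * (1 + \<i>)) * (\<gamma> * \<gamma>) = ((1 + \<i>) * (1 + \<i>)) * (\<epsilon> * (1 + \<i> * of_nat T))"
    by (simp only: mult_ac)
  hence \<gamma>2: "\<gamma> * \<gamma> = \<epsilon> * ((1 + \<i>) * c)" unfolding c0 using i1 by simp
  have \<gamma>k: "\<gamma> \<in> k" unfolding \<gamma>_def
    using \<epsilon>O(1) OK_D(1)[OF ZI_k] by (intro is_subfieldD(3,5,8)[OF k_field]) (auto dest: OK_D)
  have "algebraic_int (\<gamma>\<^sup>2)" unfolding power2_eq_square \<gamma>2
    using OK_D(2)[OF \<epsilon>O(1)] cZ by (intro algebraic_int_mult[OF _ algebraic_int_ZI]) auto
  hence \<gamma>O: "\<gamma> \<in> O\<^sub>k" using \<gamma>k by (intro OK_I algebraic_int_sqrt_complex[of \<gamma>])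
  have "c \<noteq> 0" using cop by auto
  moreover have "\<epsilon> \<noteq> 0" using unit by auto
  ultimately have \<gamma>0: "\<gamma> \<noteq> 0" using \<gamma>2 i1 by auto
  let ?A = "(*) \<gamma> ` O\<^sub>k"
  have "ideal_mult k ?A ?A = (*) ((1 + \<i>) * c) ` (*) \<epsilon> ` O\<^sub>k"
    unfolding principal_mult_principal[OF k_field \<gamma>O \<gamma>O] \<gamma>2 smul_smul by (simp only: mult.commute)
  also have "(*) \<epsilon> ` O\<^sub>k = O\<^sub>k"
  proof (intro equalityI subsetI)
    show "x \<in> O\<^sub>k" if "x \<in> (*) \<epsilon> ` O\<^sub>k" for x using that \<epsilon>O by (auto intro: OK_mult[OF k_field])
    show "x \<in> (*) \<epsilon> ` O\<^sub>k" if "x \<in> O\<^sub>k" for x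
      using unit OK_mult[OF k_field \<epsilon>O(2) that] by (intro image_eqI[of _ _ "\<epsilon>' * x"]) (simp_all flip: mult.assoc)
  qed
  finally have "ideal_mult k ?A ?A = (*) ((1 + \<i>) * (z1 * (z2 * (\<i> ^ j * g\<^sup>2)))) ` O\<^sub>k"
    unfolding 1(2) 2(2) g(3) .
  moreover have "nz_ideal k ?A" by (rule nz_ideal_smul[OF k_field nz_ideal_OK[OF k_field] \<gamma>O \<gamma>0])
  moreover have "principal k ?A" unfolding principal_def gen_ideal_singleton[OF k_field \<gamma>O, symmetric]
    using \<gamma>O by (intro bexI[of _ \<gamma>] refl)
  ultimately show ?thesis by (intro that[OF 1(1) 2(1) _ _ g(1,2)])
qed

text \<open>Peeling \<open>H0\<close> and the two primes singled out by \<open>pell_relation\<close>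
  off the principal ideal found there leaves an ideal with square \<open>(g^2)\<close>, that is
  \<open>(g)\<close>.\<close>

lemma ramified_product_principal:
  assumes z: "zfactor p z" "zfactor q z'" and H0: "ram (1 + \<i>) H0"
    and H: "ram z H1" "ram (cnj z) H2" "ram z' H3" "ram (cnj z') H4"
  obtains A B where "A = H1 \<or> A = H2" "B = H3 \<or> B = H4"
    "ideal_equiv k (ideal_mult k B (ideal_mult k A H0)) O\<^sub>k"
proof -
  obtain z1 z2 C g and j :: nat where C: "z1 = z \<or> z1 = cnj z" "z2 = z' \<or> z2 = cnj z'" "nz_ideal k C" "principal k C"
    "g \<in> ZI" "g \<noteq> 0" "ideal_mult k C C = (*) ((1 + \<i>) * (z1 * (z2 * (\<i> ^ j * g\<^sup>2)))) ` O\<^sub>k"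
    using pell_relation[OF z] .
  obtain A where A: "A = H1 \<or> A = H2" "ram z1 A" using C(1) H by blast
  obtain B where B: "B = H3 \<or> B = H4" "ram z2 B" using C(2) H by blast
  note Ad = ramD[OF A(2)] and Bd = ramD[OF B(2)] and H0d = ramD[OF H0]
  have Z: "\<i> ^ j * g\<^sup>2 \<in> ZI" "z2 * (\<i> ^ j * g\<^sup>2) \<in> ZI" "z1 * (z2 * (\<i> ^ j * g\<^sup>2)) \<in> ZI"
    using C Ad Bd by auto
  obtain C1 where C1: "nz_ideal k C1" "ideal_mult k C1 C1 = (*) (z1 * (z2 * (\<i> ^ j * g\<^sup>2))) ` O\<^sub>k"
    "C = ideal_mult k C1 H0" using ram_divide[OF H0 C(3) Z(3) C(7)] .
  obtain C2 where C2: "nz_ideal k C2" "ideal_mult k C2 C2 = (*) (z2 * (\<i> ^ j * g\<^sup>2)) ` O\<^sub>k"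
    "C1 = ideal_mult k C2 A" using ram_divide[OF A(2) C1(1) Z(2) C1(2)] .
  obtain C3 where C3: "nz_ideal k C3" "ideal_mult k C3 C3 = (*) (\<i> ^ j * g\<^sup>2) ` O\<^sub>k"
    "C2 = ideal_mult k C3 B" using ram_divide[OF B(2) C2(1) Z(1) C2(2)] .
  have gO: "g \<in> O\<^sub>k" using C ZI_k by blast
  have "C2 = (*) g ` B"
    unfolding C3(3) principal_if_square[OF C3(1) C(5,6) C3(2)] by (rule principal_mult[OF k_field Bd(1) gO])
  hence "C1 = (*) g ` ideal_mult k B A" unfolding C2(3)
    using ideal_mult_smul[OF k_field Bd(1) Ad(1) gO] by simp
  hence "C = (*) g ` ideal_mult k (ideal_mult k B A) H0" unfolding C1(3)
    using ideal_mult_smul[OF k_field is_ideal_mult[OF k_field Bd(1) Ad(1)] H0d(1) gO] by simp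
  also have "ideal_mult k (ideal_mult k B A) H0 = ideal_mult k B (ideal_mult k A H0)"
    by (rule ideal_mult_assoc[OF k_field Bd(1) Ad(1) H0d(1)])
  finally have "ideal_equiv k C (ideal_mult k B (ideal_mult k A H0))"
    using ideal_equiv_smul[OF k_field gO C(6)] by simp
  moreover have "ideal_equiv k C O\<^sub>k" using principal_iff_equiv_OK[OF k_field C(3)] C(4) by blast
  ultimately show ?thesis
    using that[OF A(1) B(1)] ideal_equiv_trans[OF k_field ideal_equiv_sym, of C] by blast
qed

end

section \<open>Insoluble norm equations\<close>

lemma gnorm_add_multiple:
  assumes "x \<in> ZI" "v \<in> ZI"
  shows "[gnorm (x + of_int P * v) = gnorm x] (mod P)"
proof -
  obtain a b where x: "x = of_int a + \<i> * of_int b" using assms(1) by (rule ZI_cases)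
  obtain c d where v: "v = of_int c + \<i> * of_int d" using assms(2) by (rule ZI_cases)
  have "x + of_int P * v = of_int (a + P * c) + \<i> * of_int (b + P * d)"
    unfolding x v by (simp add: algebra_simps)
  hence "gnorm (x + of_int P * v) = (a + P * c)\<^sup>2 + (b + P * d)\<^sup>2" by (simp only: gnorm_gi)
  moreover have "gnorm x = a\<^sup>2 + b\<^sup>2" unfolding x by (rule gnorm_gi)
  moreover have "(a + P * c)\<^sup>2 + (b + P * d)\<^sup>2 - (a\<^sup>2 + b\<^sup>2) = P * (2 * a * c + P * c\<^sup>2 + 2 * b * d + P * d\<^sup>2)"
    by (simp add: power2_eq_square algebra_simps)
  ultimately show ?thesis by (metis cong_iff_dvd_diff dvd_triv_left)
qed

text \<open>For \<open>r^2 = -1\<close> the power \<open>r ^ ((l - 1) div 2)\<close> is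
  \<open>(-1)\<close> to the even exponent \<open>(l - 1) div 4\<close>, so \<open>r\<close> is a
  square by Euler's criterion, and then 2 is one.\<close>

lemma QuadRes_2_if_mod_8:
  assumes "prime (l :: nat)" "l mod 8 = 1" shows "QuadRes (int l) 2"
proof -
  have l4: "l mod 4 = 1" using assms(2) by presburger
  obtain m where m: "l = 8 * m + 1" using assms(2) mult_div_mod_eq[of 8 l] by metis
  have l2: "l > 2" using m assms(1) prime_gt_1_nat[of l] by (cases m) auto
  obtain r where r: "int l dvd r\<^sup>2 + 1" using sqrt_minus_one_mod_prime assms(1) l4 by blast
  hence r2: "[r\<^sup>2 = -1] (mod int l)" by (simp add: cong_iff_dvd_diff)
  have "(l - 1) div 2 = 2 * (2 * m)" using m by simp
  hence e: "[Legendre r (int l) = (r\<^sup>2) ^ (2 * m)] (mod int l)"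
    using euler_criterion[OF assms(1) l2, of r] by (simp only: power_mult)
  have "[(r\<^sup>2) ^ (2 * m) = (-1) ^ (2 * m)] (mod int l)" by (rule cong_pow[OF r2])
  hence L1: "[Legendre r (int l) = 1] (mod int l)" using e cong_trans by fastforce
  have "QuadRes (int l) r"
  proof (rule ccontr)
    assume "\<not> QuadRes (int l) r"
    hence "Legendre r (int l) = 0 \<or> Legendre r (int l) = -1" by (auto simp: Legendre_def)
    hence "int l dvd 1 \<or> int l dvd 2" using L1 by (auto simp: cong_iff_dvd_diff dvd_diff_commute)
    thus False using l2 zdvd_imp_le[of "int l" 1] zdvd_imp_le[of "int l" 2] by auto
  qed
  thus ?thesis using QuadRes_2_if_fourth_root[OF r] by blast
qed

lemma square_diff_mod_4:
  fixes a b :: int assumes "even (a\<^sup>2 - b\<^sup>2)" shows "4 dvd a\<^sup>2 - b\<^sup>2"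
proof -
  have "even (a - b)" "even (a + b)" using assms by simp_all
  then obtain c d where "a - b = 2 * c" "a + b = 2 * d" by (elim evenE)
  hence "a\<^sup>2 - b\<^sup>2 = 4 * (c * d)" by (simp add: power2_eq_square square_diff_square_factored)
  thus ?thesis by simp
qed

text \<open>\<open>R + \<i> I\<close> is a value of \<open>x^2 + \<i> n y^2\<close> at Gaussian
  integers. If \<open>R\<close> is odd then \<open>a * b\<close> is even, and an even
  \<open>I\<close> forces \<open>c^2 - d^2\<close> to be even, hence divisible by 4, so 4 divides
  \<open>I\<close>. The other case exchanges the roles of the two pairs.\<close>

lemma mod_4_obstruction:
  fixes a b c d n R I :: int
  assumes n: "odd n" and R: "a\<^sup>2 - b\<^sup>2 - 2 * (n * (c * d)) = R" and I: "2 * (a * b) + n * (c\<^sup>2 - d\<^sup>2) = I"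
    and RI: "odd R \<and> even I \<and> \<not> 4 dvd I \<or> odd I \<and> even R \<and> \<not> 4 dvd R"
  shows False
proof -
  have four: "4 dvd 2 * y" if "even y" for y :: int using that by (auto elim!: evenE)
  from RI show False
  proof
    assume *: "odd R \<and> even I \<and> \<not> 4 dvd I"
    hence "odd (a\<^sup>2 - b\<^sup>2)" using R by (metis dvd_diff dvd_triv_left)
    hence "even (a * b)" by auto
    hence 1: "4 dvd 2 * (a * b)" by (rule four)
    have "even (2 * (a * b) + n * (c\<^sup>2 - d\<^sup>2))" using * I by simp
    hence "even (n * (c\<^sup>2 - d\<^sup>2))" using dvd_add_right_iff[of 2 "2 * (a * b)"] by simp
    hence "even (c\<^sup>2 - d\<^sup>2)" using n by simp
    hence "4 dvd n * (c\<^sup>2 - d\<^sup>2)" using square_diff_mod_4 dvd_mult by blast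
    with 1 have "4 dvd I" unfolding I[symmetric] by (rule dvd_add)
    thus False using * by simp
  next
    assume *: "odd I \<and> even R \<and> \<not> 4 dvd R"
    hence "odd (n * (c\<^sup>2 - d\<^sup>2))" using I by (metis dvd_add dvd_triv_left)
    hence "even (n * (c * d))" by auto
    hence 1: "4 dvd 2 * (n * (c * d))" by (rule four)
    have "even (a\<^sup>2 - b\<^sup>2 - 2 * (n * (c * d)))" using * R by simp
    hence "even (a\<^sup>2 - b\<^sup>2)" by simp
    hence "4 dvd a\<^sup>2 - b\<^sup>2" by (rule square_diff_mod_4)
    from this 1 have "4 dvd R" unfolding R[symmetric] by (rule dvd_diff)
    thus False using * by simp
  qed
qed

lemma i_power_cases: "\<i> ^ j \<in> {1, -1, \<i>, -\<i>}"
  by (induction j) auto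

context prime_pair
begin

text \<open>Modulo \<open>q\<close> the form is just \<open>x^2\<close>, and the norm of a square is
  a square.\<close>

lemma norm_form_gnorm:
  assumes "x \<in> ZI" "y \<in> ZI" "z \<in> ZI" and eq: "x\<^sup>2 + \<i> * of_nat (p * q) * y\<^sup>2 = \<i> ^ j * z"
  shows "QuadRes (int q) (gnorm z)"
proof -
  have "gnorm (\<i> ^ j * z) = gnorm (\<i> ^ j) * gnorm z" using assms by (intro gnorm_mult) auto
  moreover have "gnorm (\<i> ^ j) = 1" using gnorm_1_iff[of "\<i> ^ j"] by auto
  moreover have "x\<^sup>2 + of_int (int q) * (\<i> * of_nat p * y\<^sup>2) = \<i> ^ j * z" using eq by (simp add: mult_ac)
  moreover have "[gnorm (x\<^sup>2 + of_int (int q) * (\<i> * of_nat p * y\<^sup>2)) = gnorm (x\<^sup>2)] (mod int q)"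
    using assms by (intro gnorm_add_multiple) auto
  moreover have "gnorm (x\<^sup>2) = (gnorm x)\<^sup>2" using assms gnorm_mult[of x x] by (simp add: power2_eq_square)
  ultimately have "[gnorm z = (gnorm x)\<^sup>2] (mod int q)" by simp
  thus ?thesis using QuadRes_cong QuadRes_square by blast
qed

text \<open>The norm \<open>p\<close> would be a square modulo \<open>q\<close>, so 2 is a
  non-residue modulo \<open>p\<close> and \<open>p\<close> is not 1 modulo 8. Hence \<open>f\<close>
  is odd, and for every unit one coordinate of the right side is odd and the other is 2 modulo
  4.\<close>

lemma H1_obstruction:
  assumes ef: "int p = e\<^sup>2 + (2 * f)\<^sup>2" and Z: "x \<in> ZI" "y \<in> ZI"
    and eq: "x\<^sup>2 + \<i> * of_nat (p * q) * y\<^sup>2 = \<i> ^ j * (of_int e + 2 * \<i> * of_int f)"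
  shows False
proof -
  have z: "of_int e + 2 * \<i> * of_int f = of_int e + \<i> * of_int (2 * f)" by simp
  have zZ: "of_int e + 2 * \<i> * of_int f \<in> ZI" unfolding z by auto
  have "gnorm (of_int e + 2 * \<i> * of_int f) = int p" unfolding z gnorm_gi ef ..
  hence "QuadRes (int q) (int p)" using norm_form_gnorm[OF Z zZ eq] by simp
  hence "\<not> QuadRes (int p) 2" using nonres by blast
  hence p8: "p mod 8 \<noteq> 1" using QuadRes_2_if_mod_8 primes by blast
  have "odd (int p)" using gt2 by simp
  hence e: "odd e" unfolding ef by simp
  have f: "odd f"
  proof
    assume "even f"
    then obtain g where g: "f = 2 * g" by (elim evenE)
    have "int ((nat \<bar>e\<bar>)\<^sup>2 mod 8) = 1" using odd_square_mod_8[of "nat \<bar>e\<bar>"] e by (simp add: even_nat_iff)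
    hence "e\<^sup>2 mod 8 = 1" by (simp add: zmod_int)
    moreover define h where "h = 2 * g\<^sup>2"
    have "int p = e\<^sup>2 + 8 * h" unfolding ef g h_def by (simp add: power_mult_distrib)
    hence "int p mod 8 = e\<^sup>2 mod 8" by simp
    ultimately have "int p mod 8 = 1" by simp
    hence "int (p mod 8) = 1" by (simp add: zmod_int)
    thus False using p8 by simp
  qed
  obtain a b where x: "x = of_int a + \<i> * of_int b" using Z(1) by (rule ZI_cases)
  obtain c d where y: "y = of_int c + \<i> * of_int d" using Z(2) by (rule ZI_cases)
  let ?n = "int (p * q)"
  have n: "odd ?n" using gt2 by simp
  let ?R = "a\<^sup>2 - b\<^sup>2 - 2 * (?n * (c * d))" and ?I = "2 * (a * b) + ?n * (c\<^sup>2 - d\<^sup>2)"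
  have form: "x\<^sup>2 + \<i> * of_nat (p * q) * y\<^sup>2 = of_int ?R + \<i> * of_int ?I"
    unfolding x y by (simp add: algebra_simps power2_eq_square)
  have inj: "a1 = a2 \<and> b1 = b2" if "of_int a1 + \<i> * of_int b1 = (of_int a2 + \<i> * of_int b2 :: complex)" for a1 a2 b1 b2 :: int
    using that by (simp add: complex_eq_iff)
  have two: "even (2 * f)" "\<not> 4 dvd 2 * f" "even (- (2 * f))" "\<not> 4 dvd - (2 * f)" using f by presburger+
  from i_power_cases[of j] consider "\<i> ^ j = 1" | "\<i> ^ j = -1" | "\<i> ^ j = \<i>" | "\<i> ^ j = -\<i>" by blast
  thus False
  proof cases
    case 1
    have "of_int ?R + \<i> * of_int ?I = of_int e + \<i> * of_int (2 * f)" using eq unfolding form 1 by simp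
    from inj[OF this] show False using mod_4_obstruction[OF n refl refl] e two by metis
  next
    case 2
    have "of_int ?R + \<i> * of_int ?I = of_int (- e) + \<i> * of_int (- (2 * f))" using eq unfolding form 2 by simp
    from inj[OF this] show False using mod_4_obstruction[OF n refl refl] e two by (metis dvd_minus_iff)
  next
    case 3
    have "of_int ?R + \<i> * of_int ?I = of_int (- (2 * f)) + \<i> * of_int e"
      using eq unfolding form 3 by (simp add: algebra_simps)
    from inj[OF this] show False using mod_4_obstruction[OF n refl refl] e two by metis
  next
    case 4
    have "of_int ?R + \<i> * of_int ?I = of_int (2 * f) + \<i> * of_int (- e)"
      using eq unfolding form 4 by (simp add: algebra_simps)
    from inj[OF this] show False using mod_4_obstruction[OF n refl refl] e two by (metis dvd_minus_iff)
  qed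
qed

text \<open>Modulo \<open>q\<close> the equation reads \<open>x^2 = \<i>^j p\<close>; after
  cancelling \<open>p\<close> it reads \<open>\<i> q y^2 = \<i>^j\<close> modulo \<open>p\<close>.
  For even \<open>j\<close> the first gives \<open>(p/q) = 1\<close>, and the second makes the
  residue of \<open>\<i>\<close> a square modulo \<open>p\<close>, so \<open>(2/p) = 1\<close>. For
  odd \<open>j\<close> the second gives \<open>(p/q) = 1\<close> by reciprocity, and the first gives
  \<open>(2/q) = 1\<close>.\<close>

lemma H1H2_obstruction:
  assumes Z: "x \<in> ZI" "y \<in> ZI" and eq: "x\<^sup>2 + \<i> * of_nat (p * q) * y\<^sup>2 = \<i> ^ j * of_nat p"
  shows False
proof -
  have p0: "complex_of_nat p \<noteq> 0" using gt2 by simp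
  have "x\<^sup>2 = of_nat p * (\<i> ^ j - \<i> * of_nat q * y\<^sup>2)" using eq by (simp add: algebra_simps)
  hence "of_nat p gdvd x\<^sup>2" using Z by (intro gdvdI[of "\<i> ^ j - \<i> * of_nat q * y\<^sup>2"]) auto
  hence "of_nat p gdvd x" using gdvd_prime_square primes Z by blast
  then obtain x' where x': "x' \<in> ZI" "x = of_nat p * x'" by (auto simp: gdvd_def)
  have "of_nat p * (of_nat p * x'\<^sup>2 + \<i> * of_nat q * y\<^sup>2) = of_nat p * \<i> ^ j"
    using eq unfolding x'(2) by (simp add: power2_eq_square algebra_simps)
  hence eq2: "of_nat p * x'\<^sup>2 + \<i> * of_nat q * y\<^sup>2 = \<i> ^ j" using p0 by (simp only: mult_cancel_left) simp
  obtain r where r: "int p dvd r\<^sup>2 + 1" using sqrt_minus_one_mod_prime primes by blast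
  obtain t where t: "int q dvd t\<^sup>2 + 1" using sqrt_minus_one_mod_prime primes by blast
  have rp: "[gred r (\<i> ^ j) = r ^ j] (mod int p)" using gred_power[OF r, of \<i> j] by simp
  have tp: "[gred t (\<i> ^ j * of_int (int p)) = t ^ j * int p] (mod int q)"
    using gred_unit_mult[OF t, of "of_int (int p)" j] by simp
  have "[gred t (x\<^sup>2 + of_int (int q) * (\<i> * of_nat p * y\<^sup>2)) = (gred t x)\<^sup>2] (mod int q)"
    using Z by (intro gred_square_plus t) auto
  moreover have "x\<^sup>2 + of_int (int q) * (\<i> * of_nat p * y\<^sup>2) = \<i> ^ j * of_int (int p)" using eq by (simp add: mult_ac)
  ultimately have T: "QuadRes (int q) (t ^ j * int p)" using tp QuadRes_square QuadRes_cong by metis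
  define v where "v = \<i> * of_nat q * y\<^sup>2"
  have v: "v \<in> ZI" using Z by (auto simp: v_def)
  have "gred r (\<i> ^ j) = gred r (of_int (int p) * x'\<^sup>2) + gred r v"
    unfolding eq2[symmetric] v_def using Z x' by (subst gred_add) auto
  moreover have pd: "of_int (int p) gdvd of_int (int p) * x'\<^sup>2"
    by (rule gdvdI[of "x'\<^sup>2"]) (use x' in auto)
  have "int p dvd gred r (of_int (int p) * x'\<^sup>2)" by (rule gred_gdvd[OF r pd]) simp_all
  ultimately have 1: "[gred r (\<i> ^ j) = gred r v] (mod int p)" by (simp add: cong_iff_dvd_diff)
  have "[gred r v = gred r (\<i> * of_nat q) * gred r (y\<^sup>2)] (mod int p)"
    unfolding v_def using Z by (intro gred_mult r) auto
  moreover have "[gred r (\<i> * of_nat q) * gred r (y\<^sup>2) = (r * int q) * (gred r y)\<^sup>2] (mod int p)"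
    using gred_mult[OF r, of \<i> "of_nat q"] gred_power[OF r Z(2), of 2] by (intro cong_mult) auto
  ultimately have R: "[r * int q * (gred r y)\<^sup>2 = r ^ j] (mod int p)"
    using 1 rp by (meson cong_sym cong_trans)
  have nr: "\<not> int p dvd r" "\<not> int q dvd t" using not_dvd_sqrt_minus_one prime_int r t by blast+
  hence nrj: "\<not> int p dvd r ^ m" "\<not> int q dvd t ^ m" for m using prime_int prime_dvd_power by blast+
  hence ny: "\<not> int p dvd gred r y" using R cong_dvd_iff[OF R] by (auto simp: power2_eq_square)
  show False
  proof (cases "even j")
    case True
    then obtain m where m: "j = 2 * m" by (elim evenE)
    have sq: "r ^ j = (r ^ m)\<^sup>2" "t ^ j = (t ^ m)\<^sup>2"
      unfolding m power_mult[symmetric] mult.commute[of m] by (rule refl)+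
    have "QuadRes (int q) (int p * (t ^ m)\<^sup>2)" using T unfolding sq by (simp add: mult.commute)
    hence qp: "QuadRes (int q) (int p)" using QuadRes_cancel_square[OF prime_int(2)] nrj by blast
    have "QuadRes (int p) (r * int q * (gred r y)\<^sup>2)" using QuadRes_cong[OF R] QuadRes_square[of "int p" "r ^ m"] unfolding sq by blast
    hence "QuadRes (int p) (int q * r)" using QuadRes_cancel_square[OF prime_int(1)] ny by (simp add: mult.commute)
    hence "QuadRes (int p) r" using QuadRes_cancel[OF prime_int(1)] qp recip not_dvd by blast
    hence "QuadRes (int p) 2" using QuadRes_2_if_fourth_root[OF r] by blast
    thus False using qp nonres by blast
  next
    case False
    then obtain m where m: "j = 2 * m + 1" by (elim oddE)
    have sq: "r ^ j = r * (r ^ m)\<^sup>2" "t ^ j = t * (t ^ m)\<^sup>2"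
      unfolding m power_mult[symmetric] mult.commute[of m] by simp_all
    have "[r * (int q * (gred r y)\<^sup>2) = r * (r ^ m)\<^sup>2] (mod int p)" using R unfolding sq by (simp add: mult.assoc)
    moreover have "coprime r (int p)" using nr(1) prime_int(1) prime_imp_coprime coprime_commute by blast
    ultimately have "[int q * (gred r y)\<^sup>2 = (r ^ m)\<^sup>2] (mod int p)" using cong_mult_lcancel by blast
    hence "QuadRes (int p) (int q * (gred r y)\<^sup>2)" using QuadRes_cong QuadRes_square by blast
    hence pq: "QuadRes (int q) (int p)" using QuadRes_cancel_square[OF prime_int(1)] ny recip by blast
    have "QuadRes (int q) ((int p * t) * (t ^ m)\<^sup>2)" using T unfolding sq by (simp add: mult_ac)
    hence "QuadRes (int q) (int p * t)" using QuadRes_cancel_square[OF prime_int(2)] nrj by blast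
    hence "QuadRes (int q) t" using QuadRes_cancel[OF prime_int(2)] pq not_dvd by blast
    hence "QuadRes (int q) 2" using QuadRes_2_if_fourth_root[OF t] by blast
    thus False using pq nonres by blast
  qed
qed

text \<open>Norms modulo \<open>q\<close> make \<open>2 p\<close> a square there. Elimination of the
  unit \<open>\<i>^j\<close> leads to \<open>\<i> q Y^2 = -2\<close> at the prime
  \<open>cnj z\<close>; as \<open>-2 = \<i> (1 + \<i>)^2\<close>, this makes \<open>q\<close> a
  square modulo \<open>p\<close>. So \<open>(p/q) = 1\<close>, and then
  \<open>(2/q) = 1\<close>.\<close>

lemma H0H1_obstruction:
  assumes z: "zfactor p z" and Z: "x \<in> ZI" "y \<in> ZI"
    and eq: "x\<^sup>2 + \<i> * of_nat (p * q) * y\<^sup>2 = \<i> ^ j * ((1 + \<i>) * z)"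
  shows False
proof -
  have zZ: "z \<in> ZI" "gnorm z = int p" using z by (auto simp: zfactor_def)
  have gp: "gprime z" using gprime_if_prime_gnorm[OF zZ(1)] zZ(2) prime_int by simp
  note z0 = gprimeD(2)[OF gp]
  have i: "(1 + \<i>) = of_int 1 + \<i> * of_int 1" by simp
  have "gnorm ((1 + \<i>) * z) = gnorm (1 + \<i>) * gnorm z" using zZ by (intro gnorm_mult) auto
  also have "gnorm (1 + \<i>) = 2" unfolding i gnorm_gi by simp
  finally have g2: "gnorm ((1 + \<i>) * z) = int p * 2" using zZ by simp
  have "(1 + \<i>) * z \<in> ZI" using zZ by auto
  from norm_form_gnorm[OF Z this eq] have qp2: "QuadRes (int q) (int p * 2)" unfolding g2 .
  have zz: "of_nat p = z * cnj z" using zfactor_mult_cnj[OF z] by simp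
  have npq: "of_nat (p * q) = z * cnj z * of_nat q" using zz by simp
  have "x\<^sup>2 = z * (\<i> ^ j * (1 + \<i>) - \<i> * cnj z * of_nat q * y\<^sup>2)" using eq unfolding npq by (simp add: algebra_simps)
  hence "z gdvd x * x" using Z zZ by (intro gdvdI[of "\<i> ^ j * (1 + \<i>) - \<i> * cnj z * of_nat q * y\<^sup>2"]) (auto simp: power2_eq_square)
  hence "z gdvd x" using gprimeD(4)[OF gp Z(1,1)] by blast
  then obtain x' where x': "x' \<in> ZI" "x = z * x'" by (auto simp: gdvd_def)
  have "z * (z * x'\<^sup>2 + \<i> * cnj z * of_nat q * y\<^sup>2) = z * (\<i> ^ j * (1 + \<i>))"
    using eq unfolding npq x'(2) by (simp add: power2_eq_square algebra_simps)
  hence "z * x'\<^sup>2 + \<i> * cnj z * of_nat q * y\<^sup>2 = \<i> ^ j * (1 + \<i>)" using z0 by (simp only: mult_cancel_left) simp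
  hence "cnj (z * x'\<^sup>2 + \<i> * cnj z * of_nat q * y\<^sup>2) = cnj (\<i> ^ j * (1 + \<i>))" by simp
  hence eqc: "cnj z * (cnj x')\<^sup>2 - \<i> * z * of_nat q * (cnj y)\<^sup>2 = cnj (\<i> ^ j) * (1 - \<i>)" by simp
  text \<open>Multiplying the two equations gives a congruence modulo \<open>cnj z\<close> free of \<open>j\<close>.\<close>
  have unit: "\<i> ^ j * cnj (\<i> ^ j) = 1" by (simp flip: power_mult_distrib)
  have "(\<i> * z * of_nat q * (cnj y)\<^sup>2) * x\<^sup>2 = (cnj z * (cnj x')\<^sup>2 - cnj (\<i> ^ j) * (1 - \<i>)) * x\<^sup>2"
    unfolding eqc[symmetric] by simp
  also have "\<dots> = cnj z * ((cnj x')\<^sup>2 * x\<^sup>2) - cnj (\<i> ^ j) * (1 - \<i>) * x\<^sup>2" by (simp only: left_diff_distrib mult.assoc)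
  finally have A: "(\<i> * z * of_nat q * (cnj y)\<^sup>2) * x\<^sup>2 = cnj z * ((cnj x')\<^sup>2 * x\<^sup>2) - cnj (\<i> ^ j) * (1 - \<i>) * x\<^sup>2" .
  define v where "v = cnj (\<i> ^ j) * (1 - \<i>) * (\<i> * z * of_nat q * y\<^sup>2)"
  have x2: "x\<^sup>2 = \<i> ^ j * ((1 + \<i>) * z) - \<i> * of_nat (p * q) * y\<^sup>2" using eq by (simp add: algebra_simps)
  have "cnj (\<i> ^ j) * (1 - \<i>) * x\<^sup>2 = (\<i> ^ j * cnj (\<i> ^ j)) * ((1 - \<i>) * (1 + \<i>) * z)
      - cnj (\<i> ^ j) * (1 - \<i>) * (\<i> * of_nat (p * q) * y\<^sup>2)"
    unfolding x2 by (simp only: right_diff_distrib mult_ac)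
  also have "\<dots> = 2 * z - cnj z * v" unfolding unit npq v_def by (simp add: algebra_simps)
  finally have B: "cnj (\<i> ^ j) * (1 - \<i>) * x\<^sup>2 = 2 * z - cnj z * v" .
  have "z * (\<i> * of_nat q * (cnj y)\<^sup>2 * x\<^sup>2 + 2) = (\<i> * z * of_nat q * (cnj y)\<^sup>2) * x\<^sup>2 + 2 * z"
    by (simp add: algebra_simps)
  also have "\<dots> = cnj z * ((cnj x')\<^sup>2 * x\<^sup>2 + v)" unfolding A B by (simp add: algebra_simps)
  finally have main: "z * (\<i> * of_nat q * (cnj y)\<^sup>2 * x\<^sup>2 + 2) = cnj z * ((cnj x')\<^sup>2 * x\<^sup>2 + v)" .
  have gpc: "gprime (cnj z)" using gprime_if_prime_gnorm[of "cnj z"] zZ prime_int by (simp add: gnorm_cnj)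
  have "cnj z gdvd z * (\<i> * of_nat q * (cnj y)\<^sup>2 * x\<^sup>2 + 2)"
    unfolding main by (rule gdvdI[OF _ refl]) (use zZ Z x' in \<open>auto simp: v_def\<close>)
  moreover have "\<not> cnj z gdvd z"
    using prime_gnorm_not_gdvd_cnj[of "int p" "cnj z"] zZ prime_int gt2 by (simp add: gnorm_cnj)
  moreover have mZ: "\<i> * of_nat q * (cnj y)\<^sup>2 * x\<^sup>2 + 2 \<in> ZI" using Z by auto
  ultimately have dv: "cnj z gdvd \<i> * of_nat q * (cnj y)\<^sup>2 * x\<^sup>2 + 2"
    using gprimeD(4)[OF gpc zZ(1)] by blast
  obtain a b where ab: "z = of_int a + \<i> * of_int b" using zZ(1) by (rule ZI_cases)
  have pab: "int p = a\<^sup>2 + b\<^sup>2" using zZ(2) unfolding ab gnorm_gi by simp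
  have nb: "\<not> int p dvd b"
  proof
    assume b: "int p dvd b"
    hence "int p dvd b\<^sup>2" by (simp add: power2_eq_square)
    moreover have "int p dvd a\<^sup>2 + b\<^sup>2" using pab by simp
    ultimately have "int p dvd a\<^sup>2" by (simp add: dvd_add_left_iff)
    hence "int p dvd a" using prime_int prime_dvd_power by blast
    hence "(int p)\<^sup>2 dvd a\<^sup>2 + b\<^sup>2" using b by (intro dvd_add dvd_power_same)
    hence "(int p)\<^sup>2 dvd int p" using pab by simp
    hence "(int p)\<^sup>2 \<le> int p" using gt2 by (intro zdvd_imp_le) auto
    moreover have "int p * 1 < int p * int p" using gt2 by (intro mult_strict_left_mono) auto
    ultimately show False by (simp add: power2_eq_square)
  qed
  hence "coprime b (int p)" using prime_int(1) prime_imp_coprime coprime_commute by blast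
  then obtain b' where b': "[b * b' = 1] (mod int p)" using cong_solve_coprime_int by blast
  \<comment> \<open>The residue of \<open>\<i>\<close> at \<open>cnj z = a - \<i> b\<close> is
    \<open>a / b\<close> modulo \<open>p\<close>.\<close>
  define r where "r = a * b'"
  have rb: "[b * r = a] (mod int p)"
  proof -
    have "[a * (b * b') = a * 1] (mod int p)" by (intro cong_mult cong_refl b')
    thus ?thesis by (simp add: r_def mult_ac)
  qed
  have r: "int p dvd r\<^sup>2 + 1"
  proof -
    have "[b\<^sup>2 * r\<^sup>2 = a\<^sup>2] (mod int p)" using cong_pow[OF rb, of 2] by (simp add: power_mult_distrib)
    hence "int p dvd b\<^sup>2 * r\<^sup>2 - a\<^sup>2" by (simp only: cong_iff_dvd_diff)
    moreover have "int p dvd a\<^sup>2 + b\<^sup>2" using pab by simp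
    ultimately have "int p dvd (b\<^sup>2 * r\<^sup>2 - a\<^sup>2) + (a\<^sup>2 + b\<^sup>2)" by (rule dvd_add)
    moreover have "(b\<^sup>2 * r\<^sup>2 - a\<^sup>2) + (a\<^sup>2 + b\<^sup>2) = b\<^sup>2 * (r\<^sup>2 + 1)" by (simp add: algebra_simps)
    ultimately have "int p dvd b\<^sup>2 * (r\<^sup>2 + 1)" by simp
    thus ?thesis using nb prime_int(1) prime_dvd_mult_iff prime_dvd_power by blast
  qed
  have "gred r (cnj z) = a - b * r" unfolding ab by (simp add: gred_def)
  hence "int p dvd gred r (cnj z)" using cong_sym[OF rb] by (simp add: cong_iff_dvd_diff)
  hence "int p dvd gred r (\<i> * of_nat q * (cnj y)\<^sup>2 * x\<^sup>2 + 2)"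
    using gred_gdvd[OF r dv] zZ by auto
  also have "gred r (\<i> * of_nat q * (cnj y)\<^sup>2 * x\<^sup>2 + 2) = gred r (\<i> * of_nat q * (cnj y)\<^sup>2 * x\<^sup>2) + 2"
    using Z by (subst gred_add) auto
  finally have d1: "int p dvd gred r (\<i> * of_nat q * (cnj y)\<^sup>2 * x\<^sup>2) + 2" .
  define Y where "Y = gred r (cnj y * x)"
  have "\<i> * of_nat q * (cnj y)\<^sup>2 * x\<^sup>2 = (\<i> * of_nat q) * (cnj y * x)\<^sup>2" by (simp add: power_mult_distrib mult_ac)
  moreover have "[gred r ((\<i> * of_nat q) * (cnj y * x)\<^sup>2) = gred r (\<i> * of_nat q) * gred r ((cnj y * x)\<^sup>2)] (mod int p)"
    using Z by (intro gred_mult r) auto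
  moreover have "[gred r (\<i> * of_nat q) * gred r ((cnj y * x)\<^sup>2) = (r * int q) * Y\<^sup>2] (mod int p)"
    unfolding Y_def using gred_mult[OF r, of \<i> "of_nat q"] gred_power[OF r, of "cnj y * x" 2] Z by (intro cong_mult) auto
  ultimately have "[gred r (\<i> * of_nat q * (cnj y)\<^sup>2 * x\<^sup>2) = r * int q * Y\<^sup>2] (mod int p)"
    using cong_trans by metis
  hence "[gred r (\<i> * of_nat q * (cnj y)\<^sup>2 * x\<^sup>2) + 2 = r * int q * Y\<^sup>2 + 2] (mod int p)" by (intro cong_add cong_refl)
  hence d2: "int p dvd r * int q * Y\<^sup>2 + 2" using d1 cong_dvd_iff by blast
  \<comment> \<open>The subtracted multiple of \<open>r^2 + 1\<close> rewrites 2 as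
    \<open>- r (1 + r)^2\<close>.\<close>
  have "int p dvd (r * int q * Y\<^sup>2 + 2) - (r\<^sup>2 + 1) * (2 + r)"
    using d2 r by (intro dvd_diff) auto
  moreover have "(r * int q * Y\<^sup>2 + 2) - (r\<^sup>2 + 1) * (2 + r) = r * (int q * Y\<^sup>2 - (1 + r)\<^sup>2)"
    by (simp add: power2_eq_square algebra_simps)
  ultimately have "int p dvd r * (int q * Y\<^sup>2 - (1 + r)\<^sup>2)" by simp
  hence "int p dvd int q * Y\<^sup>2 - (1 + r)\<^sup>2"
    using not_dvd_sqrt_minus_one[OF prime_int(1) r] prime_dvd_multD[OF prime_int(1)] by blast
  hence "[int q * Y\<^sup>2 = (1 + r)\<^sup>2] (mod int p)" by (simp only: cong_iff_dvd_diff)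
  hence "QuadRes (int p) (int q * Y\<^sup>2)" using QuadRes_cong QuadRes_square by blast
  moreover have "\<not> int p dvd Y"
  proof
    assume "int p dvd Y"
    hence "int p dvd r * int q * Y\<^sup>2" by (simp add: power2_eq_square)
    hence "int p dvd 2" using d2 by (simp add: dvd_add_right_iff)
    thus False using not_dvd by blast
  qed
  ultimately have "QuadRes (int q) (int p)" using QuadRes_cancel_square[OF prime_int(1)] recip by blast
  moreover from this have "QuadRes (int q) 2" using QuadRes_cancel[OF prime_int(2) qp2] not_dvd by blast
  ultimately show False using nonres by blast
qed

end

section \<open>Capitulation in \<open>k(\<surd>p)\<close>\<close>

lemma is_subfield_Rats: "is_subfield \<rat>"
  by (auto simp: is_subfield_def)

lemma is_subfield_Reals: "is_subfield \<real>"
  by (auto simp: is_subfield_def)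

lemma Qadj_triple_eq_qext:
  assumes "is_subfield (Qadj [a, b])" "c\<^sup>2 \<in> Qadj [a, b]"
  shows "Qadj [a, b, c] = qext (Qadj [a, b]) c"
proof
  show "Qadj [a, b, c] \<subseteq> qext (Qadj [a, b]) c"
    using qext_contains[OF assms(1)] Qadj_base[of a "[a, b]"] Qadj_base[of b "[a, b]"]
    by (intro Qadj_least is_subfield_qext assms) auto
  show "qext (Qadj [a, b]) c \<subseteq> Qadj [a, b, c]"
    by (intro qext_least is_subfield_Qadj Qadj_least) (auto intro: Qadj_base)
qed

lemma Rats_square_eq_nat:
  fixes x :: real and N :: nat
  assumes "x \<in> \<rat>" "x\<^sup>2 = of_nat N" shows "sqrt (of_nat N) \<in> \<rat>"
proof -
  have "sqrt (of_nat N) = \<bar>x\<bar>" unfolding assms(2)[symmetric] by simp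
  thus ?thesis using assms(1) by simp
qed

context prime_pair
begin

definition rt :: "nat \<Rightarrow> complex" where "rt l = csqrt (of_nat l)"

abbreviation KK :: "nat \<Rightarrow> complex set" where "KK l \<equiv> Qadj [s, \<i>, rt l]"

lemma rt_eq: "rt l = of_real (sqrt (of_nat l))"
  using csqrt_of_real_nonneg[of "of_nat l"] by (simp add: rt_def)

lemma rt_sq: "rt l * rt l = of_nat l"
  using power2_csqrt[of "of_nat l"] unfolding rt_def power2_eq_square .

lemma ss: "s * s = of_nat (2 * p * q)"
  using s_sq by (simp add: power2_eq_square)

lemma irrational_if_prime_exact:
  assumes "prime (P :: nat)" "P dvd N" "\<not> P\<^sup>2 dvd N" shows "\<not> (\<exists>x\<in>\<rat>. x\<^sup>2 = real N)"
  using Rats_square_eq_nat sqrt_nat_irrational[OF assms] by blast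

lemma odd_ll: "l = p \<or> l = q \<Longrightarrow> odd (l * (p * q))" "l = p \<or> l = q \<Longrightarrow> odd (3 * l * (p * q))"
  using gt2 by auto

lemma not_4_dvd_double_odd: "odd (m :: nat) \<Longrightarrow> \<not> 2\<^sup>2 dvd 2 * m"
  by (auto simp: power2_eq_square)

text \<open>Squaring \<open>a + b w\<close> leaves a rational number only if
  \<open>a * b = 0\<close>. So \<open>\<surd>l\<close> or \<open>\<surd>l * s\<close> would lie in
  \<open>QI\<close>, although these are real square roots of numbers exactly divisible by
  \<open>l\<close> or by 2.\<close>

lemma rt_not_k:
  assumes l: "l = p \<or> l = q" shows "rt l \<notin> k"
proof
  assume "rt l \<in> k"
  then obtain a b where ab: "a \<in> QI" "b \<in> QI" "rt l = a + b * w" unfolding k_eq by (rule qextE)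
  have "of_nat l + 0 * w = (a * a + b * b * (w\<^sup>2)) + (2 * a * b) * w"
    unfolding rt_sq[symmetric] ab(3) by (simp add: algebra_simps power2_eq_square)
  moreover have two: "(2 :: complex) \<in> QI" using of_nat_QI[of 2] by simp
  moreover have "a * a + b * b * (w\<^sup>2) \<in> QI" "2 * a * b \<in> QI" "0 \<in> QI"
    by (intro is_subfieldD(1,3,5)[OF is_subfield_QI] ab two base.sq)+
  ultimately have "0 = 2 * a * b" using base.basis_unique(2)[OF of_nat_QI] by blast
  hence "a = 0 \<or> b = 0" by simp
  thus False
  proof
    assume "b = 0"
    hence "rt l \<in> QI" using ab by simp
    hence "sqrt (of_nat l) \<in> \<rat>" by (simp add: QI_def rt_eq)
    moreover have "prime l" using l primes by blast
    ultimately show False using sqrt_nat_irrational[of l l] prime_gt_1_nat[of l] by (auto simp: power2_eq_square)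
  next
    assume "a = 0"
    hence "rt l * s = b * (w * s)" using ab by simp
    also have "w * s = (s * s) / (1 + \<i>)" by (simp add: w_def)
    also have "b * ((s * s) / (1 + \<i>)) \<in> QI" unfolding ss using ab
      by (intro is_subfieldD(5,8)[OF is_subfield_QI] of_nat_QI i_QI)
    finally have "rt l * s \<in> QI" .
    moreover have "rt l * s = of_real (sqrt (of_nat (2 * (l * (p * q)))))"
      unfolding rt_eq s_eq of_real_mult[symmetric] real_sqrt_mult[symmetric] of_nat_mult[symmetric]
      by (simp only: mult_ac)
    ultimately have "sqrt (of_nat (2 * (l * (p * q)))) \<in> \<rat>" by (simp add: QI_def)
    moreover have "\<not> 2\<^sup>2 dvd 2 * (l * (p * q))" using odd_ll(1)[OF l] by (rule not_4_dvd_double_odd)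
    ultimately show False using sqrt_nat_irrational[of 2 "2 * (l * (p * q))"] by simp
  qed
qed

lemma KK_ext:
  assumes l: "l = p \<or> l = q"
  shows "KK l = qext k (rt l)" "quad_ext k (rt l)"
proof -
  have "(rt l)\<^sup>2 \<in> k" unfolding power2_eq_square rt_sq using OK_D(1)[OF ZI_k[of "of_nat l"]] by auto
  thus "KK l = qext k (rt l)" "quad_ext k (rt l)"
    using Qadj_triple_eq_qext[OF k_field] rt_not_k[OF l] k_field by (auto simp: quad_ext_def)
qed

lemma KK_field: "is_subfield (KK l)" by (rule is_subfield_Qadj)

lemma k_KK: "k \<subseteq> KK l"
  by (intro Qadj_least is_subfield_Qadj) (auto intro: Qadj_base)

lemma KK_mem: "s \<in> KK l" "\<i> \<in> KK l" "rt l \<in> KK l" "x \<in> ZI \<Longrightarrow> x \<in> KK l"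
  using k_KK ZI_k by (auto intro: Qadj_base dest: OK_D)

lemma capitulation_square:
  assumes l: "l = p \<or> l = q" and I: "nz_ideal k I" and cap: "principal (KK l) (gen_ideal (KK l) I)"
  obtains \<nu> where "\<nu> \<in> O\<^sub>k" "\<nu> \<noteq> 0" "ideal_mult k I I = (*) \<nu> ` O\<^sub>k"
  using quad_ext.capitulates_imp_square_principal[OF KK_ext(2)[OF l] I] cap unfolding KK_ext(1)[OF l] by blast

text \<open>With \<open>\<epsilon> = T + U \<surd>l\<close> of norm \<open>-1\<close>, \<open>2 \<epsilon> (T + \<i>) = (T + \<i> + U \<surd>l)\<^sup>2\<close>, and \<open>T + \<i>\<close> is a Gaussian prime
  above \<open>l\<close> up to a unit and a square.\<close>
lemma capitulates_prime_factor:
  assumes l: "l = p \<or> l = q" and z: "zfactor l z" and H: "ram z H"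
  shows "principal (KK l) (gen_ideal (KK l) H)"
proof -
  have pl: "prime l" "l mod 4 = 1" using l primes by auto
  obtain T U :: nat where TU: "T\<^sup>2 + 1 = l * U\<^sup>2" "even T" using negative_pell_prime[OF pl] .
  define c where "c = of_nat T + \<i>"
  have cZ: "c \<in> ZI" by (auto simp: c_def)
  have cc: "c * cnj c = of_nat (l * U\<^sup>2)" unfolding TU(1)[symmetric]
    by (simp add: c_def algebra_simps power2_eq_square)
  have "odd (l * U\<^sup>2)" unfolding TU(1)[symmetric] using TU(2) by simp
  then obtain b where b: "l * U\<^sup>2 = 2 * b + 1" by (elim oddE)
  \<comment> \<open>Coprimality of \<open>c\<close> and its conjugate: their product is the odd
    number \<open>2 b + 1\<close>, and their difference is \<open>2 \<i>\<close>.\<close>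
  have "of_nat b * \<i> * (c - cnj c) = - 2 * of_nat b" by (simp add: c_def)
  moreover have "c * (cnj c + of_nat b * \<i>) + cnj c * (- of_nat b * \<i>) = c * cnj c + of_nat b * \<i> * (c - cnj c)"
    by (simp add: algebra_simps)
  ultimately have cop: "c * (cnj c + of_nat b * \<i>) + cnj c * (- of_nat b * \<i>) = 1"
    unfolding cc b by simp
  have zZ: "z \<in> ZI" "prime (gnorm z)" "gnorm z = int l" using z pl by (auto simp: zfactor_def)
  have eq: "c * cnj c = of_int (gnorm z) * of_nat (U\<^sup>2)" unfolding cc zZ by simp
  have XY: "cnj c + of_nat b * \<i> \<in> ZI" "- of_nat b * \<i> \<in> ZI" using cZ by auto
  obtain z1 c1 x1 y1 where 1: "z1 = z \<or> z1 = cnj z" "c = z1 * c1" "c1 \<in> ZI" "x1 \<in> ZI" "y1 \<in> ZI"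
    "c1 * x1 + cnj c1 * y1 = 1" "c1 * cnj c1 = of_nat (U\<^sup>2)"
    by (rule gprime_split[OF zZ(1,2) cZ XY _ cop eq]) auto
  have "U \<noteq> 0" using \<open>odd (l * U\<^sup>2)\<close> by (intro notI) simp
  hence U0: "complex_of_nat U \<noteq> 0" by simp
  have sq1: "c1 * cnj c1 = (of_nat U)\<^sup>2" using 1(7) by simp
  obtain j :: nat and g where g: "g \<in> ZI" "g \<noteq> 0" "c1 = \<i> ^ j * g\<^sup>2"
    using ZI_coprime_square[OF 1(3) ZI_closed(11)[OF 1(3)] ZI_closed(5) 1(4,5) 1(6) sq1 U0] .
  have Ur: "(of_nat U * rt l) * (of_nat U * rt l) = c * cnj c"
  proof -
    have "(of_nat U * rt l) * (of_nat U * rt l) = (rt l * rt l) * (of_nat U * of_nat U)" by (simp only: mult_ac)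
    thus ?thesis unfolding rt_sq cc by (simp add: power2_eq_square)
  qed
  define \<epsilon> where "\<epsilon> = of_nat T + of_nat U * rt l"
  define \<epsilon>' where "\<epsilon>' = - of_nat T + of_nat U * rt l"
  have rO: "rt l \<in> OK (KK l)"
  proof (rule OK_I)
    have "(rt l)\<^sup>2 = of_nat l" using rt_sq by (simp add: power2_eq_square)
    thus "algebraic_int (rt l)" by (intro algebraic_int_sqrt_complex[of "rt l"]) (simp add: algebraic_int_ZI)
  qed (rule KK_mem)
  have ZK: "x \<in> OK (KK l)" if "x \<in> ZI" for x using that KK_mem(4) algebraic_int_ZI by (auto simp: OK_def)
  note K = KK_field[of l]
  have \<epsilon>O: "\<epsilon> \<in> OK (KK l)" "\<epsilon>' \<in> OK (KK l)" unfolding \<epsilon>_def \<epsilon>'_def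
    by (intro OK_add[OF K] OK_mult[OF K ZK rO] ZK; simp)+
  have "c * cnj c = of_nat T * of_nat T + 1" by (simp add: c_def algebra_simps)
  hence unit: "\<epsilon> * \<epsilon>' = 1" using Ur by (simp add: \<epsilon>_def \<epsilon>'_def algebra_simps)
  define r where "r = c + of_nat U * rt l"
  \<comment> \<open>The factor 2 is written as \<open>- \<i> (1 + \<i>)^2\<close>, so that dividing
    \<open>r\<close> by \<open>(1 + \<i>) g\<close> leaves an element whose square is
    \<open>z1\<close> times a unit.\<close>
  have rr: "r * r = (1 + \<i>) * (1 + \<i>) * (- \<i> * \<epsilon> * c)"
  proof -
    have "r * r = c * c + 2 * c * (of_nat U * rt l) + (of_nat U * rt l) * (of_nat U * rt l)"
      by (simp add: r_def algebra_simps)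
    also have "\<dots> = c * (c + cnj c + 2 * (of_nat U * rt l))" unfolding Ur by (simp add: algebra_simps)
    also have "c + cnj c + 2 * (of_nat U * rt l) = 2 * \<epsilon>" by (simp add: c_def \<epsilon>_def)
    also have "c * (2 * \<epsilon>) = (1 + \<i>) * (1 + \<i>) * (- \<i> * \<epsilon> * c)" by (simp add: algebra_simps)
    finally show ?thesis .
  qed
  have i1: "1 + \<i> \<noteq> 0" by (simp add: complex_eq_iff)
  define t where "t = r / ((1 + \<i>) * g)"
  define u where "u = - \<i> * \<epsilon> * \<i> ^ j"
  define u' where "u' = \<i> * \<epsilon>' * \<i> ^ (3 * j)"
  have "\<i> ^ j * \<i> ^ (3 * j) = (\<i> ^ 4) ^ j" by (simp flip: power_add power_mult)
  hence ij: "\<i> ^ j * \<i> ^ (3 * j) = 1" by simp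
  have "u * u' = (- \<i> * \<i>) * (\<epsilon> * \<epsilon>') * (\<i> ^ j * \<i> ^ (3 * j))" unfolding u_def u'_def by (simp only: mult_ac mult_minus_left mult_minus_right)
  hence uu: "u * u' = 1" unfolding unit ij by simp
  have uO: "u \<in> OK (KK l)" "u' \<in> OK (KK l)" unfolding u_def u'_def
    by (intro OK_mult[OF K OK_mult[OF K ZK] ZK] \<epsilon>O; auto)+
  have inv: "inverse u = u'" using uu by (rule inverse_unique)
  have u0: "u \<noteq> 0" using uu by auto
  have "t * t * ((1 + \<i>) * (1 + \<i>) * (g * g)) = r * r" using i1 g by (simp add: t_def field_simps)
  also have "\<dots> = z1 * u * ((1 + \<i>) * (1 + \<i>) * (g * g))"
    unfolding rr 1(2) g(3) u_def power2_eq_square by (simp only: mult_ac)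
  finally have tt: "t * t = z1 * u" using i1 g by simp
  have rK: "r \<in> KK l" unfolding r_def using KK_mem cZ by (intro is_subfieldD(3,5)[OF K]) auto
  have tK: "t \<in> KK l" unfolding t_def using rK KK_mem(4) g by (intro is_subfieldD(5,8)[OF K]) auto
  have z10: "z1 \<noteq> 0" using 1(1) zZ ramD(3)[OF H] by auto
  have t0: "t \<noteq> 0" using tt z10 u0 by auto
  note Hd = ramD[OF H]
  note cap = capitulates_square[OF k_field K k_KK Hd(1,4) Hd(6)]
  show ?thesis
  proof (cases "z1 = z")
    case True
    show ?thesis by (rule cap[of t u]) (use tK tt t0 uO inv True in \<open>auto simp: power2_eq_square\<close>)
  next
    case False
    hence z1: "z1 = cnj z" using 1 by simp
    \<comment> \<open>If the Pell equation singled out the conjugate prime, dividing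
      \<open>\<surd>l\<close> by its root passes to \<open>z\<close>: the square is
      \<open>l / (cnj z * u) = z * u'\<close>.\<close>
    have "(rt l / t)\<^sup>2 = of_nat l / (cnj z * u)" by (simp add: power_divide power2_eq_square rt_sq tt z1)
    also have "of_nat l = z * cnj z" using zfactor_mult_cnj[OF z] by simp
    also have "z * cnj z / (cnj z * u) = z * u'" using Hd(3) u0 by (simp add: inv[symmetric] field_simps)
    finally have "(rt l / t)\<^sup>2 = z * u'" .
    moreover have "rt l / t \<in> KK l" using KK_mem tK is_subfieldD(8)[OF K] by blast
    moreover have "rt l / t \<noteq> 0" using t0 rt_sq[of l] pl by auto
    moreover have "inverse u' = u" using uu by (intro inverse_unique) (simp add: mult.commute)
    ultimately show ?thesis using cap[of "rt l / t" u'] uO by simp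
  qed
qed

end

section \<open>Norms to the real field \<open>\<rat>(s)\<close> and the ideal
  \<open>H\<^sub>0\<close>\<close>

lemma Rats_complex_cases:
  assumes "x \<in> (\<rat> :: complex set)" obtains r where "r \<in> \<rat>" "x = of_real r"
proof -
  obtain a b where "x = of_int a / of_int b" using assms by (metis Rats_cases')
  hence "x = of_real (of_int a / of_int b)" by simp
  thus ?thesis using that[of "of_int a / of_int b"] by simp
qed

context prime_pair
begin

abbreviation EE :: "complex set" where "EE \<equiv> qext \<rat> s"
abbreviation \<sigma>s :: real where "\<sigma>s \<equiv> sqrt (of_nat (2 * p * q))"

lemma EE_field: "is_subfield EE"
proof -
  have "s\<^sup>2 \<in> \<rat>" unfolding s_sq by (rule Rats_of_nat)
  thus ?thesis by (intro is_subfield_qext is_subfield_Rats)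
qed

lemma EE_real: "EE \<subseteq> \<real>"
proof (rule qext_least[OF is_subfield_Reals])
  show "\<rat> \<subseteq> (\<real> :: complex set)" by (auto elim: Rats_complex_cases)
qed (simp add: s_eq)

lemma EE_k: "EE \<subseteq> k"
proof (rule qext_least[OF k_field])
  show "\<rat> \<subseteq> k"
  proof
    fix x :: complex assume "x \<in> \<rat>"
    thus "x \<in> k" using of_real_Rats_mem[OF k_field] by (auto elim: Rats_complex_cases)
  qed
qed (auto intro: Qadj_base)

lemma EE_cases:
  assumes "x \<in> EE" obtains a b where "a \<in> \<rat>" "b \<in> \<rat>" "x = of_real (a + b * \<sigma>s)"
proof -
  obtain a b where ab: "a \<in> \<rat>" "b \<in> \<rat>" "x = a + b * s" using assms by (rule qextE)
  obtain a' where a': "a' \<in> \<rat>" "a = of_real a'" using ab(1) by (rule Rats_complex_cases)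
  obtain b' where b': "b' \<in> \<rat>" "b = of_real b'" using ab(2) by (rule Rats_complex_cases)
  have "x = of_real (a' + b' * \<sigma>s)" unfolding ab(3) a' b' s_eq by simp
  thus ?thesis using that[of a' b'] a' b' by simp
qed

lemma sqrt_basis:
  assumes "a \<in> \<rat>" "b \<in> \<rat>" "a + b * \<sigma>s = 0" shows "a = 0" "b = 0"
proof -
  show "b = 0"
  proof (rule ccontr)
    assume b: "b \<noteq> 0"
    hence "\<sigma>s = - a / b" using assms(3) by (simp add: field_simps)
    moreover have "- a / b \<in> \<rat>" using assms by simp
    ultimately show False using sqrt_irrational by simp
  qed
  thus "a = 0" using assms by simp
qed

text \<open>With \<open>2 w = (1 - \<i>) s\<close> the imaginary part of a Gaussian combination of 1
  and \<open>w\<close> is again a combination of 1 and \<open>s\<close>; its vanishing leaves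
  exactly \<open>\<int>[s]\<close>.\<close>

lemma real_integer_cases:
  assumes "x \<in> EE" "algebraic_int x"
  obtains a b where "x = of_int a + of_int b * s"
proof -
  have "x \<in> O\<^sub>k" using assms EE_k by (auto simp: OK_def)
  then obtain u v where uv: "u \<in> ZI" "v \<in> ZI" "x = u + v * w" by (rule O_kE)
  obtain a1 a2 where a: "u = of_int a1 + \<i> * of_int a2" using uv(1) by (rule ZI_cases)
  obtain b1 b2 where b: "v = of_int b1 + \<i> * of_int b2" using uv(2) by (rule ZI_cases)
  have "2 * w = (1 - \<i>) * ((1 + \<i>) * w)" by (simp add: algebra_simps)
  hence w2: "2 * w = (1 - \<i>) * of_real \<sigma>s" unfolding s_w[symmetric] s_eq .
  have "2 * x = 2 * u + v * (2 * w)" unfolding uv(3) by (simp add: algebra_simps)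
  hence x2: "2 * x = 2 * u + v * ((1 - \<i>) * of_real \<sigma>s)" unfolding w2 .
  have "Im (2 * x) = of_int (2 * a2) + of_int (b2 - b1) * \<sigma>s"
    unfolding x2 a b by (simp add: algebra_simps)
  moreover have "Im x = 0" using assms(1) EE_real complex_is_Real_iff by auto
  ultimately have 0: "of_int (2 * a2) + of_int (b2 - b1) * \<sigma>s = 0" by simp
  have "real_of_int (2 * a2) = 0" "real_of_int (b2 - b1) = 0"
    using sqrt_basis[OF Rats_of_int Rats_of_int 0] by auto
  hence "a2 = 0" "b2 = b1" by simp_all
  hence "2 * x = 2 * (of_int a1 + of_int b1 * s)" unfolding x2 a b s_eq by (simp add: algebra_simps)
  hence "x = of_int a1 + of_int b1 * s" by (simp only: mult_cancel_left) simp
  thus ?thesis by (rule that)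
qed

lemma tau_s: "\<tau> s = - s"
  using base.conj_eq[of 0 "1 + \<i>"] is_subfieldD(1)[OF is_subfield_QI] by (simp add: s_w)

lemma real_norm: "(of_int a + of_int b * s) * \<tau> (of_int a + of_int b * s) = of_int (a\<^sup>2 - int (2 * p * q) * b\<^sup>2)"
proof -
  have t: "\<tau> (of_int a + of_int b * s) = of_int a + of_int b * (- s)"
    using tau_s s_w w_k(2) is_subfieldD(5)[OF k_field] OK_D(1)[OF ZI_k[of "of_int _"]] Qadj_base[of s "[s, \<i>]"]
    by (simp add: tau_add tau_mult tau_ZI)
  have "(of_int a + of_int b * s) * (of_int a + of_int b * (- s)) = of_int a * of_int a - of_int b * of_int b * (s * s)"
    by (simp add: algebra_simps)
  thus ?thesis unfolding t ss by (simp add: power2_eq_square algebra_simps)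
qed

text \<open>Norms turn \<open>x^2 = 2 m v\<close> into \<open>N(x)^2 = 4 m^2 N(v)\<close>. Here
  \<open>N(v)\<close> is 1 or \<open>-1\<close>, and \<open>-1\<close> is excluded because the left
  side is a square.\<close>

lemma real_square_norm:
  assumes x: "x \<in> EE" "algebraic_int x" and xx: "x * x = of_int (2 * m) * v" and m: "m \<noteq> 0"
    and v: "algebraic_int v" "algebraic_int v'" "v * v' = 1"
  obtains a b :: int where "a\<^sup>2 - int (2 * p * q) * b\<^sup>2 = 2 * m \<or> a\<^sup>2 - int (2 * p * q) * b\<^sup>2 = - (2 * m)"
proof -
  have mE: "complex_of_int (2 * m) \<in> EE" by (rule is_subfield_of_int[OF EE_field])
  have "v = x * x / of_int (2 * m)" using xx m by simp
  hence vE: "v \<in> EE" using is_subfieldD(5,8)[OF EE_field] x mE by simp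
  have "v' = inverse v" using v(3) inverse_unique by metis
  hence v'E: "v' \<in> EE" using is_subfieldD(6)[OF EE_field vE] by simp
  obtain a b where ab: "x = of_int a + of_int b * s" using real_integer_cases[OF x] .
  obtain c d where cd: "v = of_int c + of_int d * s" using real_integer_cases[OF vE v(1)] .
  obtain c' d' where cd': "v' = of_int c' + of_int d' * s" using real_integer_cases[OF v'E v(2)] .
  define N M M' where "N = a\<^sup>2 - int (2 * p * q) * b\<^sup>2" and "M = c\<^sup>2 - int (2 * p * q) * d\<^sup>2"
    and "M' = c'\<^sup>2 - int (2 * p * q) * d'\<^sup>2"
  have N: "x * \<tau> x = of_int N" "v * \<tau> v = of_int M" "v' * \<tau> v' = of_int M'"
    unfolding N_def M_def M'_def ab cd cd' by (rule real_norm)+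
  have k: "x \<in> k" "v \<in> k" "v' \<in> k" "of_int (2 * m) \<in> k" using x(1) vE v'E EE_k mE by blast+
  have "of_int (M * M') = (v * v') * \<tau> (v * v')"
    unfolding tau_mult[OF k(2,3)] of_int_mult N[symmetric] by (simp only: mult_ac)
  hence "complex_of_int (M * M') = of_int 1" unfolding v(3) using tau_ZI[of 1] by simp
  hence "M * M' = 1" unfolding of_int_eq_iff .
  hence M: "M = 1 \<or> M = -1" by (auto simp: zmult_eq_1_iff)
  have "of_int (N * N) = (x * x) * \<tau> (x * x)"
    unfolding tau_mult[OF k(1,1)] of_int_mult N[symmetric] by (simp only: mult_ac)
  also have "\<dots> = (of_int (2 * m) * of_int (2 * m)) * (v * \<tau> v)"
    unfolding xx tau_mult[OF k(4,2)] tau_ZI[OF ZI_closed(4)] by (simp only: mult_ac)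
  finally have "complex_of_int (N * N) = of_int ((2 * m) * (2 * m) * M)" unfolding N by (simp only: of_int_mult)
  hence NN: "N * N = (2 * m) * (2 * m) * M" unfolding of_int_eq_iff .
  have "M = 1"
  proof (rule ccontr)
    assume "M \<noteq> 1"
    hence "N * N = - ((2 * m) * (2 * m))" using M NN by simp
    moreover have "(2 * m) * (2 * m) > 0" using m by (auto simp: zero_less_mult_iff)
    moreover have "N * N \<ge> 0" by simp
    ultimately show False by linarith
  qed
  hence "N\<^sup>2 = (2 * m)\<^sup>2" using NN by (simp add: power2_eq_square)
  hence "N = 2 * m \<or> N = - (2 * m)" using power2_eq_iff by blast
  thus ?thesis using that unfolding N_def by blast
qed

lemma QuadRes_of_norm:
  assumes l: "l = p \<or> l = q" and eq: "a\<^sup>2 - int (2 * p * q) * b\<^sup>2 = m \<or> a\<^sup>2 - int (2 * p * q) * b\<^sup>2 = - m"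
  shows "QuadRes (int l) m"
proof -
  have pl: "prime l" "l mod 4 = 1" using l primes by auto
  have d: "int l dvd int (2 * p * q) * b\<^sup>2" using l by auto
  from eq have "[a\<^sup>2 = m] (mod int l) \<or> [a\<^sup>2 = - m] (mod int l)"
  proof
    assume "a\<^sup>2 - int (2 * p * q) * b\<^sup>2 = m"
    hence "a\<^sup>2 - m = int (2 * p * q) * b\<^sup>2" by simp
    thus ?thesis unfolding cong_iff_dvd_diff using d by simp
  next
    assume "a\<^sup>2 - int (2 * p * q) * b\<^sup>2 = - m"
    hence "a\<^sup>2 - (- m) = int (2 * p * q) * b\<^sup>2" by simp
    thus ?thesis unfolding cong_iff_dvd_diff using d by metis
  qed
  hence "QuadRes (int l) m \<or> QuadRes (int l) (- m)" using QuadRes_cong QuadRes_square by blast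
  thus ?thesis using QuadRes_minus[OF pl] by blast
qed

text \<open>Such a norm would make 2 a square modulo both primes, since the sign is absorbed by
  \<open>-1\<close> being a residue.\<close>

lemma norm_2_obstruction:
  "\<not> (a\<^sup>2 - int (2 * p * q) * b\<^sup>2 = 2 \<or> a\<^sup>2 - int (2 * p * q) * b\<^sup>2 = - 2)"
  using QuadRes_of_norm[of p a b 2] QuadRes_of_norm[of q a b 2] nonres(3) by blast

text \<open>Modulo \<open>l'\<close> the number \<open>2 l\<close> would be a square. Since
  \<open>l\<close> divides \<open>a\<close>, cancelling \<open>l\<close> gives
  \<open>l' b^2 = 1\<close> or \<open>-1\<close> modulo \<open>l\<close>, so \<open>l'\<close> is a
  square modulo \<open>l\<close>. By reciprocity 2 is then a square modulo \<open>l'\<close>,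
  contrary to \<open>nonres\<close>.\<close>

lemma norm_2l_obstruction:
  assumes l: "l = p \<and> l' = q \<or> l = q \<and> l' = p"
  shows "\<not> (a\<^sup>2 - int (2 * p * q) * b\<^sup>2 = 2 * int l \<or> a\<^sup>2 - int (2 * p * q) * b\<^sup>2 = - (2 * int l))"
proof
  assume eq: "a\<^sup>2 - int (2 * p * q) * b\<^sup>2 = 2 * int l \<or> a\<^sup>2 - int (2 * p * q) * b\<^sup>2 = - (2 * int l)"
  have pl: "prime l" "prime l'" "l mod 4 = 1" "prime (int l)" "prime (int l')" "int l \<noteq> 0" using l primes gt2 by auto
  have d: "2 * p * q = l * (2 * l')" using l by auto
  have "QuadRes (int l') (2 * int l)" using QuadRes_of_norm[OF _ eq, of l'] l by blast
  hence A: "QuadRes (int l') (int l * 2)" by (simp add: mult.commute)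
  have "a\<^sup>2 = int l * (2 * int l' * b\<^sup>2 + 2) \<or> a\<^sup>2 = int l * (2 * int l' * b\<^sup>2 - 2)"
    using eq unfolding d by (auto simp: algebra_simps)
  hence "int l dvd a\<^sup>2" by auto
  hence "int l dvd a" using pl prime_dvd_power by blast
  then obtain c where c: "a = int l * c" by (auto elim: dvdE)
  have "int l * (int l * c\<^sup>2 - 2 * int l' * b\<^sup>2) = int l * 2 \<or> int l * (int l * c\<^sup>2 - 2 * int l' * b\<^sup>2) = int l * (- 2)"
    using eq unfolding d c by (auto simp: algebra_simps power2_eq_square)
  hence "int l * c\<^sup>2 - 2 * int l' * b\<^sup>2 = 2 \<or> int l * c\<^sup>2 - 2 * int l' * b\<^sup>2 = - 2"
    using pl(6) by (metis mult_cancel_left)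
  hence "2 * (int l' * b\<^sup>2 + 1) = int l * c\<^sup>2 \<or> 2 * (int l' * b\<^sup>2 - 1) = int l * c\<^sup>2" by auto
  hence "int l dvd 2 * (int l' * b\<^sup>2 - (- 1)) \<or> int l dvd 2 * (int l' * b\<^sup>2 - 1)" by (metis diff_minus_eq_add dvd_triv_left)
  moreover have "\<not> int l dvd 2" using l not_dvd by blast
  ultimately have "int l dvd int l' * b\<^sup>2 - (- 1) \<or> int l dvd int l' * b\<^sup>2 - 1"
    using pl(4) prime_dvd_multD by blast
  hence c2: "[int l' * b\<^sup>2 = -1] (mod int l) \<or> [int l' * b\<^sup>2 = 1] (mod int l)" by (simp only: cong_iff_dvd_diff)
  have "QuadRes (int l) 1" using QuadRes_square[of "int l" 1] by simp
  hence "QuadRes (int l) (int l' * b\<^sup>2)"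
    using c2 QuadRes_cong QuadRes_minus_1[OF pl(1,3)] by blast
  moreover have "\<not> int l dvd b"
  proof
    assume "int l dvd b"
    hence "int l dvd int l' * b\<^sup>2" by (simp add: power2_eq_square)
    hence "int l dvd 1 \<or> int l dvd -1" using c2 cong_dvd_iff by blast
    thus False using pl(4) by auto
  qed
  ultimately have "QuadRes (int l) (int l')" using QuadRes_cancel_square[OF pl(4)] by blast
  hence r: "QuadRes (int l') (int l)" using l recip by blast
  have "\<not> int l' dvd int l" using l not_dvd by blast
  hence "QuadRes (int l') 2" using QuadRes_cancel[OF pl(5) A r] by blast
  thus False using r l nonres recip by blast
qed

text \<open>For a number of absolute value 1 in an imaginary quadratic field, \<open>A\<close> plays
  the role of its trace. The values 0 and 1 of \<open>A^2\<close> would make \<open>c'\<close> or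
  \<open>3 c'\<close> a rational square.\<close>

lemma rational_form_eq_4:
  fixes A :: int and S c :: real
  assumes S: "S \<in> \<rat>" and eq: "of_int (A\<^sup>2) + of_nat c' * (2 * S)\<^sup>2 = 4" and c: "c' > 0"
    and irr: "\<not> (\<exists>x\<in>\<rat>. x\<^sup>2 = real c')" "\<not> (\<exists>x\<in>\<rat>. x\<^sup>2 = real (3 * c'))"
  shows "S = 0 \<and> (A = 2 \<or> A = -2)"
proof -
  have "of_nat c' * (2 * S)\<^sup>2 \<ge> 0" by simp
  hence "real_of_int (A\<^sup>2) \<le> 4" using eq by linarith
  hence "A\<^sup>2 \<le> 4" by linarith
  hence "A\<^sup>2 \<le> 2\<^sup>2" by simp
  hence "\<bar>A\<bar> \<le> 2" using power2_le_iff_abs_le[of 2 A] by simp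
  hence "A \<in> {-2, -1, 0, 1, 2}" by auto
  hence A: "A\<^sup>2 = 0 \<or> A\<^sup>2 = 1 \<or> A = 2 \<or> A = -2" by auto
  have R: "2 * of_nat c' * S \<in> \<rat>" "of_nat c' * S \<in> \<rat>" using S by auto
  have n0: "A\<^sup>2 \<noteq> 0"
  proof
    assume "A\<^sup>2 = 0"
    hence "of_nat c' * S\<^sup>2 = 1" using eq by (simp add: power_mult_distrib)
    hence "of_nat c' * (of_nat c' * S\<^sup>2) = of_nat c' * 1" by simp
    hence "(of_nat c' * S)\<^sup>2 = real c'" by (simp add: power2_eq_square mult_ac)
    thus False using irr(1) R by blast
  qed
  have n1: "A\<^sup>2 \<noteq> 1"
  proof
    assume "A\<^sup>2 = 1"
    hence "of_nat c' * (2 * S)\<^sup>2 = 3" using eq by simp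
    hence "of_nat c' * (of_nat c' * (2 * S)\<^sup>2) = of_nat c' * 3" by simp
    hence "(2 * of_nat c' * S)\<^sup>2 = real (3 * c')" by (simp add: power2_eq_square mult_ac)
    thus False using irr(2) R by blast
  qed
  have A2: "A = 2 \<or> A = -2" using A n0 n1 by blast
  hence "of_nat c' * (2 * S)\<^sup>2 = 0" using eq by auto
  thus ?thesis using A2 c by simp
qed

text \<open>If \<open>H\<^sub>0 O\<^sub>K = \<alpha> O\<^sub>K\<close>, then the norm \<open>\<beta>\<close> of \<open>\<alpha>\<close> to \<open>L = \<rat>(s, \<surd>-l)\<close> satisfies \<open>\<beta>\<^sup>2 = 2 v\<close> with a unit \<open>v\<close>.
  The unit \<open>\<rho> = \<beta> / cnj \<beta>\<close> of absolute value 1 can only be \<open>1\<close> or \<open>-1\<close>, so \<open>\<beta>\<close> or \<open>\<beta> \<surd>-l\<close> lies in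
  \<open>\<rat>(s)\<close>, where its norm \<open>2\<close> or \<open>2 l\<close> (up to sign) is impossible.\<close>
lemma not_capitulates_1i:
  assumes l: "l = p \<and> l' = q \<or> l = q \<and> l' = p" and H0: "ram (1 + \<i>) H0"
  shows "\<not> principal (KK l) (gen_ideal (KK l) H0)"
proof
  assume cap: "principal (KK l) (gen_ideal (KK l) H0)"
  have lpq: "l = p \<or> l = q" using l by blast
  note Hd = ramD[OF H0] and K = KK_field[of l]
  let ?K = "KK l" and ?G = "gen_ideal (KK l) H0"
  have G: "is_ideal ?K ?G" by (rule is_ideal_extension[OF K k_KK Hd(1)])
  obtain \<alpha> where \<alpha>: "\<alpha> \<in> ?G" "\<And>x. x \<in> H0 \<Longrightarrow> \<exists>r\<in>OK ?K. x = \<alpha> * r"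
    using cap capitulates_iff[OF K k_KK Hd(1)] by blast
  have \<alpha>O: "\<alpha> \<in> OK ?K" using \<alpha>(1) is_idealD(1)[OF G] by blast
  have OkK: "x \<in> OK ?K" if "x \<in> O\<^sub>k" for x using OK_mono[OF k_KK] that by blast
  have HO: "x \<in> OK ?K" if "x \<in> H0" for x using OkK is_idealD(1)[OF Hd(1) that] by blast
  let ?J = "(*) (1 + \<i>) ` OK ?K"
  have J: "is_ideal ?K ?J" by (intro is_ideal_smul is_ideal_OK K OkK Hd(6))
  have "?G \<subseteq> {x \<in> OK ?K. \<forall>y\<in>H0. y * x \<in> ?J}"
  proof (rule gen_ideal_least[OF is_ideal_quotient[OF K J]], safe)
    fix x y assume "x \<in> H0" "y \<in> H0"
    hence "y * x \<in> (*) (1 + \<i>) ` O\<^sub>k" unfolding Hd(4)[symmetric] by (intro ideal_mult_memI)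
    thus "y * x \<in> ?J" using OkK by blast
  qed (rule HO)
  hence y\<alpha>: "y * \<alpha> \<in> ?J" if "y \<in> H0" for y using \<alpha>(1) that by blast
  have "?G \<subseteq> {x \<in> OK ?K. \<forall>y\<in>{\<alpha>}. y * x \<in> ?J}"
    by (rule gen_ideal_least[OF is_ideal_quotient[OF K J]]) (use HO y\<alpha> in \<open>auto simp: mult.commute\<close>)
  hence "\<alpha> * \<alpha> \<in> ?J" using \<alpha>(1) by blast
  \<comment> \<open>This \<open>u\<close> turns out to be a unit: the opposite divisibility, of
    \<open>1 + \<i>\<close> by \<open>\<alpha>^2\<close>, follows because \<open>\<alpha>\<close>
    divides all elements of \<open>H0\<close> and \<open>1 + \<i>\<close> lies in its
    square.\<close>
  then obtain u where u: "u \<in> OK ?K" "\<alpha> * \<alpha> = (1 + \<i>) * u" by blast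
  have "ideal_mult k H0 H0 \<subseteq> O\<^sub>k \<inter> (*) (\<alpha> * \<alpha>) ` OK ?K"
  proof (rule ideal_mult_least)
    have "is_ideal ?K ((*) (\<alpha> * \<alpha>) ` OK ?K)" by (intro is_ideal_smul is_ideal_OK K OK_mult \<alpha>O)
    thus "is_ideal k (O\<^sub>k \<inter> (*) (\<alpha> * \<alpha>) ` OK ?K)"
      using is_ideal_OK[OF k_field] OkK unfolding is_ideal_def by blast
    fix x y assume xy: "x \<in> H0" "y \<in> H0"
    obtain r t where rt: "r \<in> OK ?K" "t \<in> OK ?K" "x = \<alpha> * r" "y = \<alpha> * t" using \<alpha>(2) xy by meson
    hence "x * y = (\<alpha> * \<alpha>) * (r * t)" "r * t \<in> OK ?K" using OK_mult[OF K] by (simp_all add: mult_ac)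
    moreover have "x * y \<in> O\<^sub>k" using xy is_idealD(1)[OF Hd(1)] OK_mult[OF k_field] by blast
    ultimately show "x * y \<in> O\<^sub>k \<inter> (*) (\<alpha> * \<alpha>) ` OK ?K" by blast
  qed
  moreover have "1 + \<i> \<in> ideal_mult k H0 H0" unfolding Hd(4) using OK_1[OF k_field] by (auto intro!: image_eqI[of _ _ 1])
  ultimately obtain u' where u': "u' \<in> OK ?K" "1 + \<i> = \<alpha> * \<alpha> * u'" by blast
  have "(1 + \<i>) * (u * u') = (\<alpha> * \<alpha>) * u'" unfolding u(2) by (simp only: mult.assoc)
  hence "(1 + \<i>) * (u * u') = (1 + \<i>) * 1" unfolding u'(2)[symmetric] by simp
  hence uu: "u * u' = 1" using Hd(3) by simp

  \<comment> \<open>This is \<open>\<surd>-l\<close>. As \<open>\<rat>(s)\<close> is real, complex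
    conjugation on \<open>L\<close> just changes the sign of \<open>\<delta>\<close>, while the norm
    from \<open>K = L(\<i>)\<close> sends \<open>1 + \<i>\<close> to 2.\<close>
  define \<delta> where "\<delta> = \<i> * rt l"
  have \<delta>2: "\<delta> * \<delta> = - of_nat l"
  proof -
    have "\<delta> * \<delta> = (\<i> * \<i>) * (rt l * rt l)" unfolding \<delta>_def by (simp only: mult_ac)
    thus ?thesis unfolding rt_sq by simp
  qed
  define L where "L = qext EE \<delta>"
  have natE: "of_nat m \<in> EE" for m using is_subfield_of_int[OF EE_field, of "int m"] by simp
  have Lf: "is_subfield L" unfolding L_def
    by (intro is_subfield_qext EE_field) (simp add: power2_eq_square \<delta>2 natE is_subfieldD(7)[OF EE_field])
  have realE: "cnj x = x" if "x \<in> EE" for x using that EE_real by (auto simp: Reals_cnj_iff)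
  have cnj\<delta>: "cnj \<delta> = - \<delta>" by (simp add: \<delta>_def rt_eq)
  have \<delta>0: "\<delta> \<noteq> 0" using \<delta>2 lpq gt2 by auto
  have iL: "\<i> \<notin> L"
  proof
    assume "\<i> \<in> L"
    then obtain a b where ab: "a \<in> EE" "b \<in> EE" "\<i> = a + b * \<delta>" unfolding L_def by (rule qextE)
    have "cnj \<i> = cnj a + cnj b * cnj \<delta>" unfolding ab(3) by simp
    hence "- \<i> = a - b * \<delta>" using realE ab cnj\<delta> by simp
    hence "\<i> - (- \<i>) = (a + b * \<delta>) - (a - b * \<delta>)" using ab(3) by simp
    hence "2 * \<i> = 2 * \<i> * (b * rt l)" by (simp add: \<delta>_def mult_ac)
    hence "b * rt l = 1" by simp
    hence "rt l = inverse b" by (metis inverse_unique)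
    hence "rt l \<in> k" using is_subfieldD(6)[OF EE_field ab(2)] EE_k by auto
    thus False using rt_not_k[OF lpq] by blast
  qed
  interpret Li: quad_ext L \<i>
    by unfold_locales (use Lf iL is_subfieldD(2,7)[OF Lf] in auto)
  have EL: "EE \<subseteq> L" "\<delta> \<in> L" unfolding L_def using qext_contains[OF EE_field] by auto
  have KL: "?K = qext L \<i>"
  proof
    have sE: "s \<in> EE" by (rule qext_contains(2)[OF is_subfield_Rats])
    have "rt l = (- \<i>) * \<delta>" by (simp add: \<delta>_def)
    moreover have iq: "\<i> \<in> qext L \<i>" by (rule qext_contains(2)[OF Lf])
    moreover have "\<delta> \<in> qext L \<i>" "s \<in> qext L \<i>" using EL sE Li.FK by auto
    ultimately have "rt l \<in> qext L \<i>" "s \<in> qext L \<i>" using is_subfieldD(5,7)[OF Li.K] by auto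
    thus "?K \<subseteq> qext L \<i>" using iq by (intro Qadj_least Li.K) auto
    have "L \<subseteq> ?K" unfolding L_def
    proof (rule qext_least[OF K])
      show "EE \<subseteq> ?K" using EE_k k_KK by blast
      show "\<delta> \<in> ?K" unfolding \<delta>_def using KK_mem is_subfieldD(5)[OF K] by blast
    qed
    thus "qext L \<i> \<subseteq> ?K" using KK_mem by (intro qext_least K) auto
  qed
  let ?g = "qconj L \<i>"
  note uO = u(1)[unfolded KL] u'(1)[unfolded KL] \<alpha>O[unfolded KL]
  note uK = uO[THEN OK_D(1)]
  define v v' \<beta> where "v = u * ?g u" and "v' = u' * ?g u'" and "\<beta> = \<alpha> * ?g \<alpha>"
  have mem: "v \<in> OK L" "v' \<in> OK L" "\<beta> \<in> OK L"
    unfolding v_def v'_def \<beta>_def using uO Li.trace_norm_OK(2) by blast+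
  have "v * v' = (u * u') * ?g (u * u')" unfolding v_def v'_def Li.conj_mult[OF uK(1,2)] by (simp only: mult_ac)
  hence vv: "v * v' = 1" unfolding uu using Li.conj_F[OF is_subfieldD(2)[OF Lf]] by simp
  have "?g (1 + \<i>) = 1 - \<i>" using Li.conj_eq[of 1 1] is_subfieldD(2)[OF Lf] by simp
  moreover have "1 + \<i> \<in> Li.K" using is_subfieldD(2,3)[OF Li.K] qext_contains(2)[OF Lf] by blast
  ultimately have "?g ((1 + \<i>) * u) = (1 - \<i>) * ?g u" using Li.conj_mult uK by simp
  moreover have "\<beta> * \<beta> = (\<alpha> * \<alpha>) * ?g (\<alpha> * \<alpha>)" unfolding \<beta>_def Li.conj_mult[OF uK(3,3)] by (simp only: mult_ac)
  ultimately have "\<beta> * \<beta> = ((1 + \<i>) * (1 - \<i>)) * v" unfolding u(2) v_def by (simp only: mult_ac)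
  hence \<beta>2: "\<beta> * \<beta> = 2 * v" by (simp add: algebra_simps)

  obtain x y where xy: "x \<in> EE" "y \<in> EE" "\<beta> = x + y * \<delta>" using OK_D(1)[OF mem(3)] unfolding L_def by (rule qextE)
  have c\<beta>: "cnj \<beta> = x - y * \<delta>" unfolding xy(3) using realE xy cnj\<delta> by simp
  have "- y \<in> EE" using is_subfieldD(7)[OF EE_field xy(2)] .
  hence c\<beta>L: "cnj \<beta> \<in> L" unfolding c\<beta> L_def using qextI[OF xy(1), of "- y" \<delta>] by simp
  have v0: "v \<noteq> 0" using vv by auto
  hence \<beta>0: "\<beta> \<noteq> 0" using \<beta>2 by auto
  define \<rho> where "\<rho> = \<beta> / cnj \<beta>"
  have \<rho>L: "\<rho> \<in> L" unfolding \<rho>_def using is_subfieldD(8)[OF Lf] OK_D(1)[OF mem(3)] c\<beta>L by blast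
  have "cnj v * cnj v' = 1" using arg_cong[OF vv, of cnj] by simp
  hence "1 / cnj v = cnj v'" by (metis inverse_unique inverse_eq_divide)
  have "\<rho> * \<rho> = (\<beta> * \<beta>) / cnj (\<beta> * \<beta>)" by (simp add: \<rho>_def)
  also have "\<dots> = v * (1 / cnj v)" unfolding \<beta>2 by simp
  also have "\<dots> = v * cnj v'" unfolding \<open>1 / cnj v = cnj v'\<close> ..
  finally have "\<rho>\<^sup>2 = v * cnj v'" by (simp add: power2_eq_square)
  moreover have "algebraic_int (v * cnj v')"
    using OK_D(2)[OF mem(1)] OK_D(2)[OF mem(2)] by (intro algebraic_int_mult) auto
  ultimately have \<rho>ai: "algebraic_int \<rho>" by (intro algebraic_int_sqrt_complex[of \<rho>]) simp
  have \<rho>1: "\<rho> * cnj \<rho> = 1" using \<beta>0 by (simp add: \<rho>_def)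
  obtain X Y where XY: "X \<in> EE" "Y \<in> EE" "\<rho> = X + Y * \<delta>" using \<rho>L unfolding L_def by (rule qextE)
  have c\<rho>: "cnj \<rho> = X - Y * \<delta>" unfolding XY(3) using realE XY cnj\<delta> by simp
  have "algebraic_int (\<rho> + cnj \<rho>)" using \<rho>ai by (intro algebraic_int_add) auto
  moreover have "\<rho> + cnj \<rho> = 2 * X" unfolding c\<rho> unfolding XY(3) by simp
  ultimately have "algebraic_int (2 * X)" by simp
  moreover have "2 * X \<in> EE" using natE[of 2] is_subfieldD(5)[OF EE_field] XY(1) by simp
  ultimately obtain A B where AB: "2 * X = of_int A + of_int B * s" using real_integer_cases by blast
  obtain S T where ST: "S \<in> \<rat>" "T \<in> \<rat>" "Y = of_real (S + T * \<sigma>s)" using XY(2) by (rule EE_cases)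
  have \<sigma>2: "\<sigma>s * \<sigma>s = real (2 * p * q)" by simp
  \<comment> \<open>Multiplied by 4, the condition that \<open>\<rho>\<close> has absolute value 1
    reads \<open>(2 X)^2 + 4 l Y^2 = 4\<close> in \<open>\<rat>(s)\<close>. Comparing coefficients
    of 1 and \<open>s\<close> yields \<open>f1\<close>, whose terms other than \<open>-4\<close> are
    nonnegative, and \<open>f2\<close>.\<close>
  have "X * X - Y * Y * (\<delta> * \<delta>) = 1" using \<rho>1 unfolding c\<rho> unfolding XY(3) by (simp add: algebra_simps)
  moreover have "(2 * X) * (2 * X) + 4 * (of_nat l * (Y * Y)) = 4 * (X * X - Y * Y * (\<delta> * \<delta>))"
    unfolding \<delta>2 by (simp add: algebra_simps)
  ultimately have "(2 * X) * (2 * X) + 4 * (of_nat l * (Y * Y)) = 4" by simp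
  hence "complex_of_real ((of_int A + of_int B * \<sigma>s) * (of_int A + of_int B * \<sigma>s)
      + 4 * (of_nat l * ((S + T * \<sigma>s) * (S + T * \<sigma>s)))) = of_real 4"
    unfolding AB ST(3) s_eq by simp
  hence "(of_int A + of_int B * \<sigma>s) * (of_int A + of_int B * \<sigma>s)
      + 4 * (of_nat l * ((S + T * \<sigma>s) * (S + T * \<sigma>s))) = 4" unfolding of_real_eq_iff .
  moreover have "(of_int A + of_int B * \<sigma>s) * (of_int A + of_int B * \<sigma>s)
      + 4 * (of_nat l * ((S + T * \<sigma>s) * (S + T * \<sigma>s)))
    = (of_int (A * A) + of_int (B * B) * (\<sigma>s * \<sigma>s) + 4 * of_nat l * (S * S + T * T * (\<sigma>s * \<sigma>s)))
      + (of_int (2 * A * B) + 8 * of_nat l * (S * T)) * \<sigma>s" by (simp only: of_int_mult of_int_numeral ring_distribs mult_ac)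
  ultimately have form: "(of_int (A * A) + of_int (B * B) * real (2 * p * q) + 4 * of_nat l * (S * S + T * T * real (2 * p * q)) - 4)
      + (of_int (2 * A * B) + 8 * of_nat l * (S * T)) * \<sigma>s = 0" unfolding \<sigma>2 by linarith
  have f1: "of_int (A * A) + of_int (B * B) * real (2 * p * q) + 4 * of_nat l * (S * S + T * T * real (2 * p * q)) - 4 = 0"
    and f2: "of_int (2 * A * B) + 8 * of_nat l * (S * T) = 0"
    using sqrt_basis[OF _ _ form] ST by (auto intro!: Rats_add Rats_diff Rats_mult)
  have d5: "2 * p * q \<ge> 5"
  proof -
    have "2 * 3 * 3 \<le> 2 * p * q" using gt2 by (intro mult_le_mono) auto
    thus ?thesis by simp
  qed
  \<comment> \<open>Otherwise the term \<open>B^2 * 2 p q\<close> alone exceeds 4. With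
    \<open>B = 0\<close> the second equation leaves \<open>S = 0\<close> or
    \<open>T = 0\<close>.\<close>
  have "B = 0"
  proof (rule ccontr)
    assume "B \<noteq> 0"
    hence "B * B \<ge> 1" by (metis int_one_le_iff_zero_less not_real_square_gt_zero zero_less_mult_iff linorder_neqE_linordered_idom)
    hence "real_of_int (B * B) * real (2 * p * q) \<ge> 1 * 5" using d5 by (intro mult_mono) linarith+
    moreover have "real_of_int (A * A) \<ge> 0" "4 * real l * (S * S + T * T * real (2 * p * q)) \<ge> 0" by simp_all
    ultimately show False using f1 by linarith
  qed
  hence "S * T = 0" using f2 lpq gt2 by auto
  have o1: "\<not> (\<exists>x\<in>\<rat>. x\<^sup>2 = real l)" "\<not> (\<exists>x\<in>\<rat>. x\<^sup>2 = real (3 * l))"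
  proof -
    have pl: "prime l" "l mod 4 = 1" "l > 1" using lpq primes gt2 by auto
    have "\<not> l\<^sup>2 dvd l" using pl by (auto simp: power2_eq_square)
    thus "\<not> (\<exists>x\<in>\<rat>. x\<^sup>2 = real l)" by (intro irrational_if_prime_exact[OF pl(1)]) auto
    have "\<not> l dvd 3" using pl primes_dvd_imp_eq[of l 3] by auto
    hence "\<not> l\<^sup>2 dvd 3 * l" using pl by (auto simp: power2_eq_square)
    thus "\<not> (\<exists>x\<in>\<rat>. x\<^sup>2 = real (3 * l))" by (intro irrational_if_prime_exact[OF pl(1)]) auto
  qed
  have o2: "\<not> (\<exists>x\<in>\<rat>. x\<^sup>2 = real (l * (2 * p * q)))" "\<not> (\<exists>x\<in>\<rat>. x\<^sup>2 = real (3 * (l * (2 * p * q))))"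
  proof -
    have "l * (2 * p * q) = 2 * (l * (p * q))" "3 * (l * (2 * p * q)) = 2 * (3 * l * (p * q))" by (simp_all only: mult_ac)
    thus "\<not> (\<exists>x\<in>\<rat>. x\<^sup>2 = real (l * (2 * p * q)))" "\<not> (\<exists>x\<in>\<rat>. x\<^sup>2 = real (3 * (l * (2 * p * q))))"
      using not_4_dvd_double_odd[OF odd_ll(1)[OF lpq]] not_4_dvd_double_odd[OF odd_ll(2)[OF lpq]]
      by (metis irrational_if_prime_exact[of 2] two_is_prime_nat dvd_triv_left)+
  qed
  have l0: "l > 0" "l * (2 * p * q) > 0" using lpq gt2 by auto
  have concl: "S = 0 \<and> T = 0 \<and> (A = 2 \<or> A = -2)"
  proof (cases "T = 0")
    case True
    have "of_int (A\<^sup>2) + of_nat l * (2 * S)\<^sup>2 = 4" using f1 \<open>B = 0\<close> True by (simp add: power2_eq_square)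
    thus ?thesis using rational_form_eq_4[OF ST(1) _ l0(1) o1] True by blast
  next
    case False
    hence "S = 0" using \<open>S * T = 0\<close> by simp
    moreover have "of_int (A\<^sup>2) + of_nat (l * (2 * p * q)) * (2 * T)\<^sup>2 = 4"
      using f1 \<open>B = 0\<close> \<open>S = 0\<close> by (simp add: power2_eq_square mult_ac)
    ultimately show ?thesis using rational_form_eq_4[OF ST(2) _ l0(2) o2] False by blast
  qed
  have "2 * \<rho> = of_int A" using concl XY(3) ST(3) AB \<open>B = 0\<close> by simp
  hence "\<rho> = 1 \<or> \<rho> = -1" using concl by auto
  moreover have "\<beta> = \<rho> * cnj \<beta>" using \<beta>0 by (simp add: \<rho>_def)
  ultimately have "\<beta> = cnj \<beta> \<or> \<beta> = - cnj \<beta>" by auto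
  thus False
  proof
    assume "\<beta> = cnj \<beta>"
    moreover have "2 * (y * \<delta>) = \<beta> - cnj \<beta>" unfolding c\<beta> unfolding xy(3) by simp
    ultimately have "y * \<delta> = 0" by simp
    hence "\<beta> = x" using xy(3) by auto
    hence "\<beta> \<in> EE" using xy(1) by simp
    moreover have "\<beta> * \<beta> = of_int (2 * 1) * v" using \<beta>2 by simp
    ultimately obtain a b :: int where "a\<^sup>2 - int (2 * p * q) * b\<^sup>2 = 2 * 1 \<or> a\<^sup>2 - int (2 * p * q) * b\<^sup>2 = - (2 * 1)"
      using real_square_norm[OF _ OK_D(2)[OF mem(3)] _ _ OK_D(2)[OF mem(1)] OK_D(2)[OF mem(2)] vv, of 1] by auto
    thus False using norm_2_obstruction[of a b] by simp
  next
    assume "\<beta> = - cnj \<beta>"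
    moreover have "2 * x = \<beta> + cnj \<beta>" unfolding c\<beta> unfolding xy(3) by simp
    ultimately have "2 * x = 0" by (metis add.left_inverse)
    hence \<beta>y: "\<beta> = y * \<delta>" using xy(3) by simp
    have "\<beta> * \<delta> = y * (\<delta> * \<delta>)" unfolding \<beta>y by simp
    also have "\<dots> = - (y * of_nat l)" unfolding \<delta>2 by simp
    also have "\<dots> \<in> EE" by (intro is_subfieldD(5,7)[OF EE_field] xy natE)
    finally have E: "\<beta> * \<delta> \<in> EE" .
    have "\<delta>\<^sup>2 = - of_nat l" using \<delta>2 by (simp add: power2_eq_square)
    hence "algebraic_int \<delta>" by (intro algebraic_int_sqrt_complex[of \<delta>]) (simp add: algebraic_int_ZI)
    hence ai: "algebraic_int (\<beta> * \<delta>)" by (intro algebraic_int_mult OK_D(2)[OF mem(3)])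
    have "(\<beta> * \<delta>) * (\<beta> * \<delta>) = (\<beta> * \<beta>) * (\<delta> * \<delta>)" by (simp only: mult_ac)
    also have "\<dots> = of_int (2 * (- int l)) * v" unfolding \<beta>2 \<delta>2 by simp
    finally obtain a b :: int where "a\<^sup>2 - int (2 * p * q) * b\<^sup>2 = 2 * (- int l) \<or> a\<^sup>2 - int (2 * p * q) * b\<^sup>2 = - (2 * (- int l))"
      using real_square_norm[OF E ai _ _ OK_D(2)[OF mem(1)] OK_D(2)[OF mem(2)] vv, of "- int l"] l0 by auto
    thus False using norm_2l_obstruction[OF l, of a b] by auto
  qed
qed

end

section \<open>The subgroup generated by two classes of order two\<close>

text \<open>\<open>klein F P Q A\<close>: the class of \<open>A\<close> is one of \<open>1, [P], [Q], [P Q]\<close>.\<close>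
definition klein :: "complex set \<Rightarrow> complex set \<Rightarrow> complex set \<Rightarrow> complex set \<Rightarrow> bool" where
  "klein F P Q A \<longleftrightarrow> (\<exists>C\<in>{OK F, P, Q, ideal_mult F P Q}. ideal_equiv F A C)"

locale two_torsion_pair =
  fixes F P Q
  assumes F: "is_subfield F" and P: "nz_ideal F P" and Q: "nz_ideal F Q"
    and PP: "ideal_equiv F (ideal_mult F P P) (OK F)" and QQ: "ideal_equiv F (ideal_mult F Q Q) (OK F)"
begin

abbreviation eqv (infix "\<sim>" 50) where "A \<sim> B \<equiv> ideal_equiv F A B"
abbreviation mul (infixl "\<cdot>" 70) where "A \<cdot> B \<equiv> ideal_mult F A B"

lemma id: "is_ideal F P" "is_ideal F Q" "is_ideal F (P \<cdot> Q)" "is_ideal F (OK F)"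
  using P Q F by (auto intro: nz_ideal_ideal is_ideal_mult is_ideal_OK)

lemma mul_one: "is_ideal F A \<Longrightarrow> B \<sim> OK F \<Longrightarrow> is_ideal F B \<Longrightarrow> A \<cdot> B \<sim> A"
  using ideal_equiv_mult_right[OF F, of B "OK F" A] F id
  by (simp add: ideal_mult_commute[of F A] ideal_mult_OK)

lemma klein_cong: "klein F P Q A \<Longrightarrow> B \<sim> A \<Longrightarrow> klein F P Q B"
  unfolding klein_def using ideal_equiv_trans[OF F] by blast

lemma klein_sym: "klein F Q P A \<longleftrightarrow> klein F P Q A"
  unfolding klein_def by (auto simp: ideal_mult_commute[of F Q P])

lemma klein_basic: "klein F P Q (OK F)" "klein F P Q P" "klein F P Q Q" "klein F P Q (P \<cdot> Q)"
  unfolding klein_def using ideal_equiv_refl[OF F] by blast+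

lemma klein_mult_P:
  assumes A: "is_ideal F A" and k: "klein F P Q A" shows "klein F P Q (A \<cdot> P)"
proof -
  obtain C where C: "C \<in> {OK F, P, Q, P \<cdot> Q}" "A \<sim> C" using k unfolding klein_def by blast
  have CI: "is_ideal F C" using C(1) id by blast
  have AC: "A \<cdot> P \<sim> C \<cdot> P" by (rule ideal_equiv_mult_right[OF F C(2) A CI id(1)])
  have "klein F P Q (C \<cdot> P)"
  proof -
    from C(1) consider "C = OK F" | "C = P" | "C = Q" | "C = P \<cdot> Q" by blast
    thus ?thesis
    proof cases
      case 1 thus ?thesis using klein_basic ideal_mult_OK[OF F id(1)] by simp
    next
      case 2 thus ?thesis using klein_cong[OF klein_basic(1)] PP by simp
    next
      case 3 thus ?thesis using klein_basic(4) by (simp add: ideal_mult_commute[of F Q P])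
    next
      case 4
      have "P \<cdot> Q \<cdot> P = Q \<cdot> (P \<cdot> P)"
        using ideal_mult_assoc[OF F id(2,1,1)] by (simp add: ideal_mult_commute[of F P Q])
      moreover have "Q \<cdot> (P \<cdot> P) \<sim> Q" by (rule mul_one[OF id(2) PP is_ideal_mult[OF F id(1,1)]])
      ultimately show ?thesis using 4 klein_cong[OF klein_basic(3)] by simp
    qed
  qed
  thus ?thesis using AC klein_cong by blast
qed

lemma swap: "two_torsion_pair F Q P"
  using F P Q PP QQ by unfold_locales

lemma klein_mult:
  assumes A: "is_ideal F A" "is_ideal F B" and k: "klein F P Q A" "klein F P Q B"
  shows "klein F P Q (A \<cdot> B)"
proof -
  have mQ: "klein F P Q (X \<cdot> Q)" if "is_ideal F X" "klein F P Q X" for X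
    using two_torsion_pair.klein_mult_P[OF swap that(1)] that(2) klein_sym by blast
  obtain C where C: "C \<in> {OK F, P, Q, P \<cdot> Q}" "B \<sim> C" using k(2) unfolding klein_def by blast
  have CI: "is_ideal F C" using C(1) id by blast
  have "A \<cdot> B \<sim> A \<cdot> C"
    using ideal_equiv_mult_right[OF F C(2) A(2) CI A(1)] by (simp add: ideal_mult_commute[of F A])
  moreover have "klein F P Q (A \<cdot> C)"
  proof -
    from C(1) consider "C = OK F" | "C = P" | "C = Q" | "C = P \<cdot> Q" by blast
    thus ?thesis
    proof cases
      case 1 thus ?thesis using k ideal_mult_OK[OF F A(1)] by simp
    next
      case 2 thus ?thesis using klein_mult_P[OF A(1) k(1)] by simp
    next
      case 3 thus ?thesis using mQ[OF A(1) k(1)] by simp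
    next
      case 4
      have "A \<cdot> P \<cdot> Q = A \<cdot> (P \<cdot> Q)" by (rule ideal_mult_assoc[OF F A(1) id(1,2)])
      thus ?thesis using 4 mQ[OF is_ideal_mult[OF F A(1) id(1)] klein_mult_P[OF A(1) k(1)]] by simp
    qed
  qed
  ultimately show ?thesis using klein_cong by blast
qed

lemma pow_equiv:
  assumes R: "nz_ideal F R" "R \<cdot> R \<sim> OK F"
  shows "nz_ideal F (ideal_pow F R a) \<and> (ideal_pow F R a \<sim> OK F \<or> ideal_pow F R a \<sim> R)"
proof (induction a)
  case 0 thus ?case using nz_ideal_OK[OF F] ideal_equiv_refl[OF F] by simp
next
  case (Suc a)
  have RI: "is_ideal F R" by (rule nz_ideal_ideal[OF R(1)])
  have pI: "is_ideal F (ideal_pow F R a)" using Suc nz_ideal_ideal by blast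
  have "R \<cdot> ideal_pow F R a \<sim> OK F \<or> R \<cdot> ideal_pow F R a \<sim> R"
  proof (cases "ideal_pow F R a \<sim> OK F")
    case True thus ?thesis using mul_one[OF RI True pI] by blast
  next
    case False
    hence "ideal_pow F R a \<cdot> R \<sim> R \<cdot> R" using Suc ideal_equiv_mult_right[OF F _ pI RI RI] by blast
    hence "R \<cdot> ideal_pow F R a \<sim> R \<cdot> R" unfolding ideal_mult_commute[of F R "ideal_pow F R a"] .
    thus ?thesis using ideal_equiv_trans[OF F _ R(2)] by blast
  qed
  thus ?case using Suc nz_ideal_mult[OF F R(1)] by simp
qed

lemma pow_1: "nz_ideal F R \<Longrightarrow> ideal_pow F R (Suc 0) = R"
  by (simp add: ideal_mult_OK F nz_ideal_ideal)

lemma nz_four: "C \<in> {OK F, P, Q, P \<cdot> Q} \<Longrightarrow> nz_ideal F C"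
  using P Q nz_ideal_OK[OF F] nz_ideal_mult[OF F P Q] by blast

text \<open>Since \<open>P^2\<close> and \<open>Q^2\<close> are principal, exponents only matter
  modulo 2.\<close>

lemma span_eq: "cls_span2 F P Q = cls F ` {OK F, P, Q, P \<cdot> Q}"
proof
  show "cls F ` {OK F, P, Q, P \<cdot> Q} \<subseteq> cls_span2 F P Q"
  proof -
    have 00: "ideal_mult F (ideal_pow F P 0) (ideal_pow F Q 0) = OK F" by (simp add: ideal_mult_OK[OF F id(4)])
    have 10: "ideal_mult F (ideal_pow F P (Suc 0)) (ideal_pow F Q 0) = P"
      unfolding pow_1[OF P] by (simp add: ideal_mult_OK[OF F id(1)])
    have 01: "ideal_mult F (ideal_pow F P 0) (ideal_pow F Q (Suc 0)) = Q"
      unfolding pow_1[OF Q] by (simp add: ideal_mult_OK[OF F id(2)])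
    have 11: "ideal_mult F (ideal_pow F P (Suc 0)) (ideal_pow F Q (Suc 0)) = P \<cdot> Q"
      unfolding pow_1[OF P] pow_1[OF Q] ..
    have "cls F (ideal_mult F (ideal_pow F P a) (ideal_pow F Q b)) \<in> cls_span2 F P Q" for a b
      unfolding cls_span2_def by blast
    from this[of 0 0] this[of "Suc 0" 0] this[of 0 "Suc 0"] this[of "Suc 0" "Suc 0"]
    show ?thesis unfolding 00 10 01 11 by blast
  qed
  show "cls_span2 F P Q \<subseteq> cls F ` {OK F, P, Q, P \<cdot> Q}"
  proof
    fix X assume "X \<in> cls_span2 F P Q"
    then obtain a b where X: "X = cls F (ideal_pow F P a \<cdot> ideal_pow F Q b)" unfolding cls_span2_def by blast
    have a: "nz_ideal F (ideal_pow F P a)" "klein F P Q (ideal_pow F P a)"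
      using pow_equiv[OF P PP, of a] klein_cong[OF klein_basic(1)] klein_cong[OF klein_basic(2)] by blast+
    have b: "nz_ideal F (ideal_pow F Q b)" "klein F P Q (ideal_pow F Q b)"
      using pow_equiv[OF Q QQ, of b] klein_cong[OF klein_basic(1)] klein_cong[OF klein_basic(3)] by blast+
    have "klein F P Q (ideal_pow F P a \<cdot> ideal_pow F Q b)"
      using klein_mult a b nz_ideal_ideal by blast
    then obtain C where C: "C \<in> {OK F, P, Q, P \<cdot> Q}" "ideal_pow F P a \<cdot> ideal_pow F Q b \<sim> C"
      unfolding klein_def by blast
    have "X = cls F C" unfolding X
      using cls_eq_iff[OF F nz_ideal_mult[OF F a(1) b(1)] nz_four[OF C(1)]] C(2) by blast
    thus "X \<in> cls F ` {OK F, P, Q, P \<cdot> Q}" using C(1) by blast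
  qed
qed

text \<open>Any coincidence among the four classes, multiplied by \<open>P\<close> or
  \<open>Q\<close>, would make one of \<open>P\<close>, \<open>Q\<close>, \<open>P \<cdot> Q\<close>
  principal.\<close>

lemma card_span:
  assumes np: "\<not> principal F P" "\<not> principal F Q" "\<not> principal F (P \<cdot> Q)"
  shows "card (cls_span2 F P Q) = 4"
proof -
  have n: "\<not> P \<sim> OK F" "\<not> Q \<sim> OK F" "\<not> P \<cdot> Q \<sim> OK F"
    using np principal_iff_equiv_OK[OF F] P Q nz_ideal_mult[OF F P Q] by blast+
  have "\<not> P \<sim> Q"
  proof
    assume "P \<sim> Q"
    hence "P \<cdot> Q \<sim> Q \<cdot> Q" by (rule ideal_equiv_mult_right[OF F _ id(1,2,2)])
    thus False using QQ n ideal_equiv_trans[OF F] by blast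
  qed
  moreover have "\<not> P \<sim> P \<cdot> Q"
  proof
    assume "P \<sim> P \<cdot> Q"
    hence "P \<cdot> P \<sim> P \<cdot> Q \<cdot> P" by (rule ideal_equiv_mult_right[OF F _ id(1,3,1)])
    moreover have "P \<cdot> Q \<cdot> P = Q \<cdot> (P \<cdot> P)"
      using ideal_mult_assoc[OF F id(2,1,1)] by (simp add: ideal_mult_commute[of F P Q])
    moreover have "Q \<cdot> (P \<cdot> P) \<sim> Q" by (rule mul_one[OF id(2) PP is_ideal_mult[OF F id(1,1)]])
    ultimately have "P \<cdot> P \<sim> Q" using ideal_equiv_trans[OF F] by simp
    thus False using n PP ideal_equiv_trans[OF F ideal_equiv_sym] by blast
  qed
  moreover have "\<not> Q \<sim> P \<cdot> Q"
  proof
    assume "Q \<sim> P \<cdot> Q"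
    hence "Q \<cdot> Q \<sim> P \<cdot> Q \<cdot> Q" by (rule ideal_equiv_mult_right[OF F _ id(2,3,2)])
    moreover have "P \<cdot> Q \<cdot> Q = P \<cdot> (Q \<cdot> Q)" by (rule ideal_mult_assoc[OF F id(1,2,2)])
    moreover have "P \<cdot> (Q \<cdot> Q) \<sim> P" by (rule mul_one[OF id(1) QQ is_ideal_mult[OF F id(2,2)]])
    ultimately have "Q \<cdot> Q \<sim> P" using ideal_equiv_trans[OF F] by simp
    thus False using n QQ ideal_equiv_trans[OF F ideal_equiv_sym] by blast
  qed
  moreover note nz = nz_four[of "OK F"] nz_four[of P] nz_four[of Q] nz_four[of "P \<cdot> Q"]
  ultimately have "cls F P \<noteq> cls F Q" "cls F P \<noteq> cls F (P \<cdot> Q)" "cls F Q \<noteq> cls F (P \<cdot> Q)"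
    "cls F P \<noteq> cls F (OK F)" "cls F Q \<noteq> cls F (OK F)" "cls F (P \<cdot> Q) \<noteq> cls F (OK F)"
    using n cls_eq_iff[OF F] by simp_all
  thus ?thesis unfolding span_eq by (simp add: card_insert_if)
qed

end

section \<open>The capitulation kernels\<close>

context prime_pair
begin

abbreviation eqk (infix "\<sim>\<^sub>k" 50) where "A \<sim>\<^sub>k B \<equiv> ideal_equiv k A B"
abbreviation mulk (infixl "\<star>" 70) where "A \<star> B \<equiv> ideal_mult k A B"

lemma square_trivial:
  assumes "c \<in> O\<^sub>k" "c \<noteq> 0" "A \<star> A = (*) c ` O\<^sub>k" shows "A \<star> A \<sim>\<^sub>k O\<^sub>k"
  unfolding assms(3) by (rule ideal_equiv_smul[OF k_field assms(1,2)])

lemma ram_square: "ram c H \<Longrightarrow> H \<star> H \<sim>\<^sub>k O\<^sub>k"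
  using square_trivial ramD(3,4,6) by blast

lemma mul_square: "is_ideal k A \<Longrightarrow> is_ideal k B \<Longrightarrow> B \<star> B \<sim>\<^sub>k O\<^sub>k \<Longrightarrow> A \<star> (B \<star> B) \<sim>\<^sub>k A"
  using ideal_equiv_mult_right[OF k_field, of "B \<star> B" O\<^sub>k A] is_ideal_mult[OF k_field]
    is_ideal_OK[OF k_field] by (simp add: ideal_mult_commute[of k A] ideal_mult_OK[OF k_field])

lemma ram_mult_square:
  assumes "ram c A" "ram c' B"
  shows "(A \<star> B) \<star> (A \<star> B) = (*) (c * c') ` O\<^sub>k"
proof -
  note a = ramD[OF assms(1)] and b = ramD[OF assms(2)]
  have "(A \<star> B) \<star> (A \<star> B) = (A \<star> A) \<star> (B \<star> B)" by (intro ideal_mult_swap k_field a b)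
  thus ?thesis unfolding a(4) b(4) by (simp add: principal_mult_principal[OF k_field a(6) b(6)])
qed

lemma i_three: "- \<i> = \<i> ^ 3"
  by (simp add: power3_eq_cube)

text \<open>The square of the ideal \<open>w O\<^sub>k\<close> is generated by \<open>p q\<close>.\<close>
lemma ramified_all_principal:
  assumes z: "zfactor p z" "zfactor q z'"
    and H: "ram z H1" "ram (cnj z) H2" "ram z' H3" "ram (cnj z') H4"
  shows "(H3 \<star> H4) \<star> (H1 \<star> H2) \<sim>\<^sub>k O\<^sub>k"
proof -
  note d1 = ramD[OF H(1)] and d2 = ramD[OF H(2)] and d3 = ramD[OF H(3)] and d4 = ramD[OF H(4)]
  have w0: "w \<noteq> 0" using base.irr is_subfieldD(1)[OF is_subfield_QI] by auto
  define C where "C = (*) w ` O\<^sub>k"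
  have C: "nz_ideal k C" unfolding C_def by (rule nz_ideal_smul[OF k_field nz_ideal_OK[OF k_field] w_k(1) w0])
  have "w * w = - \<i> * of_nat (p * q)" using w_sq by (simp add: power2_eq_square)
  \<comment> \<open>The unit \<open>- \<i>\<close> takes the shape \<open>\<i> ^ 3 * 1^2\<close> so
    that \<open>principal_if_square\<close> applies with \<open>g = 1\<close> after the four primes
    are removed.\<close>
  also have "\<dots> = cnj z * (z * (cnj z' * (z' * (\<i> ^ 3 * 1\<^sup>2))))"
    unfolding i_three of_nat_mult zfactor_mult_cnj[OF z(1), symmetric] zfactor_mult_cnj[OF z(2), symmetric]
    by (simp only: power_one mult_1_right mult_1_left mult_ac)
  finally have ww: "w * w = cnj z * (z * (cnj z' * (z' * (\<i> ^ 3 * 1\<^sup>2))))" .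
  have CC: "C \<star> C = (*) (cnj z * (z * (cnj z' * (z' * (\<i> ^ 3 * 1\<^sup>2))))) ` O\<^sub>k"
    unfolding C_def ww[symmetric] by (rule principal_mult_principal[OF k_field w_k(1) w_k(1)])
  have Z: "\<i> ^ 3 * 1\<^sup>2 \<in> ZI" by auto
  note Z3 = ZI_closed(9)[OF d3(2) Z]
  note Z4 = ZI_closed(9)[OF d4(2) Z3]
  note Z1 = ZI_closed(9)[OF d1(2) Z4]
  obtain C1 where C1: "nz_ideal k C1" "C1 \<star> C1 = (*) (z * (cnj z' * (z' * (\<i> ^ 3 * 1\<^sup>2)))) ` O\<^sub>k" "C = C1 \<star> H2"
    using ram_divide[OF H(2) C Z1 CC] .
  obtain C2 where C2: "nz_ideal k C2" "C2 \<star> C2 = (*) (cnj z' * (z' * (\<i> ^ 3 * 1\<^sup>2))) ` O\<^sub>k" "C1 = C2 \<star> H1"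
    using ram_divide[OF H(1) C1(1) Z4 C1(2)] .
  obtain C3 where C3: "nz_ideal k C3" "C3 \<star> C3 = (*) (z' * (\<i> ^ 3 * 1\<^sup>2)) ` O\<^sub>k" "C2 = C3 \<star> H4"
    using ram_divide[OF H(4) C2(1) Z3 C2(2)] .
  obtain C4 where C4: "nz_ideal k C4" "C4 \<star> C4 = (*) (\<i> ^ 3 * 1\<^sup>2) ` O\<^sub>k" "C3 = C4 \<star> H3"
    using ram_divide[OF H(3) C3(1) Z C3(2)] .
  have "C4 = O\<^sub>k" using principal_if_square[OF C4(1) _ _ C4(2)] by simp
  hence "C = H3 \<star> H4 \<star> H1 \<star> H2" unfolding C1(3) C2(3) C3(3) C4(3) by (simp add: ideal_mult_OK[OF k_field d3(1)])
  also have "\<dots> = (H3 \<star> H4) \<star> (H1 \<star> H2)"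
    by (rule ideal_mult_assoc[OF k_field is_ideal_mult[OF k_field d3(1) d4(1)] d1(1) d2(1)])
  finally show ?thesis using ideal_equiv_smul[OF k_field w_k(1) w0, of O\<^sub>k] by (simp add: C_def)
qed

lemma nonprincipal_ramified:
  assumes ef: "int p = e\<^sup>2 + (2 * f)\<^sup>2" and H0: "ram (1 + \<i>) H0"
    and H: "ram (of_int e + 2 * \<i> * of_int f) H1" "ram (of_int e - 2 * \<i> * of_int f) H2"
  shows "\<not> principal k H1" "\<not> principal k H2" "\<not> principal k (H1 \<star> H2)"
    "\<not> principal k (H0 \<star> H1)" "\<not> principal k (H0 \<star> H2)"
proof -
  let ?z = "of_int e + 2 * \<i> * of_int f" and ?z' = "of_int e - 2 * \<i> * of_int f"
  have z: "?z = of_int e + \<i> * of_int (2 * f)" "?z' = of_int e + \<i> * of_int (- (2 * f))" by simp_all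
  have zf: "zfactor p ?z" "zfactor p ?z'" unfolding zfactor_def
    using ramD(2)[OF H(1)] ramD(2)[OF H(2)] unfolding z gnorm_gi ef by auto
  \<comment> \<open>The two primes above \<open>p\<close> differ by the sign of \<open>f\<close>, so
    one obstruction serves both.\<close>
  have ef': "int p = e\<^sup>2 + (2 * (- f))\<^sup>2" using ef by simp
  note d0 = ramD[OF H0] and d1 = ramD[OF H(1)] and d2 = ramD[OF H(2)]
  have zz: "?z * ?z' = of_nat p"
  proof -
    have "cnj ?z = ?z'" by simp
    thus ?thesis using zfactor_mult_cnj[OF zf(1)] by simp
  qed
  show "\<not> principal k H1"
  proof
    assume pr: "principal k H1"
    obtain x y j where xy: "x \<in> ZI" "y \<in> ZI" "x\<^sup>2 + \<i> * of_nat (p * q) * y\<^sup>2 = \<i> ^ j * ?z"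
      using principal_ram_norm[OF d1(1,4,2,3) pr] .
    show False by (rule H1_obstruction[OF ef xy])
  qed
  show "\<not> principal k H2"
  proof
    assume pr: "principal k H2"
    obtain x y j where xy: "x \<in> ZI" "y \<in> ZI" "x\<^sup>2 + \<i> * of_nat (p * q) * y\<^sup>2 = \<i> ^ j * ?z'"
      using principal_ram_norm[OF d2(1,4,2,3) pr] .
    have "x\<^sup>2 + \<i> * of_nat (p * q) * y\<^sup>2 = \<i> ^ j * (of_int e + 2 * \<i> * of_int (- f))" using xy(3) by simp
    thus False by (rule H1_obstruction[OF ef' xy(1,2)])
  qed
  show "\<not> principal k (H1 \<star> H2)"
  proof
    assume pr: "principal k (H1 \<star> H2)"
    have sq: "(H1 \<star> H2) \<star> (H1 \<star> H2) = (*) (of_nat p) ` O\<^sub>k"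
      using ram_mult_square[OF H] unfolding zz .
    obtain x y j where xy: "x \<in> ZI" "y \<in> ZI" "x\<^sup>2 + \<i> * of_nat (p * q) * y\<^sup>2 = \<i> ^ j * of_nat p"
      using principal_ram_norm[OF is_ideal_mult[OF k_field d1(1) d2(1)] sq _ _ pr] gt2 by auto
    show False by (rule H1H2_obstruction[OF xy])
  qed
  have *: "\<not> principal k (H0 \<star> A)" if A: "ram c A" and c: "zfactor p c" for c A
  proof
    assume pr: "principal k (H0 \<star> A)"
    note dA = ramD[OF A]
    obtain x y j where xy: "x \<in> ZI" "y \<in> ZI" "x\<^sup>2 + \<i> * of_nat (p * q) * y\<^sup>2 = \<i> ^ j * ((1 + \<i>) * c)"
      using principal_ram_norm[OF is_ideal_mult[OF k_field d0(1) dA(1)] ram_mult_square[OF H0 A]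
          ZI_closed(9)[OF d0(2) dA(2)] no_zero_divisors[OF d0(3) dA(3)] pr] .
    show False by (rule H0H1_obstruction[OF c xy])
  qed
  show "\<not> principal k (H0 \<star> H1)" "\<not> principal k (H0 \<star> H2)"
    using *[OF H(1) zf(1)] *[OF H(2) zf(2)] by auto
qed

text \<open>Every class of order two lies in \<open>\<langle>[P], [Q], [H\<^sub>0]\<rangle>\<close>; as \<open>P\<close> and \<open>Q\<close> capitulate and \<open>H\<^sub>0\<close> does not,
  the kernel is \<open>\<langle>[P], [Q]\<rangle>\<close>.\<close>
lemma cap_kernel_eq:
  assumes l: "l = p \<or> l = q" and tt: "two_torsion_pair k P Q"
    and cap: "principal (KK l) (gen_ideal (KK l) P)" "principal (KK l) (gen_ideal (KK l) Q)"
    and z: "zfactor p z" "zfactor q z'" and H0: "ram (1 + \<i>) H0"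
    and H: "ram z H1" "ram (cnj z) H2" "ram z' H3" "ram (cnj z') H4"
    and gen: "\<And>A. A \<in> {H1, H2, H3, H4} \<Longrightarrow> klein k P Q A \<or> klein k P Q (A \<star> H0)"
  shows "cap_kernel k (KK l) = cls_span2 k P Q"
proof -
  interpret t: two_torsion_pair k P Q by (rule tt)
  let ?K = "KK l"
  let ?cap = "\<lambda>I. principal ?K (gen_ideal ?K I)"
  note Kf = KK_field[of l] and d0 = ramD[OF H0]
  have cap_mult: "?cap (A \<star> B)" if "is_ideal k A" "is_ideal k B" "?cap A" "?cap B" for A B
    by (rule capitulates_mult[OF k_field Kf k_KK that])
  have cap_eqv: "?cap B" if "is_ideal k A" "is_ideal k B" "A \<sim>\<^sub>k B" "?cap A" for A B
    by (rule capitulates_equiv[OF k_field Kf k_KK that])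
  have OO: "O\<^sub>k \<star> O\<^sub>k = O\<^sub>k" by (rule ideal_mult_OK(1)[OF k_field is_ideal_OK[OF k_field]])
  \<comment> \<open>The unit ideal is the case \<open>c = s = u = 1\<close> of the square
    criterion.\<close>
  have capO: "?cap O\<^sub>k"
    by (rule capitulates_square[OF k_field Kf k_KK is_ideal_OK[OF k_field], of 1 1 1])
       (use OO OK_1[OF k_field] OK_1[OF Kf] is_subfieldD(2)[OF Kf] in auto)
  have cap4: "?cap C" if "C \<in> {O\<^sub>k, P, Q, P \<star> Q}" for C
    using that capO cap cap_mult[OF t.id(1,2)] by blast
  have sq4: "C \<star> C \<sim>\<^sub>k O\<^sub>k" if "C \<in> {O\<^sub>k, P, Q, P \<star> Q}" for C
  proof -
    have "(P \<star> Q) \<star> (P \<star> Q) = (P \<star> P) \<star> (Q \<star> Q)" by (intro ideal_mult_swap k_field t.id)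
    moreover have "(P \<star> P) \<star> (Q \<star> Q) \<sim>\<^sub>k P \<star> P"
      by (rule mul_square[OF is_ideal_mult[OF k_field t.id(1,1)] t.id(2) t.QQ])
    ultimately have "(P \<star> Q) \<star> (P \<star> Q) \<sim>\<^sub>k O\<^sub>k" using t.PP ideal_equiv_trans[OF k_field] by simp
    thus ?thesis using that t.PP t.QQ OO ideal_equiv_refl[OF k_field, of O\<^sub>k] by auto
  qed
  show ?thesis
  proof (intro equalityI subsetI)
    fix X assume "X \<in> cls_span2 k P Q"
    then obtain C where C: "C \<in> {O\<^sub>k, P, Q, P \<star> Q}" "X = cls k C" unfolding t.span_eq by blast
    have nz: "nz_ideal k C" by (rule t.nz_four[OF C(1)])
    have "ideal_pow k C (2 ^ 1) = C \<star> C"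
      using ideal_mult_OK(2)[OF k_field nz_ideal_ideal[OF nz]] by (simp add: numeral_2_eq_2)
    hence "principal k (ideal_pow k C (2 ^ 1))"
      using principal_iff_equiv_OK[OF k_field nz_ideal_mult[OF k_field nz nz]] sq4[OF C(1)] by simp
    thus "X \<in> cap_kernel k ?K" unfolding cap_kernel_def using C nz cap4[OF C(1)] by blast
  next
    fix X assume "X \<in> cap_kernel k ?K"
    then obtain I where I: "X = cls k I" "nz_ideal k I" "?cap I" unfolding cap_kernel_def by blast
    obtain \<nu> where \<nu>: "\<nu> \<in> O\<^sub>k" "\<nu> \<noteq> 0" "I \<star> I = (*) \<nu> ` O\<^sub>k" using capitulation_square[OF l I(2,3)] .
    obtain A a where A: "nz_ideal k A" "a \<in> ZI" "a \<noteq> 0" "A \<star> A = (*) a ` O\<^sub>k" "A \<sim>\<^sub>k I"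
      using order_two_class_representative[OF I(2) \<nu>(3,1,2)] .
    have AI: "is_ideal k A" by (rule nz_ideal_ideal[OF A(1)])
    have H0H0: "H0 \<star> H0 \<sim>\<^sub>k O\<^sub>k" by (rule ram_square[OF H0])
    have gen': "klein k P Q B \<or> klein k P Q (B \<star> H0)" if "B \<in> {H0, H1, H2, H3, H4}" for B
      using gen that t.klein_cong[OF t.klein_basic(1) H0H0] by blast
    \<comment> \<open>The predicate says that the class lies in
      \<open>\<langle>[P], [Q]\<rangle>\<close> or in its coset by \<open>H0\<close>. It is stable
      under multiplication by each ramified prime; the equations \<open>e1\<close> to
      \<open>e3\<close> distribute the factors \<open>H0\<close> over the four combinations.\<close>
    have "klein k P Q A \<or> klein k P Q (A \<star> H0)"
    proof (rule ramified_class_induct[of "\<lambda>A. klein k P Q A \<or> klein k P Q (A \<star> H0)" A a, OF _ _ _ A(1-4)])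
      fix c assume c: "gprime c" "c gdvd 1 + \<i> \<or> c gdvd of_nat (p * q)"
      obtain c' j where c': "c' \<in> {1 + \<i>, z, cnj z, z', cnj z'}" "c = c' * \<i> ^ j"
        using ramified_gprime_cases[OF c z] .
      then obtain B where B: "ram c' B" "B \<in> {H0, H1, H2, H3, H4}" using H0 H by blast
      note BI = ramD(1)[OF B(1)]
      have "klein k P Q (D \<star> B) \<or> klein k P Q (D \<star> B \<star> H0)"
        if D: "nz_ideal k D" "klein k P Q D \<or> klein k P Q (D \<star> H0)" for D
      proof -
        have DI: "is_ideal k D" by (rule nz_ideal_ideal[OF D(1)])
        note DH = is_ideal_mult[OF k_field DI d0(1)] and BH = is_ideal_mult[OF k_field BI d0(1)]
          and DB = is_ideal_mult[OF k_field DI BI]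
        have e1: "D \<star> B \<star> H0 = D \<star> (B \<star> H0)" by (rule ideal_mult_assoc[OF k_field DI BI d0(1)])
        have "D \<star> H0 \<star> B = D \<star> (H0 \<star> B)" by (rule ideal_mult_assoc[OF k_field DI d0(1) BI])
        hence e2: "D \<star> B \<star> H0 = D \<star> H0 \<star> B" unfolding e1 by (simp add: ideal_mult_commute[of k H0])
        have "(D \<star> H0) \<star> (B \<star> H0) = (D \<star> B) \<star> (H0 \<star> H0)" by (intro ideal_mult_swap k_field DI BI d0)
        moreover have "(D \<star> B) \<star> (H0 \<star> H0) \<sim>\<^sub>k D \<star> B" by (rule mul_square[OF DB d0(1) H0H0])
        ultimately have e3: "D \<star> B \<sim>\<^sub>k (D \<star> H0) \<star> (B \<star> H0)" using ideal_equiv_sym by simp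
        show ?thesis
          using D(2) gen'[OF B(2)] t.klein_mult[OF DI BI] t.klein_mult[OF DI BH]
            t.klein_mult[OF DH BI] t.klein_cong[OF t.klein_mult[OF DH BH] e3]
          unfolding e1[symmetric] e2[symmetric] by blast
      qed
      thus "\<exists>c' H j. ram c' H \<and> c = c' * \<i> ^ j \<and> (\<forall>A. nz_ideal k A \<longrightarrow>
          klein k P Q A \<or> klein k P Q (A \<star> H0) \<longrightarrow> klein k P Q (A \<star> H) \<or> klein k P Q (A \<star> H \<star> H0))"
        using B(1) c'(2) by blast
    next
      show "klein k P Q O\<^sub>k \<or> klein k P Q (O\<^sub>k \<star> H0)" using t.klein_basic(1) by blast
    next
      fix A B assume AB: "nz_ideal k A" "nz_ideal k B" "A \<sim>\<^sub>k B" "klein k P Q A \<or> klein k P Q (A \<star> H0)"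
      have "B \<sim>\<^sub>k A" using AB ideal_equiv_sym by blast
      moreover from this have "B \<star> H0 \<sim>\<^sub>k A \<star> H0"
        using AB d0 by (intro ideal_equiv_mult_right[OF k_field]) (auto intro: nz_ideal_ideal)
      ultimately show "klein k P Q B \<or> klein k P Q (B \<star> H0)" using AB(4) t.klein_cong by blast
    qed
    \<comment> \<open>In the coset of \<open>H0\<close>, both \<open>A \<star> H0\<close> and
      \<open>A\<close> would capitulate, hence also their product
      \<open>H0 \<star> (A \<star> A)\<close>, which is equivalent to \<open>H0\<close>.\<close>
    moreover have "\<not> klein k P Q (A \<star> H0)"
    proof
      assume "klein k P Q (A \<star> H0)"
      then obtain C where C: "C \<in> {O\<^sub>k, P, Q, P \<star> Q}" "A \<star> H0 \<sim>\<^sub>k C" unfolding klein_def by blast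
      note AH = is_ideal_mult[OF k_field AI d0(1)]
      have "?cap (A \<star> H0)"
        using cap_eqv[OF nz_ideal_ideal[OF t.nz_four[OF C(1)]] AH ideal_equiv_sym[OF C(2)] cap4[OF C(1)]] .
      moreover have "?cap A" using cap_eqv[OF nz_ideal_ideal[OF I(2)] AI ideal_equiv_sym[OF A(5)] I(3)] .
      ultimately have "?cap ((A \<star> H0) \<star> A)" using cap_mult[OF AH AI] by blast
      moreover have "(A \<star> H0) \<star> A = H0 \<star> (A \<star> A)"
        using ideal_mult_assoc[OF k_field d0(1) AI AI] by (simp add: ideal_mult_commute[of k A H0])
      moreover have "H0 \<star> (A \<star> A) \<sim>\<^sub>k H0"
        by (rule mul_square[OF d0(1) AI square_trivial[OF ZI_k[OF A(2)] A(3,4)]])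
      ultimately have "?cap H0"
        using cap_eqv[OF is_ideal_mult[OF k_field d0(1) is_ideal_mult[OF k_field AI AI]] d0(1)] by simp
      moreover have "\<not> ?cap H0" using not_capitulates_1i[OF _ H0] l by blast
      ultimately show False by blast
    qed
    ultimately obtain C where C: "C \<in> {O\<^sub>k, P, Q, P \<star> Q}" "A \<sim>\<^sub>k C" unfolding klein_def by blast
    have "I \<sim>\<^sub>k C" using A(5) C(2) ideal_equiv_sym ideal_equiv_trans[OF k_field] by blast
    hence "cls k I = cls k C" using cls_eq_iff[OF k_field I(2) t.nz_four[OF C(1)]] by blast
    thus "X \<in> cls_span2 k P Q" unfolding t.span_eq I(1) using C(1) by blast
  qed
qed

text \<open>A class with trivial square is its own inverse, which lets a relation be solved for one
  factor.\<close>

lemma equiv_if_mult_trivial: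
  assumes I: "is_ideal k A" "is_ideal k B" and AB: "A \<star> B \<sim>\<^sub>k O\<^sub>k" and BB: "B \<star> B \<sim>\<^sub>k O\<^sub>k"
  shows "A \<sim>\<^sub>k B"
proof -
  have "A \<star> B \<star> B \<sim>\<^sub>k O\<^sub>k \<star> B"
    by (rule ideal_equiv_mult_right[OF k_field AB is_ideal_mult[OF k_field I] is_ideal_OK[OF k_field] I(2)])
  hence "A \<star> (B \<star> B) \<sim>\<^sub>k B" unfolding ideal_mult_assoc[OF k_field I I(2)] ideal_mult_OK(1)[OF k_field I(2)] .
  thus ?thesis using ideal_equiv_trans[OF k_field ideal_equiv_sym[OF mul_square[OF I BB]]] by blast
qed

text \<open>Let \<open>A, B\<close> be the primes in the Pell relation and \<open>A', B'\<close> the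
  other ones above \<open>p\<close> and \<open>q\<close>. The relations say that \<open>B\<close>
  has the class of \<open>A \<star> H0\<close> and \<open>B'\<close> that of
  \<open>A' \<star> H0\<close>. So over \<open>k(\<surd>p)\<close> the primes above \<open>q\<close>
  fall into the coset of \<open>H0\<close>, while over \<open>k(\<surd>q)\<close> their capitulation
  passes to \<open>H0 \<star> A\<close> and \<open>H0 \<star> A'\<close>.\<close>

lemma capitulation_kernels:
  assumes ef: "int p = e\<^sup>2 + (2 * f)\<^sup>2" and H0: "ram (1 + \<i>) H0"
    and H: "ram (of_int e + 2 * \<i> * of_int f) H1" "ram (of_int e - 2 * \<i> * of_int f) H2"
  shows "cap_kernel k (KK p) = cls_span2 k H1 H2" "card (cls_span2 k H1 H2) = 4"
    "cap_kernel k (KK q) = cls_span2 k (H0 \<star> H1) (H0 \<star> H2)" "card (cls_span2 k (H0 \<star> H1) (H0 \<star> H2)) = 4"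
proof -
  let ?z = "of_int e + 2 * \<i> * of_int f"
  have cz: "cnj ?z = of_int e - 2 * \<i> * of_int f" by simp
  have z: "?z = of_int e + \<i> * of_int (2 * f)" by simp
  have zp: "zfactor p ?z" unfolding zfactor_def
    using ramD(2)[OF H(1)] unfolding z gnorm_gi ef by auto
  obtain a b where ab: "int q = a\<^sup>2 + b\<^sup>2" using prime_1_mod_4_sum_of_squares[OF primes(2,5)] .
  define z' where "z' = of_int a + \<i> * of_int b"
  have zq: "zfactor q z'" unfolding zfactor_def z'_def gnorm_gi using ab by auto
  obtain H3 where H3: "ram z' H3" using zfactor_ram(1)[OF _ zq] by blast
  obtain H4 where H4: "ram (cnj z') H4" using zfactor_ram(1)[OF _ zfactor_cnj[OF zq]] by blast
  have H2: "ram (cnj ?z) H2" unfolding cz by (rule H(2))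
  note HH = H(1) H2 H3 H4
  note d0 = ramD[OF H0] and d1 = ramD[OF H(1)] and d2 = ramD[OF H2] and d3 = ramD[OF H3] and d4 = ramD[OF H4]
  obtain A B where AB: "A = H1 \<or> A = H2" "B = H3 \<or> B = H4" "B \<star> (A \<star> H0) \<sim>\<^sub>k O\<^sub>k"
    using ramified_product_principal[OF zp zq H0 HH] .
  obtain cA where rA: "ram cA A" using AB(1) HH by blast
  obtain cB where rB: "ram cB B" using AB(2) HH by blast
  obtain A' cA' where A': "ram cA' A'" "{H1, H2} = {A, A'}" "A \<star> A' = H1 \<star> H2"
    using AB(1) H(1) H2 ideal_mult_commute[of k H1 H2] by (metis insert_commute)
  obtain B' cB' where B': "ram cB' B'" "{H3, H4} = {B, B'}" "B \<star> B' = H3 \<star> H4"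
    using AB(2) H3 H4 ideal_mult_commute[of k H3 H4] by (metis insert_commute)
  have I: "is_ideal k A" "is_ideal k B" "is_ideal k A'" "is_ideal k B'" "is_ideal k H0"
    using ramD(1) rA rB A'(1) B'(1) H0 by blast+
  note M = is_ideal_mult[OF k_field]
  note trans = ideal_equiv_trans[OF k_field]
  have sqm: "(X \<star> Y) \<star> (X \<star> Y) \<sim>\<^sub>k O\<^sub>k" if "ram x X" "ram y Y" for X Y x y
    using square_trivial[OF OK_mult[OF k_field ramD(6)[OF that(1)] ramD(6)[OF that(2)]]
        no_zero_divisors[OF ramD(3)[OF that(1)] ramD(3)[OF that(2)]] ram_mult_square[OF that]] .
  have r3: "B \<sim>\<^sub>k A \<star> H0" by (rule equiv_if_mult_trivial[OF I(2) M[OF I(1,5)] AB(3) sqm[OF rA H0]])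
  have r1: "B \<star> H0 \<sim>\<^sub>k A"
  proof (rule equiv_if_mult_trivial[OF M[OF I(2,5)] I(1) _ ram_square[OF rA]])
    have "B \<star> H0 \<star> A = B \<star> (A \<star> H0)"
      unfolding ideal_mult_assoc[OF k_field I(2,5,1)] ideal_mult_commute[of k H0 A] ..
    thus "B \<star> H0 \<star> A \<sim>\<^sub>k O\<^sub>k" using AB(3) by simp
  qed
  have "(B \<star> B') \<star> (A \<star> A') \<sim>\<^sub>k O\<^sub>k" unfolding A'(3) B'(3) by (rule ramified_all_principal[OF zp zq HH])
  hence r2: "B \<star> B' \<sim>\<^sub>k A \<star> A'" by (rule equiv_if_mult_trivial[OF M[OF I(2,4)] M[OF I(1,3)] _ sqm[OF rA A'(1)]])
  \<comment> \<open>Multiplying \<open>r2\<close> by \<open>B\<close> isolates \<open>B'\<close>,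
    because \<open>B \<star> B\<close> is principal.\<close>
  have r4: "B' \<sim>\<^sub>k B \<star> (A \<star> A')"
  proof -
    have "B' \<sim>\<^sub>k B' \<star> (B \<star> B)" by (rule ideal_equiv_sym[OF mul_square[OF I(4,2) ram_square[OF rB]]])
    also have "B' \<star> (B \<star> B) = (B \<star> B') \<star> B"
      unfolding ideal_mult_assoc[OF k_field I(4,2,2), symmetric] ideal_mult_commute[of k B' B] ..
    finally have "B' \<sim>\<^sub>k (A \<star> A') \<star> B"
      using trans ideal_equiv_mult_right[OF k_field r2 M[OF I(2,4)] M[OF I(1,3)] I(2)] by blast
    thus ?thesis unfolding ideal_mult_commute[of k B] .
  qed
  have np: "\<not> principal k H1" "\<not> principal k H2" "\<not> principal k (H1 \<star> H2)"
    "\<not> principal k (H0 \<star> H1)" "\<not> principal k (H0 \<star> H2)"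
    using nonprincipal_ramified[OF ef H0 H] by blast+
  have capp: "principal (KK p) (gen_ideal (KK p) H1)" "principal (KK p) (gen_ideal (KK p) H2)"
    using capitulates_prime_factor[OF _ zp H(1)] capitulates_prime_factor[OF _ zfactor_cnj[OF zp] H2] by blast+

  interpret t1: two_torsion_pair k H1 H2
    by unfold_locales (use k_field ram_nz[OF H(1)] ram_nz[OF H2] ram_square[OF H(1)] ram_square[OF H2] in blast)+
  show "card (cls_span2 k H1 H2) = 4" by (rule t1.card_span[OF np(1-3)])
  have kA: "klein k H1 H2 A" "klein k H1 H2 (A \<star> A')" using AB(1) t1.klein_basic A'(3) by auto
  show "cap_kernel k (KK p) = cls_span2 k H1 H2"
  proof (rule cap_kernel_eq[OF _ t1.two_torsion_pair_axioms capp zp zq H0 HH])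
    fix C assume "C \<in> {H1, H2, H3, H4}"
    hence "C \<in> {H1, H2} \<or> C = B \<or> C = B'" using B'(2) by blast
    moreover have "klein k H1 H2 (B \<star> H0)" by (rule t1.klein_cong[OF kA(1) r1])
    moreover have "klein k H1 H2 (B' \<star> H0)"
    proof -
      have "B' \<star> H0 \<sim>\<^sub>k B \<star> (A \<star> A') \<star> H0"
        by (rule ideal_equiv_mult_right[OF k_field r4 I(4) M[OF I(2) M[OF I(1,3)]] I(5)])
      also have "B \<star> (A \<star> A') \<star> H0 = (B \<star> H0) \<star> (A \<star> A')"
        unfolding ideal_mult_assoc[OF k_field I(2) M[OF I(1,3)] I(5)] ideal_mult_assoc[OF k_field I(2,5) M[OF I(1,3)]]
          ideal_mult_commute[of k "A \<star> A'" H0] ..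
      finally show ?thesis
        using t1.klein_cong[OF t1.klein_mult[OF M[OF I(2,5)] M[OF I(1,3)] \<open>klein k H1 H2 (B \<star> H0)\<close> kA(2)]] by blast
    qed
    ultimately show "klein k H1 H2 C \<or> klein k H1 H2 (C \<star> H0)" using t1.klein_basic by blast
  qed simp

  let ?P = "H0 \<star> H1" and ?Q = "H0 \<star> H2"
  interpret t2: two_torsion_pair k ?P ?Q
  proof unfold_locales
    show "nz_ideal k ?P" "nz_ideal k ?Q" using nz_ideal_mult[OF k_field ram_nz[OF H0]] ram_nz HH by blast+
    show "?P \<star> ?P \<sim>\<^sub>k O\<^sub>k" "?Q \<star> ?Q \<sim>\<^sub>k O\<^sub>k" using sqm[OF H0 H(1)] sqm[OF H0 H2] by blast+
  qed (rule k_field)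
  have PQ: "?P \<star> ?Q \<sim>\<^sub>k H1 \<star> H2"
  proof -
    have "?P \<star> ?Q = (H0 \<star> H0) \<star> (H1 \<star> H2)" by (intro ideal_mult_swap k_field d0 d1 d2)
    also have "\<dots> = (H1 \<star> H2) \<star> (H0 \<star> H0)" by (rule ideal_mult_commute)
    finally show ?thesis using mul_square[OF M[OF d1(1) d2(1)] d0(1) ram_square[OF H0]] by simp
  qed
  have npPQ: "\<not> principal k (?P \<star> ?Q)"
  proof
    assume "principal k (?P \<star> ?Q)"
    hence "?P \<star> ?Q \<sim>\<^sub>k O\<^sub>k" using principal_iff_equiv_OK[OF k_field t2.nz_four[of "?P \<star> ?Q"]] by blast
    hence "H1 \<star> H2 \<sim>\<^sub>k O\<^sub>k" using trans[OF ideal_equiv_sym[OF PQ]] by blast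
    thus False using np(3) principal_iff_equiv_OK[OF k_field t1.nz_four[of "H1 \<star> H2"]] by blast
  qed
  show "card (cls_span2 k ?P ?Q) = 4" by (rule t2.card_span[OF np(4,5) npPQ])
  have capq: "principal (KK q) (gen_ideal (KK q) H3)" "principal (KK q) (gen_ideal (KK q) H4)"
    using capitulates_prime_factor[OF _ zq H3] capitulates_prime_factor[OF _ zfactor_cnj[OF zq] H4] by blast+
  hence capB: "principal (KK q) (gen_ideal (KK q) B)" "principal (KK q) (gen_ideal (KK q) B')"
    using B'(2) by (metis insertCI insertE singletonD)+
  note cap_mult = capitulates_mult[OF k_field KK_field k_KK] and cap_eqv = capitulates_equiv[OF k_field KK_field k_KK]
  have c1: "principal (KK q) (gen_ideal (KK q) (A \<star> H0))" by (rule cap_eqv[OF I(2) M[OF I(1,5)] r3 capB(1)])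
  have c2: "principal (KK q) (gen_ideal (KK q) (A \<star> A'))"
    by (rule cap_eqv[OF M[OF I(2,4)] M[OF I(1,3)] r2 cap_mult[OF I(2,4) capB]])
  \<comment> \<open>Both factors capitulate by \<open>r3\<close> and \<open>r2\<close>; their
    product is \<open>H0 \<star> A'\<close> up to the principal square of \<open>A\<close>.\<close>
  have "(A \<star> H0) \<star> (A \<star> A') = (A \<star> A) \<star> (H0 \<star> A')" by (intro ideal_mult_swap k_field I)
  also have "\<dots> = (H0 \<star> A') \<star> (A \<star> A)" by (rule ideal_mult_commute)
  also have "\<dots> \<sim>\<^sub>k H0 \<star> A'" by (rule mul_square[OF M[OF I(5,3)] I(1) ram_square[OF rA]])
  finally have c3: "principal (KK q) (gen_ideal (KK q) (H0 \<star> A'))"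
    by (rule cap_eqv[OF M[OF M[OF I(1,5)] M[OF I(1,3)]] M[OF I(5,3)] _ cap_mult[OF M[OF I(1,5)] M[OF I(1,3)] c1 c2]])
  have capA: "principal (KK q) (gen_ideal (KK q) (H0 \<star> X))" if "X \<in> {A, A'}" for X
    using that c1 c3 unfolding ideal_mult_commute[of k A H0] by blast
  have capPQ: "principal (KK q) (gen_ideal (KK q) ?P)" "principal (KK q) (gen_ideal (KK q) ?Q)"
    using capA A'(2) by blast+
  have kB: "klein k ?P ?Q B"
  proof -
    have "A \<star> H0 = ?P \<or> A \<star> H0 = ?Q" using AB(1) ideal_mult_commute[of k A H0] by auto
    thus ?thesis using t2.klein_cong[OF _ r3] t2.klein_basic by metis
  qed
  have kAA: "klein k ?P ?Q (A \<star> A')" unfolding A'(3) by (rule t2.klein_cong[OF t2.klein_basic(4) ideal_equiv_sym[OF PQ]])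
  have kB': "klein k ?P ?Q B'" by (rule t2.klein_cong[OF t2.klein_mult[OF I(2) M[OF I(1,3)] kB kAA] r4])
  show "cap_kernel k (KK q) = cls_span2 k ?P ?Q"
  proof (rule cap_kernel_eq[OF _ t2.two_torsion_pair_axioms capPQ zp zq H0 HH])
    fix C assume "C \<in> {H1, H2, H3, H4}"
    hence "C = H1 \<or> C = H2 \<or> C = B \<or> C = B'" using B'(2) by blast
    moreover have "klein k ?P ?Q (H1 \<star> H0)" "klein k ?P ?Q (H2 \<star> H0)"
      using t2.klein_basic(2,3) unfolding ideal_mult_commute[of k H0] by auto
    ultimately show "klein k ?P ?Q C \<or> klein k ?P ?Q (C \<star> H0)" using kB kB' by blast
  qed simp
qed

end

text \<open>For primes congruent to 1 modulo 4 the exponent in quadratic reciprocity is even, so the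
  symbol \<open>(p/q)\<close> is symmetric.\<close>

lemma prime_pair_if_Legendre:
  assumes "prime p" "prime q" "p \<noteq> q" "p mod 4 = 1" "q mod 4 = 1"
    and L: "(Legendre (int p) (int q) = -1 \<and> Legendre 2 (int p) = -1)
       \<or> (Legendre (int p) (int q) = -1 \<and> Legendre 2 (int q) = -1)
       \<or> (Legendre 2 (int p) = -1 \<and> Legendre 2 (int q) = -1)"
  shows "prime_pair p q"
proof
  have odd: "p > 2" "q > 2"
    using assms prime_gt_1_nat[of p] prime_gt_1_nat[of q] by (cases "p = 2"; cases "q = 2"; simp)+
  have "\<not> int p dvd int q" "\<not> int q dvd int p"
    using assms primes_dvd_imp_eq[of p q] primes_dvd_imp_eq[of q p] by auto
  hence nd: "\<not> [int q = 0] (mod int p)" "\<not> [int p = 0] (mod int q)" by (auto simp: cong_0_iff)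
  have "even ((p - 1) div 2)" using assms(4) by presburger
  hence "Legendre (int p) (int q) * Legendre (int q) (int p) = 1"
    using Quadratic_Reciprocity[of p q] assms odd by simp
  thus "QuadRes (int q) (int p) \<longleftrightarrow> QuadRes (int p) (int q)"
    using nd by (auto simp: Legendre_def split: if_splits)
  show "\<not> (QuadRes (int q) (int p) \<and> QuadRes (int p) 2)" "\<not> (QuadRes (int q) (int p) \<and> QuadRes (int q) 2)"
    "\<not> (QuadRes (int p) 2 \<and> QuadRes (int q) 2)"
    using L unfolding Legendre_neg by blast+
qed (use assms in auto)

theorem mainTheorem7:
  fixes p1 p2 :: nat and e f :: int and H0 H1 H2 :: "complex set"
  assumes "prime p1" "prime p2" "p1 \<noteq> p2"
    and "p1 mod 4 = 1" "p2 mod 4 = 1"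
    and "(Legendre (int p1) (int p2) = -1 \<and> Legendre 2 (int p1) = -1)
       \<or> (Legendre (int p1) (int p2) = -1 \<and> Legendre 2 (int p2) = -1)
       \<or> (Legendre 2 (int p1) = -1 \<and> Legendre 2 (int p2) = -1)"
    and "int p1 = e ^ 2 + (2 * f) ^ 2"
    and "prime_ideal (Qadj [csqrt (of_nat (2 * p1 * p2)), \<i>]) H0"
    and "1 + \<i> \<in> H0"
    and "prime_ideal (Qadj [csqrt (of_nat (2 * p1 * p2)), \<i>]) H1"
    and "of_int e + 2 * \<i> * of_int f \<in> H1"
    and "prime_ideal (Qadj [csqrt (of_nat (2 * p1 * p2)), \<i>]) H2"
    and "of_int e - 2 * \<i> * of_int f \<in> H2"
  shows "cap_kernel (Qadj [csqrt (of_nat (2 * p1 * p2)), \<i>])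
            (Qadj [csqrt (of_nat (2 * p1 * p2)), \<i>, csqrt (of_nat p1)])
          = cls_span2 (Qadj [csqrt (of_nat (2 * p1 * p2)), \<i>]) H1 H2
       \<and> card (cap_kernel (Qadj [csqrt (of_nat (2 * p1 * p2)), \<i>])
            (Qadj [csqrt (of_nat (2 * p1 * p2)), \<i>, csqrt (of_nat p1)])) = 4
       \<and> cap_kernel (Qadj [csqrt (of_nat (2 * p1 * p2)), \<i>])
            (Qadj [csqrt (of_nat (2 * p1 * p2)), \<i>, csqrt (of_nat p2)])
          = cls_span2 (Qadj [csqrt (of_nat (2 * p1 * p2)), \<i>])
              (ideal_mult (Qadj [csqrt (of_nat (2 * p1 * p2)), \<i>]) H0 H1)
              (ideal_mult (Qadj [csqrt (of_nat (2 * p1 * p2)), \<i>]) H0 H2)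
       \<and> card (cap_kernel (Qadj [csqrt (of_nat (2 * p1 * p2)), \<i>])
            (Qadj [csqrt (of_nat (2 * p1 * p2)), \<i>, csqrt (of_nat p2)])) = 4"
proof -
  interpret prime_pair p1 p2 by (rule prime_pair_if_Legendre) (use assms in blast)+
  let ?z = "of_int e + 2 * \<i> * of_int f"
  have z: "?z = of_int e + \<i> * of_int (2 * f)" by simp
  have zf: "zfactor p1 ?z" unfolding zfactor_def z gnorm_gi assms(7) by auto
  moreover have "cnj ?z = of_int e - 2 * \<i> * of_int f" by simp
  ultimately have zf': "zfactor p1 (of_int e - 2 * \<i> * of_int f)" using zfactor_cnj[OF zf] by simp
  note H = assms(8-13)[folded s_def]
  have "ram (1 + \<i>) H0" by (rule ram_1i[OF H(1,2)])
  moreover have "ram ?z H1" by (rule zfactor_ram(2)[OF _ zf H(3,4)]) simp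
  moreover have "ram (of_int e - 2 * \<i> * of_int f) H2" by (rule zfactor_ram(2)[OF _ zf' H(5,6)]) simp
  ultimately show ?thesis unfolding s_def[symmetric] unfolding rt_def[symmetric] using capitulation_kernels[OF assms(7)] by simp
qed

end
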